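(* Let $\Delta\ge 1$ and $k\ge 0$ be fixed integers such that either $\Delta>k+2$, or $\Delta=k+2$ and $\Delta$ is odd. Then the decision problem $\Delta$-$k$-DiTTR is NP-complete. Consequently, the problem DiTTR is NP-complete.
   Context: All graphs are finite. A $\Delta$-periodic labeling of a directed graph $G=(V,E)$ is a map $\lambda:E\to\{0,1,\dots,\Delta-1\}$; edge $e$ is then active exactly at the times $\lambda(e)+i\Delta$, $i\in\mathbb{N}_0$. A temporal $s$-$z$-path is a sequence $(v_{i-1},v_i,t_i)_{i=1}^{\ell}$ with $v_0=s$, $v_\ell=z$, pairwise distinct vertices $v_0,\dots,v_\ell$, $(v_{i-1},v_i)\in E$ active at time $t_i$ for every $i$, and $t_1<t_2<\dots<t_\ell$ (strictly increasing). Its duration is $t_\ell+1-t_1$. A fastest temporal path is one of minimum duration. $\hat d(u,v)$ is the distance from $u$ to $v$ in the static graph $G$ (all edges have unit length). A bidirected tree is the directed graph obtained from an undirected tree by replacing each edge $\{u,v\}$ by the two directed edges $(u,v),(v,u)$ (which may get different labels). DiTTR: The input is a bidirected tree $G=(V,E)$, a matrix $D$ indexed by $V\times V$ with entries positive integers or $\infty$ (no restriction) such that $D_{u,v}\ge \hat d(u,v)$ for all $u,v$, and a positive integer $\Delta$. The question is whether there is a $\Delta$-periodic labeling $\lambda$ of $E$ such that, for all $u,v\in V$, the duration of a fastest temporal path from $u$ to $v$ is at most $D_{u,v}$. Diagonal entries of $D$ play no role; all conditions on $D$ are for distinct vertices. For fixed constants $\Delta,k$, $\Delta$-$k$-DiTTR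 is the restriction of DiTTR to inputs with period $\Delta$ and with $D_{u,v}\ge\hat d(u,v)+k$ for all $u,v\in V$ ($k$ is the minimum slack parameter). *)

theory Defs
  imports
    "Graph_Theory.Graph_Theory"
    "HOL-Library.Extended_Real"
    "HOL-Computational_Algebra.Polynomial"
begin

section \<open>Polynomial time and NP-completeness\<close>

text \<open>
  Deterministic multi-tape Turing machines. The states are \<open>0, \<dots>, n_states\<close>, where \<open>0\<close> is the
  initial state and \<open>n_states\<close> is the halting state; the tape symbols are
  \<open>0, \<dots>, n_symbols - 1\<close>, where \<open>0\<close> is the blank and \<open>1\<close>, \<open>2\<close> stand for the bits
  \<^const>\<open>False\<close>, \<^const>\<open>True\<close>. Tapes are infinite in both directions.
\<close>

datatype move = Move_Left | No_Move | Move_Right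

record tm =
  n_tapes :: nat
  n_symbols :: nat
  n_states :: nat
  trans :: "nat \<Rightarrow> nat list \<Rightarrow> nat \<times> (nat \<times> move) list"

definition wf_tm :: "tm \<Rightarrow> bool" where
  "wf_tm M \<longleftrightarrow> 1 \<le> n_tapes M \<and> 3 \<le> n_symbols M \<and>
    (\<forall>q ss. q < n_states M \<and> length ss = n_tapes M \<and> set ss \<subseteq> {..<n_symbols M} \<longrightarrow>
      (case trans M q ss of (q', acts) \<Rightarrow>
        q' \<le> n_states M \<and> length acts = n_tapes M \<and> fst ` set acts \<subseteq> {..<n_symbols M}))"

text \<open>A tape is its content together with the head position.\<close>

type_synonym tape = "(int \<Rightarrow> nat) \<times> int"
type_synonym config = "nat \<times> tape list"

fun read_tape :: "tape \<Rightarrow> nat" where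
  "read_tape (c, h) = c h"

fun act :: "nat \<times> move \<Rightarrow> tape \<Rightarrow> tape" where
  "act (s, m) (c, h) =
    (c(h := s), case m of Move_Left \<Rightarrow> h - 1 | No_Move \<Rightarrow> h | Move_Right \<Rightarrow> h + 1)"

fun step :: "tm \<Rightarrow> config \<Rightarrow> config" where
  "step M (q, ts) =
    (if q < n_states M
     then case trans M q (map read_tape ts) of (q', acts) \<Rightarrow> (q', map2 act acts ts)
     else (q, ts))"

definition bit_symbol :: "bool \<Rightarrow> nat" where
  "bit_symbol b = (if b then 2 else 1)"

definition input_tape :: "bool list \<Rightarrow> tape" where
  "input_tape x =
    (\<lambda>i. if 0 \<le> i \<and> i < int (length x) then bit_symbol (x ! nat i) else 0, 0)"

text \<open>The inputs are written on the first tapes, all other tapes are blank.\<close>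

definition init_config :: "tm \<Rightarrow> bool list list \<Rightarrow> config" where
  "init_config M xs =
    (0, map (\<lambda>j. input_tape (if j < length xs then xs ! j else [])) [0..<n_tapes M])"

text \<open>The output is the word on the last tape from cell \<open>0\<close> up to the first blank.\<close>

definition has_output :: "config \<Rightarrow> bool list \<Rightarrow> bool" where
  "has_output cfg y \<longleftrightarrow>
    (case last (snd cfg) of (c, h) \<Rightarrow>
      (\<forall>i<length y. c (int i) = bit_symbol (y ! i)) \<and> c (int (length y)) = 0)"

definition computes_within :: "tm \<Rightarrow> bool list list \<Rightarrow> bool list \<Rightarrow> nat \<Rightarrow> bool" where
  "computes_within M xs y T \<longleftrightarrow>
    (\<exists>t\<le>T. let cfg = (step M ^^ t) (init_config M xs)
           in fst cfg = n_states M \<and> has_output cfg y)"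

text \<open>Functions of \<open>a\<close> bit strings that are computable in polynomial time.\<close>

definition polytime :: "nat \<Rightarrow> (bool list list \<Rightarrow> bool list) \<Rightarrow> bool" where
  "polytime a f \<longleftrightarrow>
    (\<exists>M (p :: nat poly). wf_tm M \<and> a \<le> n_tapes M \<and>
      (\<forall>xs. length xs = a \<longrightarrow>
        computes_within M xs (f xs) (poly p (sum_list (map length xs)))))"

type_synonym language = "bool list set"

definition in_NP :: "language \<Rightarrow> bool" where
  "in_NP L \<longleftrightarrow>
    (\<exists>V (p :: nat poly). polytime 2 V \<and>
      (\<forall>x. x \<in> L \<longleftrightarrow> (\<exists>w. length w \<le> poly p (length x) \<and> V [x, w] = [True])))"

definition polytime_reducible :: "language \<Rightarrow> language \<Rightarrow> bool" where
  "polytime_reducible L L' \<longleftrightarrow>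
    (\<exists>f. polytime 1 (\<lambda>xs. f (hd xs)) \<and> (\<forall>x. x \<in> L \<longleftrightarrow> f x \<in> L'))"

definition NP_hard :: "language \<Rightarrow> bool" where
  "NP_hard L \<longleftrightarrow> (\<forall>L'. in_NP L' \<longrightarrow> polytime_reducible L' L)"

definition NP_complete :: "language \<Rightarrow> bool" where
  "NP_complete L \<longleftrightarrow> in_NP L \<and> NP_hard L"


section \<open>Periodic temporal graphs\<close>

definition periodic_labeling :: "nat \<Rightarrow> 'a pair_pre_digraph \<Rightarrow> ('a \<times> 'a \<Rightarrow> nat) \<Rightarrow> bool" where
  "periodic_labeling \<Delta> G l \<longleftrightarrow> (\<forall>e\<in>parcs G. l e < \<Delta>)"

definition active :: "nat \<Rightarrow> ('a \<times> 'a \<Rightarrow> nat) \<Rightarrow> 'a \<times> 'a \<Rightarrow> nat \<Rightarrow> bool" where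
  "active \<Delta> l e t \<longleftrightarrow> (\<exists>i. t = l e + i * \<Delta>)"

text \<open>
  A temporal path is a list of timed arcs \<open>((v\<^sub>i\<^sub>-\<^sub>1, v\<^sub>i), t\<^sub>i)\<close>; \<^const>\<open>pre_digraph.apath\<close> states that
  the arcs form a walk of \<open>G\<close> on pairwise distinct vertices.
\<close>

definition temporal_path ::
  "nat \<Rightarrow> 'a pair_pre_digraph \<Rightarrow> ('a \<times> 'a \<Rightarrow> nat) \<Rightarrow> 'a \<Rightarrow> (('a \<times> 'a) \<times> nat) list \<Rightarrow> 'a \<Rightarrow> bool"
where
  "temporal_path \<Delta> G l s P z \<longleftrightarrow>
    P \<noteq> [] \<and>
    pre_digraph.apath (with_proj G) s (map fst P) z \<and>
    (\<forall>(e, t)\<in>set P. active \<Delta> l e t) \<and>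
    sorted_wrt (<) (map snd P)"

definition duration :: "(('a \<times> 'a) \<times> nat) list \<Rightarrow> nat" where
  "duration P = snd (last P) + 1 - snd (hd P)"

text \<open>
  The duration of a fastest temporal path, which is \<open>\<infinity>\<close> if there is no temporal path at all.
\<close>

definition fastest_duration ::
  "nat \<Rightarrow> 'a pair_pre_digraph \<Rightarrow> ('a \<times> 'a \<Rightarrow> nat) \<Rightarrow> 'a \<Rightarrow> 'a \<Rightarrow> enat"
where
  "fastest_duration \<Delta> G l u v = (INF P\<in>{P. temporal_path \<Delta> G l u P v}. enat (duration P))"


section \<open>The problem DiTTR\<close>

text \<open>
  A \<^const>\<open>pair_graph\<close> is a finite, symmetric, loop-free digraph, i.e. it arises from an undirected
  graph by replacing each edge by two opposite arcs. The library notion \<^const>\<open>Digraph_Component.tree\<close>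
  is not suitable, because it counts \<open>u, v, u\<close> as a cycle. The cycles of the
  undirected graph are the directed cycles of length at least 3.
\<close>

definition bidirected_tree :: "'a pair_pre_digraph \<Rightarrow> bool" where
  "bidirected_tree G \<longleftrightarrow>
    pair_graph G \<and> Digraph_Component.connected (with_proj G) \<and>
    \<not> (\<exists>p. pre_digraph.cycle (with_proj G) p \<and> 3 \<le> length p)"

definition static_dist :: "'a pair_pre_digraph \<Rightarrow> 'a \<Rightarrow> 'a \<Rightarrow> ereal" where
  "static_dist G u v = wf_digraph.\<mu> (with_proj G) (\<lambda>_. 1) u v"

definition slack_at_least :: "nat \<Rightarrow> 'a pair_pre_digraph \<Rightarrow> ('a \<Rightarrow> 'a \<Rightarrow> enat) \<Rightarrow> bool" where
  "slack_at_least k G D \<longleftrightarrow>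
    (\<forall>u\<in>pverts G. \<forall>v\<in>pverts G. u \<noteq> v \<longrightarrow>
      static_dist G u v + ereal (real k) \<le> ereal_of_enat (D u v))"

definition DiTTR_input :: "'a pair_pre_digraph \<Rightarrow> ('a \<Rightarrow> 'a \<Rightarrow> enat) \<Rightarrow> nat \<Rightarrow> bool" where
  "DiTTR_input G D \<Delta> \<longleftrightarrow>
    bidirected_tree G \<and> 0 < \<Delta> \<and>
    (\<forall>u\<in>pverts G. \<forall>v\<in>pverts G. u \<noteq> v \<longrightarrow> 0 < D u v) \<and>
    slack_at_least 0 G D"

definition DiTTR_yes :: "'a pair_pre_digraph \<Rightarrow> ('a \<Rightarrow> 'a \<Rightarrow> enat) \<Rightarrow> nat \<Rightarrow> bool" where
  "DiTTR_yes G D \<Delta> \<longleftrightarrow>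
    (\<exists>l. periodic_labeling \<Delta> G l \<and>
      (\<forall>u\<in>pverts G. \<forall>v\<in>pverts G. u \<noteq> v \<longrightarrow> fastest_duration \<Delta> G l u v \<le> D u v))"

text \<open>
  Inputs are encoded as bit strings, with vertex set \<open>{0, \<dots>, n - 1}\<close> and all numbers in binary
  (least significant bit first). Each binary digit is preceded by \<^const>\<open>True\<close> and a number
  ends with \<^const>\<open>False\<close>, so that the codes of numbers are prefix-free.
\<close>

fun binary :: "nat \<Rightarrow> bool list" where
  "binary n = (if n = 0 then [] else odd n # binary (n div 2))"

declare binary.simps [simp del]

definition encode_nat :: "nat \<Rightarrow> bool list" where
  "encode_nat n = concat (map (\<lambda>b. [True, b]) (binary n)) @ [False]"

definition encode_enat :: "enat \<Rightarrow> bool list" where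
  "encode_enat d = (case d of enat m \<Rightarrow> True # encode_nat m | \<infinity> \<Rightarrow> [False])"

text \<open>The vertex number, the adjacency matrix, the matrix \<open>D\<close> (both row by row), and the period.\<close>

definition encode_DiTTR :: "nat pair_pre_digraph \<Rightarrow> (nat \<Rightarrow> nat \<Rightarrow> enat) \<Rightarrow> nat \<Rightarrow> bool list" where
  "encode_DiTTR G D \<Delta> =
    (let n = card (pverts G); ps = List.product [0..<n] [0..<n]
     in encode_nat n
        @ map (\<lambda>uv. uv \<in> parcs G) ps
        @ concat (map (\<lambda>(u, v). encode_enat (D u v)) ps)
        @ encode_nat \<Delta>)"

definition DiTTR :: language where
  "DiTTR = {encode_DiTTR G D \<Delta> | G D \<Delta>.
    pverts G = {..<card (pverts G)} \<and> DiTTR_input G D \<Delta> \<and> DiTTR_yes G D \<Delta>}"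

text \<open>The restriction to a fixed period \<open>\<Delta>\<close> and to matrices with slack at least \<open>k\<close>.\<close>

definition DiTTR_fixed :: "nat \<Rightarrow> nat \<Rightarrow> language" where
  "DiTTR_fixed \<Delta> k = {encode_DiTTR G D \<Delta> | G D.
    pverts G = {..<card (pverts G)} \<and> DiTTR_input G D \<Delta> \<and> slack_at_least k G D \<and>
    DiTTR_yes G D \<Delta>}"

end

theory Submission
  imports Defs "HOL-Library.Countable"
begin

text \<open>
  The duration of a temporal path is its length plus its slack, i.e. the sum of the waiting times
  \<open>l' - l - 1 mod \<Delta>\<close> over consecutive labels. Paths in a tree are unique, so \<open>D\<close> bounds the slack of
  every path.

  Hardness. In a sufficiently deep binary tree not every path can have slack at most \<open>k\<close>. Hence
  there are a tree, a set \<open>S\<close> of pairs and a pair \<open>(a, b)\<close> such that slack at most \<open>k\<close> on \<open>S\<close> forces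
  slack at least \<open>s > k\<close> from \<open>a\<close> to \<open>b\<close>, where \<open>s\<close> is attained. Prescribing slack at most \<open>s\<close> for
  paths that extend the path from \<open>a\<close> to \<open>b\<close> leaves no slack on the extensions. With copies of this
  tree around a common center, one expresses any system of constraints \<open>t\<^sub>j - t\<^sub>i \<in> {2, \<dots>, e + 2}\<close>
  modulo \<open>\<Delta>\<close>. For truth values coded by two adjacent residues these constraints express
  not-all-equal clauses, thus Horn clauses and disjunctions, and therefore the tableau of a
  nondeterministic polynomial-time computation.

  Membership. A certificate consists of the labels and, for every path, of its next vertices, its
  length and the number of descents of the labels: the duration is the difference of the last and
  the first label, plus \<open>1\<close>, plus \<open>\<Delta>\<close> times the number of descents. The verifier is a formula with
  quantifiers bounded by polynomials over numbers of polynomial size; such formulas are compiled to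
  Turing machines by way of counter programs.
\<close>

section \<open>Structured programs on tapes\<close>

text \<open>Every bound of an instance must leave slack at least k, so equations between labels
  cannot be demanded directly; this is the obstacle. It is overcome by a path that is forced to
  waste slack: if s is the least slack from a to b under the constraints S, then s > k makes s a
  legal bound, and any prolongation of that path under the same slack bound has to be traversed
  without waiting. The condition on \<Delta> comes from a turn between two siblings. Its slack runs
  through the residues z + 2 i, which are all residues for odd \<Delta> but only one parity class
  for even \<Delta>. So \<Delta> - 1 is attained in the odd case, while in the even case only
  \<Delta> - 2 is guaranteed. For the clause gadgets three residues are enough. For membership the
  obstacle is that \<Delta>, the labels and the entries of D are written in binary and may be
  exponentially large, whereas counters only hold numbers of polynomial size. Such numbers are
  therefore never computed; they are only compared, by their digits.\<close>

datatype cmd =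
    Act nat "nat option" move
  | Seq cmd cmd (infixr \<open>;;\<close> 60)
  | Ifs nat nat cmd cmd
  | Until nat nat cmd

primrec written :: "nat option \<Rightarrow> nat \<Rightarrow> nat" where
  "written None r = r"
| "written (Some s) r = s"

text \<open>Each control node costs one step, which is exactly the step in which
  \<open>trans_cmd\<close> unfolds it; hence the step counts agree with those of the machine. An
  infinite loop has no derivation.\<close>

inductive run :: "cmd \<Rightarrow> tape list \<Rightarrow> nat \<Rightarrow> tape list \<Rightarrow> bool" where
  run_Act: "t < length ts \<Longrightarrow>
    run (Act t w m) ts 1 (ts[t := act (written w (read_tape (ts ! t)), m) (ts ! t)])"
| run_Seq: "\<lbrakk>run c ts n ts'; run d ts' m ts''\<rbrakk> \<Longrightarrow> run (c ;; d) ts (Suc (n + m)) ts''"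
| run_IfT: "\<lbrakk>read_tape (ts ! t) = s; t < length ts; run c ts n ts'\<rbrakk> \<Longrightarrow> run (Ifs t s c d) ts (Suc n) ts'"
| run_IfF: "\<lbrakk>read_tape (ts ! t) \<noteq> s; t < length ts; run d ts n ts'\<rbrakk> \<Longrightarrow> run (Ifs t s c d) ts (Suc n) ts'"
| run_UntilT: "\<lbrakk>read_tape (ts ! t) = s; t < length ts\<rbrakk> \<Longrightarrow> run (Until t s c) ts 1 ts"
| run_UntilF: "\<lbrakk>read_tape (ts ! t) \<noteq> s; t < length ts; run c ts n ts'; run (Until t s c) ts' m ts''\<rbrakk>
    \<Longrightarrow> run (Until t s c) ts (Suc (n + m)) ts''"

section \<open>Compilation of commands to Turing machines\<close>

definition stay :: "nat list \<Rightarrow> (nat \<times> move) list" where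
  "stay ss = map (\<lambda>s. (s, No_Move)) ss"

text \<open>The control state of a compiled command is its continuation, a list of commands still to be
  executed.\<close>

fun trans_cmd :: "cmd list \<Rightarrow> nat list \<Rightarrow> cmd list \<times> (nat \<times> move) list" where
  "trans_cmd [] ss = ([], stay ss)"
| "trans_cmd (Act t w m # K) ss = (K, (stay ss)[t := (written w (ss ! t), m)])"
| "trans_cmd ((c ;; d) # K) ss = (c # d # K, stay ss)"
| "trans_cmd (Ifs t s c d # K) ss = ((if ss ! t = s then c else d) # K, stay ss)"
| "trans_cmd (Until t s c # K) ss = (if ss ! t = s then K else c # Until t s c # K, stay ss)"

definition step_cmd :: "cmd list \<times> tape list \<Rightarrow> cmd list \<times> tape list" where
  "step_cmd = (\<lambda>(K, ts). case trans_cmd K (map read_tape ts) of (K', acts) \<Rightarrow> (K', map2 act acts ts))"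

lemma act_stay: "act (read_tape t, No_Move) t = t"
  by (cases t) simp

lemma map2_act_stay: "map2 act (stay (map read_tape ts)) ts = ts"
  unfolding stay_def by (rule nth_equalityI) (auto simp: act_stay)

lemma map2_act_stay_update:
  "map2 act ((stay (map read_tape ts))[t := a]) ts = ts[t := act a (ts ! t)]"
  unfolding stay_def
  by (cases "t < length ts") (auto simp: act_stay nth_list_update intro!: nth_equalityI)

lemma step_cmd_simps:
  "step_cmd ([], ts) = ([], ts)"
  "t < length ts \<Longrightarrow>
    step_cmd (Act t w m # K, ts) = (K, ts[t := act (written w (read_tape (ts ! t)), m) (ts ! t)])"
  "step_cmd ((c ;; d) # K, ts) = (c # d # K, ts)"
  "t < length ts \<Longrightarrow> step_cmd (Ifs t s c d # K, ts) = ((if read_tape (ts ! t) = s then c else d) # K, ts)"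
  "t < length ts \<Longrightarrow> step_cmd (Until t s c # K, ts)
     = (if read_tape (ts ! t) = s then K else c # Until t s c # K, ts)"
  by (auto simp: step_cmd_def map2_act_stay map2_act_stay_update)

lemma run_step_cmd: "run c ts n ts' \<Longrightarrow> (step_cmd ^^ n) (c # K, ts) = (K, ts')"
proof (induction arbitrary: K rule: run.induct)
  case (run_Seq c ts n ts' d m ts'')
  have "Suc (n + m) = m + (n + 1)" by simp
  then show ?case
    by (simp only: funpow_add comp_apply) (simp add: run_Seq step_cmd_simps)
next
  case (run_UntilF ts t s c n ts' m ts'')
  have "Suc (n + m) = m + (n + 1)" by simp
  then show ?case using run_UntilF
    by (simp only: funpow_add comp_apply) (simp add: step_cmd_simps)
next
  case (run_IfT ts t s c n ts' d)
  then show ?case by (simp add: step_cmd_simps funpow_Suc_right del: funpow.simps)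
next
  case (run_IfF ts t s d n ts' c)
  then show ?case by (simp add: step_cmd_simps funpow_Suc_right del: funpow.simps)
qed (simp_all add: step_cmd_simps)

text \<open>These are the nonempty control states that can occur while c is executed before K.
  Unfolding a loop puts the loop itself back onto the continuation, so finiteness comes from
  recursion on the command and not on the execution.\<close>

primrec conts :: "cmd \<Rightarrow> cmd list \<Rightarrow> cmd list set" where
  "conts (Act t w m) K = {Act t w m # K}"
| "conts (c ;; d) K = {(c ;; d) # K} \<union> conts c (d # K) \<union> conts d K"
| "conts (Ifs t s c d) K = {Ifs t s c d # K} \<union> conts c K \<union> conts d K"
| "conts (Until t s c) K = {Until t s c # K} \<union> conts c (Until t s c # K)"

primrec ok_cmd :: "cmd \<Rightarrow> bool" where
  "ok_cmd (Act t w m) = (\<forall>s. w = Some s \<longrightarrow> s < 3)"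
| "ok_cmd (c ;; d) = (ok_cmd c \<and> ok_cmd d)"
| "ok_cmd (Ifs t s c d) = (ok_cmd c \<and> ok_cmd d)"
| "ok_cmd (Until t s c) = ok_cmd c"

lemma finite_conts: "finite (conts c K)"
  by (induction c arbitrary: K) auto

lemma Cons_in_conts: "c # K \<in> conts c K"
  by (cases c) auto

lemma Nil_notin_conts: "[] \<notin> conts c K"
  by (induction c arbitrary: K) auto

lemma ok_conts: "\<lbrakk>L \<in> conts c K; ok_cmd c; list_all ok_cmd K\<rbrakk> \<Longrightarrow> list_all ok_cmd L"
proof (induction c arbitrary: K L)
  case (Seq c d)
  then have "L = (c ;; d) # K \<or> L \<in> conts c (d # K) \<or> L \<in> conts d K" by simp
  then show ?case using Seq by (metis list.pred_inject(2) ok_cmd.simps(2))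
next
  case (Ifs t s c d)
  then have "L = Ifs t s c d # K \<or> L \<in> conts c K \<or> L \<in> conts d K" by simp
  then show ?case using Ifs by (metis list.pred_inject(2) ok_cmd.simps(3))
next
  case (Until t s c)
  then have "L = Until t s c # K \<or> L \<in> conts c (Until t s c # K)" by simp
  then show ?case using Until by (metis list.pred_inject(2) ok_cmd.simps(4))
qed simp

lemma trans_cmd_conts: "L \<in> conts c K \<Longrightarrow> fst (trans_cmd L ss) \<in> insert K (conts c K)"
proof (induction c arbitrary: K L)
  case (Seq c d)
  then consider "L = (c ;; d) # K" | "L \<in> conts c (d # K)" | "L \<in> conts d K" by auto
  then show ?case
  proof cases
    case 2
    from Seq.IH(1)[OF this] show ?thesis using Cons_in_conts[of d K] by auto
  qed (use Seq.IH(2) in \<open>auto simp: Cons_in_conts\<close>)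
next
  case (Ifs t s c d)
  then consider "L = Ifs t s c d # K" | "L \<in> conts c K" | "L \<in> conts d K" by auto
  then show ?case
    by cases (use Ifs.IH in \<open>auto simp: Cons_in_conts\<close>)
next
  case (Until t s c)
  then consider "L = Until t s c # K" | "L \<in> conts c (Until t s c # K)" by auto
  then show ?case
    by cases (use Until.IH in \<open>auto simp: Cons_in_conts\<close>)
qed auto

lemma ex_machine:
  assumes ok: "ok_cmd c" and nt: "1 \<le> nt"
  shows "\<exists>M. wf_tm M \<and> n_tapes M = nt \<and>
    (\<forall>ts n ts'. length ts = nt \<longrightarrow> run c ts n ts' \<longrightarrow> (step M ^^ n) (0, ts) = (n_states M, ts'))"
proof -
  define S where "S = conts c []"
  have fin: "finite (S - {[c]})" using finite_conts by (simp add: S_def)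
  have cS: "[c] \<in> S" by (simp add: S_def Cons_in_conts)
  obtain h where h: "bij_betw h (S - {[c]}) {0..<card (S - {[c]})}"
    using ex_bij_betw_finite_nat[OF fin] by blast
  define N where "N = card S"
  have NS: "N = Suc (card (S - {[c]}))"
    using cS finite_conts by (metis N_def S_def card.remove)
  \<comment> \<open>The machine model fixes the initial state 0 and the halting state
    \<open>n_states\<close>. So \<open>[c]\<close> gets number 0, the empty continuation gets N, and
    the other control states are shifted by one.\<close>
  define f where "f K = (if K = [] then N else if K = [c] then 0 else Suc (h K))" for K
  have f0: "f [c] = 0" "f [] = N" by (simp_all add: f_def)
  have nilS: "[] \<notin> S" by (simp add: S_def Nil_notin_conts)
  have injf: "inj_on f S"
    using bij_betw_imp_inj_on[OF h] nilS by (auto simp: inj_on_def f_def split: if_splits)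
  have fN: "f K < N" if "K \<in> S" for K
    using that bij_betwE[OF h] nilS by (auto simp: f_def NS)
  have surjf: "f ` S = {..<N}"
    by (rule card_subset_eq) (use fN injf in \<open>auto simp: card_image N_def\<close>)
  define g where "g = the_inv_into S f"
  have gf: "g (f K) = K" if "K \<in> S" for K using that injf by (simp add: g_def the_inv_into_f_f)
  have gS: "g q \<in> S" if "q < N" for q
    using that injf surjf by (metis g_def lessThan_iff the_inv_into_into subset_refl)
  define M where "M = \<lparr>n_tapes = nt, n_symbols = 3, n_states = N,
      trans = (\<lambda>q ss. case trans_cmd (g q) ss of (K, acts) \<Rightarrow> (f K, acts))\<rparr>"
  have closed: "fst (trans_cmd K ss) \<in> insert [] S" if "K \<in> S" for K ss
    using trans_cmd_conts that by (auto simp: S_def)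
  have acts: "length (snd (trans_cmd K ss)) = length ss \<and>
      (list_all ok_cmd K \<longrightarrow> set ss \<subseteq> {..<3} \<longrightarrow> fst ` set (snd (trans_cmd K ss)) \<subseteq> {..<3})" for K ss
  proof (induction K ss rule: trans_cmd.induct)
    case (2 t w m K ss)
    show ?case
    proof (cases "t < length ss")
      case True
      then have "set ss \<subseteq> {..<3} \<Longrightarrow> ss ! t < 3" using nth_mem by fastforce
      then show ?thesis
        by (cases w) (auto simp: stay_def dest!: set_update_subset_insert[THEN subsetD])
    qed (auto simp: stay_def list_update_beyond not_less)
  qed (auto simp: stay_def)
  have okS: "list_all ok_cmd K" if "K \<in> S" for K using ok_conts[of K c "[]"] that ok by (simp add: S_def)
  have wf: "wf_tm M"
    unfolding wf_tm_def
  proof (intro conjI allI impI)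
    fix q ss assume *: "q < n_states M \<and> length ss = n_tapes M \<and> set ss \<subseteq> {..<n_symbols M}"
    then have q: "g q \<in> S" and ss: "length ss = nt" "set ss \<subseteq> {..<3}" using gS by (auto simp: M_def)
    obtain K a where Ka: "trans_cmd (g q) ss = (K, a)" by fastforce
    have "K \<in> insert [] S" using closed[OF q, of ss] Ka by simp
    then have "f K \<le> N" using fN[of K] f0 by (cases "K = []") auto
    then show "case trans M q ss of (q', acts) \<Rightarrow> q' \<le> n_states M \<and> length acts = n_tapes M \<and>
        fst ` set acts \<subseteq> {..<n_symbols M}"
      using acts[of "g q" ss] Ka ss okS[OF q] by (auto simp: M_def)
  qed (use nt in \<open>auto simp: M_def\<close>)
  have sim: "step M (f K, ts) = (case step_cmd (K, ts) of (K', ts') \<Rightarrow> (f K', ts'))"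
    if "K \<in> insert [] S" for K ts
  proof (cases "K = []")
    case True
    then show ?thesis by (simp add: step_cmd_simps M_def f0)
  next
    case False
    then show ?thesis using that fN gf
      by (auto simp: M_def step_cmd_def split: prod.splits)
  qed
  have sims: "(step M ^^ n) (f K, ts) = (case (step_cmd ^^ n) (K, ts) of (K', ts') \<Rightarrow> (f K', ts')) \<and>
      fst ((step_cmd ^^ n) (K, ts)) \<in> insert [] S"
    if "K \<in> insert [] S" for n K ts
  proof (induction n)
    case (Suc n)
    obtain K' ts' where K': "(step_cmd ^^ n) (K, ts) = (K', ts')" by fastforce
    then have "K' \<in> insert [] S" using Suc by simp
    moreover then have "fst (step_cmd (K', ts')) \<in> insert [] S"
      using closed by (auto simp: step_cmd_def stay_def split: prod.splits) (metis fst_conv)+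
    ultimately show ?case using Suc K' sim by simp
  qed (use that in simp)
  show ?thesis
  proof (intro exI conjI allI impI)
    fix ts n ts' assume "run c ts n ts'"
    from run_step_cmd[OF this, of "[]"] show "(step M ^^ n) (0, ts) = (n_states M, ts')"
      using sims[of "[c]" n ts] cS f0 by (simp add: M_def)
  qed (use wf in \<open>auto simp: M_def\<close>)
qed

section \<open>Counters\<close>

text \<open>Only an upper bound on the time is kept, because branches of different length have to be
  joined.\<close>

definition runs :: "cmd \<Rightarrow> tape list \<Rightarrow> nat \<Rightarrow> tape list \<Rightarrow> bool" where
  "runs c ts B ts' \<longleftrightarrow> (\<exists>n\<le>B. run c ts n ts')"

lemma runs_mono: "\<lbrakk>runs c ts B ts'; B \<le> B'\<rbrakk> \<Longrightarrow> runs c ts B' ts'"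
  by (auto simp: runs_def intro: le_trans)

lemma runs_Seq: "\<lbrakk>runs c ts B ts'; runs d ts' B' ts''\<rbrakk> \<Longrightarrow> runs (c ;; d) ts (Suc (B + B')) ts''"
  unfolding runs_def by (elim exE conjE) (rule exI, rule conjI[rotated], erule (1) run_Seq, simp)

lemma runs_move:
  assumes "t < length ts"
  shows "runs (Act t None m) ts 1 (ts[t := act (read_tape (ts ! t), m) (ts ! t)])"
  using run_Act[OF assms, of None m] by (auto simp: runs_def)

lemma runs_If: "\<lbrakk>t < length ts; runs (if read_tape (ts ! t) = s then c else d) ts B ts'\<rbrakk>
    \<Longrightarrow> runs (Ifs t s c d) ts (Suc B) ts'"
  by (cases "read_tape (ts ! t) = s") (auto simp: runs_def intro: run_IfT run_IfF)

lemma runs_Until: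
  assumes "\<And>k. k \<le> n \<Longrightarrow> t < length (S k)"
    and "\<And>k. k < n \<Longrightarrow> read_tape (S k ! t) \<noteq> s"
    and "\<And>k. k < n \<Longrightarrow> runs c (S k) B (S (Suc k))"
    and "read_tape (S n ! t) = s"
  shows "runs (Until t s c) (S 0) (n * (B + 1) + 1) (S n)"
  using assms
proof (induction n arbitrary: S)
  case 0
  then show ?case by (auto simp: runs_def intro!: exI[of _ 1] run_UntilT)
next
  case (Suc n)
  from Suc.prems(3)[of 0] obtain a where a: "a \<le> B" "run c (S 0) a (S (Suc 0))"
    by (auto simp: runs_def)
  have "runs (Until t s c) (S (Suc 0)) (n * (B + 1) + 1) (S (Suc n))"
    by (rule Suc.IH[of "\<lambda>k. S (Suc k)"]) (use Suc.prems in auto)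
  then obtain b where b: "b \<le> n * (B + 1) + 1" "run (Until t s c) (S (Suc 0)) b (S (Suc n))"
    by (auto simp: runs_def)
  have "run (Until t s c) (S 0) (Suc (a + b)) (S (Suc n))"
    using run_UntilF[OF Suc.prems(2)[of 0] Suc.prems(1)[of 0] a(2) b(2)] by simp
  then show ?case using a(1) b(1) unfolding runs_def by (intro exI[of _ "Suc (a + b)"]) auto
qed

text \<open>The value of a counter is the head position; the mark on cell \<open>0\<close> makes it possible to test
  for \<open>0\<close>.\<close>

definition counter_tape :: "nat \<Rightarrow> tape" where
  "counter_tape n = ((\<lambda>i. if i = 0 then 1 else 0), int n)"

definition output_tape :: "bool list \<Rightarrow> tape" where
  "output_tape y = ((\<lambda>i. if 0 \<le> i \<and> i < int (length y) then bit_symbol (y ! nat i) else 0), int (length y))"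

text \<open>The layout follows \<open>init_config\<close> and \<open>has_output\<close>: inputs
  first, output last, R counters between them. h holds the head positions on the inputs, v the
  values of the counters; the contents of the inputs never change.\<close>

definition tapes :: "bool list list \<Rightarrow> (nat \<Rightarrow> nat) \<Rightarrow> nat \<Rightarrow> (nat \<Rightarrow> nat) \<Rightarrow> bool list \<Rightarrow> tape list" where
  "tapes xs h R v y = map (\<lambda>j. (fst (input_tape (xs ! j)), int (h j))) [0..<length xs]
     @ map (\<lambda>i. counter_tape (v i)) [0..<R] @ [output_tape y]"

lemma length_tapes: "length (tapes xs h R v y) = length xs + R + 1"
  by (simp add: tapes_def)

lemma nth_tapes_input: "j < length xs \<Longrightarrow> tapes xs h R v y ! j = (fst (input_tape (xs ! j)), int (h j))"
  by (simp add: tapes_def nth_append)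

lemma nth_tapes_counter: "i < R \<Longrightarrow> tapes xs h R v y ! (length xs + i) = counter_tape (v i)"
  by (simp add: tapes_def nth_append)

lemma nth_tapes_output: "tapes xs h R v y ! (length xs + R) = output_tape y"
  by (simp add: tapes_def nth_append)

lemma upd_tapes_input: "j < length xs \<Longrightarrow>
    (tapes xs h R v y)[j := (fst (input_tape (xs ! j)), int p)] = tapes xs (h(j := p)) R v y"
  by (rule nth_equalityI) (auto simp: tapes_def nth_append nth_list_update)

lemma upd_tapes_counter: "i < R \<Longrightarrow>
    (tapes xs h R v y)[length xs + i := counter_tape k] = tapes xs h R (v(i := k)) y"
  by (rule nth_equalityI) (auto simp: tapes_def nth_append nth_list_update)

lemma upd_tapes_output: "(tapes xs h R v y)[length xs + R := output_tape y'] = tapes xs h R v y'"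
  by (rule nth_equalityI) (auto simp: tapes_def nth_append nth_list_update)

lemma read_counter: "read_tape (counter_tape n) = (if n = 0 then 1 else 0)"
  by (simp add: counter_tape_def)

definition noop :: cmd where "noop = Act 0 None No_Move"
definition inc :: "nat \<Rightarrow> cmd" where "inc t = Act t None Move_Right"
definition dec :: "nat \<Rightarrow> cmd" where "dec t = Act t None Move_Left"
definition loop :: "nat \<Rightarrow> cmd \<Rightarrow> cmd" where "loop t c = Until t 1 (dec t ;; c)"

lemma ok_basic [simp]: "ok_cmd noop" "ok_cmd (inc t)" "ok_cmd (dec t)" "ok_cmd (loop t c) = ok_cmd c"
  by (auto simp: noop_def inc_def dec_def loop_def)

lemma runs_noop: "runs noop (tapes xs h R v y) (Suc 0) (tapes xs h R v y)"
  using runs_move[of 0 "tapes xs h R v y" No_Move] by (simp add: noop_def act_stay length_tapes)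

lemma runs_inc:
  assumes "i < R" "v' = v(i := Suc (v i))"
  shows "runs (inc (length xs + i)) (tapes xs h R v y) (Suc 0) (tapes xs h R v' y)"
proof -
  have "act (read_tape (counter_tape k), Move_Right) (counter_tape k) = counter_tape (Suc k)" for k
    by (simp add: counter_tape_def fun_eq_iff)
  then show ?thesis
    using runs_move[of "length xs + i" "tapes xs h R v y" Move_Right] assms
    by (simp add: inc_def length_tapes nth_tapes_counter upd_tapes_counter)
qed

lemma runs_dec:
  assumes "i < R" "0 < v i" "v' = v(i := v i - 1)"
  shows "runs (dec (length xs + i)) (tapes xs h R v y) (Suc 0) (tapes xs h R v' y)"
proof -
  have "act (read_tape (counter_tape k), Move_Left) (counter_tape k) = counter_tape (k - 1)" if "0 < k" for k
    using that by (simp add: counter_tape_def fun_eq_iff of_nat_diff)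
  then show ?thesis
    using runs_move[of "length xs + i" "tapes xs h R v y" Move_Left] assms
    by (simp add: dec_def length_tapes nth_tapes_counter upd_tapes_counter)
qed

lemma runs_right:
  assumes "j < length xs" "h' = h(j := Suc (h j))"
  shows "runs (inc j) (tapes xs h R v y) (Suc 0) (tapes xs h' R v y)"
proof -
  have "act (read_tape (c, int p), Move_Right) (c, int p) = (c, int (Suc p))" for c p
    by simp
  then show ?thesis
    using runs_move[of j "tapes xs h R v y" Move_Right] assms
    by (simp add: inc_def length_tapes nth_tapes_input upd_tapes_input del: act.simps of_nat_Suc)
qed

lemma runs_left:
  assumes "j < length xs" "0 < h j" "h' = h(j := h j - 1)"
  shows "runs (dec j) (tapes xs h R v y) (Suc 0) (tapes xs h' R v y)"
proof -
  have "act (read_tape (c, int p), Move_Left) (c, int p) = (c, int (p - 1))" if "0 < p" for c p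
    using that by (simp add: of_nat_diff)
  then show ?thesis
    using runs_move[of j "tapes xs h R v y" Move_Left] assms upd_tapes_input[of j xs h R v y "h j - 1"]
    by (simp add: dec_def length_tapes nth_tapes_input of_nat_diff)
qed

text \<open>The loop counter i is decremented before the body runs, so in round k the body sees n -
  Suc k there. V, H and Y describe everything else after k rounds. A round costs three steps more
  than its body: the test, the composition and the decrement.\<close>

lemma runs_loop:
  assumes i: "i < R"
    and V0: "v = (V 0)(i := n)" "h = H 0" "y = Y 0"
    and body: "\<And>k. k < n \<Longrightarrow> runs c (tapes xs (H k) R ((V k)(i := n - Suc k)) (Y k)) B
      (tapes xs (H (Suc k)) R ((V (Suc k))(i := n - Suc k)) (Y (Suc k)))"
    and Vn: "v' = (V n)(i := 0)" "h' = H n" "y' = Y n" and B': "n * (B + 3) + 1 \<le> B'"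
  shows "runs (loop (length xs + i) c) (tapes xs h R v y) B' (tapes xs h' R v' y')"
proof -
  let ?S = "\<lambda>k. tapes xs (H k) R ((V k)(i := n - k)) (Y k)"
  have "runs (loop (length xs + i) c) (?S 0) (n * (Suc (Suc 0 + B) + 1) + 1) (?S n)"
    unfolding loop_def
  proof (rule runs_Until)
    fix k assume k: "k < n"
    show "runs (dec (length xs + i) ;; c) (?S k) (Suc (Suc 0 + B)) (?S (Suc k))"
    proof (rule runs_Seq)
      show "runs (dec (length xs + i)) (?S k) (Suc 0) (tapes xs (H k) R ((V k)(i := n - Suc k)) (Y k))"
        by (rule runs_dec) (use i k in auto)
    qed (rule body[OF k])
  qed (use i in \<open>auto simp: length_tapes nth_tapes_counter read_counter\<close>)
  from runs_mono[OF this, of B'] B' show ?thesis by (simp add: V0 Vn algebra_simps)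
qed

section \<open>Arithmetic expressions\<close>

text \<open>Variables are de Bruijn indices: \<open>Sum\<close> binds one, \<open>Rec\<close> binds
  the round and the accumulator. \<open>Rec\<close> truncates every new value at a cap, so iteration
  cannot leave the polynomial range and each value fits into a unary counter.\<close>

datatype expr = Var nat | One | Add expr expr | Monus expr expr | Bit nat expr | Len nat
  | Sum expr expr | Rec expr expr expr expr

primrec eval :: "bool list list \<Rightarrow> expr \<Rightarrow> (nat \<Rightarrow> nat) \<Rightarrow> nat" where
  "eval xs (Var i) v = v i"
| "eval xs One v = 1"
| "eval xs (Add d e) v = eval xs d v + eval xs e v"
| "eval xs (Monus d e) v = eval xs d v - eval xs e v"
| "eval xs (Bit j e) v = (if j < length xs \<and> eval xs e v < length (xs ! j)
     then bit_symbol (xs ! j ! eval xs e v) else 0)"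
| "eval xs (Len j) v = (if j < length xs then length (xs ! j) else 0)"
| "eval xs (Sum d e) v = (\<Sum>i<eval xs d v. eval xs e (case_nat i v))"
| "eval xs (Rec cap ini st cnt) v =
     rec_nat (eval xs ini v) (\<lambda>i a. min (eval xs cap v) (eval xs st (case_nat i (case_nat a v)))) (eval xs cnt
         v)"

lemma poly_nat_mono: "(m::nat) \<le> n \<Longrightarrow> poly p m \<le> poly p n"
  by (induction p) (auto intro!: add_mono mult_mono)

definition bounded :: "bool list list \<Rightarrow> nat \<Rightarrow> bool" where
  "bounded xs M \<longleftrightarrow> (\<forall>x\<in>set xs. length x \<le> M)"

lemma bounded_mono: "\<lbrakk>bounded xs M; M \<le> M'\<rbrakk> \<Longrightarrow> bounded xs M'"
  by (auto simp: bounded_def)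

text \<open>One number M bounds both the variables and the input lengths, so it can be enlarged when
  a bound variable enters: the index of a sum is below the value of its upper limit. A value of
  \<open>Rec\<close> is at most the start value plus the cap.\<close>

lemma eval_bound:
  "\<exists>p :: nat poly. \<forall>xs v M. (\<forall>i. v i \<le> M) \<longrightarrow> bounded xs M \<longrightarrow> eval xs e v \<le> poly p M"
proof (induction e)
  case (Var i)
  show ?case by (rule exI[of _ "[:0, 1:]"]) simp
next
  case One
  show ?case by (rule exI[of _ "[:1:]"]) simp
next
  case (Add d e)
  then obtain p q where "\<forall>xs v M. (\<forall>i. v i \<le> M) \<longrightarrow> bounded xs M \<longrightarrow> eval xs d v \<le> poly p M"
    "\<forall>xs v M. (\<forall>i. v i \<le> M) \<longrightarrow> bounded xs M \<longrightarrow> eval xs e v \<le> poly q M" by blast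
  then show ?case by (intro exI[of _ "p + q"]) (auto intro!: add_mono)
next
  case (Monus d e)
  then obtain p where "\<forall>xs v M. (\<forall>i. v i \<le> M) \<longrightarrow> bounded xs M \<longrightarrow> eval xs d v \<le> poly p M" by blast
  then show ?case by (intro exI[of _ p]) (auto intro: le_trans[OF diff_le_self])
next
  case (Bit j e)
  show ?case by (rule exI[of _ "[:2:]"]) (simp add: bit_symbol_def)
next
  case (Len j)
  show ?case by (rule exI[of _ "[:0, 1:]"]) (auto simp: bounded_def)
next
  case (Sum d e)
  then obtain p q where p: "\<And>xs v M. (\<forall>i. v i \<le> M) \<Longrightarrow> bounded xs M \<Longrightarrow> eval xs d v \<le> poly p M"
    and q: "\<And>xs v M. (\<forall>i. v i \<le> M) \<Longrightarrow> bounded xs M \<Longrightarrow> eval xs e v \<le> poly q M" by metis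
  have "eval xs (Sum d e) v \<le> poly (p * pcompose q ([:0, 1:] + p)) M"
    if v: "\<forall>i. v i \<le> M" "bounded xs M" for xs v M
  proof -
    have "eval xs e (case_nat i v) \<le> poly q (M + poly p M)" if "i < eval xs d v" for i
      by (rule q) (use v that p[OF v] in \<open>auto split: nat.split intro: le_trans bounded_mono[OF v(2)] simp:
          trans_le_add1\<close>)
    then have "eval xs (Sum d e) v \<le> eval xs d v * poly q (M + poly p M)"
      using sum_bounded_above[of "{..<eval xs d v}" "\<lambda>i. eval xs e (case_nat i v)" "poly q (M + poly p M)"]
          by simp
    also have "\<dots> \<le> poly p M * poly q (M + poly p M)" using p[OF v] by simp
    finally show ?thesis by (simp add: poly_pcompose)
  qed
  then show ?case by blast
next
  case (Rec cap ini st cnt)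
  then obtain p q where p: "\<And>xs v M. (\<forall>i. v i \<le> M) \<Longrightarrow> bounded xs M \<Longrightarrow> eval xs cap v \<le> poly p M"
    and q: "\<And>xs v M. (\<forall>i. v i \<le> M) \<Longrightarrow> bounded xs M \<Longrightarrow> eval xs ini v \<le> poly q M" by metis
  have "rec_nat a (\<lambda>i b. min c (f i b)) n \<le> a + c" for a c n :: nat and f
    by (induction n) auto
  from order_trans[OF this add_mono[OF q p]] show ?case
    by (intro exI[of _ "q + p"]) auto
qed

text \<open>r is the target register, m places the variables, and the registers from f on are
  scratch space, which is found zero and, apart from r, left so. The value is added to the target
  rather than assigned; so a sum accumulates by itself and \<open>Add\<close> is mere composition. M
  bounds the variables but not the target.\<close>

definition compiles :: "nat \<Rightarrow> nat \<Rightarrow> nat \<Rightarrow> (nat \<Rightarrow> nat) \<Rightarrow> expr \<Rightarrow> cmd \<Rightarrow> nat \<Rightarrow> nat poly \<Rightarrow> bool" where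
  "compiles a r f m e c N p \<longleftrightarrow> f \<le> N \<and> ok_cmd c \<and>
    (\<forall>R\<ge>N. \<forall>xs v y M v'. length xs = a \<longrightarrow> bounded xs M \<longrightarrow> (\<forall>i. v (m i) \<le> M) \<longrightarrow> (\<forall>j\<ge>f. v j = 0) \<longrightarrow>
      v' = v(r := v r + eval xs e (\<lambda>i. v (m i))) \<longrightarrow>
      runs c (tapes xs (\<lambda>_. 0) R v y) (poly p M) (tapes xs (\<lambda>_. 0) R v' y))"

lemma compilesD:
  assumes "compiles a r f m e c N p" "N \<le> R" "length xs = a" "bounded xs M" "\<And>i. v (m i) \<le> M"
    "\<And>j. f \<le> j \<Longrightarrow> v j = 0" "v' = v(r := v r + eval xs e (\<lambda>i. v (m i)))"
  shows "runs c (tapes xs (\<lambda>_. 0) R v y) (poly p M) (tapes xs (\<lambda>_. 0) R v' y)"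
  using assms unfolding compiles_def by blast

section \<open>Counter programs for each kind of expression\<close>

definition add_to :: "nat \<Rightarrow> nat \<Rightarrow> nat \<Rightarrow> cmd" where
  "add_to a i r = loop (a + i) (inc (a + r))"

lemma runs_add_to:
  assumes "i < R" "r < R" "i \<noteq> r" "v i \<le> M" "v' = v(i := 0, r := v r + v i)" "length xs = a"
  shows "runs (add_to a i r) (tapes xs h R v y) (4 * M + 1) (tapes xs h R v' y)"
  unfolding add_to_def assms(6)[symmetric]
  by (rule runs_loop[where V = "\<lambda>k. v(r := v r + k)" and n = "v i" and B = 1 and H = "\<lambda>_. h" and Y = "\<lambda>_. y"])
     (use assms in \<open>auto simp: fun_eq_iff intro!: runs_inc\<close>)

definition clear :: "nat \<Rightarrow> nat \<Rightarrow> cmd" where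
  "clear a i = loop (a + i) noop"

lemma runs_clear:
  assumes "i < R" "v i \<le> M" "v' = v(i := 0)" "length xs = a"
  shows "runs (clear a i) (tapes xs h R v y) (4 * M + 1) (tapes xs h R v' y)"
  unfolding clear_def assms(4)[symmetric]
  by (rule runs_loop[where V = "\<lambda>k. v" and n = "v i" and B = 1 and H = "\<lambda>_. h" and Y = "\<lambda>_. y"])
     (use assms in \<open>auto simp: fun_eq_iff intro!: runs_noop\<close>)

lemma runs_If_zero:
  assumes "i < R" "length xs = a"
    "runs (if v i = 0 then c else d) (tapes xs h R v y) B ts'"
  shows "runs (Ifs (a + i) 1 c d) (tapes xs h R v y) (Suc B) ts'"
  by (rule runs_If) (use assms in \<open>auto simp: length_tapes nth_tapes_counter read_counter split: if_splits\<close>)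

lemma ok_add_to [simp]: "ok_cmd (add_to a i r)" "ok_cmd (clear a i)"
  by (simp_all add: add_to_def clear_def)

lemma compiles_Var:
  assumes "\<forall>i. m i < f \<and> m i \<noteq> r" "r < f"
  shows "\<exists>c N p. compiles a r f m (Var x) c N p"
proof -
  \<comment> \<open>A loop destroys its counter. So the value is moved to r and to the scratch
    register f at once, and then back from f.\<close>
  let ?c = "loop (a + m x) (inc (a + f) ;; inc (a + r)) ;; add_to a f (m x)"
  have "runs ?c (tapes xs (\<lambda>_. 0) R v y) (poly [:3, 10:] M) (tapes xs (\<lambda>_. 0) R (v(r := v r + v (m x))) y)"
    if *: "Suc f \<le> R" "length xs = a" "\<And>i. v (m i) \<le> M" "\<And>j. f \<le> j \<Longrightarrow> v j = 0" for R xs v y M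
  proof -
    have m: "m x < f" "m x \<noteq> r" "m x < R" using assms *(1) by (auto intro: less_trans[of _ f])
    have 1: "runs (loop (a + m x) (inc (a + f) ;; inc (a + r))) (tapes xs (\<lambda>_. 0) R v y) (6 * M + 1)
        (tapes xs (\<lambda>_. 0) R (v(m x := 0, f := v (m x), r := v r + v (m x))) y)"
      unfolding *(2)[symmetric]
    proof (rule runs_loop[where V = "\<lambda>k. v(f := k, r := v r + k)" and n = "v (m x)"
        and B = "Suc (Suc 0 + Suc 0)"
        and H = "\<lambda>_ _. 0" and Y = "\<lambda>_. y"])
      fix k
      show "runs (inc (length xs + f) ;; inc (length xs + r))
          (tapes xs (\<lambda>_. 0) R ((v(f := k, r := v r + k))(m x := v (m x) - Suc k)) y) (Suc (Suc 0 + Suc 0))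
          (tapes xs (\<lambda>_. 0) R ((v(f := Suc k, r := v r + Suc k))(m x := v (m x) - Suc k)) y)"
        by (rule runs_Seq[OF runs_inc[where v' = "v(f := Suc k, r := v r + k, m x := v (m x) - Suc k)"]
            runs_inc])
          (use * m assms in \<open>auto simp: fun_eq_iff\<close>)
    qed (use * m assms in \<open>auto simp: fun_eq_iff\<close>)
    have 2: "runs (add_to a f (m x)) (tapes xs (\<lambda>_. 0) R (v(m x := 0, f := v (m x), r := v r + v (m x))) y)
        (4 * M + 1)
       (tapes xs (\<lambda>_. 0) R (v(r := v r + v (m x))) y)"
      by (rule runs_add_to) (use * m assms in \<open>auto simp: fun_eq_iff\<close>)
    show ?thesis by (rule runs_mono[OF runs_Seq[OF 1 2]]) simp
  qed
  then have "compiles a r f m (Var x) ?c (Suc f) [:3, 10:]"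
    unfolding compiles_def by auto
  then show ?thesis by blast
qed

lemma compiles_One:
  assumes "r < f"
  shows "\<exists>c N p. compiles a r f m One c N p"
proof -
  have "compiles a r f m One (inc (a + r)) f [:1:]"
    unfolding compiles_def using assms by (auto intro!: runs_inc)
  then show ?thesis by blast
qed

lemma compiles_Add:
  assumes "\<forall>i. m i < f \<and> m i \<noteq> r" "r < f"
    "compiles a r f m d c1 N1 p1" "compiles a r f m e c2 N2 p2"
  shows "\<exists>c N p. compiles a r f m (Add d e) c N p"
proof -
  have "runs (c1 ;; c2) (tapes xs (\<lambda>_. 0) R v y) (poly (1 + p1 + p2) M)
      (tapes xs (\<lambda>_. 0) R (v(r := v r + eval xs (Add d e) (\<lambda>i. v (m i)))) y)"
    if *: "max N1 N2 \<le> R" "length xs = a" "bounded xs M" "\<And>i. v (m i) \<le> M" "\<And>j. f \<le> j \<Longrightarrow> v j = 0"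
        for R xs v y M
  proof (rule runs_mono[OF runs_Seq])
    show "runs c1 (tapes xs (\<lambda>_. 0) R v y) (poly p1 M)
        (tapes xs (\<lambda>_. 0) R (v(r := v r + eval xs d (\<lambda>i. v (m i)))) y)"
      by (rule compilesD[OF assms(3)]) (use * in auto)
    show "runs c2 (tapes xs (\<lambda>_. 0) R (v(r := v r + eval xs d (\<lambda>i. v (m i)))) y) (poly p2 M)
       (tapes xs (\<lambda>_. 0) R (v(r := v r + eval xs (Add d e) (\<lambda>i. v (m i)))) y)"
      by (rule compilesD[OF assms(4)]) (use * assms in auto)
  qed simp
  then have "compiles a r f m (Add d e) (c1 ;; c2) (max N1 N2) (1 + p1 + p2)"
    using assms(3,4) unfolding compiles_def by auto
  then show ?thesis by blast
qed

lemma compiles_Monus: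
  assumes "\<forall>i. m i < f \<and> m i \<noteq> r" "r < f"
    "compiles a f (Suc f) m d c1 N1 p1" "compiles a (Suc f) (f + 2) m e c2 N2 p2"
  shows "\<exists>c N p. compiles a r f m (Monus d e) c N p"
proof -
  obtain q1 q2 :: "nat poly" where
    q1: "\<And>xs v M. (\<forall>i. v i \<le> M) \<Longrightarrow> bounded xs M \<Longrightarrow> eval xs d v \<le> poly q1 M" and
    q2: "\<And>xs v M. (\<forall>i. v i \<le> M) \<Longrightarrow> bounded xs M \<Longrightarrow> eval xs e v \<le> poly q2 M"
    using eval_bound by metis
  let ?l = "loop (a + Suc f) (Ifs (a + f) 1 noop (dec (a + f)))"
  let ?c = "c1 ;; c2 ;; ?l ;; add_to a f r"
  let ?p = "p1 + p2 + 5 * q2 + 4 * q1 + 5"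
  have "runs ?c (tapes xs (\<lambda>_. 0) R v y) (poly ?p M)
      (tapes xs (\<lambda>_. 0) R (v(r := v r + eval xs (Monus d e) (\<lambda>i. v (m i)))) y)"
    if *: "max N1 N2 \<le> R" "length xs = a" "bounded xs M" "\<And>i. v (m i) \<le> M" "\<And>j. f \<le> j \<Longrightarrow> v j = 0"
        for R xs v y M
  proof -
    let ?T = "\<lambda>v. tapes xs (\<lambda>_. 0) R v y" and ?n = "eval xs d (\<lambda>i. v (m i))"
        and ?k = "eval xs e (\<lambda>i. v (m i))"
    have n: "?n \<le> poly q1 M" "?k \<le> poly q2 M" by (rule q1 q2; use assms * in auto)+
    have R: "f + 2 \<le> R" using * assms(4) by (simp add: compiles_def)
    have 1: "runs c1 (?T v) (poly p1 M) (?T (v(f := ?n)))"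
      by (rule compilesD[OF assms(3)]) (use * assms R in \<open>auto simp: fun_eq_iff le_Suc_eq\<close>)
    have mf: "m i \<noteq> f" "m i \<noteq> Suc f" for i using assms(1) by (metis less_irrefl less_Suc_eq not_less_eq)+
    have 2: "runs c2 (?T (v(f := ?n))) (poly p2 M) (?T (v(f := ?n, Suc f := ?k)))"
      by (rule compilesD[OF assms(4)]) (use * assms R mf in \<open>auto simp: fun_eq_iff\<close>)
    have 3: "runs ?l (?T (v(f := ?n, Suc f := ?k))) (5 * poly q2 M + 1) (?T (v(f := ?n - ?k)))"
      unfolding *(2)[symmetric]
    proof (rule runs_loop[where V = "\<lambda>k. v(f := ?n - k)" and n = ?k and B = "Suc (Suc 0)" and H = "\<lambda>_ _. 0"
        and Y = "\<lambda>_. y"])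
      fix k
      show "runs (Ifs (length xs + f) 1 noop (dec (length xs + f))) (?T ((v(f := ?n - k))(Suc f :=
          ?k - Suc k))) (Suc (Suc 0))
          (?T ((v(f := ?n - Suc k))(Suc f := ?k - Suc k)))"
      proof (rule runs_If_zero)
        show "runs (if ((v(f := ?n - k))(Suc f := ?k - Suc k)) f = 0 then noop else dec (length xs + f))
            (?T ((v(f := ?n - k))(Suc f := ?k - Suc k))) (Suc 0)
          (?T ((v(f := ?n - Suc k))(Suc f := ?k - Suc k)))"
        proof (cases "?n \<le> k")
          case True
          then show ?thesis by (simp add: runs_noop)
        next
          case False
          then have "runs (dec (length xs + f)) (?T ((v(f := ?n - k))(Suc f := ?k - Suc k))) (Suc 0)
              (?T ((v(f := ?n - Suc k))(Suc f := ?k - Suc k)))"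
            by (intro runs_dec) (use R in \<open>auto simp: fun_eq_iff\<close>)
          then show ?thesis using False by simp
        qed
      qed (use R in auto)
    qed (use R n(2) *(5) in \<open>auto simp: fun_eq_iff\<close>)
    have 4: "runs (add_to a f r) (?T (v(f := ?n - ?k))) (4 * poly q1 M + 1) (?T (v(r :=
        v r + eval xs (Monus d e) (\<lambda>i. v (m i)))))"
      by (rule runs_add_to) (use * assms R n in \<open>auto simp: fun_eq_iff\<close>)
    show ?thesis
      by (rule runs_mono[OF runs_Seq[OF 1 runs_Seq[OF 2 runs_Seq[OF 3 4]]]]) (simp add: poly_pcompose
          numeral_poly)
  qed
  then have "compiles a r f m (Monus d e) ?c (max N1 N2) ?p"
    using assms(3,4) unfolding compiles_def by auto
  then show ?thesis by blast
qed

lemma compiles_Bit: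
  assumes "\<forall>i. m i < f \<and> m i \<noteq> r" "r < f" "compiles a f (f + 2) m e c1 N1 p1"
  shows "\<exists>c N p. compiles a r f m (Bit j e) c N p"
proof (cases "j < a")
  case False
  then have "compiles a r f m (Bit j e) noop f [:1:]"
    unfolding compiles_def by (auto intro!: runs_noop)
  then show ?thesis by blast
next
  case j: True
  obtain q1 :: "nat poly" where
    q1: "\<And>xs v M. (\<forall>i. v i \<le> M) \<Longrightarrow> bounded xs M \<Longrightarrow> eval xs e v \<le> poly q1 M"
    using eval_bound by metis
  \<comment> \<open>The input tapes carry no mark on cell 0, so the distance walked is kept in
    \<open>Suc f\<close> for the way back. Beyond the end of the input a blank is read, which is the
    value 0 demanded by \<open>eval\<close>.\<close>
  let ?l1 = "loop (a + f) (inc (a + Suc f) ;; inc j)" and ?l2 = "loop (a + Suc f) (dec j)"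
  let ?i = "Ifs j 1 (inc (a + r)) (Ifs j 2 (inc (a + r) ;; inc (a + r)) noop)"
  let ?c = "c1 ;; ?l1 ;; ?i ;; ?l2"
  let ?p = "p1 + 10 * q1 + 12"
  have "runs ?c (tapes xs (\<lambda>_. 0) R v y) (poly ?p M)
      (tapes xs (\<lambda>_. 0) R (v(r := v r + eval xs (Bit j e) (\<lambda>i. v (m i)))) y)"
    if *: "N1 \<le> R" "length xs = a" "bounded xs M" "\<And>i. v (m i) \<le> M" "\<And>j. f \<le> j \<Longrightarrow> v j = 0" for R xs v y M
  proof -
    let ?n = "eval xs e (\<lambda>i. v (m i))" and ?b = "eval xs (Bit j e) (\<lambda>i. v (m i))"
    let ?T = "\<lambda>h v. tapes xs h R v y" and ?h = "\<lambda>k. (\<lambda>_. 0 :: nat)(j := k)"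
    have n: "?n \<le> poly q1 M" by (rule q1) (use assms * in auto)
    have R: "f + 2 \<le> R" using * assms(3) by (simp add: compiles_def)
    have 1: "runs c1 (?T (\<lambda>_. 0) v) (poly p1 M) (?T (\<lambda>_. 0) (v(f := ?n)))"
      by (rule compilesD[OF assms(3)]) (use * assms R in \<open>auto simp: fun_eq_iff\<close>)
    have 2: "runs ?l1 (?T (\<lambda>_. 0) (v(f := ?n))) (6 * poly q1 M + 1) (?T (?h ?n) (v(Suc f := ?n)))"
      unfolding *(2)[symmetric]
    proof (rule runs_loop[where V = "\<lambda>k. v(Suc f := k)" and n = ?n and B = "Suc (Suc 0 + Suc 0)" and H = ?h
        and Y = "\<lambda>_. y"])
      fix k
      show "runs (inc (length xs + Suc f) ;; inc j) (?T (?h k) ((v(Suc f := k))(f := ?n - Suc k)))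
          (Suc (Suc 0 + Suc 0))
          (?T (?h (Suc k)) ((v(Suc f := Suc k))(f := ?n - Suc k)))"
        by (rule runs_Seq[OF runs_inc runs_right]) (use R j *(2) in auto)
    qed (use R n *(5) in \<open>auto simp: fun_eq_iff\<close>)
    have 3: "runs ?i (?T (?h ?n) (v(Suc f := ?n))) 6 (?T (?h ?n) (v(Suc f := ?n, r := v r + ?b)))"
    proof -
      have rd: "read_tape (?T (?h ?n) (v(Suc f := ?n)) ! j) = ?b"
        using j *(2) by (auto simp: nth_tapes_input input_tape_def)
      have b: "?b = 0 \<or> ?b = 1 \<or> ?b = 2" by (auto simp: bit_symbol_def)
      have rf: "r \<noteq> Suc f" using assms(2) by simp
      have i1: "runs (inc (a + r)) (?T (?h ?n) (v(Suc f := ?n))) (Suc 0) (?T (?h ?n) (v(Suc f := ?n, r :=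
          v r + 1)))"
        unfolding *(2)[symmetric] by (rule runs_inc) (use R assms(2) in auto)
      have i2: "runs (inc (a + r)) (?T (?h ?n) (v(Suc f := ?n, r := v r + 1))) (Suc 0) (?T (?h ?n) (v(Suc f :=
          ?n, r := v r + 2)))"
        unfolding *(2)[symmetric] by (rule runs_inc) (use R assms(2) in auto)
      have "runs (if read_tape (?T (?h ?n) (v(Suc f := ?n)) ! j) = 1 then inc (a + r)
          else Ifs j 2 (inc (a + r) ;; inc (a + r)) noop) (?T (?h ?n) (v(Suc f := ?n))) 5
          (?T (?h ?n) (v(Suc f := ?n, r := v r + ?b)))"
      proof (cases "?b = 1")
        case True
        show ?thesis unfolding rd using True runs_mono[OF i1, of 5] by (simp only: if_True) simp
      next
        case False
        have "runs (Ifs j 2 (inc (a + r) ;; inc (a + r)) noop) (?T (?h ?n) (v(Suc f := ?n))) (Suc 4)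
          (?T (?h ?n) (v(Suc f := ?n, r := v r + ?b)))"
        proof (rule runs_If)
          show "runs (if read_tape (?T (?h ?n) (v(Suc f := ?n)) ! j) = 2 then inc (a + r) ;;
              inc (a + r) else noop)
              (?T (?h ?n) (v(Suc f := ?n))) 4 (?T (?h ?n) (v(Suc f := ?n, r := v r + ?b)))"
          proof (cases "?b = 2")
            case True
            show ?thesis unfolding rd using True runs_mono[OF runs_Seq[OF i1 i2], of 4]
                by (simp only: if_True) simp
          next
            case F: False
            with False b have "?b = 0" by blast
            then show ?thesis unfolding rd
              using runs_mono[OF runs_noop, of 4] rf fun_upd_triv[of v r] by (simp only: fun_upd_twist) simp
          qed
        qed (use j *(2) in \<open>simp add: length_tapes\<close>)
        then show ?thesis unfolding rd using False by simp
      qed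
      from runs_If[OF _ this] j *(2) show ?thesis by (simp add: length_tapes)
    qed
    have 4: "runs ?l2 (?T (?h ?n) (v(Suc f := ?n, r := v r + ?b))) (4 * poly q1 M + 1) (?T (\<lambda>_. 0) (v(r :=
        v r + ?b)))"
      unfolding *(2)[symmetric]
    proof (rule runs_loop[where V = "\<lambda>k. v(r := v r + ?b)" and n = ?n and B = "Suc 0"
        and H = "\<lambda>k. ?h (?n - k)" and Y = "\<lambda>_. y"])
      fix k assume "k < ?n"
      then show "runs (dec j) (?T (?h (?n - k)) ((v(r := v r + ?b))(Suc f := ?n - Suc k))) (Suc 0)
          (?T (?h (?n - Suc k)) ((v(r := v r + ?b))(Suc f := ?n - Suc k)))"
        by (intro runs_left) (use R j *(2) in \<open>auto simp: fun_eq_iff\<close>)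
    qed (use R n *(5) assms(2) in \<open>auto simp: fun_eq_iff\<close>)
    show ?thesis
      by (rule runs_mono[OF runs_Seq[OF 1 runs_Seq[OF 2 runs_Seq[OF 3 4]]]]) (simp add: numeral_poly)
  qed
  then have "compiles a r f m (Bit j e) ?c N1 ?p"
    using assms(3) unfolding compiles_def by auto
  then show ?thesis by blast
qed

lemma compiles_Len:
  assumes "\<forall>i. m i < f \<and> m i \<noteq> r" "r < f"
  shows "\<exists>c N p. compiles a r f m (Len j) c N p"
proof (cases "j < a")
  case False
  then have "compiles a r f m (Len j) noop f [:1:]"
    unfolding compiles_def by (auto intro!: runs_noop)
  then show ?thesis by blast
next
  case j: True
  let ?l1 = "Until j 0 (inc j ;; inc (a + f) ;; inc (a + r))" and ?l2 = "loop (a + f) (dec j)"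
  let ?p = "[:3, 10:] :: nat poly"
  have "runs (?l1 ;; ?l2) (tapes xs (\<lambda>_. 0) R v y) (poly ?p M)
      (tapes xs (\<lambda>_. 0) R (v(r := v r + eval xs (Len j) (\<lambda>i. v (m i)))) y)"
    if *: "Suc f \<le> R" "length xs = a" "bounded xs M" "\<And>i. v (m i) \<le> M" "\<And>j. f \<le> j \<Longrightarrow> v j = 0" for R xs v y M
  proof -
    let ?n = "length (xs ! j)"
    let ?T = "\<lambda>h v. tapes xs h R v y" and ?h = "\<lambda>k. (\<lambda>_. 0 :: nat)(j := k)"
    let ?V = "\<lambda>k. v(f := k, r := v r + k)"
    have n: "?n \<le> M" using j *(2,3) by (auto simp: bounded_def)
    have l1: "runs ?l1 (?T (?h 0) (?V 0)) (?n * (Suc (Suc 0 + Suc (Suc 0 + Suc 0)) + 1) + 1) (?T (?h ?n)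
        (?V ?n))"
    proof (rule runs_Until)
      fix k assume "k < ?n"
      show "runs (inc j ;; inc (a + f) ;; inc (a + r)) (?T (?h k) (?V k)) (Suc (Suc 0 + Suc (Suc 0 + Suc 0)))
          (?T (?h (Suc k)) (?V (Suc k)))"
        unfolding *(2)[symmetric]
        by (rule runs_Seq[OF runs_right[where h' = "?h (Suc k)"] runs_Seq[OF runs_inc[where v' =
            "v(f := Suc k, r := v r + k)"] runs_inc]])
          (use * j assms(2) in \<open>auto simp: fun_eq_iff\<close>)
    qed (use j *(2) in \<open>auto simp: length_tapes nth_tapes_input input_tape_def bit_symbol_def\<close>)
    have h0: "?h 0 = (\<lambda>_. 0 :: nat)" "?V 0 = v" using *(5) assms(2) by (auto simp: fun_eq_iff)
    have 1: "runs ?l1 (?T (\<lambda>_. 0) v) (6 * M + 1) (?T (?h ?n) (?V ?n))"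
      by (rule runs_mono[OF l1[unfolded h0]]) (use n in simp)
    have 2: "runs ?l2 (?T (?h ?n) (?V ?n)) (4 * M + 1) (?T (\<lambda>_. 0) (v(r := v r + ?n)))"
      unfolding *(2)[symmetric]
    proof (rule runs_loop[where V = "\<lambda>k. v(r := v r + ?n)" and n = ?n and B = "Suc 0"
        and H = "\<lambda>k. ?h (?n - k)" and Y = "\<lambda>_. y"])
      fix k assume "k < ?n"
      then show "runs (dec j) (?T (?h (?n - k)) ((v(r := v r + ?n))(f := ?n - Suc k))) (Suc 0)
          (?T (?h (?n - Suc k)) ((v(r := v r + ?n))(f := ?n - Suc k)))"
        by (intro runs_left) (use j * in \<open>auto simp: fun_eq_iff\<close>)
    qed (use n * assms(2) in \<open>auto simp: fun_eq_iff\<close>)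
    show ?thesis
      using runs_mono[OF runs_Seq[OF 1 2], of "poly ?p M"] j *(2) by simp
  qed
  then have "compiles a r f m (Len j) (?l1 ;; ?l2) (Suc f) ?p"
    unfolding compiles_def by auto
  then show ?thesis by blast
qed

lemma compiles_Sum:
  assumes "\<forall>i. m i < f \<and> m i \<noteq> r" "r < f"
    "compiles a f (f + 2) m d c1 N1 p1" "compiles a r (f + 2) (case_nat (Suc f) m) e c2 N2 p2"
  shows "\<exists>c N p. compiles a r f m (Sum d e) c N p"
proof -
  obtain q1 :: "nat poly" where
    q1: "\<And>xs v M. (\<forall>i. v i \<le> M) \<Longrightarrow> bounded xs M \<Longrightarrow> eval xs d v \<le> poly q1 M"
    using eval_bound by metis
  let ?l = "loop (a + f) (c2 ;; inc (a + Suc f))"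
  let ?c = "c1 ;; ?l ;; clear a (Suc f)"
  let ?B = "pcompose p2 ([:0, 1:] + q1) + 2"
  let ?p = "p1 + q1 * (?B + 3) + 4 * q1 + 4"
  have "runs ?c (tapes xs (\<lambda>_. 0) R v y) (poly ?p M)
      (tapes xs (\<lambda>_. 0) R (v(r := v r + eval xs (Sum d e) (\<lambda>i. v (m i)))) y)"
    if *: "max N1 N2 \<le> R" "length xs = a" "bounded xs M" "\<And>i. v (m i) \<le> M" "\<And>j. f \<le> j \<Longrightarrow> v j = 0"
        for R xs v y M
  proof -
    let ?T = "\<lambda>v. tapes xs (\<lambda>_. 0) R v y" and ?n = "eval xs d (\<lambda>i. v (m i))"
    define s where "s k = (\<Sum>i<k. eval xs e (case_nat i (\<lambda>i. v (m i))))" for k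
    have n: "?n \<le> poly q1 M" by (rule q1; use assms * in auto)
    have R: "f + 2 \<le> R" using * assms(4) by (simp add: compiles_def)
    have mf: "m i \<noteq> f" "m i \<noteq> Suc f" for i using assms(1) by (metis less_irrefl less_Suc_eq not_less_eq)+
    have 1: "runs c1 (?T v) (poly p1 M) (?T (v(f := ?n)))"
      by (rule compilesD[OF assms(3)]) (use * assms R in \<open>auto simp: fun_eq_iff le_Suc_eq\<close>)
    have 2: "runs ?l (?T (v(f := ?n))) (?n * (poly ?B M + 3) + 1) (?T (v(Suc f := ?n, r := v r + s ?n)))"
      unfolding *(2)[symmetric]
    proof (rule runs_loop[where V = "\<lambda>k. v(Suc f := k, r := v r + s k)" and n = ?n and B = "poly ?B M"
          and H = "\<lambda>_ _. 0" and Y = "\<lambda>_. y"])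
      fix k assume k: "k < ?n"
      let ?V = "v(Suc f := k, r := v r + s k, f := ?n - Suc k)"
      let ?V' = "v(Suc f := k, r := v r + s (Suc k), f := ?n - Suc k)"
      have env: "(\<lambda>i. ?V (case_nat (Suc f) m i)) = case_nat k (\<lambda>i. v (m i))"
        using assms mf by (auto simp: fun_eq_iff split: nat.split)
      have "runs c2 (?T ?V) (poly p2 (M + poly q1 M)) (?T ?V')"
      proof (rule compilesD[OF assms(4)])
        have "(case_nat k (\<lambda>i. v (m i))) i \<le> M + poly q1 M" for i
          using k n *(4) by (cases i) (auto intro: le_trans trans_le_add1)
        then show "?V (case_nat (Suc f) m i) \<le> M + poly q1 M" for i using fun_cong[OF env, of i] by metis
        show "?V' = ?V(r := ?V r + eval xs e (\<lambda>i. ?V (case_nat (Suc f) m i)))"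
          unfolding env using assms(2) by (auto simp: s_def fun_eq_iff)
      qed (use * R assms(2) bounded_mono in \<open>auto simp: fun_eq_iff\<close>)
      moreover have "runs (inc (length xs + Suc f)) (?T ?V') (Suc 0) (?T (v(Suc f := Suc k, r :=
          v r + s (Suc k), f := ?n - Suc k)))"
        by (rule runs_inc) (use R assms(2) in \<open>auto simp: fun_eq_iff\<close>)
      ultimately have "runs (c2 ;; inc (length xs + Suc f)) (?T ?V) (Suc (poly p2 (M + poly q1 M) + Suc 0))
          (?T (v(Suc f := Suc k, r := v r + s (Suc k), f := ?n - Suc k)))" by (rule runs_Seq)
      then show "runs (c2 ;; inc (length xs + Suc f)) (?T ?V) (poly ?B M)
          (?T (v(Suc f := Suc k, r := v r + s (Suc k), f := ?n - Suc k)))"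
        by (rule runs_mono) (simp add: poly_pcompose numeral_poly)
    qed (use * R n assms(2) in \<open>auto simp: fun_eq_iff s_def\<close>)
    have 3: "runs (clear a (Suc f)) (?T (v(Suc f := ?n, r := v r + s ?n))) (4 * poly q1 M + 1)
       (?T (v(r := v r + eval xs (Sum d e) (\<lambda>i. v (m i)))))"
      by (rule runs_clear) (use * R n assms(2) in \<open>auto simp: fun_eq_iff s_def\<close>)
    have "?n * (poly ?B M + 3) \<le> poly q1 M * (poly ?B M + 3)" using n by simp
    then show ?thesis
      by (intro runs_mono[OF runs_Seq[OF 1 runs_Seq[OF 2 3]]]) (simp add: numeral_poly)
  qed
  then have "compiles a r f m (Sum d e) ?c (max N1 N2) ?p"
    using assms(3,4) unfolding compiles_def by auto
  then show ?thesis by blast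
qed

lemma compiles_Rec:
  assumes "\<forall>i. m i < f \<and> m i \<noteq> r" "r < f"
    "compiles a f (f + 6) m cap c1 N1 p1" "compiles a (f + 1) (f + 6) m ini c2 N2 p2"
    "compiles a (f + 2) (f + 6) m cnt c3 N3 p3"
    "compiles a (f + 4) (f + 6) (case_nat (f + 3) (case_nat (f + 1) m)) st c4 N4 p4"
  shows "\<exists>c N p. compiles a r f m (Rec cap ini st cnt) c N p"
proof -
  have "\<exists>q. \<forall>e. \<forall>xs v M. (\<forall>i. v i \<le> M) \<longrightarrow> bounded xs M \<longrightarrow> eval xs e v \<le> poly (q e) M"
    using eval_bound by (intro choice) blast
  then obtain q :: "expr \<Rightarrow> nat poly" where
    q: "\<And>e xs v M. (\<forall>i. v i \<le> M) \<Longrightarrow> bounded xs M \<Longrightarrow> eval xs e v \<le> poly (q e) M" by blast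
  define q1 q2 q3 q4 where "q1 = q cap" and "q2 = q ini" and "q3 = q cnt" and "q4 = q st"
  \<comment> \<open>Registers: f the cap, f + 1 the accumulator, f + 2 the remaining rounds, f + 3
    the index, f + 4 the new value, f + 5 a copy of the cap. The loop \<open>?t\<close> moves the
    cap to its copy and, in each round, one unit from the new value to the accumulator while there
    is one left; this computes the minimum.\<close>
  let ?t = "loop (a + f) (inc (a + (f + 5)) ;; Ifs (a + (f + 4)) 1 noop (dec (a + (f + 4)) ;;
      inc (a + (f + 1))))"
  let ?b = "c4 ;; clear a (f + 1) ;; ?t ;; clear a (f + 4) ;; add_to a (f + 5) f ;; inc (a + (f + 3))"
  let ?l = "loop (a + (f + 2)) ?b"
  let ?c = "c1 ;; c2 ;; c3 ;; ?l ;; add_to a (f + 1) r ;; clear a f ;; clear a (f + 3)"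
  let ?M' = "[:0, 1:] + q1 + q2 + q3"
  let ?B = "pcompose p4 ?M' + 4 * (q1 + q2) + 13 * q1 + 4 * pcompose q4 ?M' + 20"
  let ?p = "p1 + p2 + p3 + q3 * (?B + 3) + 4 * (q1 + q2) + 4 * q1 + 4 * q3 + 20"
  have "runs ?c (tapes xs (\<lambda>_. 0) R v y) (poly ?p M)
      (tapes xs (\<lambda>_. 0) R (v(r := v r + eval xs (Rec cap ini st cnt) (\<lambda>i. v (m i)))) y)"
    if *: "max (max N1 N2) (max N3 N4) \<le> R" "length xs = a" "bounded xs M" "\<And>i. v (m i) \<le> M"
        "\<And>j. f \<le> j \<Longrightarrow> v j = 0" for R xs v y M
  proof -
    let ?T = "\<lambda>v. tapes xs (\<lambda>_. 0) R v y"
    define C I n where "C = eval xs cap (\<lambda>i. v (m i))" and "I = eval xs ini (\<lambda>i. v (m i))"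
        and "n = eval xs cnt (\<lambda>i. v (m i))"
    define s where "s k = rec_nat I (\<lambda>i x. min C (eval xs st (case_nat i (case_nat x (\<lambda>i. v (m i)))))) k"
        for k
    have s0: "s 0 = I" and sS: "s (Suc k) = min C (eval xs st (case_nat k (case_nat (s k) (\<lambda>i. v (m i)))))"
        for k
      by (simp_all add: s_def)
    have bd: "C \<le> poly q1 M" "I \<le> poly q2 M" "n \<le> poly q3 M"
      unfolding C_def I_def n_def q1_def q2_def q3_def by (rule q; use * in auto)+
    have sb: "s k \<le> poly q1 M + poly q2 M" for k
      by (cases k) (use bd in \<open>auto simp: s0 sS min.coboundedI1 trans_le_add1 trans_le_add2\<close>)
    have R: "f + 6 \<le> R" using * assms(3) by (simp add: compiles_def)
    have mf: "m i \<noteq> f" "m i \<noteq> f + k" "m i \<noteq> Suc f" "m i \<noteq> Suc (Suc f)" "m i \<noteq> r" for i k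
      using assms(1) by (metis less_irrefl trans_less_add1 less_Suc_eq)+
    have fk: "f + k \<noteq> r" "r \<noteq> f + k" "r \<noteq> f" "f \<noteq> r" "Suc f \<noteq> r" "r \<noteq> Suc f" "Suc (Suc f) \<noteq> r"
        "r \<noteq> Suc (Suc f)" for k using assms(2) by auto
    let ?V = "\<lambda>c acc k i new cp rr. v(f := c, f + 1 := acc, f + 2 := k, f + 3 := i, f + 4 := new, f + 5 := cp,
        r := rr)"
    have V0: "v = ?V 0 0 0 0 0 0 (v r)" using *(5) by (auto simp: fun_eq_iff)
    have 1: "runs c1 (?T v) (poly p1 M) (?T (?V C 0 0 0 0 0 (v r)))"
      by (rule compilesD[OF assms(3)]) (use * R fk in \<open>auto simp: fun_eq_iff C_def\<close>)
    have 2: "runs c2 (?T (?V C 0 0 0 0 0 (v r))) (poly p2 M) (?T (?V C I 0 0 0 0 (v r)))"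
      by (rule compilesD[OF assms(4)]) (use * R mf fk in \<open>auto simp: fun_eq_iff I_def\<close>)
    have 3: "runs c3 (?T (?V C I 0 0 0 0 (v r))) (poly p3 M) (?T (?V C I n 0 0 0 (v r)))"
      by (rule compilesD[OF assms(5)]) (use * R mf fk in \<open>auto simp: fun_eq_iff n_def\<close>)
    have 4: "runs ?l (?T (?V C I n 0 0 0 (v r))) (n * (poly ?B M + 3) + 1) (?T (?V C (s n) 0 n 0 0 (v r)))"
      unfolding *(2)[symmetric]
    proof (rule runs_loop[where V = "\<lambda>k. ?V C (s k) 0 k 0 0 (v r)" and n = n and B = "poly ?B M"
          and H = "\<lambda>_ _. 0" and Y = "\<lambda>_. y"])
      fix k assume k: "k < n"
      define z where "z = eval xs st (case_nat k (case_nat (s k) (\<lambda>i. v (m i))))"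
      let ?W = "\<lambda>c acc i new cp. ?V c acc (n - Suc k) i new cp (v r)"
      have envb: "(case_nat k (case_nat (s k) (\<lambda>i. v (m i)))) i \<le> poly ?M' M" for i
        using k bd sb[of k] *(4) by (auto split: nat.split intro: trans_le_add1 trans_le_add2)
      have bd': "bounded xs (poly ?M' M)" using *(3) by (rule bounded_mono) simp
      have zb: "z \<le> poly q4 (poly ?M' M)" unfolding z_def q4_def by (rule q) (use envb bd' in auto)
      have env: "(\<lambda>i. ?W C (s k) k 0 0 (case_nat (f + 3) (case_nat (f + 1) m) i)) =
          case_nat k (case_nat (s k) (\<lambda>i. v (m i)))"
        using assms mf fk by (auto simp: fun_eq_iff split: nat.split)
      have b1: "runs c4 (?T (?W C (s k) k 0 0)) (poly p4 (poly ?M' M)) (?T (?W C (s k) k z 0))"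
      proof (rule compilesD[OF assms(6)])
        show "?W C (s k) k 0 0 (case_nat (f + 3) (case_nat (f + 1) m) i) \<le> poly ?M' M" for i
          using fun_cong[OF env, of i] envb[of i] by metis
        show "?W C (s k) k z 0 = (?W C (s k) k 0 0)(f + 4 := ?W C (s k) k 0 0 (f + 4) +
            eval xs st (\<lambda>i. ?W C (s k) k 0 0 (case_nat (f + 3) (case_nat (f + 1) m) i)))"
          unfolding env using fk by (auto simp: z_def fun_eq_iff)
      qed (use * R fk bd' in auto)
      have b2: "runs (clear a (f + 1)) (?T (?W C (s k) k z 0)) (4 * (poly q1 M + poly q2 M) + 1)
          (?T (?W C 0 k z 0))"
        by (rule runs_clear) (use * R fk sb[of k] in \<open>auto simp: fun_eq_iff\<close>)
      have b3: "runs ?t (?T (?W C 0 k z 0)) (9 * poly q1 M + 1) (?T (?W 0 (min C z) k (z - C) C))"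
        unfolding *(2)[symmetric]
      proof (rule runs_loop[where V = "\<lambda>j. ?W 0 (min j z) k (z - j) j" and n = C and B = 6 and H = "\<lambda>_ _. 0"
          and Y = "\<lambda>_. y"])
        fix j
        let ?X = "?W (C - Suc j) (min j z) k (z - j) (Suc j)"
        have i1: "runs (inc (length xs + (f + 5))) (?T ((?W 0 (min j z) k (z - j) j)(f := C - Suc j))) (Suc 0)
            (?T ?X)"
          by (rule runs_inc) (use R fk in \<open>auto simp: fun_eq_iff\<close>)
        have i2: "runs (Ifs (length xs + (f + 4)) 1 noop (dec (length xs + (f + 4)) ;;
            inc (length xs + (f + 1)))) (?T ?X) (Suc 3)
           (?T ((?W 0 (min (Suc j) z) k (z - Suc j) (Suc j))(f := C - Suc j)))"
        proof (rule runs_If_zero)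
          show "runs (if ?X (f + 4) = 0 then noop else dec (length xs + (f + 4)) ;; inc (length xs + (f + 1)))
              (?T ?X) 3
            (?T ((?W 0 (min (Suc j) z) k (z - Suc j) (Suc j))(f := C - Suc j)))"
          proof (cases "z \<le> j")
            case True
            then have "?X = (?W 0 (min (Suc j) z) k (z - Suc j) (Suc j))(f := C - Suc j)"
              using fk by (auto simp: fun_eq_iff)
            then show ?thesis using True fk runs_mono[OF runs_noop, of 3] by simp
          next
            case False
            have "runs (dec (length xs + (f + 4)) ;; inc (length xs + (f + 1))) (?T ?X) (Suc (Suc 0 + Suc 0))
              (?T ((?W 0 (min (Suc j) z) k (z - Suc j) (Suc j))(f := C - Suc j)))"
              by (rule runs_Seq[OF runs_dec[where v' = "?W (C - Suc j) (min j z) k (z - Suc j) (Suc j)"]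
                  runs_inc])
                (use R fk False in \<open>auto simp: fun_eq_iff min_def\<close>)
            then show ?thesis using False fk by (auto elim!: runs_mono)
          qed
        qed (use R in auto)
        show "runs (inc (length xs + (f + 5)) ;; Ifs (length xs + (f + 4)) 1 noop (dec (length xs + (f + 4))
            ;; inc (length xs + (f + 1))))
          (?T ((?W 0 (min j z) k (z - j) j)(f := C - Suc j))) 6
          (?T ((?W 0 (min (Suc j) z) k (z - Suc j) (Suc j))(f := C - Suc j)))"
          by (rule runs_mono[OF runs_Seq[OF i1 i2]]) simp
      qed (use R fk bd in \<open>auto simp: fun_eq_iff\<close>)
      have b4: "runs (clear a (f + 4)) (?T (?W 0 (min C z) k (z - C) C)) (4 * poly q4 (poly ?M' M) + 1)
          (?T (?W 0 (min C z) k 0 C))"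
        by (rule runs_clear) (use * R fk zb in \<open>auto simp: fun_eq_iff\<close>)
      have b5: "runs (add_to a (f + 5) f) (?T (?W 0 (min C z) k 0 C)) (4 * poly q1 M + 1) (?T (?W C (min C z)
          k 0 0))"
        by (rule runs_add_to) (use * R fk bd in \<open>auto simp: fun_eq_iff\<close>)
      have b6: "runs (inc (a + (f + 3))) (?T (?W C (min C z) k 0 0)) (Suc 0) (?T (?W C (min C z) (Suc k) 0
          0))"
        unfolding *(2)[symmetric] by (rule runs_inc) (use R fk in \<open>auto simp: fun_eq_iff\<close>)
      have e: "(?V C (s k) 0 k 0 0 (v r))(f + 2 := n - Suc k) = ?W C (s k) k 0 0"
        "(?V C (s (Suc k)) 0 (Suc k) 0 0 (v r))(f + 2 := n - Suc k) = ?W C (min C z) (Suc k) 0 0"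
        using fk by (auto simp: fun_eq_iff sS z_def)
      show "runs (c4 ;; clear (length xs) (f + 1) ;;
          loop (length xs + f) (inc (length xs + (f + 5)) ;; Ifs (length xs + (f + 4)) 1 noop
              (dec (length xs + (f + 4)) ;; inc (length xs + (f + 1)))) ;;
          clear (length xs) (f + 4) ;; add_to (length xs) (f + 5) f ;; inc (length xs + (f + 3)))
          (?T ((?V C (s k) 0 k 0 0 (v r))(f + 2 := n - Suc k))) (poly ?B M)
          (?T ((?V C (s (Suc k)) 0 (Suc k) 0 0 (v r))(f + 2 := n - Suc k)))"
        unfolding *(2) e
        by (rule runs_mono[OF runs_Seq[OF b1 runs_Seq[OF b2 runs_Seq[OF b3 runs_Seq[OF b4 runs_Seq[OF b5
            b6]]]]]])
          (simp add: poly_pcompose numeral_poly)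
    qed (use * R bd fk in \<open>auto simp: fun_eq_iff s0\<close>)
    have 5: "runs (add_to a (f + 1) r) (?T (?V C (s n) 0 n 0 0 (v r))) (4 * (poly q1 M + poly q2 M) + 1)
        (?T (?V C 0 0 n 0 0 (v r + s n)))"
      by (rule runs_add_to) (use * R fk sb assms(2) in \<open>auto simp: fun_eq_iff\<close>)
    have 6: "runs (clear a f) (?T (?V C 0 0 n 0 0 (v r + s n))) (4 * poly q1 M + 1) (?T (?V 0 0 0 n 0 0
        (v r + s n)))"
      by (rule runs_clear) (use * R fk bd in \<open>auto simp: fun_eq_iff\<close>)
    have 7: "runs (clear a (f + 3)) (?T (?V 0 0 0 n 0 0 (v r + s n))) (4 * poly q3 M + 1)
        (?T (v(r := v r + eval xs (Rec cap ini st cnt) (\<lambda>i. v (m i)))))"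
      by (rule runs_clear) (use * R fk bd in \<open>auto simp: fun_eq_iff s_def C_def I_def n_def\<close>)
    have "n * (poly ?B M + 3) \<le> poly q3 M * (poly ?B M + 3)" using bd by simp
    then show ?thesis
      by (intro runs_mono[OF runs_Seq[OF 1 runs_Seq[OF 2 runs_Seq[OF 3 runs_Seq[OF 4 runs_Seq[OF 5 runs_Seq[OF
          6 7]]]]]]])
        (simp add: numeral_poly trans_le_add2)
  qed
  then have "compiles a r f m (Rec cap ini st cnt) ?c (max (max N1 N2) (max N3 N4)) ?p"
    using assms(3-6) unfolding compiles_def by auto
  then show ?thesis by blast
qed

lemma ex_compiles:
  assumes "\<forall>i. m i < f \<and> m i \<noteq> r" "r < f"
  shows "\<exists>c N p. compiles a r f m e c N p"
  using assms
proof (induction e arbitrary: m r f)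
  case (Monus d e)
  have "\<exists>c N p. compiles a f (Suc f) m d c N p" "\<exists>c N p. compiles a (Suc f) (f + 2) m e c N p"
    by (rule Monus.IH; use Monus.prems in \<open>auto simp: less_Suc_eq dest: spec\<close>; metis less_irrefl less_SucI)+
  then show ?case using compiles_Monus[OF Monus.prems] by blast
next
  case (Bit j e)
  have "\<exists>c N p. compiles a f (f + 2) m e c N p"
    by (rule Bit.IH; use Bit.prems in \<open>auto simp: less_Suc_eq\<close>; metis less_irrefl)
  then show ?case using compiles_Bit[OF Bit.prems] by blast
next
  case (Sum d e)
  have "\<exists>c N p. compiles a f (f + 2) m d c N p"
    by (rule Sum.IH; use Sum.prems in \<open>auto simp: less_Suc_eq\<close>; metis less_irrefl)
  moreover have "\<exists>c N p. compiles a r (f + 2) (case_nat (Suc f) m) e c N p"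
    by (rule Sum.IH; use Sum.prems in \<open>auto simp: less_Suc_eq split: nat.split\<close>)
  ultimately show ?case using compiles_Sum[OF Sum.prems] by blast
next
  case (Rec cap ini st cnt)
  have m: "m i < f + k" "m i \<noteq> f + k" "m i \<noteq> f" for i k using Rec.prems(1)
      by (metis less_irrefl trans_less_add1)+
  have m': "m i \<noteq> Suc f" "m i \<noteq> Suc (Suc f)" for i using m(2)[of i 1] m(2)[of i 2] by auto
  have "\<exists>c N p. compiles a f (f + 6) m cap c N p" "\<exists>c N p. compiles a (f + 1) (f + 6) m ini c N p"
    "\<exists>c N p. compiles a (f + 2) (f + 6) m cnt c N p"
    "\<exists>c N p. compiles a (f + 4) (f + 6) (case_nat (f + 3) (case_nat (f + 1) m)) st c N p"
    by (rule Rec.IH; use m m' in \<open>auto split: nat.split\<close>)+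
  then show ?case using compiles_Rec[OF Rec.prems] by blast
next
  case (Var x)
  then show ?case by (rule compiles_Var)
next
  case One
  then show ?case by (intro compiles_One)
next
  case (Add d e)
  obtain c1 N1 p1 c2 N2 p2 where "compiles a r f m d c1 N1 p1" "compiles a r f m e c2 N2 p2"
    using Add.IH[OF Add.prems] by blast
  then show ?case by (rule compiles_Add[OF Add.prems])
next
  case (Len j)
  then show ?case by (rule compiles_Len)
qed

section \<open>Polynomial-time functions\<close>

primrec init_counters :: "nat \<Rightarrow> nat \<Rightarrow> cmd" where
  "init_counters a 0 = noop"
| "init_counters a (Suc k) = init_counters a k ;; Act (a + k) (Some 1) No_Move"

primrec emit :: "nat \<Rightarrow> bool list \<Rightarrow> cmd" where
  "emit t [] = noop"
| "emit t (b # bs) = Act t (Some (bit_symbol b)) Move_Right ;; emit t bs"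

text \<open>Table lookup in the finite control: the register is counted down until it is zero, and
  the corresponding word is written. A value beyond the table writes nothing.\<close>

primrec dispatch :: "nat \<Rightarrow> nat \<Rightarrow> nat \<Rightarrow> (nat \<Rightarrow> bool list) \<Rightarrow> cmd" where
  "dispatch r t 0 tab = noop"
| "dispatch r t (Suc n) tab = Ifs r 1 (emit t (tab 0)) (dec r ;; dispatch r t n (\<lambda>i. tab (Suc i)))"

lemma ok_output [simp]: "ok_cmd (init_counters a k)" "ok_cmd (emit t bs)" "ok_cmd (dispatch r t n tab)"
proof -
  show "ok_cmd (emit t bs)" for bs by (induction bs) (auto simp: bit_symbol_def)
  then show "ok_cmd (dispatch r t n tab)" by (induction n arbitrary: tab) auto
qed (induction k, auto)

lemma output_tape_snoc: "act (bit_symbol b, Move_Right) (output_tape y) = output_tape (y @ [b])"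
  by (auto simp: output_tape_def fun_eq_iff nth_append)

lemma runs_emit: "runs (emit (length xs + R) bs) (tapes xs h R v y) (2 * length bs + 1) (tapes xs h R v (y @
    bs))"
proof (induction bs arbitrary: y)
  case Nil
  then show ?case using runs_noop by simp
next
  case (Cons b bs)
  have "run (Act (length xs + R) (Some (bit_symbol b)) Move_Right) (tapes xs h R v y) 1 (tapes xs h R v (y @
      [b]))"
    using run_Act[of "length xs + R" "tapes xs h R v y" "Some (bit_symbol b)" Move_Right]
    by (simp add: length_tapes nth_tapes_output output_tape_snoc upd_tapes_output)
  then have 1: "runs (Act (length xs + R) (Some (bit_symbol b)) Move_Right) (tapes xs h R v y) 1 (tapes xs h R
      v (y @ [b]))"
    by (auto simp: runs_def)
  from runs_mono[OF runs_Seq[OF this Cons.IH]] show ?case by simp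
qed

lemma runs_dispatch:
  assumes "r < R"
  shows "runs (dispatch (length xs + r) (length xs + R) n tab) (tapes xs h R v y) ((\<Sum>i<n. 2 * length (tab i))
      + 4 * n + 1)
     (tapes xs h R (v(r := v r - n)) (y @ (if v r < n then tab (v r) else [])))"
proof (induction n arbitrary: v tab)
    case 0
    then show ?case using runs_noop by simp
  next
    case (Suc n)
    let ?B = "(\<Sum>i<n. 2 * length (tab (Suc i))) + 4 * n + 1"
    have S: "(\<Sum>i<Suc n. 2 * length (tab i)) + 4 * Suc n + 1 = Suc (2 * length (tab 0) + ?B + 3)"
      by (simp add: sum.lessThan_Suc_shift del: sum.lessThan_Suc)
    show ?case unfolding S dispatch.simps
    proof (rule runs_If_zero[OF assms refl])
      show "runs (if v r = 0 then emit (length xs + R) (tab 0)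
          else dec (length xs + r) ;; dispatch (length xs + r) (length xs + R) n (\<lambda>i. tab (Suc i)))
          (tapes xs h R v y) (2 * length (tab 0) + ?B + 3)
          (tapes xs h R (v(r := v r - Suc n)) (y @ (if v r < Suc n then tab (v r) else [])))"
      proof (cases "v r")
        case 0
        then have v: "v(r := v r - Suc n) = v" by (auto simp: fun_eq_iff)
        show ?thesis unfolding v using runs_mono[OF runs_emit, of "tab 0" "2 * length (tab 0) + ?B + 3"] 0
            by simp
      next
        case v: (Suc u)
        have 1: "runs (dec (length xs + r)) (tapes xs h R v y) (Suc 0) (tapes xs h R (v(r := u)) y)"
          by (rule runs_dec) (use assms v in auto)
        show ?thesis
          using runs_mono[OF runs_Seq[OF 1 Suc.IH[of "\<lambda>i. tab (Suc i)" "v(r := u)", unfolded fun_upd_same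
              fun_upd_upd]], of "2 * length (tab 0) + ?B + 3"] v
          by (auto simp: fun_upd_def split: if_splits)
      qed
    qed
  qed

definition blank_tapes :: "bool list list \<Rightarrow> nat \<Rightarrow> tape list" where
  "blank_tapes xs n = map (\<lambda>j. input_tape (if j < length xs then xs ! j else [])) [0..<n]"

lemma length_blank_tapes: "length (blank_tapes xs n) = n"
  by (simp add: blank_tapes_def)

lemma runs_init_counters:
  assumes "k \<le> R"
  shows "runs (init_counters (length xs) k) (blank_tapes xs (length xs + R + 1)) (3 * k + 1)
    (map (\<lambda>j. if length xs \<le> j \<and> j < length xs + k then counter_tape 0
              else input_tape (if j < length xs then xs ! j else [])) [0..<length xs + R + 1])"
  using assms
proof (induction k)
  case 0
  have "map (\<lambda>j. if length xs \<le> j \<and> j < length xs + 0 then counter_tape 0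
              else input_tape (if j < length xs then xs ! j else [])) [0..<length xs + R + 1] = blank_tapes xs
                  (length xs + R + 1)"
    by (auto simp: blank_tapes_def)
  moreover have "runs noop (blank_tapes xs (length xs + R + 1)) 1 (blank_tapes xs (length xs + R + 1))"
    using runs_move[of 0 "blank_tapes xs (length xs + R + 1)" No_Move]
    by (simp add: noop_def act_stay length_blank_tapes)
  ultimately show ?case by (simp del: upt_Suc)
next
  case (Suc k)
  let ?ts = "\<lambda>k. map (\<lambda>j. if length xs \<le> j \<and> j < length xs + k then counter_tape 0
              else input_tape (if j < length xs then xs ! j else [])) [0..<length xs + R + 1]"
  have IH: "runs (init_counters (length xs) k) (blank_tapes xs (length xs + R + 1)) (3 * k + 1) (?ts k)"
    using Suc by simp
  have "act (1, No_Move) (input_tape []) = counter_tape 0"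
    by (auto simp: input_tape_def counter_tape_def)
  then have "(?ts k)[length xs + k := act (1, No_Move) (?ts k ! (length xs + k))] = ?ts (Suc k)"
    using Suc.prems by (intro nth_equalityI) (auto simp: nth_list_update simp del: upt_Suc)
  moreover have "run (Act (length xs + k) (Some 1) No_Move) (?ts k) 1
      ((?ts k)[length xs + k := act (1, No_Move) (?ts k ! (length xs + k))])"
    using run_Act[of "length xs + k" "?ts k" "Some 1" No_Move] Suc.prems by (simp del: upt_Suc)
  ultimately have "runs (Act (length xs + k) (Some 1) No_Move) (?ts k) 1 (?ts (Suc k))"
    unfolding runs_def by (intro exI[of _ 1]) simp
  from runs_mono[OF runs_Seq[OF IH this]] show ?case by simp
qed

lemma init_tapes:
  "map (\<lambda>j. if length xs \<le> j \<and> j < length xs + R then counter_tape 0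
              else input_tape (if j < length xs then xs ! j else [])) [0..<length xs + R + 1]
   = tapes xs (\<lambda>_. 0) R (\<lambda>_. 0) []"
  by (rule nth_equalityI)
    (auto simp: tapes_def nth_append input_tape_def output_tape_def fun_eq_iff simp del: upt_Suc)

text \<open>Definability is stated for functions instead of expressions, so that the closure rules
  apply by the shape of a function and large expressions are never written down.\<close>

definition pf :: "nat \<Rightarrow> (bool list list \<Rightarrow> (nat \<Rightarrow> nat) \<Rightarrow> nat) \<Rightarrow> bool" where
  "pf a F \<longleftrightarrow> (\<exists>e. \<forall>xs v. length xs = a \<longrightarrow> F xs v = eval xs e v)"

text \<open>The general form of output: an expression computes the index of a word, and a finite
  table holds the words. Register 0 is the round and serves as every variable, register 1 counts
  down the number of words, register 2 receives the table index.\<close>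

lemma polytime_concat:
  assumes "pf a F" "pf a G" and tab: "\<And>u. K \<le> u \<Longrightarrow> tab u = []"
  shows "polytime a (\<lambda>xs. concat (map (\<lambda>i. tab (G xs (\<lambda>_. i))) [0..<F xs (\<lambda>_. 0)]))"
proof -
  from assms obtain d e where F: "\<And>xs v. length xs = a \<Longrightarrow> F xs v = eval xs d v"
    and G: "\<And>xs v. length xs = a \<Longrightarrow> G xs v = eval xs e v" unfolding pf_def by metis
  obtain q1 q2 :: "nat poly" where
    q1: "\<And>xs v M. (\<forall>i. v i \<le> M) \<Longrightarrow> bounded xs M \<Longrightarrow> eval xs d v \<le> poly q1 M" and
    q2: "\<And>xs v M. (\<forall>i. v i \<le> M) \<Longrightarrow> bounded xs M \<Longrightarrow> eval xs e v \<le> poly q2 M"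
    using eval_bound by metis
  have "\<exists>c N p. compiles a 1 3 (\<lambda>_. 0) d c N p" "\<exists>c N p. compiles a 2 3 (\<lambda>_. 0) e c N p"
    by (rule ex_compiles; simp)+
  then obtain c1 N1 p1 c2 N2 p2 where c1: "compiles a 1 3 (\<lambda>_. 0) d c1 N1 p1"
    and c2: "compiles a 2 3 (\<lambda>_. 0) e c2 N2 p2" by blast
  define R where "R = max N1 N2"
  have R3: "3 \<le> R" and R: "N1 \<le> R" "N2 \<le> R" using c1 by (auto simp: compiles_def R_def)
  define L where "L = (\<Sum>i<K. 2 * length (tab i)) + 4 * K + 1"
  let ?b = "c2 ;; dispatch (a + 2) (a + R) K tab ;; clear a 2 ;; inc (a + 0)"
  let ?c = "init_counters a R ;; c1 ;; loop (a + 1) ?b"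
  have ok: "ok_cmd ?c" using c1 c2 by (auto simp: compiles_def)
  obtain M where M: "wf_tm M" "n_tapes M = a + R + 1"
    "\<And>ts n ts'. length ts = a + R + 1 \<Longrightarrow> run ?c ts n ts' \<Longrightarrow> (step M ^^ n) (0, ts) = (n_states M, ts')"
    using ex_machine[OF ok, of "a + R + 1"] by auto
  let ?B = "pcompose p2 (q1 + [:0, 1:]) + 4 * pcompose q2 ([:0, 1:] + q1) + [:L + 7:]"
  let ?p = "[:3 * R + 5:] + p1 + q1 * (?B + 3)"
  let ?y = "\<lambda>xs n. concat (map (\<lambda>i. tab (G xs (\<lambda>_. i))) [0..<n])"
  have "computes_within M xs (?y xs (F xs (\<lambda>_. 0))) (poly ?p (sum_list (map length xs)))"
    if xs: "length xs = a" for xs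
  proof -
    let ?S = "sum_list (map length xs)" and ?n = "F xs (\<lambda>_. 0)"
    let ?T = "\<lambda>v y. tapes xs (\<lambda>_. 0) R v y"
    have bd: "bounded xs ?S" by (auto simp: bounded_def member_le_sum_list)
    have n: "?n \<le> poly q1 ?S" unfolding F[OF xs] by (rule q1) (use bd in auto)
    have 1: "runs (init_counters a R) (snd (init_config M xs)) (3 * R + 1) (?T (\<lambda>_. 0) [])"
      using runs_init_counters[of R R xs] xs M(2) unfolding init_tapes
      by (simp add: init_config_def blank_tapes_def)
    have 2: "runs c1 (?T (\<lambda>_. 0) []) (poly p1 ?S) (?T ((\<lambda>_. 0)(1 := ?n)) [])"
      by (rule compilesD[OF c1 R(1) xs bd]) (use xs F in auto)
    have 3: "runs (loop (a + 1) ?b) (?T ((\<lambda>_. 0)(1 := ?n)) []) (?n * (poly ?B ?S + 3) + 1) (?T ((\<lambda>_. 0)(0 :=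
        ?n)) (?y xs ?n))"
      unfolding xs[symmetric]
    proof (rule runs_loop[where V = "\<lambda>k. (\<lambda>_. 0)(0 := k)" and n = ?n and B = "poly ?B ?S" and H = "\<lambda>_ _. 0"
        and Y = "?y xs"])
      fix k assume k: "k < ?n"
      let ?V = "\<lambda>i. (\<lambda>_. 0 :: nat)(0 := i, 1 := ?n - Suc k)"
      let ?g = "G xs (\<lambda>_. k)"
      have g: "?g \<le> poly q2 (?S + poly q1 ?S)" unfolding G[OF xs]
        by (rule q2) (use bd k n in \<open>auto intro: bounded_mono\<close>)
      have b1: "runs c2 (?T (?V k) (?y xs k)) (poly p2 (poly q1 ?S + ?S)) (?T ((?V k)(2 := ?g)) (?y xs k))"
        by (rule compilesD[OF c2 R(2) xs]) (use bd k n xs G in \<open>auto intro: bounded_mono\<close>)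
      have b2: "runs (dispatch (a + 2) (a + R) K tab) (?T ((?V k)(2 := ?g)) (?y xs k)) L
          (?T ((?V k)(2 := ?g - K)) (?y xs k @ (if ?g < K then tab ?g else [])))"
      proof -
        have "2 < R" using R3 by simp
        from runs_dispatch[OF this, of xs K tab "\<lambda>_. 0" "(?V k)(2 := ?g)" "?y xs k"] show ?thesis
          by (simp only: L_def[symmetric] xs fun_upd_same fun_upd_upd)
      qed
      have y: "?y xs k @ (if ?g < K then tab ?g else []) = ?y xs (Suc k)" using tab by auto
      have b3: "runs (clear a 2) (?T ((?V k)(2 := ?g - K)) (?y xs (Suc k))) (4 * poly q2 (?S + poly q1 ?S) +
          1) (?T (?V k) (?y xs (Suc k)))"
        by (rule runs_clear) (use g R3 xs in \<open>auto simp: fun_eq_iff\<close>)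
      have b4: "runs (inc (a + 0)) (?T (?V k) (?y xs (Suc k))) (Suc 0) (?T (?V (Suc k)) (?y xs (Suc k)))"
        unfolding xs[symmetric] by (rule runs_inc) (use R3 in \<open>auto simp: fun_eq_iff\<close>)
      show "runs (c2 ;; dispatch (length xs + 2) (length xs + R) K tab ;; clear (length xs) 2 ;;
          inc (length xs + 0))
         (?T (((\<lambda>_. 0)(0 := k))(1 := ?n - Suc k)) (?y xs k)) (poly (pcompose p2 (q1 + [:0, 1:]) + 4 * pcompose
             q2 ([:0, 1:] + q1) + [:L + 7:]) ?S)
         (?T (((\<lambda>_. 0)(0 := Suc k))(1 := ?n - Suc k)) (?y xs (Suc k)))"
        unfolding xs
        by (rule runs_mono[OF runs_Seq[OF b1 runs_Seq[OF b2[unfolded y] runs_Seq[OF b3 b4]]]])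
          (simp add: poly_pcompose numeral_poly)
    qed (use R3 in \<open>auto simp: fun_eq_iff\<close>)
    have "?n * (poly ?B ?S + 3) \<le> poly q1 ?S * (poly ?B ?S + 3)" using n by simp
    then have "runs ?c (snd (init_config M xs)) (poly ?p ?S) (?T ((\<lambda>_. 0)(0 := ?n)) (?y xs ?n))"
      by (intro runs_mono[OF runs_Seq[OF 1 runs_Seq[OF 2 3]]]) (simp add: numeral_poly le_SucI)
    then obtain t where t: "t \<le> poly ?p ?S" "run ?c (snd (init_config M xs)) t (?T ((\<lambda>_. 0)(0 :=
        ?n)) (?y xs ?n))"
      by (auto simp: runs_def)
    have "(step M ^^ t) (init_config M xs) = (n_states M, ?T ((\<lambda>_. 0)(0 := ?n)) (?y xs ?n))"
      using M(3)[OF _ t(2)] by (simp add: init_config_def M(2))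
    moreover have "has_output (n_states M, ?T ((\<lambda>_. 0)(0 := ?n)) (?y xs ?n)) (?y xs ?n)"
      by (simp add: has_output_def tapes_def output_tape_def)
    ultimately show ?thesis using t(1) unfolding computes_within_def Let_def by (intro exI[of _ t]) simp
  qed
  then show ?thesis unfolding polytime_def using M(1,2) by (intro exI[of _ M] exI[of _ ?p]) auto
qed

section \<open>Closure properties of functions and predicates defined by expressions\<close>

lemma pfI: "(\<And>xs v. length xs = a \<Longrightarrow> F xs v = eval xs e v) \<Longrightarrow> pf a F"
  by (auto simp: pf_def)

lemma pf_var: "pf a (\<lambda>xs v. v i)"
  by (rule pfI[of _ _ "Var i"]) simp

lemma pf_add: "\<lbrakk>pf a F; pf a G\<rbrakk> \<Longrightarrow> pf a (\<lambda>xs v. F xs v + G xs v)"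
  unfolding pf_def by (metis eval.simps(3))

lemma pf_sub: "\<lbrakk>pf a F; pf a G\<rbrakk> \<Longrightarrow> pf a (\<lambda>xs v. F xs v - G xs v)"
  unfolding pf_def by (metis eval.simps(4))

lemma pf_const: "pf a (\<lambda>xs v. c)"
proof (induction c)
  case 0
  show ?case by (rule pfI[of _ _ "Monus One One"]) simp
next
  case (Suc c)
  have "pf a (\<lambda>xs v. 1)" by (rule pfI[of _ _ One]) simp
  from pf_add[OF Suc this] show ?case by simp
qed

lemma pf_Suc: "pf a F \<Longrightarrow> pf a (\<lambda>xs v. Suc (F xs v))"
  using pf_add[of a F "\<lambda>_ _. 1"] pf_const[of a 1] by simp

lemma pf_length: "j < a \<Longrightarrow> pf a (\<lambda>xs v. length (xs ! j))"
  by (rule pfI[of _ _ "Len j"]) simp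

text \<open>The bound variable of a sum is variable \<open>0\<close> of the body, the other variables are shifted.\<close>

lemma pf_sum:
  assumes "pf a F" "pf a (\<lambda>xs v. G xs (\<lambda>i. v (Suc i)) (v 0))"
  shows "pf a (\<lambda>xs v. \<Sum>i<F xs v. G xs v i)"
proof -
  from assms obtain d e where F: "\<And>xs v. length xs = a \<Longrightarrow> F xs v = eval xs d v"
    and "\<forall>xs v. length xs = a \<longrightarrow> G xs (\<lambda>i. v (Suc i)) (v 0) = eval xs e v" unfolding pf_def by metis
  then have "G xs v i = eval xs e (case_nat i v)" if "length xs = a" for xs v i
    by (elim allE[of _ xs] allE[of _ "case_nat i v"]) (use that in simp)
  then show ?thesis using F by (intro pfI[of _ _ "Sum d e"]) simp
qed

lemma pf_rec:
  assumes "pf a C" "pf a I" "pf a N" "pf a (\<lambda>xs v. S xs (\<lambda>i. v (Suc (Suc i))) (v 0) (v (Suc 0)))"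
  shows "pf a (\<lambda>xs v. rec_nat (I xs v) (\<lambda>i x. min (C xs v) (S xs v i x)) (N xs v))"
proof -
  from assms(1-3) obtain c i n where e: "\<And>xs v. length xs = a \<Longrightarrow> C xs v = eval xs c v"
    "\<And>xs v. length xs = a \<Longrightarrow> I xs v = eval xs i v" "\<And>xs v. length xs = a \<Longrightarrow> N xs v = eval xs n v"
    unfolding pf_def by metis
  from assms(4) obtain s where "\<forall>xs v. length xs = a \<longrightarrow> S xs (\<lambda>i. v (Suc (Suc i))) (v 0) (v (Suc 0)) =
      eval xs s v"
    unfolding pf_def by metis
  then have "S xs v j x = eval xs s (case_nat j (case_nat x v))" if "length xs = a" for xs v j x
    by (elim allE[of _ xs] allE[of _ "case_nat j (case_nat x v)"]) (use that in simp)
  then show ?thesis using e by (intro pfI[of _ _ "Rec c i s n"]) simp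
qed

text \<open>Under \<open>Sum\<close> and \<open>Rec\<close> the renaming has to fix the bound
  variables and shift the others; this is the role of the \<open>case_nat\<close> renamings in the
  proof.\<close>

lemma ex_rename: "\<exists>e'. \<forall>xs v. eval xs e' v = eval xs e (\<lambda>i. v (\<rho> i))"
proof (induction e arbitrary: \<rho>)
  case (Var i)
  show ?case by (rule exI[of _ "Var (\<rho> i)"]) simp
next
  case (Add d e)
  then show ?case by (metis eval.simps(3))
next
  case (Monus d e)
  then show ?case by (metis eval.simps(4))
next
  case (Bit j e)
  then obtain e' where "\<forall>xs v. eval xs e' v = eval xs e (\<lambda>i. v (\<rho> i))" by blast
  then show ?case by (intro exI[of _ "Bit j e'"]) simp
next
  case (Sum d e)
  have *: "(\<lambda>i. case_nat j v (case_nat 0 (\<lambda>i. Suc (\<rho> i)) i)) = case_nat j (\<lambda>i. v (\<rho> i))" for j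
      and v :: "nat \<Rightarrow> nat"
    by (auto simp: fun_eq_iff split: nat.split)
  from Sum obtain d' where "\<forall>xs v. eval xs d' v = eval xs d (\<lambda>i. v (\<rho> i))" by blast
  moreover from Sum obtain e' where "\<forall>xs v. eval xs e' v = eval xs e (\<lambda>i. v (case_nat 0 (\<lambda>i. Suc (\<rho> i)) i))"
      by blast
  ultimately show ?case by (intro exI[of _ "Sum d' e'"]) (simp add: *)
next
  case (Rec c i s n)
  let ?\<rho> = "case_nat 0 (case_nat 1 (\<lambda>i. Suc (Suc (\<rho> i))))"
  have *: "(\<lambda>i. case_nat j (case_nat x v) (?\<rho> i)) = case_nat j (case_nat x (\<lambda>i. v (\<rho> i)))" for j x
      and v :: "nat \<Rightarrow> nat"
    by (auto simp: fun_eq_iff split: nat.split)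
  from Rec obtain c' where "\<forall>xs v. eval xs c' v = eval xs c (\<lambda>i. v (\<rho> i))" by blast
  moreover from Rec obtain i' where "\<forall>xs v. eval xs i' v = eval xs i (\<lambda>i. v (\<rho> i))" by blast
  moreover from Rec obtain n' where "\<forall>xs v. eval xs n' v = eval xs n (\<lambda>i. v (\<rho> i))" by blast
  moreover from Rec obtain s' where "\<forall>xs v. eval xs s' v = eval xs s (\<lambda>i. v (?\<rho> i))" by blast
  ultimately show ?case by (intro exI[of _ "Rec c' i' s' n'"]) (simp add: *)
qed (metis eval.simps)+

lemma pf_rename: "pf a F \<Longrightarrow> pf a (\<lambda>xs v. F xs (\<lambda>i. v (\<rho> i)))"
proof -
  assume "pf a F"
  then obtain e where e: "\<forall>xs v. length xs = a \<longrightarrow> F xs v = eval xs e v" by (auto simp: pf_def)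
  obtain e' where "\<forall>xs v. eval xs e' v = eval xs e (\<lambda>i. v (\<rho> i))" using ex_rename by blast
  with e show ?thesis by (intro pfI[of _ _ e']) auto
qed

lemmas pf_shift = pf_rename[where \<rho> = Suc]

lemma pf_mult: "\<lbrakk>pf a F; pf a G\<rbrakk> \<Longrightarrow> pf a (\<lambda>xs v. F xs v * G xs v)"
  using pf_sum[of a F "\<lambda>xs v i. G xs v"] pf_shift[of a G] by simp

definition pp :: "nat \<Rightarrow> (bool list list \<Rightarrow> (nat \<Rightarrow> nat) \<Rightarrow> bool) \<Rightarrow> bool" where
  "pp a P \<longleftrightarrow> pf a (\<lambda>xs v. of_bool (P xs v))"

lemma pf_cong: "\<lbrakk>pf a F; \<And>xs v. length xs = a \<Longrightarrow> F xs v = G xs v\<rbrakk> \<Longrightarrow> pf a G"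
  by (simp add: pf_def)

lemma pp_cong: "\<lbrakk>pp a F; \<And>xs v. length xs = a \<Longrightarrow> F xs v = G xs v\<rbrakk> \<Longrightarrow> pp a G"
  by (simp add: pp_def pf_def)

lemma pf_of_bool: "pp a P \<Longrightarrow> pf a (\<lambda>xs v. of_bool (P xs v))"
  by (simp add: pp_def)

text \<open>1 - (1 - (G - F)) is the sign of the truncated difference G - F.\<close>

lemma pp_less: "\<lbrakk>pf a F; pf a G\<rbrakk> \<Longrightarrow> pp a (\<lambda>xs v. F xs v < G xs v)"
  unfolding pp_def
  by (rule pf_cong[OF pf_sub[OF pf_const[of a 1] pf_sub[OF pf_const[of a 1] pf_sub[of a G F]]]]) auto

lemma pp_not: "pp a P \<Longrightarrow> pp a (\<lambda>xs v. \<not> P xs v)"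
  unfolding pp_def by (drule pf_sub[OF pf_const[of a 1]]) (erule pf_cong, auto)

lemma pp_and: "\<lbrakk>pp a P; pp a Q\<rbrakk> \<Longrightarrow> pp a (\<lambda>xs v. P xs v \<and> Q xs v)"
  unfolding pp_def by (drule (1) pf_mult) (erule pf_cong, auto)

lemma pp_le: "\<lbrakk>pf a F; pf a G\<rbrakk> \<Longrightarrow> pp a (\<lambda>xs v. F xs v \<le> G xs v)"
  by (rule pp_cong[OF pp_not[OF pp_less[of a G F]]]) auto

lemma pp_eq: "\<lbrakk>pf a F; pf a G\<rbrakk> \<Longrightarrow> pp a (\<lambda>xs v. F xs v = G xs v)"
  by (rule pp_cong[OF pp_and[OF pp_le[of a F G] pp_le[of a G F]]]) auto

lemma pp_or: "\<lbrakk>pp a P; pp a Q\<rbrakk> \<Longrightarrow> pp a (\<lambda>xs v. P xs v \<or> Q xs v)"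
  by (rule pp_cong[OF pp_not[OF pp_and[OF pp_not[of a P] pp_not[of a Q]]]]) auto

lemma pp_imp: "\<lbrakk>pp a P; pp a Q\<rbrakk> \<Longrightarrow> pp a (\<lambda>xs v. P xs v \<longrightarrow> Q xs v)"
  by (rule pp_cong[OF pp_or[OF pp_not[of a P]]]) auto

lemma pp_iff: "\<lbrakk>pp a P; pp a Q\<rbrakk> \<Longrightarrow> pp a (\<lambda>xs v. P xs v \<longleftrightarrow> Q xs v)"
  by (rule pp_cong[OF pp_and[OF pp_imp[of a P Q] pp_imp[of a Q P]]]) auto

lemma pp_const: "pp a (\<lambda>xs v. c)"
  unfolding pp_def by (rule pf_const)

lemma pp_Ex:
  assumes "pf a F" "pp a (\<lambda>xs v. P xs (\<lambda>i. v (Suc i)) (v 0))"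
  shows "pp a (\<lambda>xs v. \<exists>i<F xs v. P xs v i)"
proof -
  have "pf a (\<lambda>xs v. \<Sum>i<F xs v. of_bool (P xs v i))"
    by (rule pf_sum) (use assms in \<open>auto simp: pp_def\<close>)
  then have "pp a (\<lambda>xs v. 0 < (\<Sum>i<F xs v. of_bool (P xs v i) :: nat))"
    by (rule pp_less[OF pf_const])
  then show ?thesis by (rule pp_cong) (auto simp: card_gt_0_iff)
qed

lemma pp_All:
  assumes "pf a F" "pp a (\<lambda>xs v. P xs (\<lambda>i. v (Suc i)) (v 0))"
  shows "pp a (\<lambda>xs v. \<forall>i<F xs v. P xs v i)"
  by (rule pp_cong[OF pp_not[OF pp_Ex[OF assms(1) pp_not[OF assms(2)]]]]) auto

lemma pf_if: "\<lbrakk>pp a P; pf a F; pf a G\<rbrakk> \<Longrightarrow> pf a (\<lambda>xs v. if P xs v then F xs v else G xs v)"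
  by (rule pf_cong[OF pf_add[OF pf_mult[OF pf_of_bool[of a P], of F] pf_mult[OF pf_of_bool[OF pp_not[of a P]],
      of G]]]) auto

lemma pp_if: "\<lbrakk>pp a P; pp a Q; pp a R\<rbrakk> \<Longrightarrow> pp a (\<lambda>xs v. if P xs v then Q xs v else R xs v)"
  by (rule pp_cong[OF pp_and[OF pp_imp[of a P Q] pp_or[of a P R]]]) (auto split: if_splits)

text \<open>The quotient m div n counts the indices i with (i + 1) n at most m; the conjunct 0 < n
  yields the value 0 for division by zero.\<close>

lemma pf_div: "\<lbrakk>pf a F; pf a G\<rbrakk> \<Longrightarrow> pf a (\<lambda>xs v. F xs v div G xs v)"
proof -
  assume FG: "pf a F" "pf a G"
  have *: "m div n = (\<Sum>i<m. of_bool (Suc i * n \<le> m \<and> 0 < n))" for m n :: nat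
  proof (cases "n = 0")
    case False
    then have iff: "Suc i * n \<le> m \<longleftrightarrow> i < m div n" for i
      using less_eq_div_iff_mult_less_eq[of n "Suc i" m] by (simp only: Suc_le_eq)
    have "m div n = (\<Sum>i<m div n. 1)" by simp
    also have "\<dots> = (\<Sum>i<m. of_bool (i < m div n))"
      by (rule sum.mono_neutral_cong_left) (auto intro: less_le_trans[OF _ div_le_dividend])
    finally show ?thesis unfolding iff using False by simp
  qed simp
  have "pf a (\<lambda>xs v. \<Sum>i<F xs v. of_bool (Suc i * G xs v \<le> F xs v \<and> 0 < G xs v))"
    by (intro pf_sum pf_of_bool pp_and pp_le pp_less pf_mult pf_Suc pf_var pf_const pf_shift FG)
  then show ?thesis unfolding *[symmetric] .
qed

lemma pf_mod: "\<lbrakk>pf a F; pf a G\<rbrakk> \<Longrightarrow> pf a (\<lambda>xs v. F xs v mod G xs v)"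
  unfolding minus_div_mult_eq_mod[symmetric] by (intro pf_sub pf_mult pf_div)

lemma pp_odd: "pf a F \<Longrightarrow> pp a (\<lambda>xs v. odd (F xs v))"
  unfolding odd_iff_mod_2_eq_one by (intro pp_eq pf_mod pf_const)

lemma pf_poly: "pf a F \<Longrightarrow> pf a (\<lambda>xs v. poly p (F xs v))"
proof (induction p)
  case (pCons c p)
  then show ?case unfolding poly_pCons by (intro pf_add pf_mult pf_const) auto
qed (simp add: pf_const)

lemma pp_Ex_finite:
  assumes "finite S" "\<And>s. s \<in> S \<Longrightarrow> pp a (P s)"
  shows "pp a (\<lambda>xs v. \<exists>s\<in>S. P s xs v)"
  using assms by (induction S) (auto simp: bex_simps(5) intro!: pp_const pp_or)

text \<open>The function g is arbitrary: only n of its values matter, and they are wired into the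
  expression.\<close>

lemma pf_table: "pf a F \<Longrightarrow> pf a (\<lambda>xs v. if F xs v < n then g (F xs v) else (0 :: nat))"
proof (induction n)
  case (Suc n)
  have "pf a (\<lambda>xs v. if F xs v = n then g n else if F xs v < n then g (F xs v) else 0)"
    by (intro pf_if pp_eq pf_const Suc)
  then show ?case by (rule pf_cong) auto
qed (simp add: pf_const)

definition bit_at :: "bool list \<Rightarrow> nat \<Rightarrow> bool" where
  "bit_at x i \<longleftrightarrow> i < length x \<and> x ! i"

lemma pp_bit_at: "\<lbrakk>j < a; pf a F\<rbrakk> \<Longrightarrow> pp a (\<lambda>xs v. bit_at (xs ! j) (F xs v))"
proof -
  assume j: "j < a" and "pf a F"
  then obtain e where e: "\<forall>xs v. length xs = a \<longrightarrow> F xs v = eval xs e v" by (auto simp: pf_def)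
  then have "pf a (\<lambda>xs v. eval xs (Bit j e) v)" by (intro pfI[of _ _ "Bit j e"]) simp
  then have "pp a (\<lambda>xs v. 1 < eval xs (Bit j e) v)" by (rule pp_less[OF pf_const])
  then show ?thesis by (rule pp_cong) (use j e in \<open>auto simp: bit_at_def bit_symbol_def\<close>)
qed

lemmas pf_intros = pf_var pf_const pf_add pf_sub pf_mult pf_Suc pf_sum pf_if pf_div pf_mod pf_of_bool
  pp_less pp_le pp_eq pp_not pp_and pp_or pp_imp pp_iff pp_const pp_Ex pp_All pp_if pp_odd

section \<open>Slack and duration\<close>

text \<open>The waiting time between an arc of label a and a next arc of label b. The term -1 is due
  to strictly increasing times: equal labels cost \<Delta> - 1.\<close>

fun slack_step :: "nat \<Rightarrow> nat \<Rightarrow> nat \<Rightarrow> nat" where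
  "slack_step \<Delta> a b = nat ((int b - int a - 1) mod int \<Delta>)"

declare slack_step.simps [simp del]

fun slack :: "nat \<Rightarrow> ('a \<times> 'a \<Rightarrow> nat) \<Rightarrow> 'a list \<Rightarrow> nat" where
  "slack \<Delta> l (a # b # c # vs) = slack_step \<Delta> (l (a, b)) (l (b, c)) + slack \<Delta> l (b # c # vs)"
| "slack \<Delta> l vs = 0"

definition path_in :: "'a pair_pre_digraph \<Rightarrow> 'a \<Rightarrow> 'a list \<Rightarrow> 'a \<Rightarrow> bool" where
  "path_in G u vs v \<longleftrightarrow> vs \<noteq> [] \<and> hd vs = u \<and> last vs = v \<and> set vs \<subseteq> pverts G \<and> distinct vs \<and>
     successively (\<lambda>a b. (a, b) \<in> parcs G) vs"

definition arcs_of :: "'a list \<Rightarrow> ('a \<times> 'a) list" where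
  "arcs_of vs = zip vs (tl vs)"

lemma arcs_of_simps [simp]: "arcs_of [] = []" "arcs_of [a] = []"
    "arcs_of (a # b # vs) = (a, b) # arcs_of (b # vs)"
  by (auto simp: arcs_of_def)

lemma length_arcs_of: "length (arcs_of vs) = length vs - 1"
  by (simp add: arcs_of_def)

lemma pawalk_verts_arcs_of: "pawalk_verts a (arcs_of (a # vs)) = a # vs"
  by (induction vs arbitrary: a) auto

lemma pcas_arcs_of: "pcas a (arcs_of (a # vs)) v \<longleftrightarrow> last (a # vs) = v"
  by (induction vs arbitrary: a) auto

lemma set_arcs_of: "set (arcs_of vs) \<subseteq> E \<longleftrightarrow> successively (\<lambda>a b. (a, b) \<in> E) vs"
  by (induction vs rule: induct_list012) auto

lemma arcs_of_pawalk_verts: "pcas u p v \<Longrightarrow> arcs_of (pawalk_verts u p) = p"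
proof (induction p arbitrary: u)
  case (Cons e p)
  then show ?case by (cases p; cases e) auto
qed simp

lemma hd_pawalk_verts: "pcas u p v \<Longrightarrow> hd (pawalk_verts u p) = u"
  by (cases p) auto

lemma last_pawalk_verts: "pcas u p v \<Longrightarrow> last (pawalk_verts u p) = v"
proof (induction p arbitrary: u)
  case (Cons e p)
  then show ?case by (cases p) auto
qed simp

lemma pawalk_verts_Nil [simp]: "pawalk_verts u p \<noteq> []"
  by (cases p) auto

lemma awalk_conv_list:
  assumes "pair_wf_digraph G"
  shows "pre_digraph.awalk (with_proj G) u p v \<longleftrightarrow>
    (\<exists>vs. vs \<noteq> [] \<and> hd vs = u \<and> last vs = v \<and> set vs \<subseteq> pverts G \<and>
      successively (\<lambda>a b. (a, b) \<in> parcs G) vs \<and> p = arcs_of vs)"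
proof -
  interpret pair_wf_digraph G by fact
  show ?thesis
  proof
    assume w: "awalk u p v"
    then have c: "pcas u p v" and s: "set (pawalk_verts u p) \<subseteq> pverts G" "set p \<subseteq> parcs G"
      unfolding awalk_conv by blast+
    show "\<exists>vs. vs \<noteq> [] \<and> hd vs = u \<and> last vs = v \<and> set vs \<subseteq> pverts G \<and>
      successively (\<lambda>a b. (a, b) \<in> parcs G) vs \<and> p = arcs_of vs"
      using c s set_arcs_of[of "pawalk_verts u p" "parcs G"]
      by (intro exI[of _ "pawalk_verts u p"]) (simp add: hd_pawalk_verts last_pawalk_verts
          arcs_of_pawalk_verts)
  next
    assume "\<exists>vs. vs \<noteq> [] \<and> hd vs = u \<and> last vs = v \<and> set vs \<subseteq> pverts G \<and>
      successively (\<lambda>a b. (a, b) \<in> parcs G) vs \<and> p = arcs_of vs"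
    then obtain ws where "last (u # ws) = v" "set (u # ws) \<subseteq> pverts G"
      "successively (\<lambda>a b. (a, b) \<in> parcs G) (u # ws)" "p = arcs_of (u # ws)"
      by (metis list.collapse)
    then show "awalk u p v"
      using pcas_arcs_of[of u ws v] set_arcs_of[of "u # ws" "parcs G"] by (auto simp: awalk_def)
  qed
qed

lemma apath_conv_path_in:
  assumes "pair_wf_digraph G"
  shows "pre_digraph.apath (with_proj G) u p v \<longleftrightarrow> (\<exists>vs. path_in G u vs v \<and> p = arcs_of vs)"
proof -
  interpret pair_wf_digraph G by fact
  have *: "pawalk_verts (hd vs) (arcs_of vs) = vs" if "vs \<noteq> []" for vs :: "'a list"
    using that pawalk_verts_arcs_of by (metis list.collapse)
  show ?thesis
  proof
    assume "apath u p v"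
    then have "awalk u p v" and d: "distinct (pawalk_verts u p)" by (auto simp: apath_def)
    then obtain vs where vs: "vs \<noteq> []" "hd vs = u" "last vs = v" "set vs \<subseteq> pverts G"
      "successively (\<lambda>a b. (a, b) \<in> parcs G) vs" "p = arcs_of vs"
      unfolding awalk_conv_list[OF assms] by blast
    have "distinct vs" using *[OF vs(1)] d vs(2,6) by simp
    then show "\<exists>vs. path_in G u vs v \<and> p = arcs_of vs" using vs unfolding path_in_def by blast
  next
    assume "\<exists>vs. path_in G u vs v \<and> p = arcs_of vs"
    then obtain vs where vs: "path_in G u vs v" "p = arcs_of vs" by blast
    then have "awalk u p v" unfolding awalk_conv_list[OF assms] path_in_def by blast
    moreover have "pawalk_verts u p = vs" using * vs by (auto simp: path_in_def)
    ultimately show "apath u p v" using vs by (simp add: apath_def path_in_def)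
  qed
qed

lemma int_slack_step: "0 < \<Delta> \<Longrightarrow> int (slack_step \<Delta> a b) = (int b - int a - 1) mod int \<Delta>"
  by (simp add: slack_step.simps)

lemma slack_step_mod: "(t + 1 + slack_step \<Delta> (t mod \<Delta>) b) mod \<Delta> = b" if "b < \<Delta>"
proof -
  have "int ((t + 1 + slack_step \<Delta> (t mod \<Delta>) b) mod \<Delta>) =
      (int t + 1 + (int b - int t mod int \<Delta> - 1) mod int \<Delta>) mod int \<Delta>"
    using that by (simp add: zmod_int int_slack_step add_ac)
  also have "\<dots> = (int t + 1 + (int b - int t mod int \<Delta> - 1)) mod int \<Delta>" by (simp add: mod_simps)
  also have "\<dots> = (int t + 1 + (int b - int t - 1)) mod int \<Delta>"
    by (intro mod_add_cong mod_diff_cong) simp_all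
  also have "\<dots> = int b mod int \<Delta>" by simp
  finally show ?thesis using that by simp
qed

lemma slack_step_le: "t < t' \<Longrightarrow> t + 1 + slack_step \<Delta> (t mod \<Delta>) (t' mod \<Delta>) \<le> t'"
proof -
  assume t: "t < t'"
  have "(int (t' mod \<Delta>) - int (t mod \<Delta>) - 1) mod int \<Delta> = (int t' - int t - 1) mod int \<Delta>"
    by (intro mod_diff_cong) (simp_all add: zmod_int)
  also have "int t' - int t - 1 = int (t' - t - 1)" using t by simp
  also have "\<dots> mod int \<Delta> = int ((t' - t - 1) mod \<Delta>)" by (simp only: zmod_int)
  finally have "slack_step \<Delta> (t mod \<Delta>) (t' mod \<Delta>) = (t' - t - 1) mod \<Delta>" by (simp add: slack_step.simps)
  also have "\<dots> \<le> t' - t - 1" by (rule mod_less_eq_dividend)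
  finally show ?thesis using t by simp
qed

lemma active_iff: "0 < \<Delta> \<Longrightarrow> l e < \<Delta> \<Longrightarrow> active \<Delta> l e t \<longleftrightarrow> t mod \<Delta> = l e"
  unfolding active_def by (metis add.commute div_mult_mod_eq mod_less mod_mult_self1)

text \<open>The greedy schedule, which uses every next arc at its first possible time.\<close>

fun timed :: "nat \<Rightarrow> ('a \<times> 'a \<Rightarrow> nat) \<Rightarrow> nat \<Rightarrow> 'a list \<Rightarrow> (('a \<times> 'a) \<times> nat) list" where
  "timed \<Delta> l t (a # b # c # vs) = ((a, b), t) # timed \<Delta> l (t + 1 + slack_step \<Delta> (l (a, b)) (l (b, c)))
      (b # c # vs)"
| "timed \<Delta> l t [a, b] = [((a, b), t)]"
| "timed \<Delta> l t _ = []"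

lemma timed_props:
  assumes "\<forall>e\<in>set (arcs_of vs). l e < \<Delta>" "2 \<le> length vs" "t mod \<Delta> = l (hd (arcs_of vs))"
  shows "map fst (timed \<Delta> l t vs) = arcs_of vs \<and> timed \<Delta> l t vs \<noteq> [] \<and> snd (hd (timed \<Delta> l t vs)) = t \<and>
    snd (last (timed \<Delta> l t vs)) + 1 = t + (length vs - 1) + slack \<Delta> l vs \<and>
    (\<forall>(e, t')\<in>set (timed \<Delta> l t vs). active \<Delta> l e t' \<and> t \<le> t') \<and> sorted_wrt (<) (map snd (timed \<Delta> l t vs))"
  using assms
proof (induction \<Delta> l t vs rule: timed.induct)
  case (1 \<Delta> l t a b c vs)
  have D: "0 < \<Delta>" using 1 by fastforce
  have "(t + 1 + slack_step \<Delta> (l (a, b)) (l (b, c))) mod \<Delta> = l (b, c)"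
    using slack_step_mod[of "l (b, c)" \<Delta> t] 1 by simp
  then have IH: "map fst (timed \<Delta> l (t + 1 + slack_step \<Delta> (l (a, b)) (l (b, c))) (b # c # vs)) =
      arcs_of (b # c # vs) \<and>
     timed \<Delta> l (t + 1 + slack_step \<Delta> (l (a, b)) (l (b, c))) (b # c # vs) \<noteq> [] \<and>
     snd (last (timed \<Delta> l (t + 1 + slack_step \<Delta> (l (a, b)) (l (b, c))) (b # c # vs))) + 1
       = (t + 1 + slack_step \<Delta> (l (a, b)) (l (b, c))) + (length (b # c # vs) - 1) + slack \<Delta> l (b # c # vs) \<and>
     (\<forall>(e, t')\<in>set (timed \<Delta> l (t + 1 + slack_step \<Delta> (l (a, b)) (l (b, c))) (b # c # vs)).
        active \<Delta> l e t' \<and> t + 1 + slack_step \<Delta> (l (a, b)) (l (b, c)) \<le> t') \<and>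
     sorted_wrt (<) (map snd (timed \<Delta> l (t + 1 + slack_step \<Delta> (l (a, b)) (l (b, c))) (b # c # vs)))"
    using 1 by simp
  have "active \<Delta> l (a, b) t" using 1 D by (simp add: active_iff)
  with IH show ?case by fastforce
next
  case (2 \<Delta> l t a b)
  then show ?case by (auto simp: active_iff)
qed auto

lemma fastest_duration_le_slack:
  assumes "pair_wf_digraph G" "periodic_labeling \<Delta> G l" "path_in G u vs v" "2 \<le> length vs"
  shows "fastest_duration \<Delta> G l u v \<le> enat (length vs - 1 + slack \<Delta> l vs)"
proof -
  have lab: "\<forall>e\<in>set (arcs_of vs). l e < \<Delta>"
    using assms(2,3) set_arcs_of[of vs "parcs G"] by (auto simp: periodic_labeling_def path_in_def)
  let ?t = "l (hd (arcs_of vs))"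
  have "hd (arcs_of vs) \<in> set (arcs_of vs)"
    using assms(4) length_arcs_of[of vs] by (intro hd_in_set) (auto simp: length_0_conv[symmetric] simp del:
        length_0_conv)
  then have "?t mod \<Delta> = ?t" using lab by simp
  from timed_props[OF lab assms(4) this] show ?thesis
    using assms unfolding fastest_duration_def
    by (intro INF_lower2[of "timed \<Delta> l ?t vs"])
       (auto simp: temporal_path_def apath_conv_path_in duration_def)
qed

text \<open>For consecutive times t < t' the number t' - t - 1 is congruent to the waiting time
  modulo \<Delta>, hence at least that residue. So no schedule beats the greedy one.\<close>

lemma temporal_slack:
  assumes "map fst P = arcs_of vs" "P \<noteq> []" "\<forall>(e, t)\<in>set P. active \<Delta> l e t" "sorted_wrt (<) (map snd P)"
    "\<forall>e\<in>fst ` set P. l e < \<Delta>"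
  shows "snd (hd P) + (length vs - 1) + slack \<Delta> l vs \<le> snd (last P) + 1"
  using assms
proof (induction P arbitrary: vs)
  case (Cons et P)
  obtain e t where et: "et = (e, t)" by fastforce
  have D: "0 < \<Delta>" using Cons by fastforce
  obtain a b ws where vs: "vs = a # b # ws"
    using Cons.prems(1) by (cases vs rule: remdups_adj.cases) auto
  show ?case
  proof (cases P)
    case Nil
    then have "ws = []" using Cons.prems(1) vs by (cases ws) auto
    then show ?thesis using Nil vs by simp
  next
    case (Cons ft P')
    obtain f t' where ft: "ft = (f, t')" by fastforce
    obtain c ws' where ws: "ws = c # ws'" using Cons.prems(1) vs Cons by (cases ws) auto
    have IH: "snd (hd P) + (length (b # ws) - 1) + slack \<Delta> l (b # ws) \<le> snd (last P) + 1"
      by (rule Cons.IH) (use Cons.prems Cons vs in auto)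
    have e: "e = (a, b)" "f = (b, c)" using Cons.prems(1) vs ws et Cons ft by auto
    have m: "l (a, b) = t mod \<Delta>" "l (b, c) = t' mod \<Delta>" "t < t'"
      using Cons.prems(3-5) Cons et ft e D by (auto simp: active_iff)
    have "t + 1 + slack_step \<Delta> (l (a, b)) (l (b, c)) \<le> t'" unfolding m by (rule slack_step_le) (rule m)
    then show ?thesis using IH Cons vs ws et ft e by simp
  qed
qed simp

lemma fastest_duration_leD:
  assumes "pair_wf_digraph G" "periodic_labeling \<Delta> G l" "fastest_duration \<Delta> G l u v \<le> enat d"
  obtains vs where "path_in G u vs v" "2 \<le> length vs" "length vs - 1 + slack \<Delta> l vs \<le> d"
proof -
  have "fastest_duration \<Delta> G l u v < enat (Suc d)"
    using assms(3) by (rule le_less_trans) simp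
  then obtain P where P: "temporal_path \<Delta> G l u P v" "duration P < Suc d"
    unfolding fastest_duration_def INF_less_iff by auto
  then obtain vs where vs: "path_in G u vs v" "map fst P = arcs_of vs"
    using apath_conv_path_in[OF assms(1)] by (auto simp: temporal_path_def)
  have "set (map fst P) \<subseteq> parcs G"
    using vs set_arcs_of[of vs "parcs G"] by (simp add: path_in_def)
  then have "snd (hd P) + (length vs - 1) + slack \<Delta> l vs \<le> snd (last P) + 1"
    using P(1) assms(2) by (intro temporal_slack[OF vs(2)]) (auto simp: temporal_path_def
        periodic_labeling_def)
  then have "length vs - 1 + slack \<Delta> l vs \<le> d"
    using P(2) by (simp add: duration_def)
  moreover have "length P = length vs - 1" using vs(2) by (metis length_arcs_of length_map)
  then have "2 \<le> length vs" using P(1) by (cases P) (auto simp: temporal_path_def)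
  ultimately show thesis using that vs(1) by blast
qed

section \<open>Paths in bidirected trees\<close>

text \<open>The part between two occurrences of a vertex can be cut out, which shortens the
  walk.\<close>

lemma walk_contains_path:
  assumes "ws \<noteq> []" "successively P ws"
  shows "\<exists>vs. vs \<noteq> [] \<and> hd vs = hd ws \<and> last vs = last ws \<and> set vs \<subseteq> set ws \<and> distinct vs \<and> successively P vs"
  using assms
proof (induction ws rule: length_induct)
  case (1 ws)
  show ?case
  proof (cases "distinct ws")
    case False
    then obtain xs ys zs y where ws: "ws = xs @ [y] @ ys @ [y] @ zs"
      using not_distinct_decomp by blast
    let ?ws = "xs @ [y] @ zs"
    have "successively P ?ws" using 1(3) ws
      by (auto simp: successively_append_iff successively_Cons)
    moreover have "length ?ws < length ws" "?ws \<noteq> []" using ws by auto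
    ultimately obtain vs where "vs \<noteq> [] \<and> hd vs = hd ?ws \<and> last vs = last ?ws \<and> set vs \<subseteq> set ?ws \<and>
        distinct vs \<and> successively P vs"
      using 1(1) by blast
    moreover have "hd ?ws = hd ws" "last ?ws = last ws" "set ?ws \<subseteq> set ws"
      unfolding ws by (cases xs; auto)+
    ultimately show ?thesis by (intro exI[of _ vs]) auto
  qed (use 1 in blast)
qed

lemma tree_graphD:
  assumes "bidirected_tree G"
  shows "pair_wf_digraph G" "(u, v) \<in> parcs G \<Longrightarrow> (v, u) \<in> parcs G" "(u, u) \<notin> parcs G" "finite (pverts G)"
    "(u, v) \<in> parcs G \<Longrightarrow> u \<in> pverts G \<and> v \<in> pverts G"
proof -
  interpret pair_graph G using assms by (simp add: bidirected_tree_def)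
  show "pair_wf_digraph G" ..
  show "(u, v) \<in> parcs G \<Longrightarrow> (v, u) \<in> parcs G" using pair_sym_arcs by (auto simp: symmetric_def dest: symD)
  show "(u, u) \<notin> parcs G" using pair_no_loops[of "(u, u)"] by auto
  show "finite (pverts G)" by simp
  show "(u, v) \<in> parcs G \<Longrightarrow> u \<in> pverts G \<and> v \<in> pverts G" using in_arcsD1 in_arcsD2 by blast
qed

text \<open>If two paths leave u to different neighbors, then following one and returning along the
  other gives a walk between these neighbors that avoids u. A path inside this walk is closed by u
  to a cycle, of length at least 3 because the neighbors differ.\<close>

lemma tree_path_unique:
  assumes T: "bidirected_tree G" and "path_in G u vs v" "path_in G u ws v"
  shows "vs = ws"
  using assms(2,3)
proof (induction vs arbitrary: u ws)
  case (Cons u' vs)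
  note T = tree_graphD[OF T]
  interpret pair_wf_digraph G by (rule T(1))
  let ?E = "\<lambda>a b. (a, b) \<in> parcs G"
  have [simp]: "u' = u" using Cons.prems by (simp add: path_in_def)
  obtain ws' where ws: "ws = u # ws'" using Cons.prems(2) by (cases ws) (auto simp: path_in_def)
  show ?case
  proof (cases "vs = [] \<or> ws' = []")
    case True
    then have "u = v" using Cons.prems ws by (auto simp: path_in_def)
    then have "vs = []" "ws' = []" using Cons.prems ws
      by (auto simp: path_in_def split: if_splits)
    then show ?thesis using ws by simp
  next
    case False
    have p: "path_in G (hd vs) vs v" "path_in G (hd ws') ws' v"
        and arc: "(u, hd vs) \<in> parcs G" "(u, hd ws') \<in> parcs G"
      and nin: "u \<notin> set vs" "u \<notin> set ws'"
      using Cons.prems ws False by (auto simp: path_in_def successively_Cons)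
    show ?thesis
    proof (cases "hd vs = hd ws'")
      case True
      with p Cons.IH ws show ?thesis by simp
    next
      case ne: False
      have rev: "successively ?E (rev ws')"
        unfolding successively_rev using p(2) T(2)
        by (auto simp: path_in_def intro: successively_mono)
      let ?W = "vs @ tl (rev ws')"
      have "successively ?E ?W"
      proof (cases "tl (rev ws') = []")
        case False
        have "rev ws' = v # tl (rev ws')" using p(2)
            by (cases "rev ws'") (auto simp: path_in_def hd_rev[symmetric])
        then have "(v, hd (tl (rev ws'))) \<in> parcs G \<and> successively ?E (tl (rev ws'))"
          using rev False by (metis successively_Cons)
        then show ?thesis using p(1) False by (simp add: successively_append_iff path_in_def)
      qed (use p in \<open>simp add: path_in_def\<close>)
      moreover have "set (tl (rev ws')) \<subseteq> set ws'"
        by (metis list.sel(2) list.set_sel(2) set_rev subsetI)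
      then have W: "?W \<noteq> []" "hd ?W = hd vs" "set ?W \<subseteq> pverts G - {u}" using p nin
        by (auto simp: path_in_def)
      moreover have "last ?W = hd ws'"
      proof (cases "tl (rev ws') = []")
        case True
        then have "ws' = [v]" using p(2) by (cases ws' rule: rev_cases) (auto simp: path_in_def)
        then show ?thesis using True p(1) by (simp add: path_in_def)
      next
        case F: False
        then have "last (tl (rev ws')) = last (rev ws')" by (simp add: last_tl)
        then show ?thesis using F False by (simp add: last_rev)
      qed
      ultimately obtain xs where xs: "xs \<noteq> []" "hd xs = hd vs" "last xs = hd ws'" "set xs \<subseteq> pverts G - {u}"
        "distinct xs" "successively ?E xs"
        using walk_contains_path[of ?W ?E] by (metis subset_trans)
      let ?c = "u # xs @ [u]"
      have u: "u \<in> pverts G" using arc T(5) by blast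
      have arcs: "(u, hd xs) \<in> parcs G" "(last xs, u) \<in> parcs G" using arc T(2) xs by auto
      have "awalk u (arcs_of ?c) u"
        unfolding awalk_conv_list[OF T(1)]
        by (intro exI[of _ ?c]) (use xs(1,4,6) arcs u in
            \<open>auto simp: successively_Cons successively_append_iff\<close>)
      then have "cycle (arcs_of ?c)" unfolding cycle_def
        using xs pawalk_verts_arcs_of[of u "xs @ [u]"] by (intro exI[of _ u]) (cases xs; auto)
      moreover have "2 \<le> length xs" using xs(1-3) ne by (cases xs rule: remdups_adj.cases) auto
      then have "3 \<le> length (arcs_of ?c)" by (simp add: length_arcs_of)
      ultimately show ?thesis using assms(1) unfolding bidirected_tree_def by blast
    qed
  qed
qed (simp add: path_in_def)

lemma tree_path_ex:
  assumes "bidirected_tree G" "u \<in> pverts G" "v \<in> pverts G"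
  shows "\<exists>vs. path_in G u vs v"
proof -
  interpret pair_graph G using assms by (simp add: bidirected_tree_def)
  have "u \<rightarrow>\<^sup>*\<^bsub>mk_symmetric (with_proj G)\<^esub> v"
    using assms unfolding bidirected_tree_def connected_def strongly_connected_def by auto
  then have "u \<rightarrow>\<^sup>*\<^bsub>with_proj G\<^esub> v" using reachable_mk_symmetric_eq[OF pair_sym_arcs] by simp
  then obtain p where "apath u p v" using reachable_apath by blast
  then show ?thesis using apath_conv_path_in[of G u p v] pair_wf_digraph_axioms by auto
qed

text \<open>Trees given by a parent function. The rank certifies that parents lead to r and excludes
  cycles; any measure that decreases towards the root serves.\<close>

definition rooted :: "'a pair_pre_digraph \<Rightarrow> 'a \<Rightarrow> ('a \<Rightarrow> 'a) \<Rightarrow> ('a \<Rightarrow> nat) \<Rightarrow> bool" where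
  "rooted G r par rk \<longleftrightarrow> finite (pverts G) \<and> r \<in> pverts G \<and>
     (\<forall>v\<in>pverts G - {r}. par v \<in> pverts G \<and> rk (par v) < rk v) \<and>
     parcs G = (\<lambda>v. (v, par v)) ` (pverts G - {r}) \<union> (\<lambda>v. (par v, v)) ` (pverts G - {r})"

lemma rooted_arc: "rooted G r par rk \<Longrightarrow> (a, b) \<in> parcs G \<longleftrightarrow>
    (a \<in> pverts G - {r} \<and> b = par a) \<or> (b \<in> pverts G - {r} \<and> a = par b)"
  by (auto simp: rooted_def)

text \<open>A path that has stepped from a parent to a child cannot turn back: the only neighbor of
  a vertex that is not its child is its parent, which was just visited. So the rank keeps
  growing.\<close>

lemma rooted_away:
  assumes "rooted G r par rk" "successively (\<lambda>a b. (a, b) \<in> parcs G) (u # w # vs)" "distinct (u # w # vs)"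
    "w \<in> pverts G - {r}" "u = par w"
  shows "rk u < rk (last (w # vs)) \<and> last (w # vs) \<noteq> r \<and> par (last (w # vs)) = last (butlast (u # w # vs))"
  using assms(2-)
proof (induction vs arbitrary: u w)
  case Nil
  then show ?case using assms(1) by (auto simp: rooted_def)
next
  case (Cons x vs)
  have "(w, x) \<in> parcs G" "x \<noteq> u" using Cons.prems by auto
  then have x: "x \<in> pverts G - {r}" "w = par x" using Cons.prems(4) rooted_arc[OF assms(1)] by auto
  have "rk u < rk w" using assms(1) Cons.prems by (auto simp: rooted_def)
  with Cons.IH[OF _ _ x] Cons.prems show ?case by auto
qed

lemma rooted_no_cycle:
  assumes R: "rooted G r par rk" and "successively (\<lambda>a b. (a, b) \<in> parcs G) (u # xs)" "distinct (u # xs)"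
    "2 \<le> length xs" "(last xs, u) \<in> parcs G" "hd xs \<in> pverts G - {r}" "u = par (hd xs)"
  shows False
proof -
  obtain w vs where xs: "xs = w # vs" "vs \<noteq> []" using assms(4) by (cases xs) (auto simp: Suc_le_eq)
  have A: "rk u < rk (last xs)" "last xs \<noteq> r" "par (last xs) = last (butlast (u # xs))"
    using rooted_away[OF R, of u w vs] assms xs by auto
  have "u \<noteq> par (last xs)"
  proof -
    have "last (butlast xs) \<in> set xs" using xs by (simp add: in_set_butlastD)
    then show ?thesis using A(3) assms(3) xs by auto
  qed
  then have "last xs = par u" "u \<in> pverts G - {r}" using assms(5) rooted_arc[OF R] by auto
  then show False using A(1) R unfolding rooted_def by (metis less_asym)
qed

lemma rooted_pair_graph:
  assumes R: "rooted G r par rk"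
  shows "pair_graph G"
proof -
  have arcs: "parcs G = (\<lambda>v. (v, par v)) ` (pverts G - {r}) \<union> (\<lambda>v. (par v, v)) ` (pverts G - {r})"
    and fin: "finite (pverts G)" and par: "\<And>v. v \<in> pverts G - {r} \<Longrightarrow> par v \<in> pverts G \<and> rk (par v) < rk v"
    using R by (auto simp: rooted_def)
  show ?thesis
  proof unfold_locales
    show "symmetric G" by (auto simp: symmetric_def arcs intro!: symI)
    show "fst e \<in> pverts G" "snd e \<in> pverts G" "fst e \<noteq> snd e" if "e \<in> parcs G" for e
      using that par unfolding arcs by fastforce+
  qed (auto simp: fin arcs)
qed

lemma rooted_bidirected_tree:
  assumes R: "rooted G r par rk"
  shows "bidirected_tree G"
proof -
  let ?E = "\<lambda>a b. (a, b) \<in> parcs G"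
  interpret pair_graph G using rooted_pair_graph[OF R] .
  have par: "\<And>v. v \<in> pverts G - {r} \<Longrightarrow> par v \<in> pverts G \<and> rk (par v) < rk v" and r: "r \<in> pverts G"
    using R by (auto simp: rooted_def)
  have reach: "v \<rightarrow>\<^sup>*\<^bsub>with_proj G\<^esub> r" if "v \<in> pverts G" for v
    using that
  proof (induction "rk v" arbitrary: v rule: less_induct)
    case less
    show ?case
    proof (cases "v = r")
      case False
      then have "par v \<rightarrow>\<^sup>*\<^bsub>with_proj G\<^esub> r" "(v, par v) \<in> parcs G" using less par rooted_arc[OF R] by auto
      then show ?thesis by (meson adj_reachable_trans)
    qed (use less in simp)
  qed
  have "u \<rightarrow>\<^sup>*\<^bsub>with_proj G\<^esub> v" if "u \<in> pverts G" "v \<in> pverts G" for u v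
    using reach that by (meson pair_sym_arcs reachable_trans symmetric_reachable)
  then have "connected G"
    unfolding connected_def strongly_connected_def
    using r reachable_mk_symmetric_eq[OF pair_sym_arcs] by auto
  moreover have False if c: "cycle p" "3 \<le> length p" for p
  proof -
    obtain u vs where vs: "vs \<noteq> []" "hd vs = u" "last vs = u" "set vs \<subseteq> pverts G" "successively ?E vs"
        "p = arcs_of vs"
      and d: "distinct (tl (pawalk_verts u p))"
      using c(1) awalk_conv_list[of G] pair_wf_digraph_axioms unfolding cycle_def by fastforce
    have "pawalk_verts u p = vs" using vs(1,2,6) pawalk_verts_arcs_of[of u "tl vs"] by (cases vs) auto
    with d have d: "distinct (tl vs)" by simp
    have len: "4 \<le> length vs" using c(2) vs(6) by (simp add: length_arcs_of)
    obtain xs where xs: "vs = u # xs @ [u]"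
    proof -
      have "tl vs \<noteq> []" using len by (cases vs) auto
      then have "vs = hd vs # butlast (tl vs) @ [last (tl vs)]" using vs(1) by simp
      moreover have "last (tl vs) = u" using vs(3) \<open>tl vs \<noteq> []\<close> by (simp add: last_tl)
      ultimately show thesis using that vs(2) by metis
    qed
    have l2: "2 \<le> length xs" using len xs by simp
    then have ne: "xs \<noteq> []" by auto
    have S: "successively ?E (u # xs)" "(last xs, u) \<in> parcs G" "(u, hd xs) \<in> parcs G" "distinct (u # xs)"
      using vs(5) d xs ne by (auto simp: successively_Cons successively_append_iff)
    have sym: "(b, a) \<in> parcs G" if "(a, b) \<in> parcs G" for a b
      using that pair_sym_arcs by (auto simp: symmetric_def dest: symD)
    have S': "successively ?E (u # rev xs)" "(last (rev xs), u) \<in> parcs G"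
    proof -
      have "successively ?E xs" using S(1) ne by (simp add: successively_Cons)
      then have "successively ?E (rev xs)" unfolding successively_rev
        using sym by (auto intro: successively_mono)
      then show "successively ?E (u # rev xs)" using sym[OF S(2)] ne by (simp add: successively_Cons hd_rev)
      show "(last (rev xs), u) \<in> parcs G" using sym[OF S(3)] ne by (simp add: last_rev)
    qed
    \<comment> \<open>The first step of the cycle leads up, and so does the first step of the
      reversed cycle. Both neighbors of u would then be its parent, although they differ.\<close>
    have 1: "\<not> (hd xs \<in> pverts G - {r} \<and> u = par (hd xs))"
      using rooted_no_cycle[OF R S(1,4) l2 S(2)] by blast
    have 2: "\<not> (hd (rev xs) \<in> pverts G - {r} \<and> u = par (hd (rev xs)))"
      using rooted_no_cycle[OF R S'(1) _ _ S'(2)] S(4) l2 by auto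
    have "hd xs = par u" using S(3) 1 rooted_arc[OF R] by blast
    moreover have "last xs = par u" using S(2) 2 rooted_arc[OF R] ne by (auto simp: hd_rev)
    ultimately have "hd xs = last xs" by simp
    then show False using S(4) l2 by (cases xs) (auto split: if_splits)
  qed
  ultimately show ?thesis unfolding bidirected_tree_def using pair_graph_axioms by blast
qed

section \<open>Trees without labelings of small slack\<close>

definition tree_path :: "'a pair_pre_digraph \<Rightarrow> 'a \<Rightarrow> 'a \<Rightarrow> 'a list" where
  "tree_path G u v = (THE vs. path_in G u vs v)"

lemma tree_path_eq: "\<lbrakk>bidirected_tree G; path_in G u vs v\<rbrakk> \<Longrightarrow> tree_path G u v = vs"
  unfolding tree_path_def by (rule the_equality) (auto intro: tree_path_unique)

lemma path_in_tree_path: "\<lbrakk>bidirected_tree G; u \<in> pverts G; v \<in> pverts G\<rbrakk> \<Longrightarrow> path_in G u (tree_path G u v) v"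
  by (metis tree_path_eq tree_path_ex)

lemma path_in_rev: "\<lbrakk>bidirected_tree G; path_in G u vs v\<rbrakk> \<Longrightarrow> path_in G v (rev vs) u"
  using tree_graphD(2)[of G]
  by (auto simp: path_in_def hd_rev last_rev successively_rev intro: successively_mono)

lemma path_in_ConsD: "path_in G u (u # w # ws) v \<Longrightarrow> path_in G w (w # ws) v \<and> (u, w) \<in> parcs G \<and>
    u \<notin> set (w # ws)"
  by (auto simp: path_in_def)

lemma path_in_ConsI: "\<lbrakk>path_in G w ws v; (u, w) \<in> parcs G; u \<in> pverts G; u \<notin> set ws\<rbrakk> \<Longrightarrow> path_in G u (u # ws) v"
  by (cases ws) (auto simp: path_in_def)

text \<open>The parent of x is the second vertex of its path to r. For an arc (a, b), either a is
  not on the path from b to r, and then putting a in front gives the path from a; or a is on it and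
  must be its second vertex. Both follow from the uniqueness of paths.\<close>

lemma tree_rooted:
  assumes T: "bidirected_tree G" and r: "r \<in> pverts G"
  shows "rooted G r (\<lambda>x. tree_path G x r ! 1) (\<lambda>x. length (tree_path G x r))"
proof -
  define p where "p x = tree_path G x r" for x
  have p: "path_in G x (p x) r" if "x \<in> pverts G" for x
    unfolding p_def by (rule path_in_tree_path[OF T that r])
  have p2: "\<exists>y ws. p x = x # y # ws \<and> path_in G y (y # ws) r \<and> p y = y # ws \<and> (x, y) \<in> parcs G"
    if V: "x \<in> pverts G" "x \<noteq> r" for x
  proof -
    obtain y ws where "p x = x # y # ws"
      using p[OF V(1)] V(2) by (cases "p x" rule: remdups_adj.cases) (auto simp: path_in_def)
    then show ?thesis using path_in_ConsD p[OF V(1)] tree_path_eq[OF T] unfolding p_def by metis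
  qed
  let ?par = "\<lambda>x. p x ! 1" and ?rk = "\<lambda>x. length (p x)"
  have "parcs G = (\<lambda>v. (v, ?par v)) ` (pverts G - {r}) \<union> (\<lambda>v. (?par v, v)) ` (pverts G - {r})" (is "_ = ?R")
  proof
    show "?R \<subseteq> parcs G" using p2 tree_graphD(2)[OF T] by fastforce
    show "parcs G \<subseteq> ?R"
    proof safe
      fix a b assume ab: "(a, b) \<in> parcs G" "(a, b) \<notin> (\<lambda>v. (?par v, v)) ` (pverts G - {r})"
      have V: "a \<in> pverts G" "b \<in> pverts G" "a \<noteq> b" using ab(1) tree_graphD[OF T] by metis+
      show "(a, b) \<in> (\<lambda>v. (v, ?par v)) ` (pverts G - {r})"
      proof (cases "a \<in> set (p b)")
        case False
        then have "path_in G a (a # p b) r" using path_in_ConsI p V ab(1) by metis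
        then have "p a = a # p b" using tree_path_eq[OF T] p_def by metis
        moreover have "p b \<noteq> []" "hd (p b) = b" using p[OF V(2)] by (auto simp: path_in_def)
        moreover have "a \<noteq> r" using False p[OF V(2)] by (auto simp: path_in_def)
        ultimately show ?thesis using V by (auto simp: image_iff hd_conv_nth)
      next
        case True
        then obtain xs ys where xs: "p b = xs @ a # ys" by (meson split_list)
        have "xs \<noteq> []" using p[OF V(2)] xs V by (auto simp: path_in_def)
        then have "b \<in> set xs" using p[OF V(2)] xs by (cases xs) (auto simp: path_in_def)
        then have "b \<notin> set (a # ys)" using p[OF V(2)] xs by (auto simp: path_in_def)
        moreover have "path_in G a (a # ys) r" using p[OF V(2)] xs
          by (auto simp: path_in_def successively_append_iff)
        ultimately have "path_in G b (b # a # ys) r"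
          using path_in_ConsI tree_graphD(2)[OF T] ab(1) V by metis
        then have "p b = b # a # ys" using tree_path_eq[OF T] p_def by metis
        moreover then have "b \<noteq> r" using p[OF V(2)] by (auto simp: path_in_def split: if_splits)
        ultimately show ?thesis using ab(2) V by (auto simp: image_iff)
      qed
    qed
  qed
  moreover have "?par x \<in> pverts G \<and> ?rk (?par x) < ?rk x" if "x \<in> pverts G - {r}" for x
    using p2[of x] that tree_graphD(5)[OF T] by fastforce
  ultimately show ?thesis using r tree_graphD(4)[OF T] unfolding rooted_def p_def by simp
qed

lemma slack_snoc: "slack \<Delta> l (vs @ [a, b, c]) = slack \<Delta> l (vs @ [a, b]) + slack_step \<Delta> (l (a, b)) (l (b, c))"
proof (induction vs)
  case (Cons v vs)
  then show ?case by (cases vs; cases "tl vs") auto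
qed simp

lemma slack_step_0: "\<lbrakk>0 < \<Delta>; slack_step \<Delta> a b = 0\<rbrakk> \<Longrightarrow> int \<Delta> dvd int b - int a - 1"
  using int_slack_step[of \<Delta> a b] by (simp add: mod_0_imp_dvd)

text \<open>The number r is the distance from z to the residue \<Delta> - 1. If r is even, r / 2
  steps of size 2 reach \<Delta> - 1; if r and \<Delta> are odd, (r + \<Delta>) / 2 steps do. If r
  is odd and \<Delta> even, the residue \<Delta> - 2 is reached, which exceeds k because then
  \<Delta> > k + 2.\<close>

lemma mod_above:
  assumes "\<Delta> > k + 2 \<or> (\<Delta> = k + 2 \<and> odd \<Delta>)"
  shows "\<exists>i\<le>\<Delta>. int k < (z + 2 * int i) mod int \<Delta>"
proof -
  define r where "r = nat ((-1 - z) mod int \<Delta>)"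
  have D: "0 < \<Delta>" using assms by auto
  have r: "int r = (-1 - z) mod int \<Delta>" "r < \<Delta>" using D by (auto simp: r_def nat_less_iff)
  have e: "(z + (int r + c)) mod int \<Delta> = (c - 1) mod int \<Delta>" for c
  proof -
    have "(z + (int r + c)) mod int \<Delta> = (z + ((-1 - z) + c)) mod int \<Delta>"
      unfolding r(1) by (intro mod_add_cong) simp_all
    then show ?thesis by (simp add: algebra_simps)
  qed
  have m1: "(- 1) mod int \<Delta> = int \<Delta> - 1" using D by (simp add: zmod_minus1)
  have m2: "(- 2) mod int \<Delta> = int \<Delta> - 2" if "k + 2 < \<Delta>"
    using mod_pos_pos_trivial[of "int \<Delta> - 2" "int \<Delta>"] that by simp
  consider "even r" | "odd r" "odd \<Delta>" | "odd r" "even \<Delta>" by blast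
  then show ?thesis
  proof cases
    case 1
    then have "2 * int (r div 2) = int r" by auto
    then show ?thesis using e[of 0] m1 r(2) assms by (intro exI[of _ "r div 2"]) auto
  next
    case 2
    then have "2 * ((r + \<Delta>) div 2) = r + \<Delta>" by simp
    then have "2 * int ((r + \<Delta>) div 2) = int r + int \<Delta>" by (metis of_nat_add of_nat_mult of_nat_numeral)
    then show ?thesis using e[of "int \<Delta>"] m1 r(2) assms by (intro exI[of _ "(r + \<Delta>) div 2"]) auto
  next
    case 3
    then have "2 * int (r div 2) = int r + -1" by (auto elim!: oddE)
    then show ?thesis using e[of "-1"] m2 r(2) assms 3 by (intro exI[of _ "r div 2"]) auto
  qed
qed

text \<open>Heap numbering of a binary tree: the children of v are 2 v + 1 and 2 v + 2, so depth is
  controlled by powers of 2.\<close>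

definition heap_tree :: "nat \<Rightarrow> nat pair_pre_digraph" where
  "heap_tree n = \<lparr>pverts = {..n}, parcs = (\<lambda>v. (v, (v - 1) div 2)) ` ({..n} - {0}) \<union> (\<lambda>v. ((v - 1) div 2,
      v)) ` ({..n} - {0})\<rparr>"

lemma heap_tree_rooted: "rooted (heap_tree n) 0 (\<lambda>v. (v - 1) div 2) id"
  by (auto simp: rooted_def heap_tree_def intro!: le_trans[OF div_le_dividend])

fun up :: "nat \<Rightarrow> nat list" where
  "up n = (if n = 0 then [0] else n # up ((n - 1) div 2))"

declare up.simps [simp del]

lemma up_Cons: "\<exists>ws. up v = v # ws"
  by (subst up.simps) auto

lemma up_path: "v \<le> n \<Longrightarrow> path_in (heap_tree n) v (up v) 0 \<and> (\<forall>x\<in>set (up v). x \<le> v)"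
proof (induction v rule: up.induct)
  case (1 v)
  show ?case
  proof (cases "v = 0")
    case True
    then show ?thesis by (simp add: up.simps[of 0] path_in_def heap_tree_def)
  next
    case False
    let ?p = "(v - 1) div 2"
    have lt: "?p < v" using False by auto
    then have IH: "path_in (heap_tree n) ?p (up ?p) 0" "\<forall>x\<in>set (up ?p). x \<le> ?p" using 1 False by auto
    have "(v, ?p) \<in> parcs (heap_tree n)" "v \<in> pverts (heap_tree n)" using 1 False
        by (auto simp: heap_tree_def)
    moreover have "v \<notin> set (up ?p)" using IH(2) lt by fastforce
    ultimately have "path_in (heap_tree n) v (v # up ?p) 0" using path_in_ConsI[OF IH(1)] by blast
    then show ?thesis using False IH(2) lt by (auto simp: up.simps[of v] intro: le_trans less_imp_le)
  qed
qed

text \<open>If all paths had slack at most \<open>k\<close>, then the total slack of a leaf-to-root path and its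
  reverse would be at most \<open>2 k\<close>, so that some path of length \<open>\<Delta>\<close> away from the root would have no
  slack in either direction. Along such a path the difference of the labels of opposite arcs
  increases by \<open>2\<close> in each step, and this difference determines the slack of a turn between
  siblings.\<close>

lemma heap_tree_infeasible:
  assumes D: "\<Delta> > k + 2 \<or> (\<Delta> = k + 2 \<and> odd \<Delta>)"
  shows "\<exists>n. \<forall>l. \<exists>a\<in>pverts (heap_tree n). \<exists>b\<in>pverts (heap_tree n). a \<noteq> b \<and>
      k < slack \<Delta> l (tree_path (heap_tree n) a b)"
proof -
  \<comment> \<open>The tree is cut into bands of \<Delta> + 1 levels; \<open>top j\<close> is the
    last vertex on level j m + 1. The number 2 k + 3 of bands is chosen because the totals lie
    between 0 and 2 k.\<close>
  define m where "m = \<Delta> + 1"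
  define top where "top j = 2 ^ (j * m + 2) - (2 :: nat)" for j
  define n where "n = top (2 * k + 3)"
  have D0: "0 < \<Delta>" using D by auto
  have False if l: "\<forall>a\<in>pverts (heap_tree n). \<forall>b\<in>pverts (heap_tree n). a \<noteq> b \<longrightarrow>
      slack \<Delta> l (tree_path (heap_tree n) a b) \<le> k" for l
  proof -
    have T: "bidirected_tree (heap_tree n)" using rooted_bidirected_tree[OF heap_tree_rooted] .
    have S: "slack \<Delta> l vs \<le> k" if "path_in (heap_tree n) a vs b" "a \<noteq> b" for a b vs
    proof -
      have "a \<in> pverts (heap_tree n)" "b \<in> pverts (heap_tree n)" using that(1) by (auto simp: path_in_def)
      then show ?thesis using l that tree_path_eq[OF T that(1)] by metis
    qed
    define tot where "tot v = slack \<Delta> l (up v) + slack \<Delta> l (rev (up v))" for v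
    have tot_le: "tot v \<le> 2 * k" if "0 < v" "v \<le> n" for v
      using S[of v "up v" 0] S[of 0 "rev (up v)" v] path_in_rev[OF T, of v "up v" 0] up_path[OF that(2)]
          that(1)
      by (simp add: tot_def)
    have tot_child: "tot c = tot e + slack_step \<Delta> (l (c, e)) (l (e, (e - 1) div 2)) + slack_step \<Delta>
        (l ((e - 1) div 2, e)) (l (e, c))"
      if "0 < e" "c = 2 * e + 1 \<or> c = 2 * e + 2" for c e
    proof -
      have c: "up c = c # up e" using that by (auto simp: up.simps[of c])
      have that0: "up e = e # up ((e - 1) div 2)" using that(1) by (simp add: up.simps[of e])
      obtain ws where e: "up e = e # (e - 1) div 2 # ws"
        using that0 up_Cons[of "(e - 1) div 2"] by auto
      show ?thesis unfolding tot_def c e using slack_snoc[of \<Delta> l "rev ws" "(e - 1) div 2" e c] by simp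
    qed
    define M where "M j = Max (tot ` {1..top j})" for j
    have top_mono: "top i \<le> top j" if "i \<le> j" for i j
      using that by (auto simp: top_def intro!: diff_le_mono power_increasing)
    have top1: "1 \<le> top j" for j
    proof -
      have "2 ^ (j * m + 2) = 4 * (2 :: nat) ^ (j * m)" "0 < (2 :: nat) ^ (j * m)"
          by (simp_all add: power_add)
      then show ?thesis unfolding top_def by linarith
    qed
    have top_n: "top j \<le> n" if "j \<le> 2 * k + 3" for j unfolding n_def by (rule top_mono[OF that])
    \<comment> \<open>The maxima \<open>M 0\<close>, ..., \<open>M (2 * k + 2)\<close> are at most 2
      k, so they cannot grow strictly at every step.\<close>
    have "\<exists>j\<le>2 * k + 1. M (Suc j) \<le> M j"
    proof (rule ccontr)
      assume "\<not> ?thesis"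
      then have less: "M j < M (Suc j)" if "j \<le> 2 * k + 1" for j using that not_le by blast
      have "j \<le> 2 * k + 2 \<Longrightarrow> j \<le> M j" for j
      proof (induction j)
        case (Suc j)
        then show ?case using less[of j] by simp
      qed simp
      then have "2 * k + 2 \<le> M (2 * k + 2)" by blast
      moreover have "M (2 * k + 2) \<le> 2 * k" unfolding M_def
        using top1 tot_le top_n[of "2 * k + 2"] by (subst Max_le_iff) (auto intro: le_trans)
      ultimately show False by simp
    qed
    then obtain j where j: "j \<le> 2 * k + 1" "M (Suc j) \<le> M j" by blast
    \<comment> \<open>Let e attain the maximum \<open>M j\<close>. Its descendants up to
      \<open>top (Suc j)\<close> have at least its total, and at most \<open>M (Suc j)\<close>; so
      below e no slack is added for \<Delta> + 1 levels.\<close>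
    have "M j \<in> tot ` {1..top j}" unfolding M_def using top1[of j] by (intro Max_in) auto
    then obtain e where e: "0 < e" "e \<le> top j" "tot e = M j" by (auto simp: Suc_le_eq)
    have tot_max: "tot x \<le> tot e" if "0 < x" "x \<le> top (Suc j)" for x
      using that j(2) e(3) unfolding M_def[of "Suc j"]
          by (metis Max_ge atLeastAtMost_iff finite_atLeastAtMost finite_imageI image_eqI le_trans Suc_leI
          One_nat_def)
    define c where "c i = ((\<lambda>x. 2 * x + 1) ^^ i) e" for i
    have cS: "c (Suc i) = 2 * c i + 1" "0 < c i" for i using e(1) by (induction i) (auto simp: c_def)
    have cb: "c i + 2 \<le> 2 ^ (j * m + 2 + i)" for i
    proof (induction i)
      case 0
      have "2 ^ (j * m + 2) = 4 * (2 :: nat) ^ (j * m)" "0 < (2 :: nat) ^ (j * m)"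
          by (simp_all add: power_add)
      then show ?case using e(2) unfolding top_def c_def by (simp only: funpow.simps id_apply add_0_right)
    next
      case (Suc i)
      then show ?case using cS[of i] by simp
    qed
    have ct: "2 * c i + 2 \<le> top (Suc j)" if "i \<le> \<Delta>" for i
    proof -
      have "2 * c i + 4 \<le> 2 ^ (j * m + 2 + Suc i)" using cb[of i] by simp
      also have "\<dots> \<le> 2 ^ (Suc j * m + 2)" using that by (intro power_increasing) (auto simp: m_def)
      finally show ?thesis by (simp add: top_def)
    qed
    have tc: "tot (c i) = tot e" if "i \<le> Suc \<Delta>" for i
      using that
    proof (induction i)
      case (Suc i)
      have "tot (c i) \<le> tot (c (Suc i))" using tot_child[of "c i" "c (Suc i)"] cS by simp
      then show ?case using Suc tot_max[of "c (Suc i)"] ct[of i] cS by fastforce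
    qed (simp add: c_def)
    let ?m = "int \<Delta>"
    \<comment> \<open>The label difference of the two arcs between x and its parent, downward minus
      upward. Without slack in either direction the downward label grows and the upward label falls
      by one per level, hence the increment 2.\<close>
    define o' where "o' x = int (l ((x - 1) div 2, x)) - int (l (x, (x - 1) div 2))" for x
    have zero: "?m dvd int (l (x, (x - 1) div 2)) - int (l (y, x)) - 1 \<and> ?m dvd int (l (x,
        y)) - int (l ((x - 1) div 2, x)) - 1"
      if "i \<le> \<Delta>" "x = c i" "y = 2 * x + 1 \<or> y = 2 * x + 2" for i x y
    proof -
      have "tot y \<le> tot (c i)" using tot_max[of y] ct[OF that(1)] that tc[of i] by auto
      then have "slack_step \<Delta> (l (y, x)) (l (x, (x - 1) div 2)) = 0 \<and> slack_step \<Delta> (l ((x - 1) div 2,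
          x)) (l (x, y)) = 0"
        using tot_child[of x y] cS that by simp
      then show ?thesis using slack_step_0[OF D0] by blast
    qed
    have oS: "o' (c (Suc i)) mod ?m = (o' (c i) + 2) mod ?m" if "i \<le> \<Delta>" for i
    proof -
      let ?x = "c i" and ?y = "2 * c i + 1"
      have "o' ?y - (o' ?x + 2) = (int (l (?x, (?x - 1) div 2)) - int (l (?y, ?x)) - 1) + (int (l (?x,
          ?y)) - int (l ((?x - 1) div 2, ?x)) - 1)"
        by (simp add: o'_def)
      also have "?m dvd \<dots>" using zero[OF that refl, of ?y] by (intro dvd_add) blast+
      finally show ?thesis using cS by (simp only: mod_eq_dvd_iff)
    qed
    have oi: "o' (c i) mod ?m = (o' e + 2 * int i) mod ?m" if "i \<le> Suc \<Delta>" for i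
      using that
    proof (induction i)
      case (Suc i)
      have "(o' (c i) + 2) mod ?m = (o' e + 2 * int i + 2) mod ?m" using Suc by (intro mod_add_cong) auto
      then show ?case using oS[of i] Suc.prems by (simp add: algebra_simps)
    qed (simp add: c_def)
    obtain i where i: "i \<le> \<Delta>" "int k < (o' e + 1 + 2 * int i) mod ?m" using mod_above[OF D] by blast
    let ?x = "c i"
    let ?a = "2 * ?x + 1" and ?b = "2 * ?x + 2"
    have bn: "?b \<le> n" using ct[OF i(1)] top_n[of "Suc j"] j(1) by simp
    have "path_in (heap_tree n) ?a [?a, ?x, ?b] ?b"
      using bn by (auto simp: path_in_def heap_tree_def image_iff intro!: bexI[of _ ?a] bexI[of _ ?b])
    then have "slack_step \<Delta> (l (?a, ?x)) (l (?x, ?b)) \<le> k" using S[of ?a _ ?b] by fastforce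
    \<comment> \<open>Both children continue the arcs of \<open>?x\<close> without slack: the arc
      from \<open>?x\<close> to \<open>?b\<close> has one more than the label of the arc into
      \<open>?x\<close> from above, and the arc from \<open>?a\<close> to \<open>?x\<close> has one
      less than the label of the arc from \<open>?x\<close> upward. So the turn has slack
      \<open>o' ?x + 1\<close> modulo \<Delta>.\<close>
    moreover have "int (slack_step \<Delta> (l (?a, ?x)) (l (?x, ?b))) = (o' e + 1 + 2 * int i) mod ?m"
    proof -
      have "(int (l (?x, ?b)) - int (l (?a, ?x)) - 1) - (o' ?x + 1)
          = (int (l (?x, (?x - 1) div 2)) - int (l (?a, ?x)) - 1) + (int (l (?x, ?b)) - int (l ((?x - 1) div
              2, ?x)) - 1)"
        by (simp add: o'_def)
      also have "?m dvd \<dots>" using zero[OF i(1) refl, of ?a] zero[OF i(1) refl, of ?b] by (intro dvd_add) blast+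
      finally have "(int (l (?x, ?b)) - int (l (?a, ?x)) - 1) mod ?m = (o' ?x + 1) mod ?m"
        by (simp only: mod_eq_dvd_iff)
      also have "\<dots> = (o' e + 2 * int i + 1) mod ?m" using oi[of i] i(1) by (intro mod_add_cong) auto
      finally show ?thesis using D0 by (simp add: int_slack_step algebra_simps)
    qed
    ultimately show False using i(2) by simp
  qed
  then show ?thesis by (intro exI[of _ n]) (meson not_le)
qed

text \<open>Slack at most k is demanded for one pair after the other. Since all demands together
  cannot be met, some pair (a, b) is the first that cannot be added to a feasible set S. The least
  slack s from a to b over all labelings feasible for S is then larger than k.\<close>

lemma ex_critical_path:
  assumes D: "\<Delta> > k + 2 \<or> (\<Delta> = k + 2 \<and> odd \<Delta>)"
  shows "\<exists>(T :: nat pair_pre_digraph) \<tau> S a b s l0. bidirected_tree T \<and> pverts T = {..<\<tau>} \<and>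
    S \<subseteq> {(x, y). x < \<tau> \<and> y < \<tau> \<and> x \<noteq> y} \<and> a < \<tau> \<and> b < \<tau> \<and> a \<noteq> b \<and> k < s \<and>
    (\<forall>e. l0 e < \<Delta>) \<and> (\<forall>(x, y)\<in>S. slack \<Delta> l0 (tree_path T x y) \<le> k) \<and> slack \<Delta> l0 (tree_path T a b) = s \<and>
    (\<forall>l. (\<forall>(x, y)\<in>S. slack \<Delta> l (tree_path T x y) \<le> k) \<longrightarrow> s \<le> slack \<Delta> l (tree_path T a b))"
proof -
  obtain n where n: "\<forall>l. \<exists>a\<in>pverts (heap_tree n). \<exists>b\<in>pverts (heap_tree n). a \<noteq> b \<and>
      k < slack \<Delta> l (tree_path (heap_tree n) a b)"
    using heap_tree_infeasible[OF D] by blast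
  let ?T = "heap_tree n" and ?V = "{..<Suc n}"
  have D0: "0 < \<Delta>" using D by auto
  have V: "pverts ?T = ?V" by (auto simp: heap_tree_def)
  define ok where "ok l S \<longleftrightarrow> (\<forall>(x, y)\<in>S. slack \<Delta> l (tree_path ?T x y) \<le> k)" for l S
  define P where "P = {(x, y). x < Suc n \<and> y < Suc n \<and> x \<noteq> y}"
  have fin: "finite P" by (rule finite_subset[of _ "?V \<times> ?V"]) (auto simp: P_def)
  have "(\<exists>l. ok l Q) \<or> (\<exists>S\<subseteq>Q. \<exists>p\<in>Q. (\<exists>l. ok l S) \<and> \<not> (\<exists>l. ok l (insert p S)))"
    if "Q \<subseteq> P" for Q using finite_subset[OF that fin]
  proof (induction Q)
    case (insert p Q)
    show ?case
    proof (cases "\<exists>l. ok l Q")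
      case True
      then show ?thesis by (metis insertI1 subset_insertI)
    next
      case False
      with insert.IH obtain S p' where "S \<subseteq> Q" "p' \<in> Q" "\<exists>l. ok l S" "\<not> (\<exists>l. ok l (insert p' S))" by blast
      then show ?thesis by (metis insertI2 subset_insertI2)
    qed
  qed (simp add: ok_def)
  from this[OF subset_refl]
  have "(\<exists>l. ok l P) \<or> (\<exists>S\<subseteq>P. \<exists>p\<in>P. (\<exists>l. ok l S) \<and> \<not> (\<exists>l. ok l (insert p S)))" .
  moreover have "\<not> ok l P" for l
  proof -
    obtain x y where "x \<in> pverts ?T" "y \<in> pverts ?T" "x \<noteq> y" "\<not> slack \<Delta> l (tree_path ?T x y) \<le> k"
      using n by (meson not_le)
    then show ?thesis using V by (auto simp: ok_def P_def)
  qed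
  ultimately obtain S p where Sp: "S \<subseteq> P" "p \<in> P" "\<exists>l. ok l S" "\<not> (\<exists>l. ok l (insert p S))" by blast
  obtain a b where "p = (a, b)" by fastforce
  with Sp have S: "S \<subseteq> P" "(a, b) \<in> P" "\<exists>l. ok l S" "\<not> (\<exists>l. ok l (insert (a, b) S))" by auto
  let ?s = "\<lambda>l. slack \<Delta> l (tree_path ?T a b)"
  define s where "s = (LEAST m. \<exists>l. ok l S \<and> ?s l = m)"
  obtain l where l: "ok l S" "?s l = s"
    unfolding s_def using LeastI_ex[of "\<lambda>m. \<exists>l. ok l S \<and> ?s l = m"] S(3) by blast
  have min: "s \<le> ?s l'" if "ok l' S" for l' unfolding s_def by (rule Least_le) (use that in blast)
  have "k < s" using S(4) l by (fastforce simp: ok_def)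
  \<comment> \<open>The minimum was taken over labels of arbitrary size. Slack depends on residues
    only, so reduction modulo \<Delta> gives a proper labeling.\<close>
  define l0 where "l0 e = l e mod \<Delta>" for e
  have "slack_step \<Delta> (x mod \<Delta>) (y mod \<Delta>) = slack_step \<Delta> x y" for x y
    by (simp add: slack_step.simps zmod_int) (intro arg_cong[where f = nat] mod_diff_cong; simp)
  then have sl: "slack \<Delta> l0 vs = slack \<Delta> l vs" for vs
  proof (induction vs)
    case (Cons v vs)
    then show ?case by (cases vs; cases "tl vs") (auto simp: l0_def)
  qed simp
  then have "ok l0 S" "?s l0 = s" using l by (auto simp: ok_def sl)
  then show ?thesis
    using S(1,2) min \<open>k < s\<close> D0 rooted_bidirected_tree[OF heap_tree_rooted] V
    by (intro exI[of _ ?T] exI[of _ "Suc n"] exI[of _ S] exI[of _ a] exI[of _ b] exI[of _ s] exI[of _ l0])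
      (auto simp: ok_def P_def l0_def)
qed

section \<open>From difference constraints to trees\<close>

lemma slack_map: "slack \<Delta> l (map f vs) = slack \<Delta> (\<lambda>(x, y). l (f x, f y)) vs"
proof (induction vs)
  case (Cons v vs)
  then show ?case by (cases vs; cases "tl vs") auto
qed simp

lemma slack_cong: "(\<And>e. e \<in> set (arcs_of vs) \<Longrightarrow> l e = l' e) \<Longrightarrow> slack \<Delta> l vs = slack \<Delta> l' vs"
proof (induction vs)
  case (Cons v vs)
  then show ?case by (cases vs; cases "tl vs") auto
qed simp

lemma arcs_of_memD: "(p, q) \<in> set (arcs_of vs) \<Longrightarrow> p \<in> set vs \<and> q \<in> set vs"
  by (induction vs rule: induct_list012) auto

lemma slack_step_shift: "slack_step \<Delta> ((x + z) mod \<Delta>) ((y + z) mod \<Delta>) = slack_step \<Delta> x y"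
proof -
  have "(int ((y + z) mod \<Delta>) - int ((x + z) mod \<Delta>) - 1) mod int \<Delta> = (int (y + z) - int (x + z) - 1) mod int \<Delta>"
    by (intro mod_diff_cong) (simp_all add: zmod_int)
  then show ?thesis by (simp add: slack_step.simps)
qed

lemma slack_shift: "slack \<Delta> (\<lambda>e. (l e + z) mod \<Delta>) vs = slack \<Delta> l vs"
proof (induction vs)
  case (Cons v vs)
  then show ?case by (cases vs; cases "tl vs") (auto simp: slack_step_shift)
qed simp

lemma slack_step_Suc_mod: "0 < \<Delta> \<Longrightarrow> slack_step \<Delta> (x mod \<Delta>) (Suc x mod \<Delta>) = 0"
  using slack_step_shift[of \<Delta> 0 x 1] by (simp add: slack_step.simps)

lemma slack_step_eq_0D: "\<lbrakk>slack_step \<Delta> x y = 0; x < \<Delta>; y < \<Delta>\<rbrakk> \<Longrightarrow> y = Suc x mod \<Delta>"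
  using slack_step_mod[of y \<Delta> x] by simp

lemma slack_append2: "slack \<Delta> l (vs @ [x, y, z, w]) = slack \<Delta> l (vs @ [x, y]) + slack_step \<Delta> (l (x, y)) (l (y,
    z)) + slack_step \<Delta> (l (y, z)) (l (z, w))"
  using slack_snoc[of \<Delta> l "vs @ [x]" y z w] slack_snoc[of \<Delta> l vs x y z] by simp

lemma slack_append3: "slack \<Delta> l (vs @ [x, y, z, w, u]) = slack \<Delta> l (vs @ [x, y]) + slack_step \<Delta> (l (x,
    y)) (l (y, z))
   + slack_step \<Delta> (l (y, z)) (l (z, w)) + slack_step \<Delta> (l (z, w)) (l (w, u))"
  using slack_snoc[of \<Delta> l "vs @ [x, y]" z w u] slack_append2[of \<Delta> l vs x y z w] by simp

lemma path_in_snoc: "\<lbrakk>path_in G u vs v; (v, w) \<in> parcs G; w \<in> pverts G; w \<notin> set vs\<rbrakk> \<Longrightarrow> path_in G u (vs @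
    [w]) w"
  by (auto simp: path_in_def successively_append_iff)

lemma static_dist_le:
  assumes "pair_wf_digraph G" "path_in G u vs v"
  shows "static_dist G u v \<le> ereal (real (length vs - 1))"
proof -
  interpret pair_wf_digraph G by fact
  have "apath u (arcs_of vs) v" using apath_conv_path_in[OF assms(1)] assms(2) by blast
  then have "awalk u (arcs_of vs) v" by (rule awalkI_apath)
  from min_cost_le_walk_cost[OF this, of "\<lambda>_. 1"] show ?thesis
    by (simp add: static_dist_def awalk_cost_def length_arcs_of sum_list_triv)
qed

lemma fastest_duration_le_tree:
  assumes T: "bidirected_tree G" and l: "periodic_labeling \<Delta> G l" and vs: "path_in G u vs v" "2 \<le> length vs"
  shows "fastest_duration \<Delta> G l u v \<le> enat d \<longleftrightarrow> length vs - 1 + slack \<Delta> l vs \<le> d"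
proof
  assume "fastest_duration \<Delta> G l u v \<le> enat d"
  then obtain ws where "path_in G u ws v" "length ws - 1 + slack \<Delta> l ws \<le> d"
    by (rule fastest_duration_leD[OF tree_graphD(1)[OF T] l])
  then show "length vs - 1 + slack \<Delta> l vs \<le> d" using tree_path_unique[OF T vs(1)] by auto
next
  assume "length vs - 1 + slack \<Delta> l vs \<le> d"
  then have "enat (length vs - 1 + slack \<Delta> l vs) \<le> enat d" by simp
  with fastest_duration_le_slack[OF tree_graphD(1)[OF T] l vs] show "fastest_duration \<Delta> G l u v \<le> enat d"
    by (rule order_trans)
qed

lemma fastest_duration_le_iff:
  assumes "bidirected_tree G" "periodic_labeling \<Delta> G l" "path_in G u vs v" "2 \<le> length vs"
  shows "fastest_duration \<Delta> G l u v \<le> enat (length vs - 1 + q) \<longleftrightarrow> slack \<Delta> l vs \<le> q"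
  using fastest_duration_le_tree[OF assms] by simp

text \<open>A positive entry \<open>rc i j = Suc e\<close> demands that the residue of \<open>t j - t i - 2\<close> modulo \<open>\<Delta>\<close> is at
  most \<open>e\<close>.\<close>

definition csp :: "nat \<Rightarrow> nat \<Rightarrow> (nat \<Rightarrow> nat \<Rightarrow> nat) \<Rightarrow> bool" where
  "csp \<Delta> m rc \<longleftrightarrow> (\<exists>t. \<forall>i<m. \<forall>j<m. i \<noteq> j \<longrightarrow> 0 < rc i j \<longrightarrow> slack_step \<Delta> (Suc (t i) mod \<Delta>) (t j mod \<Delta>) < rc i j)"

locale critical =
  fixes \<Delta> k \<tau> a b s :: nat and T :: "nat pair_pre_digraph" and S :: "(nat \<times> nat) set"
      and l0 :: "nat \<times> nat \<Rightarrow> nat"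
  assumes D0: "0 < \<Delta>" and T: "bidirected_tree T" and VT: "pverts T = {..<\<tau>}"
    and S: "(x, y) \<in> S \<Longrightarrow> x < \<tau> \<and> y < \<tau> \<and> x \<noteq> y" and ab: "a < \<tau>" "b < \<tau>" "a \<noteq> b" and ks: "k < s"
    and l0: "l0 e < \<Delta>" "(x, y) \<in> S \<Longrightarrow> slack \<Delta> l0 (tree_path T x y) \<le> k" "slack \<Delta> l0 (tree_path T a b) = s"
    and forced: "\<forall>(x, y)\<in>S. slack \<Delta> l (tree_path T x y) \<le> k \<Longrightarrow> s \<le> slack \<Delta> l (tree_path T a b)"
begin

definition "tp = tree_path T a b"

lemma tp: "path_in T a tp b"
  unfolding tp_def by (rule path_in_tree_path[OF T]) (simp_all add: VT ab)

lemma tp_front: "\<exists>y ys. tp = a # y # ys"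
  using tp ab by (cases tp rule: remdups_adj.cases) (auto simp: path_in_def)

lemma tp_back: "\<exists>xs x. tp = xs @ [x, b]"
proof -
  obtain xs where xs: "tp = xs @ [b]" using tp by (cases tp rule: rev_cases) (auto simp: path_in_def)
  moreover have "xs \<noteq> []" using xs tp_front by auto
  ultimately show ?thesis by (cases xs rule: rev_cases) auto
qed

lemma ab_notin_S: "(a, b) \<notin> S"
  using l0(2)[of a b] l0(3) ks by auto

text \<open>Vertex \<open>0\<close> is the center of the graph. The block of the variable \<open>i\<close> consists of a neighbor
  \<open>zz i\<close> of the center and of two copies \<open>aa i\<close> and \<open>bb i\<close> of \<open>T\<close>, attached to \<open>zz i\<close> at \<open>b\<close> and at
  \<open>a\<close>. The slack \<open>s\<close> is already used up inside the copies. Hence, if the paths from \<open>aa i a\<close> to the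
  center and to \<open>bb i a\<close> and the path from the center to \<open>bb i b\<close> have slack \<open>s\<close>, then the labels of
  \<open>(aa i b, zz i)\<close>, \<open>(zz i, 0)\<close> and \<open>(0, zz i)\<close> are \<open>t i\<close>, \<open>t i + 1\<close> and \<open>t i\<close>, and a bound on the
  path from \<open>aa i a\<close> to \<open>zz j\<close> is a constraint on \<open>t i\<close> and \<open>t j\<close>.\<close>

definition "\<beta> = 1 + 2 * \<tau>"
definition "zz i = 1 + \<beta> * i"
definition "aa i y = 2 + \<beta> * i + y"
definition "bb i y = 2 + \<beta> * i + \<tau> + y"
definition "blk v = (v - 1) div \<beta>"
definition "off v = (v - 1) mod \<beta>"

lemma blk_off [simp]: "blk (zz i) = i" "off (zz i) = 0" "y < \<tau> \<Longrightarrow> blk (aa i y) = i"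
    "y < \<tau> \<Longrightarrow> off (aa i y) = Suc y"
  "y < \<tau> \<Longrightarrow> blk (bb i y) = i" "y < \<tau> \<Longrightarrow> off (bb i y) = Suc (\<tau> + y)"
proof -
  have "(o' + \<beta> * i) div \<beta> = i \<and> (o' + \<beta> * i) mod \<beta> = o'" if "o' < \<beta>" for o' i using that by simp
  note * = this[of 0 i] this[of "Suc y" i] this[of "Suc (\<tau> + y)" i]
  show "blk (zz i) = i" "off (zz i) = 0" using *(1) by (auto simp: blk_def off_def zz_def \<beta>_def)
  show "y < \<tau> \<Longrightarrow> blk (aa i y) = i" "y < \<tau> \<Longrightarrow> off (aa i y) = Suc y"
    using *(2) by (auto simp: blk_def off_def aa_def \<beta>_def add_ac)
  show "y < \<tau> \<Longrightarrow> blk (bb i y) = i" "y < \<tau> \<Longrightarrow> off (bb i y) = Suc (\<tau> + y)"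
    using *(3) by (auto simp: blk_def off_def bb_def \<beta>_def add_ac)
qed

lemma pos [simp]: "0 < zz i" "0 < aa i y" "0 < bb i y" "zz i \<noteq> 0" "aa i y \<noteq> 0" "bb i y \<noteq> 0"
  by (auto simp: zz_def aa_def bb_def)

lemma distinct_vertices [simp]:
  "y < \<tau> \<Longrightarrow> zz i \<noteq> aa j y" "y < \<tau> \<Longrightarrow> zz i \<noteq> bb j y" "y < \<tau> \<Longrightarrow> aa j y \<noteq> zz i" "y < \<tau> \<Longrightarrow> bb j y \<noteq> zz i"
  "y < \<tau> \<Longrightarrow> x < \<tau> \<Longrightarrow> aa i x \<noteq> bb j y" "y < \<tau> \<Longrightarrow> x < \<tau> \<Longrightarrow> bb j y \<noteq> aa i x" "zz i = zz j \<longleftrightarrow> i = j"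
  "y < \<tau> \<Longrightarrow> x < \<tau> \<Longrightarrow> aa i x = aa j y \<longleftrightarrow> i = j \<and> x = y" "y < \<tau> \<Longrightarrow> x < \<tau> \<Longrightarrow> bb i x = bb j y \<longleftrightarrow> i = j \<and> x = y"
  by (metis blk_off Suc_inject add_left_cancel nat.distinct(1) less_irrefl not_add_less1)+

lemma vertex_cases:
  obtains "v = 0" | i where "v = zz i" | i y where "v = aa i y" "y < \<tau>" | i y where "v = bb i y" "y < \<tau>"
proof (cases "v = 0")
  case False
  then have v: "v = 1 + (\<beta> * blk v + off v)" by (simp add: blk_def off_def)
  have "off v < \<beta>" by (simp add: off_def \<beta>_def)
  then consider "off v = 0" | y where "off v = Suc y" "y < \<tau>" | y where "off v = Suc (\<tau> + y)" "y < \<tau>"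
    unfolding \<beta>_def by (metis One_nat_def add_less_cancel_left le_add_diff_inverse mult_2
        nat_add_left_cancel_less not_le not_less_eq old.nat.exhaust plus_1_eq_Suc)
  then show thesis
  proof cases
    case 1
    then show ?thesis using that(2)[of "blk v"] v by (simp add: zz_def)
  next
    case (2 y)
    then show ?thesis using that(3)[of "blk v" y] v by (simp add: aa_def)
  next
    case (3 y)
    then show ?thesis using that(4)[of "blk v" y] v by (simp add: bb_def)
  qed
qed (rule that(1))

definition size_of :: "nat \<Rightarrow> nat" where "size_of m = 1 + \<beta> * m"

lemma in_range [simp]: "zz i < size_of m \<longleftrightarrow> i < m" "y < \<tau> \<Longrightarrow> aa i y < size_of m \<longleftrightarrow> i < m"
  "y < \<tau> \<Longrightarrow> bb i y < size_of m \<longleftrightarrow> i < m" "0 < size_of m"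
proof -
  have *: "o' + \<beta> * i < \<beta> * m \<longleftrightarrow> i < m" if "o' < \<beta>" for o'
  proof
    assume "i < m"
    then have "\<beta> * Suc i \<le> \<beta> * m" by (intro mult_le_mono2) simp
    then show "o' + \<beta> * i < \<beta> * m" using that by simp
  next
    assume "o' + \<beta> * i < \<beta> * m"
    then have "\<beta> * i < \<beta> * m" by linarith
    then show "i < m" by simp
  qed
  show "zz i < size_of m \<longleftrightarrow> i < m" "y < \<tau> \<Longrightarrow> aa i y < size_of m \<longleftrightarrow> i < m"
    "y < \<tau> \<Longrightarrow> bb i y < size_of m \<longleftrightarrow> i < m" "0 < size_of m"
    using *[of 0] *[of "Suc y"] *[of "Suc (\<tau> + y)"]
    by (simp_all add: zz_def aa_def bb_def size_of_def \<beta>_def add_ac)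
qed

text \<open>In a block, offset 0 is \<open>zz\<close>, offsets 1 to \<tau> are the copy
  \<open>aa\<close>, and \<tau> + 1 to 2 \<tau> the copy \<open>bb\<close>. Adjacency within a block
  depends on the offsets only, so it is a finite table that does not grow with the instance.\<close>

definition local_arc :: "nat \<Rightarrow> nat \<Rightarrow> bool" where
  "local_arc x y \<longleftrightarrow> (x = 0 \<and> (y = Suc b \<or> y = Suc (\<tau> + a))) \<or> (y = 0 \<and> (x = Suc b \<or> x = Suc (\<tau> + a))) \<or>
     (0 < x \<and> 0 < y \<and> ((x - 1, y - 1) \<in> parcs T \<or> (\<tau> < x \<and> \<tau> < y \<and> (x - 1 - \<tau>, y - 1 - \<tau>) \<in> parcs T)))"

definition is_arc :: "nat \<Rightarrow> nat \<Rightarrow> bool" where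
  "is_arc u v \<longleftrightarrow> (u = 0 \<and> 0 < v \<and> off v = 0) \<or> (v = 0 \<and> 0 < u \<and> off u = 0) \<or>
     (0 < u \<and> 0 < v \<and> blk u = blk v \<and> local_arc (off u) (off v))"

definition graph :: "nat \<Rightarrow> nat pair_pre_digraph" where
  "graph m = \<lparr>pverts = {..<size_of m}, parcs = {(u, v). u < size_of m \<and> v < size_of m \<and> is_arc u v}\<rparr>"

lemma T_arc_less: "(x, y) \<in> parcs T \<Longrightarrow> x < \<tau> \<and> y < \<tau>"
  using tree_graphD(5)[OF T] VT by blast

lemma is_arc_simps [simp]:
  "\<not> is_arc 0 0" "is_arc 0 (zz i)" "is_arc (zz i) 0"
  "y < \<tau> \<Longrightarrow> \<not> is_arc 0 (aa i y)" "y < \<tau> \<Longrightarrow> \<not> is_arc 0 (bb i y)" "y < \<tau> \<Longrightarrow> \<not> is_arc (aa i y) 0"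
      "y < \<tau> \<Longrightarrow> \<not> is_arc (bb i y) 0"
  "\<not> is_arc (zz i) (zz j)"
  "y < \<tau> \<Longrightarrow> is_arc (zz i) (aa j y) \<longleftrightarrow> i = j \<and> y = b" "y < \<tau> \<Longrightarrow> is_arc (aa j y) (zz i) \<longleftrightarrow> i = j \<and> y = b"
  "y < \<tau> \<Longrightarrow> is_arc (zz i) (bb j y) \<longleftrightarrow> i = j \<and> y = a" "y < \<tau> \<Longrightarrow> is_arc (bb j y) (zz i) \<longleftrightarrow> i = j \<and> y = a"
  "x < \<tau> \<Longrightarrow> y < \<tau> \<Longrightarrow> is_arc (aa i x) (aa j y) \<longleftrightarrow> i = j \<and> (x, y) \<in> parcs T"
  "x < \<tau> \<Longrightarrow> y < \<tau> \<Longrightarrow> is_arc (bb i x) (bb j y) \<longleftrightarrow> i = j \<and> (x, y) \<in> parcs T"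
  "x < \<tau> \<Longrightarrow> y < \<tau> \<Longrightarrow> \<not> is_arc (aa i x) (bb j y)" "x < \<tau> \<Longrightarrow> y < \<tau> \<Longrightarrow> \<not> is_arc (bb j y) (aa i x)"
  using ab by (auto simp: is_arc_def local_arc_def dest: T_arc_less)

lemma graph_tree: "bidirected_tree (graph m)"
proof -
  have "a \<in> pverts T" "b \<in> pverts T" using VT ab by auto
  then obtain pa ra pb rb where A: "rooted T b pa ra" and B: "rooted T a pb rb"
    using tree_rooted[OF T] by blast
  \<comment> \<open>The center is the root; a copy \<open>aa\<close> hangs at b and is therefore
    rooted there, a copy \<open>bb\<close> hangs at a.\<close>
  define par where "par v = (if off v = 0 then 0 else if off v \<le> \<tau> then if off v =
      Suc b then zz (blk v) else aa (blk v) (pa (off v - 1))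
    else if off v = Suc (\<tau> + a) then zz (blk v) else bb (blk v) (pb (off v - 1 - \<tau>)))" for v
  define rk where "rk v = (if v = 0 then 0 else if off v = 0 then 1 else if off v \<le> \<tau> then 2 + ra (off v - 1)
      else 2 + rb (off v - 1 - \<tau>))" for v
  have par: "par (zz i) = 0" "y < \<tau> \<Longrightarrow> par (aa i y) = (if y = b then zz i else aa i (pa y))"
    "y < \<tau> \<Longrightarrow> par (bb i y) = (if y = a then zz i else bb i (pb y))"
    "rk 0 = 0" "rk (zz i) = 1" "y < \<tau> \<Longrightarrow> rk (aa i y) = 2 + ra y" "y < \<tau> \<Longrightarrow> rk (bb i y) = 2 + rb y" for i y
    by (auto simp: par_def rk_def)
  have pA: "y < \<tau> \<Longrightarrow> y \<noteq> b \<Longrightarrow> pa y < \<tau> \<and> ra (pa y) < ra y" and pB: "y < \<tau> \<Longrightarrow> y \<noteq> a \<Longrightarrow> pb y < \<tau> \<and> rb (pb y) < rb y"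
      for y
    using A B VT by (auto simp: rooted_def)
  have arcA: "(x, y) \<in> parcs T \<longleftrightarrow> (x < \<tau> \<and> x \<noteq> b \<and> y = pa x) \<or> (y < \<tau> \<and> y \<noteq> b \<and> x = pa y)" for x y
    using rooted_arc[OF A] VT by auto
  have arcB: "(x, y) \<in> parcs T \<longleftrightarrow> (x < \<tau> \<and> x \<noteq> a \<and> y = pb x) \<or> (y < \<tau> \<and> y \<noteq> a \<and> x = pb y)" for x y
    using rooted_arc[OF B] VT by auto
  have iff: "is_arc u v \<longleftrightarrow> (u \<noteq> 0 \<and> v = par u) \<or> (v \<noteq> 0 \<and> u = par v)" for u v
  proof (cases u rule: vertex_cases)
    case 1
    then show ?thesis using pA pB by (cases v rule: vertex_cases) (auto simp: par)
  next
    case (2 i)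
    then show ?thesis using pA pB by (cases v rule: vertex_cases) (auto simp: par)
  next
    case (3 i y)
    then show ?thesis using pA pB by (cases v rule: vertex_cases) (auto simp: par arcA)
  next
    case (4 i y)
    then show ?thesis using pA pB by (cases v rule: vertex_cases) (auto simp: par arcB)
  qed
  have less: "par v < size_of m \<and> rk (par v) < rk v" if "v \<noteq> 0" "v < size_of m" for v
    using that pA pB by (cases v rule: vertex_cases) (auto simp: par)
  have "parcs (graph m) = (\<lambda>v. (v, par v)) ` (pverts (graph m) - {0}) \<union> (\<lambda>v. (par v, v)) ` (pverts (graph m) -
      {0})"
    using less by (auto simp: graph_def iff image_iff)
  then have "rooted (graph m) 0 par rk" unfolding rooted_def using less by (auto simp: graph_def)
  then show ?thesis by (rule rooted_bidirected_tree)
qed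

definition "L = length tp - 1"

text \<open>Positive values are one more than a number of arcs plus an allowed slack. The path
  \<open>tp\<close> has L arcs, its extensions have L + 2, and the path to another block has L + 3;
  there \<open>L + 3 + s + rc\<close> stands for slack at most s + (rc - 1).\<close>

definition treq :: "nat \<Rightarrow> nat \<Rightarrow> nat" where
  "treq x y = (if (x, y) \<in> S then Suc (length (tree_path T x y) - 1 + k) else if x = a \<and> y =
      b then Suc (L + s) else 0)"

definition local_req :: "nat \<Rightarrow> nat \<Rightarrow> nat" where
  "local_req x y = (if 0 < x \<and> x \<le> \<tau> \<and> 0 < y \<and> y \<le> \<tau> then treq (x - 1) (y - 1)
     else if \<tau> < x \<and> \<tau> < y then treq (x - 1 - \<tau>) (y - 1 - \<tau>)
     else if x = Suc a \<and> y = Suc (\<tau> + a) then Suc (L + 2 + s) else 0)"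

text \<open>The bound \<open>\<infinity>\<close> is coded by \<open>0\<close> and a finite bound \<open>d\<close> by \<open>Suc d\<close>.\<close>

definition req :: "(nat \<Rightarrow> nat \<Rightarrow> nat) \<Rightarrow> nat \<Rightarrow> nat \<Rightarrow> nat" where
  "req rc u v = (if u = 0 then (if 0 < v \<and> off v = Suc (\<tau> + b) then Suc (L + 2 + s) else 0)
     else if v = 0 then (if off u = Suc a then Suc (L + 2 + s) else 0)
     else if blk u = blk v then local_req (off u) (off v)
     else if off u = Suc a \<and> off v = 0 \<and> 0 < rc (blk u) (blk v) then L + 3 + s + rc (blk u) (blk v) else 0)"

definition bound :: "(nat \<Rightarrow> nat \<Rightarrow> nat) \<Rightarrow> nat \<Rightarrow> nat \<Rightarrow> enat" where
  "bound rc u v = (case req rc u v of 0 \<Rightarrow> \<infinity> | Suc d \<Rightarrow> enat d)"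

lemma req_simps [simp]:
  "req rc 0 0 = 0" "req rc 0 (zz j) = 0" "y < \<tau> \<Longrightarrow> req rc 0 (aa j y) = 0"
      "y < \<tau> \<Longrightarrow> req rc 0 (bb j y) = (if y = b then Suc (L + 2 + s) else 0)"
  "req rc (zz i) v = 0"
  "x < \<tau> \<Longrightarrow> req rc (aa i x) 0 = (if x = a then Suc (L + 2 + s) else 0)"
  "x < \<tau> \<Longrightarrow> req rc (aa i x) (zz j) = (if x = a \<and> i \<noteq> j \<and> 0 < rc i j then L + 3 + s + rc i j else 0)"
  "x < \<tau> \<Longrightarrow> y < \<tau> \<Longrightarrow> req rc (aa i x) (aa j y) = (if i = j then treq x y else 0)"
  "x < \<tau> \<Longrightarrow> y < \<tau> \<Longrightarrow> req rc (aa i x) (bb j y) = (if i = j \<and> x = a \<and> y = a then Suc (L + 2 + s) else 0)"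
  "x < \<tau> \<Longrightarrow> req rc (bb i x) 0 = 0" "x < \<tau> \<Longrightarrow> req rc (bb i x) (zz j) = 0"
  "x < \<tau> \<Longrightarrow> y < \<tau> \<Longrightarrow> req rc (bb i x) (bb j y) = (if i = j then treq x y else 0)"
  "x < \<tau> \<Longrightarrow> y < \<tau> \<Longrightarrow> req rc (bb i x) (aa j y) = 0"
  using ab by (auto simp: req_def local_req_def)

lemma len_tp: "length tp = Suc L" "0 < L"
  using tp_front by (auto simp: L_def)

lemma arc_simp: "(u, v) \<in> parcs (graph m) \<longleftrightarrow> u < size_of m \<and> v < size_of m \<and> is_arc u v"
  by (simp add: graph_def)

lemma path_aa:
  assumes "i < m" "path_in T x vs y"
  shows "path_in (graph m) (aa i x) (map (aa i) vs) (aa i y)"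
proof -
  have "set vs \<subseteq> {..<\<tau>}" "vs \<noteq> []" using assms(2) VT by (auto simp: path_in_def)
  moreover have "successively (\<lambda>a b. (a, b) \<in> parcs (graph m)) (map (aa i) vs)"
    unfolding successively_map using assms T_arc_less
    by (auto simp: path_in_def arc_simp elim!: successively_mono)
  moreover have "inj_on (aa i) (set vs)" by (auto simp: inj_on_def aa_def)
  ultimately show ?thesis using assms
    by (auto simp: path_in_def hd_map last_map distinct_map graph_def)
qed

lemma path_bb:
  assumes "i < m" "path_in T x vs y"
  shows "path_in (graph m) (bb i x) (map (bb i) vs) (bb i y)"
proof -
  have "set vs \<subseteq> {..<\<tau>}" "vs \<noteq> []" using assms(2) VT by (auto simp: path_in_def)
  moreover have "successively (\<lambda>a b. (a, b) \<in> parcs (graph m)) (map (bb i) vs)"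
    unfolding successively_map using assms T_arc_less
    by (auto simp: path_in_def arc_simp elim!: successively_mono)
  moreover have "inj_on (bb i) (set vs)" by (auto simp: inj_on_def bb_def)
  ultimately show ?thesis using assms
    by (auto simp: path_in_def hd_map last_map distinct_map graph_def)
qed

lemma tp_less: "y \<in> set tp \<Longrightarrow> y < \<tau>"
  using tp VT by (auto simp: path_in_def)

lemma long_paths:
  assumes "i < m"
  shows "path_in (graph m) (aa i a) (map (aa i) tp @ [zz i, 0]) 0"
    "path_in (graph m) (aa i a) (map (aa i) tp @ [zz i, bb i a]) (bb i a)"
    "path_in (graph m) 0 (0 # zz i # map (bb i) tp) (bb i b)"
    "j < m \<Longrightarrow> i \<noteq> j \<Longrightarrow> path_in (graph m) (aa i a) (map (aa i) tp @ [zz i, 0, zz j]) (zz j)"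
proof -
  note p = path_aa[OF assms tp] path_bb[OF assms tp]
  have 0: "zz i \<in> pverts (graph m)" "0 \<in> pverts (graph m)" "bb i a \<in> pverts (graph m)"
      "j < m \<Longrightarrow> zz j \<in> pverts (graph m)" for j
    using assms ab by (auto simp: graph_def)
  have n1: "zz j \<notin> set (map (aa i) tp)" "0 \<notin> set (map (aa i) tp)" "bb i a \<notin> set (map (aa i) tp)"
    "zz j \<notin> set (map (bb i) tp)" "0 \<notin> set (map (bb i) tp)" for j
    using tp_less ab by (force simp: image_iff)+
  have 1: "path_in (graph m) (aa i a) (map (aa i) tp @ [zz i]) (zz i)"
    by (rule path_in_snoc[OF p(1)]) (use n1 assms ab in \<open>auto simp: arc_simp graph_def\<close>)
  have 2: "path_in (graph m) (aa i a) ((map (aa i) tp @ [zz i]) @ [0]) 0"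
    by (rule path_in_snoc[OF 1]) (use n1 assms ab in \<open>auto simp: arc_simp graph_def\<close>)
  then show "path_in (graph m) (aa i a) (map (aa i) tp @ [zz i, 0]) 0" by simp
  have "path_in (graph m) (aa i a) ((map (aa i) tp @ [zz i]) @ [bb i a]) (bb i a)"
    by (rule path_in_snoc[OF 1]) (use n1 assms ab in \<open>auto simp: arc_simp graph_def\<close>)
  then show "path_in (graph m) (aa i a) (map (aa i) tp @ [zz i, bb i a]) (bb i a)" by simp
  show "path_in (graph m) (aa i a) (map (aa i) tp @ [zz i, 0, zz j]) (zz j)" if "j < m" "i \<noteq> j"
  proof -
    have "path_in (graph m) (aa i a) (((map (aa i) tp @ [zz i]) @ [0]) @ [zz j]) (zz j)"
      by (rule path_in_snoc[OF 2]) (use that n1 assms ab in \<open>auto simp: arc_simp graph_def\<close>)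
    then show ?thesis by simp
  qed
  have "path_in (graph m) (zz i) (zz i # map (bb i) tp) (bb i b)"
    by (rule path_in_ConsI[OF p(2)]) (use n1 assms ab in \<open>auto simp: arc_simp graph_def\<close>)
  then show "path_in (graph m) 0 (0 # zz i # map (bb i) tp) (bb i b)"
    by (rule path_in_ConsI) (use n1 assms ab in \<open>auto simp: arc_simp graph_def\<close>)
qed

section \<open>The constructed instance in terms of slack\<close>

definition satisfies :: "nat \<Rightarrow> (nat \<Rightarrow> nat \<Rightarrow> nat) \<Rightarrow> (nat \<times> nat \<Rightarrow> nat) \<Rightarrow> bool" where
  "satisfies m rc l \<longleftrightarrow> (\<forall>i<m. (\<forall>(x, y)\<in>S. slack \<Delta> l (map (aa i) (tree_path T x y)) \<le> k) \<and>
      (\<forall>(x, y)\<in>S. slack \<Delta> l (map (bb i) (tree_path T x y)) \<le> k) \<and>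
      slack \<Delta> l (map (aa i) tp) \<le> s \<and> slack \<Delta> l (map (bb i) tp) \<le> s \<and>
      slack \<Delta> l (map (aa i) tp @ [zz i, 0]) \<le> s \<and> slack \<Delta> l (map (aa i) tp @ [zz i, bb i a]) \<le> s \<and>
      slack \<Delta> l (0 # zz i # map (bb i) tp) \<le> s \<and>
      (\<forall>j<m. i \<noteq> j \<longrightarrow> 0 < rc i j \<longrightarrow> slack \<Delta> l (map (aa i) tp @ [zz i, 0, zz j]) \<le> s + (rc i j - 1)))"

lemma S_path: "(x, y) \<in> S \<Longrightarrow> path_in T x (tree_path T x y) y \<and> 2 \<le> length (tree_path T x y)"
proof -
  assume xy: "(x, y) \<in> S"
  then have p: "path_in T x (tree_path T x y) y" using path_in_tree_path[OF T] S VT by auto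
  moreover have "2 \<le> length (tree_path T x y)"
    using p S[OF xy] by (cases "tree_path T x y" rule: remdups_adj.cases) (auto simp: path_in_def)
  ultimately show ?thesis by blast
qed

lemma bound_cases:
  assumes "u \<in> pverts (graph m)" "v \<in> pverts (graph m)" "u \<noteq> v" "bound rc u v \<noteq> \<infinity>"
  obtains i x y where "i < m" "(x, y) \<in> S" "u = aa i x" "v = aa i y"
      "bound rc u v = enat (length (map (aa i) (tree_path T x y)) - 1 + k)"
  | i x y where "i < m" "(x, y) \<in> S" "u = bb i x" "v = bb i y"
      "bound rc u v = enat (length (map (bb i) (tree_path T x y)) - 1 + k)"
  | i where "i < m" "u = aa i a" "v = aa i b" "bound rc u v = enat (length (map (aa i) tp) - 1 + s)"
  | i where "i < m" "u = bb i a" "v = bb i b" "bound rc u v = enat (length (map (bb i) tp) - 1 + s)"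
  | i where "i < m" "u = aa i a" "v = 0" "bound rc u v = enat (length (map (aa i) tp @ [zz i, 0]) - 1 + s)"
  | i where "i < m" "u = aa i a" "v = bb i a"
      "bound rc u v = enat (length (map (aa i) tp @ [zz i, bb i a]) - 1 + s)"
  | i where "i < m" "u = 0" "v = bb i b" "bound rc u v = enat (length (0 # zz i # map (bb i) tp) - 1 + s)"
  | i j where "i < m" "j < m" "i \<noteq> j" "0 < rc i j" "u = aa i a" "v = zz j"
      "bound rc u v = enat (length (map (aa i) tp @ [zz i, 0, zz j]) - 1 + (s + (rc i j - 1)))"
proof -
  have V: "u < size_of m" "v < size_of m" using assms by (auto simp: graph_def)
  have 0: "req rc u v \<noteq> 0" using assms(4) by (cases "req rc u v") (auto simp: bound_def)
  show thesis
  proof (cases u rule: vertex_cases)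
    case u: 1
    show thesis
    proof (cases v rule: vertex_cases)
      case (4 j y)
      then show ?thesis using u 0 V that(7)[of j] by (auto simp: bound_def len_tp split: if_splits)
    qed (use u 0 in auto)
  next
    case (2 i)
    then show ?thesis using 0 by simp
  next
    case u: (3 i x)
    show thesis
    proof (cases v rule: vertex_cases)
      case 1
      then show ?thesis using u 0 V that(5)[of i] by (auto simp: bound_def len_tp split: if_splits)
    next
      case (2 j)
      then show ?thesis using u 0 V that(8)[of i j]
        by (auto simp: bound_def len_tp split: if_splits nat.splits)
    next
      case (3 j y)
      then show ?thesis using u 0 V that(1)[of i x y] that(3)[of i] assms(3)
        by (auto simp: bound_def len_tp treq_def split: if_splits)
    next
      case (4 j y)
      then show ?thesis using u 0 V that(6)[of i] by (auto simp: bound_def len_tp split: if_splits)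
    qed
  next
    case u: (4 i x)
    show thesis
    proof (cases v rule: vertex_cases)
      case (4 j y)
      then show ?thesis using u 0 V that(2)[of i x y] that(4)[of i] assms(3)
        by (auto simp: bound_def len_tp treq_def split: if_splits)
    qed (use u 0 in auto)
  qed
qed

lemma bound_simps:
  "(x, y) \<in> S \<Longrightarrow> bound rc (aa i x) (aa i y) = enat (length (map (aa i) (tree_path T x y)) - 1 + k)"
  "(x, y) \<in> S \<Longrightarrow> bound rc (bb i x) (bb i y) = enat (length (map (bb i) (tree_path T x y)) - 1 + k)"
  "bound rc (aa i a) (aa i b) = enat (length (map (aa i) tp) - 1 + s)"
  "bound rc (bb i a) (bb i b) = enat (length (map (bb i) tp) - 1 + s)"
  "bound rc (aa i a) 0 = enat (length (map (aa i) tp @ [zz i, 0]) - 1 + s)"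
  "bound rc (aa i a) (bb i a) = enat (length (map (aa i) tp @ [zz i, bb i a]) - 1 + s)"
  "bound rc 0 (bb i b) = enat (length (0 # zz i # map (bb i) tp) - 1 + s)"
  "i \<noteq> j \<Longrightarrow> 0 < rc i j \<Longrightarrow> bound rc (aa i a) (zz j) = enat (length (map (aa i) tp @ [zz i, 0, zz j]) - 1 +
      (s + (rc i j - 1)))"
  using ab S[of x y] ab_notin_S by (auto simp: bound_def len_tp treq_def split: nat.splits)

lemma yes_iff_satisfies:
  "DiTTR_yes (graph m) (bound rc) \<Delta> \<longleftrightarrow> (\<exists>l. periodic_labeling \<Delta> (graph m) l \<and> satisfies m rc l)"
proof -
  have "(\<forall>u\<in>pverts (graph m). \<forall>v\<in>pverts (graph m). u \<noteq> v \<longrightarrow> fastest_duration \<Delta> (graph m) l u v \<le> bound rc u v)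
      \<longleftrightarrow> satisfies m rc l"
    (is "?L \<longleftrightarrow> ?R") if l: "periodic_labeling \<Delta> (graph m) l" for l
  proof -
    note iff = fastest_duration_le_iff[OF graph_tree l]
    have V [simp]: "i < m \<Longrightarrow> zz i \<in> pverts (graph m)" "i < m \<Longrightarrow> y < \<tau> \<Longrightarrow> aa i y \<in> pverts (graph m)"
      "i < m \<Longrightarrow> y < \<tau> \<Longrightarrow> bb i y \<in> pverts (graph m)" "0 \<in> pverts (graph m)" for i y by (auto simp: graph_def)
    have p: "2 \<le> length (map (aa i) tp)" "2 \<le> length (map (bb i) tp)" "2 \<le> length (map (aa i) tp @ [zz i, 0])"
      "2 \<le> length (map (aa i) tp @ [zz i, bb i a])" "2 \<le> length (0 # zz i # map (bb i) tp)"
          "2 \<le> length (map (aa i) tp @ [zz i, 0, zz j])" for i j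
      using len_tp by auto
    have A: "fastest_duration \<Delta> (graph m) l (aa i x) (aa i y) \<le> bound rc (aa i x) (aa i y) \<longleftrightarrow>
        slack \<Delta> l (map (aa i) (tree_path T x y)) \<le> k" if "i < m" "(x, y) \<in> S" for i x y
      unfolding bound_simps(1)[OF that(2)] by (rule iff[OF path_aa]) (use S_path that in auto)
    have A': "fastest_duration \<Delta> (graph m) l (bb i x) (bb i y) \<le> bound rc (bb i x) (bb i y) \<longleftrightarrow>
        slack \<Delta> l (map (bb i) (tree_path T x y)) \<le> k" if "i < m" "(x, y) \<in> S" for i x y
      unfolding bound_simps(2)[OF that(2)] by (rule iff[OF path_bb]) (use S_path that in auto)
    have B: "fastest_duration \<Delta> (graph m) l (aa i a) (aa i b) \<le> bound rc (aa i a) (aa i b) \<longleftrightarrow>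
        slack \<Delta> l (map (aa i) tp) \<le> s"
      "fastest_duration \<Delta> (graph m) l (bb i a) (bb i b) \<le> bound rc (bb i a) (bb i b) \<longleftrightarrow>
          slack \<Delta> l (map (bb i) tp) \<le> s"
      "fastest_duration \<Delta> (graph m) l (aa i a) 0 \<le> bound rc (aa i a) 0 \<longleftrightarrow> slack \<Delta> l (map (aa i) tp @
          [zz i, 0]) \<le> s"
      "fastest_duration \<Delta> (graph m) l (aa i a) (bb i a) \<le> bound rc (aa i a) (bb i a) \<longleftrightarrow>
          slack \<Delta> l (map (aa i) tp @ [zz i, bb i a]) \<le> s"
      "fastest_duration \<Delta> (graph m) l 0 (bb i b) \<le> bound rc 0 (bb i b) \<longleftrightarrow> slack \<Delta> l (0 # zz i # map (bb i) tp)
          \<le> s"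
      if "i < m" for i
      unfolding bound_simps
      by (rule iff[OF path_aa[OF that tp] p(1)] iff[OF path_bb[OF that tp] p(2)] iff[OF long_paths(1)[OF that]
          p(3)]
          iff[OF long_paths(2)[OF that] p(4)] iff[OF long_paths(3)[OF that] p(5)])+
    have C: "fastest_duration \<Delta> (graph m) l (aa i a) (zz j) \<le> bound rc (aa i a) (zz j) \<longleftrightarrow>
        slack \<Delta> l (map (aa i) tp @ [zz i, 0, zz j]) \<le> s + (rc i j - 1)" if "i < m" "j < m" "i \<noteq> j" "0 < rc i
            j" for i j
      unfolding bound_simps(8)[of i j rc, OF that(3,4)]
          by (rule iff[OF long_paths(4) p(6)]) (use that in auto)
    show ?thesis
    proof
      assume L: ?L
      show ?R unfolding satisfies_def
      proof (intro allI impI conjI ballI)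
        fix i xy assume i: "i < m" and xy: "xy \<in> S"
        obtain x y where [simp]: "xy = (x, y)" by fastforce
        note xy = xy[simplified] S[of x y]
        show "case xy of (x, y) \<Rightarrow> slack \<Delta> l (map (aa i) (tree_path T x y)) \<le> k"
          using A[OF i xy(1)] L i xy by auto
        show "case xy of (x, y) \<Rightarrow> slack \<Delta> l (map (bb i) (tree_path T x y)) \<le> k"
          using A'[OF i xy(1)] L i xy by auto
      qed (use L B C ab in auto)
    next
      assume R: ?R
      show ?L
      proof (intro ballI impI)
        fix u v assume uv: "u \<in> pverts (graph m)" "v \<in> pverts (graph m)" "u \<noteq> v"
        show "fastest_duration \<Delta> (graph m) l u v \<le> bound rc u v"
        proof (cases "bound rc u v = \<infinity>")
          case False
          with uv show ?thesis
          proof (cases rule: bound_cases)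
            case (1 i x y)
            then show ?thesis using 1(1,2) A R by (fastforce simp: satisfies_def)
          next
            case (2 i x y)
            then show ?thesis using 2(1,2) A' R by (fastforce simp: satisfies_def)
          next
            case (3 i)
            then show ?thesis unfolding 3(2,3) using B[OF 3(1)] R 3(1) unfolding satisfies_def by blast
          next
            case (4 i)
            then show ?thesis unfolding 4(2,3) using B[OF 4(1)] R 4(1) unfolding satisfies_def by blast
          next
            case (5 i)
            then show ?thesis unfolding 5(2,3) using B[OF 5(1)] R 5(1) unfolding satisfies_def by blast
          next
            case (6 i)
            then show ?thesis unfolding 6(2,3) using B[OF 6(1)] R 6(1) unfolding satisfies_def by blast
          next
            case (7 i)
            then show ?thesis unfolding 7(2,3) using B[OF 7(1)] R 7(1) unfolding satisfies_def by blast
          next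
            case (8 i j)
            then show ?thesis unfolding 8(5,6) using C[OF 8(1-4)] R 8(1-4) unfolding satisfies_def by blast
          qed
        qed simp
      qed
    qed
  qed
  then show ?thesis unfolding DiTTR_yes_def by blast
qed

lemma DiTTR_input_graph: "DiTTR_input (graph m) (bound rc) \<Delta>"
    and slack_graph: "slack_at_least k (graph m) (bound rc)"
proof -
  have *: "static_dist (graph m) u v + ereal (real k) \<le> ereal_of_enat (bound rc u v)"
    if "u \<in> pverts (graph m)" "v \<in> pverts (graph m)" "u \<noteq> v" for u v
  proof (cases "bound rc u v = \<infinity>")
    case False
    have le: "static_dist (graph m) u v + ereal (real k) \<le> ereal_of_enat (enat (length vs - 1 + q))"
      if "path_in (graph m) u vs v" "k \<le> q" for vs q
    proof -
      have "static_dist (graph m) u v + ereal (real k) \<le> ereal (real (length vs - 1)) + ereal (real q)"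
        using static_dist_le[OF tree_graphD(1)[OF graph_tree] that(1)] that(2) by (intro add_mono) auto
      then show ?thesis by simp
    qed
    from that False show ?thesis
    proof (cases rule: bound_cases)
      case (1 i x y)
      show ?thesis unfolding 1(5) by (rule le) (use 1 path_aa S_path in auto)
    next
      case (2 i x y)
      show ?thesis unfolding 2(5) by (rule le) (use 2 path_bb S_path in auto)
    next
      case (3 i)
      show ?thesis unfolding 3(4) by (rule le) (use 3 path_aa tp ks in auto)
    next
      case (4 i)
      show ?thesis unfolding 4(4) by (rule le) (use 4 path_bb tp ks in auto)
    next
      case (5 i)
      show ?thesis unfolding 5(4) by (rule le) (use 5 long_paths ks in auto)
    next
      case (6 i)
      show ?thesis unfolding 6(4) by (rule le) (use 6 long_paths ks in auto)
    next
      case (7 i)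
      show ?thesis unfolding 7(4) by (rule le) (use 7 long_paths ks in auto)
    next
      case (8 i j)
      show ?thesis unfolding 8(7) by (rule le) (use 8 long_paths ks in auto)
    qed
  qed simp
  then show "slack_at_least k (graph m) (bound rc)" by (simp add: slack_at_least_def)
  have "static_dist (graph m) u v + ereal (real 0) \<le> ereal_of_enat (bound rc u v)"
    if "u \<in> pverts (graph m)" "v \<in> pverts (graph m)" "u \<noteq> v" for u v
    using *[OF that] by (rule order_trans[rotated]) (intro add_mono; simp)
  then have "slack_at_least 0 (graph m) (bound rc)" by (simp add: slack_at_least_def)
  moreover have "0 < bound rc u v" if "u \<in> pverts (graph m)" "v \<in> pverts (graph m)" "u \<noteq> v" for u v
  proof (cases "bound rc u v = \<infinity>")
    case False
    with that show ?thesis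
    proof (cases rule: bound_cases)
      case (1 i x y)
      then show ?thesis using S_path[of x y] by (auto simp: zero_enat_def)
    next
      case (2 i x y)
      then show ?thesis using S_path[of x y] by (auto simp: zero_enat_def)
    qed (use ks in \<open>auto simp: zero_enat_def\<close>)
  qed simp
  ultimately show "DiTTR_input (graph m) (bound rc) \<Delta>"
    unfolding DiTTR_input_def using graph_tree D0 by blast
qed

lemma satisfies_imp_csp:
  assumes "periodic_labeling \<Delta> (graph m) l" "satisfies m rc l"
  shows "csp \<Delta> m rc"
proof -
  have lt: "l (u, v) < \<Delta>" if "is_arc u v" "u < size_of m" "v < size_of m" for u v
    using assms(1) that by (auto simp: periodic_labeling_def arc_simp)
  obtain xs x where xs: "tp = xs @ [x, b]" using tp_back by blast
  define t where "t i = l (aa i b, zz i)" for i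
  have t: "t i < \<Delta>" if "i < m" for i unfolding t_def by (rule lt) (use that ab in auto)
  \<comment> \<open>The labels on a copy form a labeling of T, so the lower bound s holds in every
    copy. Any prolongation with slack at most s then has waiting time 0 at the new vertices.\<close>
  have force: "s \<le> slack \<Delta> l (map f tp)" if "\<forall>(x, y)\<in>S. slack \<Delta> l (map f (tree_path T x y)) \<le> k" for f
    using forced[of "\<lambda>(x, y). l (f x, f y)"] that unfolding slack_map tp_def .
  have sat: "\<forall>(x, y)\<in>S. slack \<Delta> l (map (aa i) (tree_path T x y)) \<le> k"
      "\<forall>(x, y)\<in>S. slack \<Delta> l (map (bb i) (tree_path T x y)) \<le> k"
    "slack \<Delta> l (map (aa i) tp @ [zz i, 0]) \<le> s" "slack \<Delta> l (map (aa i) tp @ [zz i, bb i a]) \<le> s"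
    "slack \<Delta> l (0 # zz i # map (bb i) tp) \<le> s"
    "j < m \<Longrightarrow> i \<noteq> j \<Longrightarrow> 0 < rc i j \<Longrightarrow> slack \<Delta> l (map (aa i) tp @ [zz i, 0, zz j]) \<le> s + (rc i j - 1)"
    if "i < m" for i j using assms(2) that unfolding satisfies_def by blast+
  have A: "map (aa i) tp = map (aa i) xs @ [aa i x, aa i b]" for i using xs by simp
  have out: "l (zz i, 0) = Suc (t i) mod \<Delta>" if i: "i < m" for i
  proof -
    have "slack_step \<Delta> (t i) (l (zz i, 0)) = 0"
      using sat(3)[OF i] force[OF sat(1)[OF i]] unfolding A t_def
      by (simp add: slack_append2)
    then show ?thesis by (rule slack_step_eq_0D) (use t lt i in auto)
  qed
  \<comment> \<open>The arc from \<open>zz i\<close> to \<open>bb i a\<close> is entered without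
    waiting both from \<open>aa i b\<close> and from the center. So the arc from the center to
    \<open>zz i\<close> has the same label as the arc from \<open>aa i b\<close>; this is the
    purpose of the second copy.\<close>
  have inn: "l (0, zz i) = t i" if i: "i < m" for i
  proof -
    have "slack_step \<Delta> (t i) (l (zz i, bb i a)) = 0"
      using sat(4)[OF i] force[OF sat(1)[OF i]] unfolding A t_def
      by (simp add: slack_append2)
    then have 1: "l (zz i, bb i a) = Suc (t i) mod \<Delta>"
      by (rule slack_step_eq_0D) (use t lt i ab in auto)
    obtain y ys where ys: "tp = a # y # ys" using tp_front by blast
    have "slack_step \<Delta> (l (0, zz i)) (l (zz i, bb i a)) = 0"
      using sat(5)[OF i] force[OF sat(2)[OF i]] unfolding ys by simp
    then have 2: "l (zz i, bb i a) = Suc (l (0, zz i)) mod \<Delta>"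
      by (rule slack_step_eq_0D) (use lt i ab in auto)
    have "l (0, zz i) < \<Delta>" using lt i by auto
    then show ?thesis using 1 2 t[OF i] by (simp add: mod_Suc split: if_splits)
  qed
  show ?thesis unfolding csp_def
  proof (intro exI[of _ t] allI impI)
    fix i j assume ij: "i < m" "j < m" "i \<noteq> j" "0 < rc i j"
    have "slack \<Delta> l (map (aa i) tp @ [zz i, 0, zz j]) = slack \<Delta> l (map (aa i) tp) + slack_step \<Delta> (l (aa i x,
        aa i b)) (l (aa i b, zz i))
       + slack_step \<Delta> (l (aa i b, zz i)) (l (zz i, 0)) + slack_step \<Delta> (l (zz i, 0)) (l (0, zz j))"
      unfolding A by (simp add: slack_append3 slack_snoc[of _ _ _ "aa i b" "zz i" "0", symmetric])
    then have "slack_step \<Delta> (l (zz i, 0)) (l (0, zz j)) < rc i j"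
      using sat(6)[OF ij] force[OF sat(1)[OF ij(1)]] ij(4) by simp
    then show "slack_step \<Delta> (Suc (t i) mod \<Delta>) (t j mod \<Delta>) < rc i j"
      using out[OF ij(1)] inn[OF ij(2)] t[OF ij(2)] by simp
  qed
qed

lemma csp_imp_satisfies:
  assumes "csp \<Delta> m rc"
  shows "\<exists>l. periodic_labeling \<Delta> (graph m) l \<and> satisfies m rc l"
proof -
  obtain t where t: "\<And>i j. i < m \<Longrightarrow> j < m \<Longrightarrow> i \<noteq> j \<Longrightarrow> 0 < rc i j \<Longrightarrow> slack_step \<Delta> (Suc (t i) mod \<Delta>) (t j mod \<Delta>) <
      rc i j"
    using assms unfolding csp_def by blast
  obtain xs x where xs: "tp = xs @ [x, b]" using tp_back by blast
  obtain y ys where ys: "tp = a # y # ys" using tp_front by blast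
  have "x \<in> set tp" unfolding xs by simp
  moreover have "y \<in> set tp" unfolding ys by simp
  ultimately have xy: "x < \<tau>" "y < \<tau>" by (auto intro: tp_less)
  \<comment> \<open>The slack inside a copy does not change when all its labels are shifted.
    \<open>\<alpha> i\<close> shifts the last arc of \<open>tp\<close> to label t i - 1 and
    \<open>\<gamma> i\<close> its first arc to t i + 2, as the adjacent labels t i and t i + 1
    require.\<close>
  define \<alpha> \<gamma> where "\<alpha> i = t i + (\<Delta> - 1 - l0 (x, b))" and "\<gamma> i = t i + 2 + (\<Delta> - l0 (a, y))" for i
  define l where "l e = (case e of (u, v) \<Rightarrow> (if u = 0 then t (blk v) else if v = 0 then Suc (t (blk u))
     else if off u = 0 then Suc (t (blk u)) else if off v = 0 then t (blk u)
     else if off u \<le> \<tau> then l0 (off u - 1, off v - 1) + \<alpha> (blk u)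
     else l0 (off u - 1 - \<tau>, off v - 1 - \<tau>) + \<gamma> (blk u)) mod \<Delta>)" for e
  have l: "l (0, zz i) = t i mod \<Delta>" "l (zz i, 0) = Suc (t i) mod \<Delta>" "l (aa i b, zz i) = t i mod \<Delta>"
    "l (zz i, bb i a) = Suc (t i) mod \<Delta>"
    "p < \<tau> \<Longrightarrow> q < \<tau> \<Longrightarrow> l (aa i p, aa i q) = (l0 (p, q) + \<alpha> i) mod \<Delta>"
    "p < \<tau> \<Longrightarrow> q < \<tau> \<Longrightarrow> l (bb i p, bb i q) = (l0 (p, q) + \<gamma> i) mod \<Delta>" for i p q
    using ab by (auto simp: l_def)
  have per: "periodic_labeling \<Delta> (graph m) l" using D0 by (auto simp: periodic_labeling_def l_def)
  have arc: "p < \<tau> \<and> q < \<tau>" if "(p, q) \<in> set (arcs_of vs)" "set vs \<subseteq> {..<\<tau>}" for p q vs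
    using that arcs_of_memD[of p q vs] by auto
  have sl: "slack \<Delta> l (map (aa i) vs) = slack \<Delta> l0 vs" "slack \<Delta> l (map (bb i) vs) = slack \<Delta> l0 vs"
    if "set vs \<subseteq> {..<\<tau>}" for vs i
  proof -
    have "slack \<Delta> l (map (aa i) vs) = slack \<Delta> (\<lambda>e. (l0 e + \<alpha> i) mod \<Delta>) vs"
      unfolding slack_map by (rule slack_cong) (use arc that l in force)
    then show "slack \<Delta> l (map (aa i) vs) = slack \<Delta> l0 vs" by (simp add: slack_shift)
    have "slack \<Delta> l (map (bb i) vs) = slack \<Delta> (\<lambda>e. (l0 e + \<gamma> i) mod \<Delta>) vs"
      unfolding slack_map by (rule slack_cong) (use arc that l in force)
    then show "slack \<Delta> l (map (bb i) vs) = slack \<Delta> l0 vs" by (simp add: slack_shift)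
  qed
  have tps: "slack \<Delta> l (map (aa i) tp) = s" "slack \<Delta> l (map (bb i) tp) = s" for i
    using sl[of tp] tp_less l0(3) by (auto simp: tp_def[symmetric])
  have Ss: "slack \<Delta> l (map (aa i) (tree_path T p q)) \<le> k" "slack \<Delta> l (map (bb i) (tree_path T p q)) \<le> k"
      if "(p, q) \<in> S" for i p q
    using sl[of "tree_path T p q"] S_path[OF that] l0(2)[OF that] VT by (auto simp: path_in_def)
  have step: "slack_step \<Delta> (u mod \<Delta>) (Suc u mod \<Delta>) = 0" for u by (rule slack_step_Suc_mod[OF D0])
  have st1: "slack_step \<Delta> (l (aa i x, aa i b)) (l (aa i b, zz i)) = 0" for i
  proof -
    have "Suc (l0 (x, b) + \<alpha> i) = t i + \<Delta>" using l0(1)[of "(x, b)"] by (simp add: \<alpha>_def)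
    then have "l (aa i b, zz i) = Suc (l0 (x, b) + \<alpha> i) mod \<Delta>" using l by simp
    then show ?thesis using step l(5) xy ab by metis
  qed
  have st2: "slack_step \<Delta> (l (zz i, bb i a)) (l (bb i a, bb i y)) = 0" for i
  proof -
    have "l0 (a, y) + \<gamma> i = Suc (Suc (t i)) + \<Delta>" using l0(1)[of "(a, y)"] by (simp add: \<gamma>_def)
    then have "(l0 (a, y) + \<gamma> i) mod \<Delta> = Suc (Suc (t i)) mod \<Delta>" by (simp only: mod_add_self2)
    then have "l (bb i a, bb i y) = Suc (Suc (t i)) mod \<Delta>" using l(6) xy ab by metis
    then show ?thesis using step l(4) by metis
  qed
  have A: "map (aa i) tp = map (aa i) xs @ [aa i x, aa i b]" for i using xs by simp
  have "satisfies m rc l" unfolding satisfies_def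
  proof (intro allI impI conjI ballI)
    fix i assume i: "i < m"
    show "slack \<Delta> l (map (aa i) tp) \<le> s" "slack \<Delta> l (map (bb i) tp) \<le> s" using tps by simp_all
    show "slack \<Delta> l (map (aa i) tp @ [zz i, 0]) \<le> s" "slack \<Delta> l (map (aa i) tp @ [zz i, bb i a]) \<le> s"
      using tps(1)[of i] st1[of i] l step unfolding A by (simp_all add: slack_append2)
    show "slack \<Delta> l (0 # zz i # map (bb i) tp) \<le> s"
      using tps(2)[of i] st2[of i] l step unfolding ys by simp
    fix j assume ij: "j < m" "i \<noteq> j" "0 < rc i j"
    show "slack \<Delta> l (map (aa i) tp @ [zz i, 0, zz j]) \<le> s + (rc i j - 1)"
      using tps(1)[of i] st1[of i] l step t[OF i ij] unfolding A by (simp add: slack_append3)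
  qed (use Ss in auto)
  then show ?thesis using per by blast
qed

theorem DiTTR_yes_graph: "DiTTR_yes (graph m) (bound rc) \<Delta> \<longleftrightarrow> csp \<Delta> m rc"
  using yes_iff_satisfies satisfies_imp_csp csp_imp_satisfies by blast

end

section \<open>Clauses as difference constraints\<close>

text \<open>Atom 0 is falsity. It makes a Horn clause a prohibition when it is the conclusion, and
  \<open>or2\<close> with two equal atoms states a fact.\<close>

definition horn_or_sat :: "nat \<Rightarrow> (nat \<Rightarrow> nat \<Rightarrow> nat \<Rightarrow> bool) \<Rightarrow> (nat \<Rightarrow> nat \<Rightarrow> bool) \<Rightarrow> bool" where
  "horn_or_sat M horn or2 \<longleftrightarrow> (\<exists>val. \<not> val 0 \<and>
     (\<forall>A<M. \<forall>B<M. \<forall>C<M. horn A B C \<longrightarrow> val A \<longrightarrow> val B \<longrightarrow> val C) \<and>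
     (\<forall>A<M. \<forall>B<M. or2 A B \<longrightarrow> val A \<or> val B))"

lemma slack_step_iff:
  assumes "j < \<Delta>"
  shows "slack_step \<Delta> (Suc x mod \<Delta>) (y mod \<Delta>) = j \<longleftrightarrow> y mod \<Delta> = (x + 2 + j) mod \<Delta>"
proof -
  have D: "0 < \<Delta>" using assms by simp
  let ?\<sigma> = "slack_step \<Delta> (Suc x mod \<Delta>) (y mod \<Delta>)"
  have lt: "?\<sigma> < \<Delta>" using D by (simp add: slack_step.simps nat_less_iff)
  have e: "(x + 2 + ?\<sigma>) mod \<Delta> = y mod \<Delta>"
    using slack_step_mod[of "y mod \<Delta>" \<Delta> "Suc x"] D by simp
  have "(x + 2 + ?\<sigma>) mod \<Delta> = (x + 2 + j) mod \<Delta> \<longleftrightarrow> ?\<sigma> = j"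
  proof
    assume "(x + 2 + ?\<sigma>) mod \<Delta> = (x + 2 + j) mod \<Delta>"
    then have "int (x + 2 + ?\<sigma>) mod int \<Delta> = int (x + 2 + j) mod int \<Delta>" by (simp only: zmod_int[symmetric])
    then have "int \<Delta> dvd int ?\<sigma> - int j" by (simp add: mod_eq_dvd_iff)
    then have "int ?\<sigma> mod int \<Delta> = int j mod int \<Delta>" by (simp add: mod_eq_dvd_iff)
    then show "?\<sigma> = j" using lt assms by simp
  qed simp
  then show ?thesis using e by metis
qed

lemma step_less_iff:
  assumes "3 \<le> \<Delta>"
  shows "slack_step \<Delta> (Suc x mod \<Delta>) (y mod \<Delta>) < 1 \<longleftrightarrow> y mod \<Delta> = (x + 2) mod \<Delta>"
    "slack_step \<Delta> (Suc x mod \<Delta>) (y mod \<Delta>) < 2 \<longleftrightarrow> y mod \<Delta> = (x + 2) mod \<Delta> \<or> y mod \<Delta> = (x + 3) mod \<Delta>"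
    "slack_step \<Delta> (Suc x mod \<Delta>) (y mod \<Delta>) < \<Delta> - 1 \<longleftrightarrow> y mod \<Delta> \<noteq> (x + 1) mod \<Delta>"
    "slack_step \<Delta> (Suc x mod \<Delta>) (y mod \<Delta>) < \<Delta> - 2 \<longleftrightarrow> y mod \<Delta> \<noteq> x mod \<Delta> \<and> y mod \<Delta> \<noteq> (x + 1) mod \<Delta>"
proof -
  let ?\<sigma> = "slack_step \<Delta> (Suc x mod \<Delta>) (y mod \<Delta>)"
  have lt: "?\<sigma> < \<Delta>" using assms by (simp add: slack_step.simps nat_less_iff)
  note iff = slack_step_iff[of _ \<Delta> x y]
  have n: "x + 2 + (\<Delta> - 1) = x + 1 + \<Delta>" "x + 2 + (\<Delta> - 2) = x + \<Delta>" using assms by auto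
  have e: "?\<sigma> = \<Delta> - 1 \<longleftrightarrow> y mod \<Delta> = (x + 1) mod \<Delta>" "?\<sigma> = \<Delta> - 2 \<longleftrightarrow> y mod \<Delta> = x mod \<Delta>"
    using iff[of "\<Delta> - 1"] iff[of "\<Delta> - 2"] assms unfolding n mod_add_self2 by simp_all
  have z: "?\<sigma> = 0 \<longleftrightarrow> y mod \<Delta> = (x + 2) mod \<Delta>" "?\<sigma> = 1 \<longleftrightarrow> y mod \<Delta> = (x + 3) mod \<Delta>"
    using iff[of 0] iff[of 1] assms by (simp_all add: numeral_3_eq_3)
  show "?\<sigma> < 1 \<longleftrightarrow> y mod \<Delta> = (x + 2) mod \<Delta>"
    "?\<sigma> < 2 \<longleftrightarrow> y mod \<Delta> = (x + 2) mod \<Delta> \<or> y mod \<Delta> = (x + 3) mod \<Delta>"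
    unfolding z[symmetric] by linarith+
  show "?\<sigma> < \<Delta> - 1 \<longleftrightarrow> y mod \<Delta> \<noteq> (x + 1) mod \<Delta>"
    "?\<sigma> < \<Delta> - 2 \<longleftrightarrow> y mod \<Delta> \<noteq> x mod \<Delta> \<and> y mod \<Delta> \<noteq> (x + 1) mod \<Delta>"
    unfolding e[symmetric] using lt assms by linarith+
qed

text \<open>A variable of the difference system is coded by a tag below \<open>16\<close> and a triple of atoms. With
  \<open>u X = 2\<close> for false and \<open>u X = 3\<close> for true atoms, relative to the variable \<open>0\<close>, the intended
  values are \<open>u C + 2 c\<close> for tag \<open>1 + c\<close> at \<open>(0, 0, C)\<close>. The tags \<open>5\<close> and \<open>6\<close> (and likewise \<open>7, 8\<close>
  and \<open>9, 10\<close>) express that the values of three variables \<open>A, B, C\<close> are not all equal: some \<open>w\<close> in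
  \<open>{u C + 2, u C + 3}\<close> avoids \<open>u A + 2\<close> and \<open>u B + 3\<close>. A Horn clause \<open>A, B \<rightarrow> C\<close> is
  \<open>nae A B s \<and> nae 0 C s\<close> for a fresh \<open>s\<close> (tag \<open>4\<close>), and \<open>A \<or> B\<close> is \<open>nae A B 0\<close>, where the atom \<open>0\<close>
  is false.\<close>

definition "horn_at M horn j \<longleftrightarrow> horn (j div 16 div M div M) (j div 16 div M mod M) (j div 16 mod M)"
  for M :: nat and horn :: "nat \<Rightarrow> nat \<Rightarrow> nat \<Rightarrow> bool"
definition "or_at M or2 j \<longleftrightarrow> or2 (j div 16 div M div M) (j div 16 div M mod M) \<and> j div 16 mod M = 0"
  for M :: nat and or2 :: "nat \<Rightarrow> nat \<Rightarrow> bool"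

definition rel_eq :: "nat \<Rightarrow> nat \<Rightarrow> bool" where
  "rel_eq i j \<longleftrightarrow> i = 0 \<and> j = 1 \<or> i div 16 = j div 16 \<and> (i mod 16 = 1 \<and> j mod 16 = 2 \<or> i mod 16 = 2 \<and> j mod 16 =
      3)"

definition rel_two :: "nat \<Rightarrow> (nat \<Rightarrow> nat \<Rightarrow> nat \<Rightarrow> bool) \<Rightarrow> (nat \<Rightarrow> nat \<Rightarrow> bool) \<Rightarrow> nat \<Rightarrow> nat \<Rightarrow> bool" where
  "rel_two M horn or2 i j \<longleftrightarrow> i = 0 \<and> (j mod 16 = 1 \<or> j mod 16 = 4) \<or>
     i div 16 = j div 16 \<and> horn_at M horn j \<and> (i mod 16 = 4 \<and> j mod 16 = 5 \<or> i mod 16 = 5 \<and> j mod 16 = 6 \<or>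
       i mod 16 = 4 \<and> j mod 16 = 7 \<or> i mod 16 = 7 \<and> j mod 16 = 8) \<or>
     or_at M or2 j \<and> (i = 1 \<and> j mod 16 = 9 \<or> i div 16 = j div 16 \<and> i mod 16 = 9 \<and> j mod 16 = 10)"

definition rel_one :: "nat \<Rightarrow> (nat \<Rightarrow> nat \<Rightarrow> nat \<Rightarrow> bool) \<Rightarrow> (nat \<Rightarrow> nat \<Rightarrow> bool) \<Rightarrow> nat \<Rightarrow> nat \<Rightarrow> bool" where
  "rel_one M horn or2 i j \<longleftrightarrow> i mod 16 = 2 \<and> (horn_at M horn j \<and> (j mod 16 = 5 \<and> i div 16 =
      j div 16 div M mod M \<or>
     j mod 16 = 7 \<and> i div 16 = j div 16 mod M) \<or> or_at M or2 j \<and> j mod 16 = 9 \<and> i div 16 = j div 16 div M mod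
         M)"

definition rel_both :: "nat \<Rightarrow> (nat \<Rightarrow> nat \<Rightarrow> nat \<Rightarrow> bool) \<Rightarrow> (nat \<Rightarrow> nat \<Rightarrow> bool) \<Rightarrow> nat \<Rightarrow> nat \<Rightarrow> bool" where
  "rel_both M horn or2 i j \<longleftrightarrow> i mod 16 = 3 \<and> (horn_at M horn j \<and> (j mod 16 = 6 \<and> i div 16 =
      j div 16 div M div M \<or>
     j mod 16 = 8 \<and> i div 16 = 0) \<or> or_at M or2 j \<and> j mod 16 = 10 \<and> i div 16 = j div 16 div M div M)"

text \<open>A single entry has to express all relations of a pair. This works because the bounds are
  nested, so that the strictest one can be taken. For \<Delta> = 3 the bound \<Delta> - 2 is 1 and
  precedes 2; otherwise it is at least 2.\<close>

definition rel_code :: "nat \<Rightarrow> nat \<Rightarrow> (nat \<Rightarrow> nat \<Rightarrow> nat \<Rightarrow> bool) \<Rightarrow> (nat \<Rightarrow> nat \<Rightarrow> bool) \<Rightarrow> nat \<Rightarrow> nat \<Rightarrow> nat" where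
  "rel_code \<Delta> M horn or2 i j = (if rel_eq i j \<or> \<Delta> = 3 \<and> rel_both M horn or2 i j then 1
     else if rel_two M horn or2 i j then 2 else if rel_both M horn or2 i j then \<Delta> - 2
     else if rel_one M horn or2 i j then \<Delta> - 1 else 0)"

lemma csp_rel_code:
  assumes "3 \<le> \<Delta>"
  shows "csp \<Delta> m (rel_code \<Delta> M horn or2) \<longleftrightarrow> (\<exists>t. \<forall>i<m. \<forall>j<m. i \<noteq> j \<longrightarrow>
     (rel_eq i j \<longrightarrow> t j mod \<Delta> = (t i + 2) mod \<Delta>) \<and>
     (rel_two M horn or2 i j \<longrightarrow> t j mod \<Delta> = (t i + 2) mod \<Delta> \<or> t j mod \<Delta> = (t i + 3) mod \<Delta>) \<and>
     (rel_one M horn or2 i j \<longrightarrow> t j mod \<Delta> \<noteq> (t i + 1) mod \<Delta>) \<and>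
     (rel_both M horn or2 i j \<longrightarrow> t j mod \<Delta> \<noteq> t i mod \<Delta> \<and> t j mod \<Delta> \<noteq> (t i + 1) mod \<Delta>))"
proof -
  have "(0 < rel_code \<Delta> M horn or2 i j \<longrightarrow> \<sigma> < rel_code \<Delta> M horn or2 i j) \<longleftrightarrow>
     (rel_eq i j \<longrightarrow> \<sigma> < 1) \<and> (rel_two M horn or2 i j \<longrightarrow> \<sigma> < 2) \<and>
     (rel_one M horn or2 i j \<longrightarrow> \<sigma> < \<Delta> - 1) \<and> (rel_both M horn or2 i j \<longrightarrow> \<sigma> < \<Delta> - 2)" for i j \<sigma>
    using assms unfolding rel_code_def by (cases "\<Delta> = 3") auto
  then show ?thesis unfolding csp_def by (simp only: step_less_iff[OF assms])
qed

lemma code_decode: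
  fixes A B C M c :: nat
  assumes "A < M" "B < M" "C < M" "c < 16"
  defines "j \<equiv> ((A * M + B) * M + C) * 16 + c"
  shows "j div 16 div M div M = A" "j div 16 div M mod M = B" "j div 16 mod M = C" "j mod 16 = c"
    "j div 16 = (A * M + B) * M + C" "j < 16 * M ^ 3"
proof -
  have "(x * 16 + c) div 16 = x \<and> (x * 16 + c) mod 16 = c" for x :: nat using assms(4) by simp
  from this[of "(A * M + B) * M + C"] have j: "j div 16 = (A * M + B) * M + C" "j mod 16 = c"
      by (simp_all add: j_def)
  moreover have "((A * M + B) * M + C) div M = A * M + B" "((A * M + B) * M + C) mod M = C"
    "(A * M + B) div M = A" "(A * M + B) mod M = B" using assms by auto
  ultimately show "j div 16 div M div M = A" "j div 16 div M mod M = B" "j div 16 mod M = C" "j mod 16 = c"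
    "j div 16 = (A * M + B) * M + C" by simp_all
  have lt: "x * M + y < z * M" if "x < z" "y < M" for x y z
  proof -
    have "Suc x * M \<le> z * M" using that by (intro mult_le_mono1) simp
    then show ?thesis using that by simp
  qed
  have "A * M + B < M * M" using assms by (intro lt)
  then have "(A * M + B) * M + C < M * M * M" using assms by (intro lt)
  then show "j < 16 * M ^ 3" using assms(4) unfolding j_def by (simp add: power3_eq_cube)
qed

lemma csp_imp_horn_or_sat:
  assumes D: "3 \<le> \<Delta>" and M: "0 < M" and csp: "csp \<Delta> (16 * M ^ 3) (rel_code \<Delta> M horn or2)"
  shows "horn_or_sat M horn or2"
proof -
  obtain t where t: "\<forall>i<16 * M ^ 3. \<forall>j<16 * M ^ 3. i \<noteq> j \<longrightarrow>
     (rel_eq i j \<longrightarrow> t j mod \<Delta> = (t i + 2) mod \<Delta>) \<and>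
     (rel_two M horn or2 i j \<longrightarrow> t j mod \<Delta> = (t i + 2) mod \<Delta> \<or> t j mod \<Delta> = (t i + 3) mod \<Delta>) \<and>
     (rel_one M horn or2 i j \<longrightarrow> t j mod \<Delta> \<noteq> (t i + 1) mod \<Delta>) \<and>
     (rel_both M horn or2 i j \<longrightarrow> t j mod \<Delta> \<noteq> t i mod \<Delta> \<and> t j mod \<Delta> \<noteq> (t i + 1) mod \<Delta>)"
    using csp unfolding csp_rel_code[OF D] by blast
  \<comment> \<open>All values are shifted so that variable 0 gets the residue 0; the constraints
    concern differences only.\<close>
  define u where "u i = (t i + (\<Delta> - t 0 mod \<Delta>)) mod \<Delta>" for i
  have u0: "u 0 = 0"
  proof -
    have "(t 0 + (\<Delta> - t 0 mod \<Delta>)) mod \<Delta> = (t 0 mod \<Delta> + (\<Delta> - t 0 mod \<Delta>)) mod \<Delta>" by (simp add: mod_add_left_eq)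
    also have "\<dots> = 0" using D by (simp add: less_imp_le)
    finally show ?thesis by (simp add: u_def)
  qed
  have shift: "u j = (u i + c) mod \<Delta> \<longleftrightarrow> t j mod \<Delta> = (t i + c) mod \<Delta>" for i j c
  proof
    assume "t j mod \<Delta> = (t i + c) mod \<Delta>"
    then have "(t j + (\<Delta> - t 0 mod \<Delta>)) mod \<Delta> = (t i + c + (\<Delta> - t 0 mod \<Delta>)) mod \<Delta>"
        by (intro mod_add_cong) simp_all
    then show "u j = (u i + c) mod \<Delta>" by (simp add: u_def mod_add_left_eq mod_add_right_eq add_ac)
  next
    assume "u j = (u i + c) mod \<Delta>"
    then have "(t j + (\<Delta> - t 0 mod \<Delta>)) mod \<Delta> = (t i + c + (\<Delta> - t 0 mod \<Delta>)) mod \<Delta>"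
      by (simp add: u_def mod_add_left_eq mod_add_right_eq add_ac)
    then show "t j mod \<Delta> = (t i + c) mod \<Delta>"
      by (simp add: mod_eq_iff_dvd_symdiff_nat)
  qed
  let ?m = "16 * M ^ 3"
  have eq: "u j = (u i + 2) mod \<Delta>" if "rel_eq i j" "i < ?m" "j < ?m" "i \<noteq> j" for i j
    using t that shift by blast
  have two: "u j = (u i + 2) mod \<Delta> \<or> u j = (u i + 3) mod \<Delta>" if "rel_two M horn or2 i j" "i < ?m" "j < ?m"
      "i \<noteq> j" for i j
    using t that shift by blast
  have one: "u j \<noteq> (u i + 1) mod \<Delta>" if "rel_one M horn or2 i j" "i < ?m" "j < ?m" "i \<noteq> j" for i j
    using t that shift by blast
  have both: "u j \<noteq> (u i + 0) mod \<Delta>" "u j \<noteq> (u i + 1) mod \<Delta>" if "rel_both M horn or2 i j" "i < ?m" "j < ?m"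
      "i \<noteq> j" for i j
    using t that shift[of j i 0] shift[of j i 1] by auto
  define av where "av X c = X * 16 + (c :: nat)" for X c
  have av: "av X c div 16 = X" "av X c mod 16 = c" "av X c < ?m" if "X < M" "c < 16" for X c
    using code_decode[of 0 M 0 X c] that M by (simp_all add: av_def)
  have u1: "u (av X 1) = 2 mod \<Delta> \<or> u (av X 1) = 3 mod \<Delta>" if "X < M" for X
    using two[of 0 "av X 1"] av[of X 1] that M u0 by (simp add: rel_two_def av_def numeral_2_eq_2)
  have u2: "u (av X 2) = (u (av X 1) + 2) mod \<Delta>" "u (av X 3) = (u (av X 1) + 4) mod \<Delta>" if "X < M" for X
  proof -
    show 1: "u (av X 2) = (u (av X 1) + 2) mod \<Delta>"
      by (rule eq) (use av[of X 1] av[of X 2] that in \<open>auto simp: rel_eq_def av_def\<close>)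
    have "u (av X 3) = (u (av X 2) + 2) mod \<Delta>"
      by (rule eq) (use av[of X 2] av[of X 3] that in \<open>auto simp: rel_eq_def av_def\<close>)
    then show "u (av X 3) = (u (av X 1) + 4) mod \<Delta>"
        by (simp only: 1 mod_add_left_eq add.assoc numeral_plus_numeral add_num_simps)
  qed
  have F: "u (av 0 1) = 2 mod \<Delta>"
    using eq[of 0 "av 0 1"] av[of 0 1] M u0 by (simp add: rel_eq_def av_def numeral_2_eq_2)
  \<comment> \<open>If w were uA + 2, then z would be uA + 4 or uA + 5, that is v or v + 1, and both
    are excluded.\<close>
  have nae: "w \<noteq> (uA + 2) mod \<Delta>"
    if "z = (w + 2) mod \<Delta> \<or> z = (w + 3) mod \<Delta>" "z \<noteq> (v + 0) mod \<Delta>" "z \<noteq> (v + 1) mod \<Delta>" "v = (uA + 4) mod \<Delta>"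
        for w z v uA :: nat
    using that by (auto simp: mod_simps add_ac simp del: add_2_eq_Suc add_2_eq_Suc' One_nat_def)
  have d23: "2 mod \<Delta> \<noteq> 3 mod \<Delta>" using D by (cases "\<Delta> = 3") auto
  define val where "val X \<longleftrightarrow> u (av X 1) = 3 mod \<Delta>" for X
  show ?thesis unfolding horn_or_sat_def
  proof (intro exI[of _ val] conjI allI impI)
    show "\<not> val 0" using F d23 by (simp add: val_def)
  next
    fix A B C assume *: "A < M" "B < M" "C < M" "horn A B C" "val A" "val B"
    define x where "x c = ((A * M + B) * M + C) * 16 + (c :: nat)" for c
    note dec = code_decode[OF *(1-3), folded x_def]
    have h: "horn_at M horn (x c)" if "c < 16" for c using dec[OF that] *(4) by (simp add: horn_at_def)
    have s: "u (x 4) = 2 mod \<Delta> \<or> u (x 4) = 3 mod \<Delta>"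
      using two[of 0 "x 4"] dec[of 4] M u0 by (simp add: rel_two_def x_def numeral_2_eq_2)
    have w: "u (x 5) = (u (x 4) + 2) mod \<Delta> \<or> u (x 5) = (u (x 4) + 3) mod \<Delta>"
      by (rule two) (use dec[of 4] dec[of 5] h[of 5] in \<open>auto simp: rel_two_def x_def\<close>)
    have z: "u (x 6) = (u (x 5) + 2) mod \<Delta> \<or> u (x 6) = (u (x 5) + 3) mod \<Delta>"
      by (rule two) (use dec[of 5] dec[of 6] h[of 6] in \<open>auto simp: rel_two_def x_def\<close>)
    have w': "u (x 7) = (u (x 4) + 2) mod \<Delta> \<or> u (x 7) = (u (x 4) + 3) mod \<Delta>"
      by (rule two) (use dec[of 4] dec[of 7] h[of 7] in \<open>auto simp: rel_two_def x_def\<close>)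
    have z': "u (x 8) = (u (x 7) + 2) mod \<Delta> \<or> u (x 8) = (u (x 7) + 3) mod \<Delta>"
      by (rule two) (use dec[of 7] dec[of 8] h[of 8] in \<open>auto simp: rel_two_def x_def\<close>)
    have ne: "av X c \<noteq> x d" if "c < 4" "4 \<le> d" "d < 16" "X < M" for X c d
      using av(2)[of X c] dec(4)[of d] that by auto
    have b: "u (x 5) \<noteq> (u (av B 2) + 1) mod \<Delta>" "u (x 7) \<noteq> (u (av C 2) + 1) mod \<Delta>"
      by (rule one; use dec[of 5] dec[of 7] h[of 5] h[of 7] av * ne in \<open>auto simp: rel_one_def\<close>)+
    have za: "u (x 6) \<noteq> (u (av A 3) + 0) mod \<Delta>" "u (x 6) \<noteq> (u (av A 3) + 1) mod \<Delta>"
      by (rule both; use dec[of 6] h[of 6] av * ne in \<open>auto simp: rel_both_def\<close>)+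
    have zf: "u (x 8) \<noteq> (u (av 0 3) + 0) mod \<Delta>" "u (x 8) \<noteq> (u (av 0 3) + 1) mod \<Delta>"
      by (rule both; use dec[of 8] h[of 8] av M ne in \<open>auto simp: rel_both_def\<close>)+
    have n1: "u (x 5) \<noteq> (u (av A 1) + 2) mod \<Delta>" by (rule nae[OF z za u2(2)[OF *(1)]])
    have n2: "u (x 7) \<noteq> (u (av 0 1) + 2) mod \<Delta>" by (rule nae[OF z' zf u2(2)[OF M]])
    \<comment> \<open>With A and B true, the value at tag 5 avoids 5 and 6, which are its only
      choices if the auxiliary atom at tag 4 has value 3. So this atom is 2; then the value at tag 7
      has to be 5, and its last exclusion makes C true.\<close>
    have "u (x 4) = 2 mod \<Delta>"
      using s w n1 b(1) *(5,6) u2(1)[OF *(2)] by (auto simp: val_def mod_simps add_ac simp del: add_2_eq_Suc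
          add_2_eq_Suc' One_nat_def)
    then show "val C"
      using w' n2 b(2) F u1[OF *(3)] u2(1)[OF *(3)]
          by (auto simp: val_def mod_simps add_ac simp del: add_2_eq_Suc add_2_eq_Suc' One_nat_def)
  next
    fix A B assume *: "A < M" "B < M" "or2 A B"
    define x where "x c = ((A * M + B) * M + 0) * 16 + (c :: nat)" for c
    note dec = code_decode[OF *(1,2) M, folded x_def]
    have h: "or_at M or2 (x c)" if "c < 16" for c using dec[OF that] *(3) by (simp add: or_at_def)
    have ne: "av X c \<noteq> x d" if "c < 4" "4 \<le> d" "d < 16" "X < M" for X c d
      using av(2)[of X c] dec(4)[of d] that by auto
    have w: "u (x 9) = (u (av 0 1) + 2) mod \<Delta> \<or> u (x 9) = (u (av 0 1) + 3) mod \<Delta>"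
      by (rule two) (use dec[of 9] h[of 9] av[of 0 1] M ne[of 1 9 0] in \<open>auto simp: rel_two_def av_def\<close>)
    have z: "u (x 10) = (u (x 9) + 2) mod \<Delta> \<or> u (x 10) = (u (x 9) + 3) mod \<Delta>"
      by (rule two) (use dec[of 9] dec[of 10] h[of 10] in \<open>auto simp: rel_two_def x_def\<close>)
    have b: "u (x 9) \<noteq> (u (av B 2) + 1) mod \<Delta>"
      by (rule one) (use dec[of 9] h[of 9] av * ne in \<open>auto simp: rel_one_def\<close>)
    have za: "u (x 10) \<noteq> (u (av A 3) + 0) mod \<Delta>" "u (x 10) \<noteq> (u (av A 3) + 1) mod \<Delta>"
      by (rule both; use dec[of 10] h[of 10] av * ne in \<open>auto simp: rel_both_def\<close>)+
    have n1: "u (x 9) \<noteq> (u (av A 1) + 2) mod \<Delta>" by (rule nae[OF z za u2(2)[OF *(1)]])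
    show "val A \<or> val B"
      using w n1 b F u1[OF *(1)] u1[OF *(2)] u2(1)[OF *(2)]
          by (auto simp: val_def mod_simps add_ac simp del: add_2_eq_Suc add_2_eq_Suc' One_nat_def)
  qed
qed

lemma mod_add_right_cancel: "(x + c) mod D = (y + c) mod D \<longleftrightarrow> x mod D = y mod (D :: nat)"
proof -
  have "int ((x + c) mod D) = int ((y + c) mod D) \<longleftrightarrow> int (x mod D) = int (y mod D)"
    unfolding zmod_int mod_eq_dvd_iff by simp
  then show ?thesis by (simp only: of_nat_eq_iff)
qed

lemma add_mod_neq: "\<lbrakk>0 < c; c < \<Delta>\<rbrakk> \<Longrightarrow> (x + c) mod \<Delta> \<noteq> (x :: nat) mod \<Delta>"
  using mod_eq_dvd_iff_nat[of x "x + c" \<Delta>] nat_dvd_not_less by auto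

lemma horn_or_sat_imp_csp:
  assumes D: "3 \<le> \<Delta>" and sat: "horn_or_sat M horn or2"
  shows "csp \<Delta> (16 * M ^ 3) (rel_code \<Delta> M horn or2)"
proof -
  obtain val where v: "\<not> val 0 \<and> (\<forall>A<M. \<forall>B<M. \<forall>C<M. horn A B C \<longrightarrow> val A \<longrightarrow> val B \<longrightarrow> val C) \<and>
     (\<forall>A<M. \<forall>B<M. or2 A B \<longrightarrow> val A \<or> val B)"
    using sat unfolding horn_or_sat_def ..
  then have v0: "\<not> val 0" by simp
  have vh: "val C" if "A < M" "B < M" "C < M" "horn A B C" "val A" "val B" for A B C using v that by simp
  have vo: "val A \<or> val B" if "A < M" "B < M" "or2 A B" for A B using v that by simp
  define U :: "nat \<Rightarrow> nat" where "U X = (if val X then 3 else 2)" for X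
  \<comment> \<open>\<open>Z w u\<close> is the choice among w + 2 and w + 3 that avoids u + 4 and u
    + 5, provided that w is not u + 2. For w = u + 3 it must be u + 6, which differs from both
    because \<Delta> is at least 3.\<close>
  define Z where "Z w u = (if w mod \<Delta> = (u + 3) mod \<Delta> then w + 3 else w + 2)" for w u :: nat
  define a b c where "a i = i div 16 div M div M" and "b i = i div 16 div M mod M" and "c i = i div 16 mod M"
      for i
  define S W W' V where "S i = (if val (a i) \<and> val (b i) then 2 else 3 :: nat)"
    and "W i = (if val (a i) \<and> val (b i) then 4 else if val (b i) then 5 else 6 :: nat)"
    and "W' i = (if val (c i) then 5 else 6 :: nat)" and "V i = (if val (a i) then 4 else 5 :: nat)" for i
  define t where "t i = (if i mod 16 = 1 then U (i div 16) else if i mod 16 = 2 then U (i div 16) + 2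
    else if i mod 16 = 3 then U (i div 16) + 4 else if i mod 16 = 4 then S i else if i mod 16 = 5 then W i
    else if i mod 16 = 6 then Z (W i) (U (a i)) else if i mod 16 = 7 then W' i else
        if i mod 16 = 8 then Z (W' i) 2
    else if i mod 16 = 9 then V i else if i mod 16 = 10 then Z (V i) (U (a i)) else 0)" for i
  have ne: "(x + 1) mod \<Delta> \<noteq> x mod \<Delta>" "(x + 2) mod \<Delta> \<noteq> x mod \<Delta>" for x :: nat
    using add_mod_neq[of 1 \<Delta> x] add_mod_neq[of 2 \<Delta> x] D by auto
  note nums = ne(1)[of 4] ne(1)[of 5] ne(1)[of 6] ne(2)[of 4]
  have nums': "4 mod \<Delta> \<noteq> 5 mod \<Delta>" "5 mod \<Delta> \<noteq> 6 mod \<Delta>" "4 mod \<Delta> \<noteq> 6 mod \<Delta>"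
    "5 mod \<Delta> \<noteq> 4 mod \<Delta>" "6 mod \<Delta> \<noteq> 5 mod \<Delta>" "6 mod \<Delta> \<noteq> 4 mod \<Delta>"
    using nums by (auto simp del: One_nat_def add_2_eq_Suc')
  have Z1: "Z w u = w + 2 \<or> Z w u = w + 3" for w u by (auto simp: Z_def)
  have Z2: "Z w u mod \<Delta> \<noteq> (u + 4) mod \<Delta>" "Z w u mod \<Delta> \<noteq> (u + 5) mod \<Delta>" if w: "w mod \<Delta> \<noteq> (u + 2) mod \<Delta>" for w u
  proof -
    have e: "u + 4 = (u + 2) + 2" "u + 5 = (u + 3) + 2" "u + 6 = (u + 3) + 3" "u + 6 = (u + 4) + 2"
        "u + 6 = (u + 5) + 1" by simp_all
    show "Z w u mod \<Delta> \<noteq> (u + 4) mod \<Delta>" "Z w u mod \<Delta> \<noteq> (u + 5) mod \<Delta>"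
    proof (atomize (full), cases "w mod \<Delta> = (u + 3) mod \<Delta>")
      case True
      then have "(w + 3) mod \<Delta> = (u + 6) mod \<Delta>" unfolding e(3) by (intro mod_add_cong) simp_all
      moreover have "(u + 6) mod \<Delta> \<noteq> (u + 4) mod \<Delta>" "(u + 6) mod \<Delta> \<noteq> (u + 5) mod \<Delta>"
        using ne(2)[of "u + 4"] ne(1)[of "u + 5"] unfolding e(4)[symmetric] e(5)[symmetric] by blast+
      ultimately show "Z w u mod \<Delta> \<noteq> (u + 4) mod \<Delta> \<and> Z w u mod \<Delta> \<noteq> (u + 5) mod \<Delta>" using True
          by (simp add: Z_def)
    next
      case False
      then show "Z w u mod \<Delta> \<noteq> (u + 4) mod \<Delta> \<and> Z w u mod \<Delta> \<noteq> (u + 5) mod \<Delta>"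
        using w unfolding e(1,2) Z_def by (simp only: mod_add_right_cancel if_False) blast
    qed
  qed
  have lt: "a j < M" "b j < M" "c j < M" if "j < 16 * M ^ 3" for j
  proof -
    have M: "0 < M" using that by (cases M) auto
    have "j div 16 < M * M * M" using that by (simp add: less_mult_imp_div_less power3_eq_cube mult.commute)
    then show "a j < M" by (simp add: a_def less_mult_imp_div_less)
    show "b j < M" "c j < M" using M by (simp_all add: b_def c_def)
  qed
  have H: "val (c j)" if "horn_at M horn j" "j < 16 * M ^ 3" "val (a j)" "val (b j)" for j
    using that lt[OF that(2)] vh unfolding horn_at_def a_def b_def c_def by blast
  have O: "val (a j) \<or> val (b j)" if "or_at M or2 j" "j < 16 * M ^ 3" for j
    using that lt[OF that(2)] vo unfolding or_at_def a_def b_def by blast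
  have W1: "W j mod \<Delta> \<noteq> (U (a j) + 2) mod \<Delta>" "W j mod \<Delta> \<noteq> (U (b j) + 3) mod \<Delta>"
    "W' j mod \<Delta> \<noteq> 4 mod \<Delta>" "W' j mod \<Delta> \<noteq> (U (c j) + 3) mod \<Delta>" "V j mod \<Delta> \<noteq> (U (a j) + 2) mod \<Delta>"
    "val (a j) \<or> val (b j) \<Longrightarrow> V j mod \<Delta> \<noteq> (U (b j) + 3) mod \<Delta>" for j
    using nums' by (auto simp: W_def W'_def V_def U_def simp del: add_2_eq_Suc')
  show ?thesis unfolding csp_rel_code[OF D]
  proof (intro exI[of _ t] allI impI conjI)
    fix i j assume ij: "i < 16 * M ^ 3" "j < 16 * M ^ 3" "i \<noteq> j"
    have t0: "t 0 = 0" "t 1 = 2" using v0 by (simp_all add: t_def U_def)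
    show "t j mod \<Delta> = (t i + 2) mod \<Delta>" if r: "rel_eq i j"
    proof -
      consider "i = 0" "j = 1" | "i div 16 = j div 16" "i mod 16 = 1" "j mod 16 = 2" | "i div 16 = j div 16"
          "i mod 16 = 2" "j mod 16 = 3"
        using r unfolding rel_eq_def by blast
      then have "t j = t i + 2" by cases (use t0 in \<open>simp_all add: t_def\<close>)
      then show ?thesis by simp
    qed
    show "t j mod \<Delta> = (t i + 2) mod \<Delta> \<or> t j mod \<Delta> = (t i + 3) mod \<Delta>" if r: "rel_two M horn or2 i j"
    proof -
      have E: "a i = a j" "b i = b j" "c i = c j" if "i div 16 = j div 16" using that
          by (simp_all add: a_def b_def c_def)
      consider "i = 0" "j mod 16 = 1" | "i = 0" "j mod 16 = 4" | "i div 16 = j div 16" "i mod 16 = 4"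
          "j mod 16 = 5"
        | "i div 16 = j div 16" "i mod 16 = 5" "j mod 16 = 6" | "i div 16 = j div 16" "i mod 16 = 4"
            "j mod 16 = 7" "horn_at M horn j"
        | "i div 16 = j div 16" "i mod 16 = 7" "j mod 16 = 8" | "i = 1" "j mod 16 = 9" | "i div 16 = j div 16"
            "i mod 16 = 9" "j mod 16 = 10"
        using r unfolding rel_two_def by blast
      then have "t j = t i + 2 \<or> t j = t i + 3"
      proof cases
        case 5
        then show ?thesis using E H[OF 5(4) ij(2)] by (simp add: t_def S_def W'_def)
      next
        case 4
        then have "W i = W j" using E by (simp add: W_def)
        then show ?thesis using 4 E Z1[of "W j" "U (a j)"] by (simp add: t_def)
      next
        case 6
        then have "W' i = W' j" using E by (simp add: W'_def)
        then show ?thesis using 6 E Z1[of "W' j" "2"] by (simp add: t_def)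
      next
        case 8
        then have "V i = V j" using E by (simp add: V_def)
        then show ?thesis using 8 E Z1[of "V j" "U (a j)"] by (simp add: t_def)
      qed (use E t0 in \<open>simp_all add: t_def U_def S_def W_def V_def\<close>)
      then show ?thesis by auto
    qed
    show "t j mod \<Delta> \<noteq> (t i + 1) mod \<Delta>" if r: "rel_one M horn or2 i j"
    proof -
      consider "i mod 16 = 2" "j mod 16 = 5" "i div 16 = b j" | "i mod 16 = 2" "j mod 16 = 7" "i div 16 = c j"
        | "i mod 16 = 2" "j mod 16 = 9" "i div 16 = b j" "or_at M or2 j"
        using r unfolding rel_one_def b_def c_def by metis
      then show ?thesis
      proof cases
        case 1
        then have "t i + 1 = U (b j) + 3" "t j = W j" by (simp_all add: t_def)
        then show ?thesis using W1(2)[of j] by (simp only: not_False_eq_True)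
      next
        case 2
        then have "t i + 1 = U (c j) + 3" "t j = W' j" by (simp_all add: t_def)
        then show ?thesis using W1(4)[of j] by (simp only: not_False_eq_True)
      next
        case 3
        then have "t i + 1 = U (b j) + 3" "t j = V j" by (simp_all add: t_def)
        then show ?thesis using W1(6)[OF O[OF 3(4) ij(2)]] by (simp only: not_False_eq_True)
      qed
    qed
    show "t j mod \<Delta> \<noteq> t i mod \<Delta>" "t j mod \<Delta> \<noteq> (t i + 1) mod \<Delta>" if r: "rel_both M horn or2 i j"
    proof -
      have W'4: "W' j mod \<Delta> \<noteq> (2 + 2) mod \<Delta>" using W1(3)[of j] by simp
      note Z2' = Z2[OF W1(1)[of j]] Z2[OF W1(5)[of j]] Z2[OF W'4]
      consider "i mod 16 = 3" "j mod 16 = 6" "i div 16 = a j" | "i mod 16 = 3" "j mod 16 = 8" "i div 16 = 0"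
        | "i mod 16 = 3" "j mod 16 = 10" "i div 16 = a j"
        using r unfolding rel_both_def a_def by metis
      then have "t j mod \<Delta> \<noteq> t i mod \<Delta> \<and> t j mod \<Delta> \<noteq> (t i + 1) mod \<Delta>"
      proof cases
        case 1
        then have "t i = U (a j) + 4" "t i + 1 = U (a j) + 5" "t j = Z (W j) (U (a j))"
            by (simp_all add: t_def)
        then show ?thesis using Z2'(1,2) by (simp only: not_False_eq_True simp_thms)
      next
        case 2
        then have "t i = 2 + 4" "t i + 1 = 2 + 5" "t j = Z (W' j) 2" using v0 by (simp_all add: t_def U_def)
        then show ?thesis using Z2'(5,6) by (simp only: not_False_eq_True simp_thms)
      next
        case 3
        then have "t i = U (a j) + 4" "t i + 1 = U (a j) + 5" "t j = Z (V j) (U (a j))"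
            by (simp_all add: t_def)
        then show ?thesis using Z2'(3,4) by (simp only: not_False_eq_True simp_thms)
      qed
      then show "t j mod \<Delta> \<noteq> t i mod \<Delta>" "t j mod \<Delta> \<noteq> (t i + 1) mod \<Delta>" by blast+
    qed
  qed
qed

theorem csp_horn_or_sat:
  "\<lbrakk>3 \<le> \<Delta>; 0 < M\<rbrakk> \<Longrightarrow> csp \<Delta> (16 * M ^ 3) (rel_code \<Delta> M horn or2) \<longleftrightarrow> horn_or_sat M horn or2"
  using csp_imp_horn_or_sat horn_or_sat_imp_csp by blast

section \<open>The tableau of a computation\<close>

definition code5 :: "nat \<Rightarrow> nat \<Rightarrow> nat \<Rightarrow> nat \<Rightarrow> nat \<Rightarrow> nat \<Rightarrow> nat" where
  "code5 N a b c d e = (((a * N + b) * N + c) * N + d) * N + e"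

lemma code5_decode:
  assumes "b < N" "c < N" "d < N" "e < N"
  shows "code5 N a b c d e mod N = e" "code5 N a b c d e div N mod N = d"
      "code5 N a b c d e div N div N mod N = c"
    "code5 N a b c d e div N div N div N mod N = b" "code5 N a b c d e div N div N div N div N = a"
  using assms by (simp_all add: code5_def)

lemma mult_add_less: "u < m \<Longrightarrow> v < n \<Longrightarrow> u * n + v < m * (n :: nat)"
proof -
  assume "u < m" "v < n"
  then have "u * n + v < Suc u * n" by simp
  also have "\<dots> \<le> m * n" using \<open>u < m\<close> by (intro mult_le_mono1) simp
  finally show ?thesis .
qed

lemma code5_less: "a < m \<Longrightarrow> b < N \<Longrightarrow> c < N \<Longrightarrow> d < N \<Longrightarrow> e < N \<Longrightarrow> code5 N a b c d e < m * N * N * N * N"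
  unfolding code5_def by (intro mult_add_less)

text \<open>Lists shorter than the number of tapes occur because the symbols under the heads are
  collected one tape after the other; this keeps every clause at two premises.\<close>

definition reads :: "tm \<Rightarrow> (nat \<times> nat list) set" where
  "reads V = {(q, ss). q \<le> n_states V \<and> length ss \<le> n_tapes V \<and> set ss \<subseteq> {..<n_symbols V}}"

lemma finite_reads: "finite (reads V)"
proof -
  have "reads V \<subseteq> {..n_states V} \<times> {ss. set ss \<subseteq> {..<n_symbols V} \<and> length ss \<le> n_tapes V}"
    by (auto simp: reads_def)
  then show ?thesis by (rule finite_subset) (intro finite_cartesian_product finite_lists_length_le; simp)
qed

definition total_trans :: "tm \<Rightarrow> nat \<times> nat list \<Rightarrow> nat \<times> (nat \<times> move) list" where
  "total_trans V = (\<lambda>(q, ss). if q < n_states V then trans V q ss else (q, stay ss))"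

definition shift_index :: "move \<Rightarrow> nat \<Rightarrow> nat" where
  "shift_index m i = (case m of Move_Left \<Rightarrow> i - 1 | No_Move \<Rightarrow> i | Move_Right \<Rightarrow> i + 1)"

text \<open>The atoms of the tableau, with tape cell \<open>i\<close> (an integer) represented by \<open>i + Tm + 1\<close>: tag \<open>1\<close>
  is the state at time \<open>t\<close> together with the symbols read so far on the first tapes, tag \<open>2\<close> a head
  position, tag \<open>3\<close> the content of a cell, tag \<open>4\<close> the symbol read on a tape; tags \<open>5\<close>--\<open>8\<close> say that
  the \<open>i\<close>-th bit of the witness is \<^const>\<open>True\<close>, is \<^const>\<open>False\<close>, exists, and does not exist. All clauses but
  those for the witness are Horn clauses, so that every model contains the atoms of the actual run.\<close>

abbreviation "conf N t r \<equiv> code5 N 1 t (to_nat (r :: nat \<times> nat list)) 0 0"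
abbreviation "headat N t j i \<equiv> code5 N 2 t j i 0"
abbreviation "content_at N t j i s \<equiv> code5 N 3 t j i s"
abbreviation "look N t j s \<equiv> code5 N 4 t j s 0"
abbreviation "wit N c i \<equiv> code5 N c i 0 0 0"

text \<open>A clause with a single premise repeats it. The last three rules are prohibitions: at
  time Tm the machine must have halted, and the output tape must show 2 followed by a blank, which
  is the word \<open>[True]\<close>.\<close>

inductive tab_horn :: "tm \<Rightarrow> nat \<Rightarrow> nat \<Rightarrow> nat \<Rightarrow> nat \<Rightarrow> nat \<Rightarrow> nat \<Rightarrow> nat \<Rightarrow> bool" for V W P Tm N where
  look: "\<lbrakk>t < Suc Tm; j < n_tapes V; i < W; s < n_symbols V\<rbrakk> \<Longrightarrow>
    tab_horn V W P Tm N (headat N t j i) (content_at N t j i s) (look N t j s)"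
| collect: "\<lbrakk>t < Suc Tm; r \<in> reads V; s < n_symbols V; length (snd r) < n_tapes V\<rbrakk> \<Longrightarrow>
    tab_horn V W P Tm N (conf N t r) (look N t (length (snd r)) s) (conf N t (fst r, snd r @ [s]))"
| state: "\<lbrakk>t < Tm; r \<in> reads V; length (snd r) = n_tapes V\<rbrakk> \<Longrightarrow>
    tab_horn V W P Tm N (conf N t r) (conf N t r) (conf N (Suc t) (fst (total_trans V r), []))"
| move: "\<lbrakk>t < Tm; r \<in> reads V; length (snd r) = n_tapes V; j < n_tapes V; i < W\<rbrakk> \<Longrightarrow>
    tab_horn V W P Tm N (conf N t r) (headat N t j i) (headat N (Suc t) j (shift_index
        (snd (snd (total_trans V r) ! j)) i))"
| put: "\<lbrakk>t < Tm; r \<in> reads V; length (snd r) = n_tapes V; j < n_tapes V; i < W\<rbrakk> \<Longrightarrow>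
    tab_horn V W P Tm N (conf N t r) (headat N t j i) (content_at N (Suc t) j i (fst (snd (total_trans V r) !
        j)))"
| keep: "\<lbrakk>t < Tm; j < n_tapes V; i < W; i' < W; s < n_symbols V; i \<noteq> i'\<rbrakk> \<Longrightarrow>
    tab_horn V W P Tm N (content_at N t j i s) (headat N t j i') (content_at N (Suc t) j i s)"
| bit_true: "i < P \<Longrightarrow> tab_horn V W P Tm N (wit N 5 i) (wit N 7 i) (content_at N 0 1 (Suc Tm + i) 2)"
| bit_false: "i < P \<Longrightarrow> tab_horn V W P Tm N (wit N 6 i) (wit N 7 i) (content_at N 0 1 (Suc Tm + i) 1)"
| bit_none: "i < P \<Longrightarrow> tab_horn V W P Tm N (wit N 8 i) (wit N 8 i) (content_at N 0 1 (Suc Tm + i) 0)"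
| bit_next: "\<lbrakk>i < P; Suc i < P\<rbrakk> \<Longrightarrow> tab_horn V W P Tm N (wit N 8 i) (wit N 8 i) (wit N 8 (Suc i))"
| halted: "q < n_states V \<Longrightarrow> tab_horn V W P Tm N (conf N Tm (q, [])) (conf N Tm (q, [])) 0"
| out_true: "\<lbrakk>s < n_symbols V; s \<noteq> 2\<rbrakk> \<Longrightarrow> tab_horn V W P Tm N
    (content_at N Tm (n_tapes V - 1) (Suc Tm) s) (content_at N Tm (n_tapes V - 1) (Suc Tm) s) 0"
| out_end: "\<lbrakk>s < n_symbols V; s \<noteq> 0\<rbrakk> \<Longrightarrow> tab_horn V W P Tm N
    (content_at N Tm (n_tapes V - 1) (Suc (Suc Tm)) s) (content_at N Tm (n_tapes V - 1) (Suc (Suc Tm)) s) 0"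

text \<open>Facts about the start configuration are disjunctions of an atom with itself. The only
  proper disjunctions are \<open>or_bit\<close> and \<open>or_len\<close>, which guess the witness
  and its length.\<close>

inductive tab_or :: "tm \<Rightarrow> bool list \<Rightarrow> nat \<Rightarrow> nat \<Rightarrow> nat \<Rightarrow> nat \<Rightarrow> nat \<Rightarrow> nat \<Rightarrow> bool" for V x W P Tm N where
  or_conf: "tab_or V x W P Tm N (conf N 0 (0, [])) (conf N 0 (0, []))"
| or_head: "j < n_tapes V \<Longrightarrow> tab_or V x W P Tm N (headat N 0 j (Suc Tm)) (headat N 0 j (Suc Tm))"
| or_input: "i < length x \<Longrightarrow> tab_or V x W P Tm N
    (content_at N 0 0 (Suc Tm + i) (if bit_at x i then 2 else 1)) (content_at N 0 0 (Suc Tm + i) (if bit_at x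
        i then 2 else 1))"
| or_blank: "\<lbrakk>j < n_tapes V; i < W; i < Suc Tm \<or> j = 0 \<and> Suc Tm + length x \<le> i \<or> j = 1 \<and> Suc Tm + P \<le> i \<or>
    1 < j\<rbrakk> \<Longrightarrow>
    tab_or V x W P Tm N (content_at N 0 j i 0) (content_at N 0 j i 0)"
| or_bit: "i < P \<Longrightarrow> tab_or V x W P Tm N (wit N 5 i) (wit N 6 i)"
| or_len: "i < P \<Longrightarrow> tab_or V x W P Tm N (wit N 7 i) (wit N 8 i)"

lemma wf_total_trans:
  assumes "wf_tm V" "(q, ss) \<in> reads V" "length ss = n_tapes V" "total_trans V (q, ss) = (q', acts)"
  shows "length acts = n_tapes V" "q' \<le> n_states V" "fst ` set acts \<subseteq> {..<n_symbols V}"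
proof -
  have "length acts = n_tapes V \<and> q' \<le> n_states V \<and> fst ` set acts \<subseteq> {..<n_symbols V}"
  proof (cases "q < n_states V")
    case True
    then have "trans V q ss = (q', acts)" using assms(4) by (simp add: total_trans_def)
    moreover have "case trans V q ss of (q', acts) \<Rightarrow>
        q' \<le> n_states V \<and> length acts = n_tapes V \<and> fst ` set acts \<subseteq> {..<n_symbols V}"
      using assms(1)[unfolded wf_tm_def, THEN conjunct2, THEN conjunct2, rule_format, of q ss] assms(2,3) True
      by (simp add: reads_def)
    ultimately show ?thesis by simp
  next
    case False
    then show ?thesis using assms by (auto simp: total_trans_def reads_def stay_def)
  qed
  then show "length acts = n_tapes V" "q' \<le> n_states V" "fst ` set acts \<subseteq> {..<n_symbols V}" by blast+
qed

lemma step_total_trans: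
  "step V (q, ts) = (case total_trans V (q, map read_tape ts) of (q', acts) \<Rightarrow> (q', map2 act acts ts))"
  by (auto simp: total_trans_def map2_act_stay split: prod.splits)

lemma has_output_unique: "has_output cfg y \<Longrightarrow> has_output cfg z \<Longrightarrow> y = z"
proof -
  assume *: "has_output cfg y" "has_output cfg z"
  obtain c h where c: "last (snd cfg) = (c, h)" by fastforce
  have "\<not> length y < length z"
  proof
    assume "length y < length z"
    then have "c (int (length y)) = bit_symbol (z ! length y)" "c (int (length y)) = 0"
      using * c by (auto simp: has_output_def)
    then show False by (simp add: bit_symbol_def split: if_splits)
  qed
  moreover have "\<not> length z < length y"
  proof
    assume "length z < length y"
    then have "c (int (length z)) = bit_symbol (y ! length z)" "c (int (length z)) = 0"
      using * c by (auto simp: has_output_def)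
    then show False by (simp add: bit_symbol_def split: if_splits)
  qed
  ultimately have l: "length y = length z" by simp
  moreover have "bit_symbol (y ! i) = bit_symbol (z ! i)" if "i < length y" for i
    using * c that l by (auto simp: has_output_def)
  moreover have "bit_symbol b = bit_symbol d \<longleftrightarrow> b = d" for b d by (simp add: bit_symbol_def)
  ultimately show ?thesis by (simp add: nth_equalityI)
qed

text \<open>Heads start at cell index Tm + 1 and move by at most Tm, and the inputs extend at most
  length x or P to the right; W leaves room for all this. N is a common base for the components of
  an atom.\<close>

locale tableau =
  fixes V :: tm and x :: "bool list" and W P Tm N :: nat
  assumes wf: "wf_tm V" and K2: "2 \<le> n_tapes V" and W: "W = 2 * Tm + length x + P + 5"
    and N: "W + n_tapes V + n_symbols V + 10 \<le> N" "\<And>r. r \<in> reads V \<Longrightarrow> to_nat r < N"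
begin

definition "cfg w t = (step V ^^ t) (init_config V [x, w])"
definition "state w t = fst (cfg w t)"
definition "symb w t j = fst (snd (cfg w t) ! j)"
definition "hpos w t j = snd (snd (cfg w t) ! j)"
definition "seen w t = map read_tape (snd (cfg w t))"
definition "cell i = int i - int (Tm + 1)"

lemma cfg_Suc: "cfg w (Suc t) = step V (cfg w t)"
  by (simp add: cfg_def)

lemma run_inv: "length (snd (cfg w t)) = n_tapes V \<and> state w t \<le> n_states V \<and>
   (\<forall>j<n_tapes V. \<bar>hpos w t j\<bar> \<le> int t \<and> (\<forall>i. symb w t j i < n_symbols V))"
proof (induction t)
  case 0
  have "3 \<le> n_symbols V" using wf by (simp add: wf_tm_def)
  then show ?case
    by (auto simp: state_def hpos_def symb_def cfg_def init_config_def input_tape_def bit_symbol_def)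
next
  case (Suc t)
  obtain q ts where c: "cfg w t = (q, ts)" by fastforce
  have ts: "length ts = n_tapes V" "q \<le> n_states V" using Suc c by (auto simp: state_def)
  have set: "set (map read_tape ts) \<subseteq> {..<n_symbols V}"
  proof
    fix s assume "s \<in> set (map read_tape ts)"
    then obtain j where j: "j < n_tapes V" "s = read_tape (ts ! j)" using ts by (auto simp: in_set_conv_nth)
    then show "s \<in> {..<n_symbols V}" using Suc c by (cases "ts ! j") (auto simp: symb_def)
  qed
  obtain q' acts where tr: "total_trans V (q, map read_tape ts) = (q', acts)" by fastforce
  have "(q, map read_tape ts) \<in> reads V" using set ts by (simp add: reads_def)
  note a = wf_total_trans[OF wf this _ tr, simplified, OF ts(1)]
  have r: "cfg w (Suc t) = (q', map2 act acts ts)"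
      by (simp add: cfg_Suc c step_total_trans tr del: step.simps)
  have "\<bar>hpos w (Suc t) j\<bar> \<le> int (Suc t) \<and> (\<forall>i. symb w (Suc t) j i < n_symbols V)" if j: "j < n_tapes V" for j
  proof -
    obtain s m where m: "acts ! j = (s, m)" by fastforce
    have "(s, m) \<in> set acts" using m j a(1) by (metis nth_mem)
    then have "s < n_symbols V" using a(3) by force
    moreover have "\<bar>hpos w t j\<bar> \<le> int t" "\<forall>i. symb w t j i < n_symbols V" using Suc j by auto
    ultimately show ?thesis using m j a(1) ts c
      by (cases "ts ! j") (auto simp: hpos_def symb_def r split: move.split)
  qed
  then show ?case using a ts by (simp add: r state_def)
qed

lemma seen: "j < n_tapes V \<Longrightarrow> seen w t ! j = symb w t j (hpos w t j)" "length (seen w t) = n_tapes V"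
proof -
  show "length (seen w t) = n_tapes V" using run_inv by (simp add: seen_def)
  show "j < n_tapes V \<Longrightarrow> seen w t ! j = symb w t j (hpos w t j)"
    using run_inv[of w t] by (cases "snd (cfg w t) ! j") (simp add: seen_def symb_def hpos_def)
qed

lemma seen_reads: "(state w t, take l (seen w t)) \<in> reads V"
proof -
  have "s < n_symbols V" if "s \<in> set (seen w t)" for s
    using that seen run_inv[of w t] by (auto simp: in_set_conv_nth)
  then have "set (take l (seen w t)) \<subseteq> {..<n_symbols V}" by (auto dest: in_set_takeD)
  then show ?thesis using seen(2)[of w t] run_inv[of w t] by (simp add: reads_def)
qed

lemma trans_seen:
  assumes "total_trans V (state w t, seen w t) = (q', acts)" "j < n_tapes V"
  shows "state w (Suc t) = q'" "hpos w (Suc t) j = (case snd (acts ! j) of Move_Left \<Rightarrow> hpos w t j - 1 |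
      No_Move \<Rightarrow> hpos w t j | Move_Right \<Rightarrow> hpos w t j + 1)"
    "symb w (Suc t) j = (symb w t j)(hpos w t j := fst (acts ! j))" "length acts = n_tapes V"
        "fst (acts ! j) < n_symbols V"
proof -
  obtain q ts where c: "cfg w t = (q, ts)" by fastforce
  have tr: "total_trans V (q, map read_tape ts) = (q', acts)" using assms(1) c
      by (simp add: state_def seen_def)
  have r: "cfg w (Suc t) = (q', map2 act acts ts)"
      by (simp add: cfg_Suc c step_total_trans tr del: step.simps)
  have ts: "length ts = n_tapes V" using run_inv[of w t] c by simp
  have sr: "(state w t, seen w t) \<in> reads V" using seen_reads[of w t "n_tapes V"] seen(2)[of w t] by simp
  show la: "length acts = n_tapes V" by (rule wf_total_trans(1)[OF wf sr seen(2) assms(1)])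
  show "state w (Suc t) = q'" by (simp add: state_def r)
  obtain c0 h0 s0 m0 where j: "ts ! j = (c0, h0)" "acts ! j = (s0, m0)" by (meson surj_pair)
  have "snd (cfg w (Suc t)) ! j = act (s0, m0) (c0, h0)" using assms(2) la ts
      by (simp add: r j del: act.simps)
  moreover have "snd (cfg w t) ! j = (c0, h0)" by (simp add: c j)
  ultimately show "hpos w (Suc t) j = (case snd (acts ! j) of Move_Left \<Rightarrow> hpos w t j - 1 | No_Move \<Rightarrow> hpos w t
      j | Move_Right \<Rightarrow> hpos w t j + 1)"
    and *: "symb w (Suc t) j = (symb w t j)(hpos w t j := fst (acts ! j))"
    unfolding hpos_def symb_def j by (cases m0; simp)+
  have "symb w (Suc t) j (hpos w t j) < n_symbols V" using run_inv[of w "Suc t"] assms(2) by blast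
  then show "fst (acts ! j) < n_symbols V" using * by simp
qed

lemma index_less [simp]: "t \<le> Suc Tm \<Longrightarrow> t < N" "j < n_tapes V \<Longrightarrow> j < N" "i < W \<Longrightarrow> i < N"
    "s < n_symbols V \<Longrightarrow> s < N" "i < P \<Longrightarrow> i < N"
  using N(1) W by auto

lemma hpos_cell: "t \<le> Tm \<Longrightarrow> j < n_tapes V \<Longrightarrow> 0 < hpos w t j + int (Suc Tm) \<and> nat (hpos w t j + int (Suc Tm)) <
    W"
  using run_inv[of w t] W by (auto simp: abs_le_iff)

lemma symb_less: "j < n_tapes V \<Longrightarrow> symb w t j i < n_symbols V"
  using run_inv[of w t] by blast

lemma symb_0: "symb w 0 j i = (if j < 2 \<and> 0 \<le> i \<and> nat i < length ([x, w] ! j) then bit_symbol ([x,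
    w] ! j ! nat i) else 0)"
  if "j < n_tapes V"
  using that by (auto simp: symb_def cfg_def init_config_def input_tape_def less_2_cases_iff)

lemma init_0: "state w 0 = 0" "j < n_tapes V \<Longrightarrow> hpos w 0 j = 0"
  by (auto simp: state_def hpos_def cfg_def init_config_def input_tape_def)

lemma sat_imp_accepts:
  assumes nz: "\<not> val (0 :: nat)"
    and horn: "\<And>A B C. tab_horn V W P Tm N A B C \<Longrightarrow> val A \<Longrightarrow> val B \<Longrightarrow> val C"
    and or2: "\<And>A B. tab_or V x W P Tm N A B \<Longrightarrow> val A \<or> val B"
  shows "\<exists>w. length w \<le> P \<and> state w Tm = n_states V \<and> symb w Tm (n_tapes V - 1) 0 = 2 \<and>
      symb w Tm (n_tapes V - 1) 1 = 0"
proof -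
  \<comment> \<open>The witness read off a model ends at the first position declared missing; by
    \<open>bit_next\<close> all later ones are missing too. Before l, \<open>or_len\<close> makes
    each position present.\<close>
  define l where "l = (LEAST i. i = P \<or> val (wit N 8 i))"
  have l: "l = P \<or> val (wit N 8 l)" unfolding l_def by (rule LeastI[of _ P]) simp
  have lP: "l \<le> P" unfolding l_def by (rule Least_le) simp
  have nl: "\<not> val (wit N 8 i)" if "i < l" for i using that not_less_Least unfolding l_def by blast
  define w where "w = map (\<lambda>i. val (wit N 5 i)) [0..<l]"
  have wl: "length w = l" by (simp add: w_def)
  have wn: "w ! i = val (wit N 5 i)" if "i < l" for i using that by (simp add: w_def)
  have U: "val (wit N 8 i)" if "l \<le> i" "i < P" for i
    using that
  proof (induction i rule: dec_induct)
    case base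
    then show ?case using l by blast
  next
    case (step i)
    then have "val (wit N 8 i)" by simp
    from horn[OF bit_next this this] step show ?case by simp
  qed
  have cell0: "val (content_at N 0 j i (symb w 0 j (cell i)))" if j: "j < n_tapes V" and i: "i < W" for i j
  proof -
    consider "i < Suc Tm \<or> j = 0 \<and> Suc Tm + length x \<le> i \<or> j = 1 \<and> Suc Tm + P \<le> i \<or> 1 < j"
      | p where "j = 0" "i = Suc Tm + p" "p < length x"
      | p where "j = 1" "i = Suc Tm + p" "p < P"
      by (metis One_nat_def add_less_cancel_left le_Suc_ex less_Suc_eq_0_disj not_less not_less_eq)
    then show ?thesis
    proof cases
      case 1
      then have "symb w 0 j (cell i) = 0"
        using lP wl by (auto simp: symb_0[OF j] cell_def less_2_cases_iff)
      then show ?thesis using or2[OF or_blank[OF j i 1]] by simp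
    next
      case (2 p)
      then have "symb w 0 j (cell i) = (if bit_at x p then 2 else 1)"
        using symb_0[OF j] by (simp add: cell_def bit_at_def bit_symbol_def)
      then show ?thesis using or2[OF or_input[OF 2(3)]] 2 by simp
    next
      case (3 p)
      have c: "symb w 0 j (cell i) = (if p < l then if val (wit N 5 p) then 2 else 1 else 0)"
        using 3 wn[of p] symb_0[OF j] by (simp add: cell_def bit_symbol_def wl)
      show ?thesis
      proof (cases "p < l")
        case pl: True
        have E: "val (wit N 7 p)" using or2[OF or_len[OF 3(3)]] nl[OF pl] by blast
        show ?thesis
        proof (cases "val (wit N 5 p)")
          case True
          then show ?thesis using horn[OF bit_true[OF 3(3)] True E] c pl 3 by simp
        next
          case False
          then have "val (wit N 6 p)" using or2[OF or_bit[OF 3(3)]] by blast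
          then show ?thesis using horn[OF bit_false[OF 3(3)] _ E] c pl 3 False by simp
        qed
      next
        case False
        then have "val (wit N 8 p)" using U[of p] 3 by simp
        then show ?thesis using horn[OF bit_none[OF 3(3)]] c False 3 by simp
      qed
    qed
  qed
  \<comment> \<open>Only one inclusion is claimed: the model contains the atoms of the true run, but
    it may contain more.\<close>
  have inv: "val (conf N t (state w t, [])) \<and> (\<forall>j<n_tapes V.
      val (headat N t j (nat (hpos w t j + int (Suc Tm)))) \<and> (\<forall>i<W. val (content_at N t j i (symb w t j
          (cell i)))))"
    if "t \<le> Tm" for t
    using that
  proof (induction t)
    case 0
    have "val (conf N 0 (state w 0, []))" using or2[OF or_conf] by (simp add: init_0)
    moreover have "val (headat N 0 j (nat (hpos w 0 j + int (Suc Tm))))" if "j < n_tapes V" for j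
      using or2[OF or_head[OF that]] by (simp add: init_0 that nat_add_distrib)
    ultimately show ?case using cell0 by blast
  next
    case (Suc t)
    define hd where "hd j = nat (hpos w t j + int (Suc Tm))" for j
    have IH: "val (conf N t (state w t, []))" "j < n_tapes V \<Longrightarrow> val (headat N t j (hd j))"
      "j < n_tapes V \<Longrightarrow> i < W \<Longrightarrow> val (content_at N t j i (symb w t j (cell i)))" for i j
      using Suc by (simp_all add: hd_def)
    have hdW: "hd j < W" "0 < hd j" "cell (hd j) = hpos w t j" if "j < n_tapes V" for j
      using hpos_cell[of t j w] Suc.prems that by (auto simp: hd_def cell_def)
    have tT: "t < Suc Tm" "t < Tm" using Suc.prems by simp_all
    have sym: "val (look N t j (seen w t ! j))" if j: "j < n_tapes V" for j
      using horn[OF look[OF tT(1) j hdW(1)[OF j] symb_less[OF j]] IH(2)[OF j] IH(3)[OF j hdW(1)[OF j]]]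
          hdW(3)[OF j]
      by (simp add: seen(1)[OF j])
    have rd: "val (conf N t (state w t, take l (seen w t)))" if "l \<le> n_tapes V" for l
      using that
    proof (induction l)
      case (Suc l)
      then have l: "l < n_tapes V" by simp
      have tk: "take (Suc l) (seen w t) = take l (seen w t) @ [seen w t ! l]" "length (take l (seen w t)) = l"
        using l seen(2) by (simp_all add: take_Suc_conv_app_nth)
      have sl: "seen w t ! l < n_symbols V" using symb_less[OF l] by (simp add: seen(1)[OF l])
      show ?case using horn[OF collect[OF tT(1) seen_reads[of w t l] sl]] Suc.IH sym[OF l] l
        unfolding fst_conv snd_conv tk by simp
    qed (use IH(1) in simp)
    have rd': "val (conf N t (state w t, seen w t))" using rd[of "n_tapes V"] seen(2) by simp
    have rr: "(state w t, seen w t) \<in> reads V" "length (snd (state w t, seen w t)) = n_tapes V"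
      using seen_reads[of w t "n_tapes V"] seen(2) by simp_all
    obtain q' acts where tr: "total_trans V (state w t, seen w t) = (q', acts)" by fastforce
    note ts = trans_seen[OF tr]
    have s1: "val (conf N (Suc t) (state w (Suc t), []))"
      using horn[OF tab_horn.state[OF tT(2) rr] rd' rd'] ts(1)[of 0] K2 tr by simp
    have s2: "val (headat N (Suc t) j (nat (hpos w (Suc t) j + int (Suc Tm))))" if j: "j < n_tapes V" for j
    proof -
      have "nat (hpos w (Suc t) j + int (Suc Tm)) = shift_index (snd (acts ! j)) (hd j)"
        using ts(2)[OF j] hdW(2)[OF j] by (auto simp: shift_index_def hd_def split: move.split)
      then show ?thesis using horn[OF move[OF tT(2) rr j hdW(1)[OF j]] rd' IH(2)[OF j]] tr by simp
    qed
    have s3: "val (content_at N (Suc t) j i (symb w (Suc t) j (cell i)))" if j: "j < n_tapes V" "i < W"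
        for i j
    proof (cases "i = hd j")
      case True
      then show ?thesis using horn[OF put[OF tT(2) rr j(1) hdW(1)[OF j(1)]] rd' IH(2)[OF j(1)]]
          ts(3)[OF j(1)] hdW(3)[OF j(1)] tr by simp
    next
      case False
      then have "cell i \<noteq> hpos w t j" using hdW(3)[OF j(1)] by (auto simp: cell_def)
      then have "symb w (Suc t) j (cell i) = symb w t j (cell i)" using ts(3)[OF j(1)] by simp
      then show ?thesis using horn[OF keep[OF tT(2) j hdW(1)[OF j(1)] symb_less[OF j(1)] False] IH(3)[OF j]
          IH(2)[OF j(1)]] by simp
    qed
    show ?case using s1 s2 s3 by blast
  qed
  have K: "n_tapes V - 1 < n_tapes V" using K2 by simp
  have T: "Suc Tm < W" "Suc (Suc Tm) < W" using W by simp_all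
  have c: "cell (Suc Tm) = 0" "cell (Suc (Suc Tm)) = 1" by (simp_all add: cell_def)
  note fin = inv[OF order_refl, THEN conjunct2, rule_format, OF K, THEN conjunct2, rule_format]
  have "state w Tm = n_states V"
  proof (rule ccontr)
    assume "state w Tm \<noteq> n_states V"
    then have "state w Tm < n_states V" using run_inv[of w Tm] by simp
    from horn[OF halted[OF this]] nz inv[of Tm] show False by blast
  qed
  moreover have "symb w Tm (n_tapes V - 1) 0 = 2"
    using horn[OF out_true[OF symb_less[OF K]] fin[OF T(1)] fin[OF T(1)]] nz c by metis
  moreover have "symb w Tm (n_tapes V - 1) 1 = 0"
    using horn[OF out_end[OF symb_less[OF K]] fin[OF T(2)] fin[OF T(2)]] nz c by metis
  ultimately show ?thesis using lP wl by blast
qed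

definition model :: "bool list \<Rightarrow> nat \<Rightarrow> nat \<Rightarrow> nat \<Rightarrow> nat \<Rightarrow> nat \<Rightarrow> bool" where
  "model w a b c d e \<longleftrightarrow>
     a = 1 \<and> (\<exists>l. c = to_nat (state w b, take l (seen w b))) \<or>
     a = 2 \<and> int d = hpos w b c + int (Suc Tm) \<or>
     a = 3 \<and> symb w b c (cell d) = e \<or>
     a = 4 \<and> seen w b ! c = d \<or>
     a = 5 \<and> b < length w \<and> w ! b \<or> a = 6 \<and> \<not> (b < length w \<and> w ! b) \<or>
     a = 7 \<and> b < length w \<or> a = 8 \<and> length w \<le> b"

definition "val w A = model w (A div N div N div N div N) (A div N div N div N mod N) (A div N div N mod N)
  (A div N mod N) (A mod N)"

lemma val_code5: "b < N \<Longrightarrow> c < N \<Longrightarrow> d < N \<Longrightarrow> e < N \<Longrightarrow> val w (code5 N a b c d e) = model w a b c d e"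
  by (simp add: val_def code5_decode)

lemma model_simps:
  "model w (Suc 0) b c d e \<longleftrightarrow> (\<exists>l. c = to_nat (state w b, take l (seen w b)))"
  "model w 2 b c d e \<longleftrightarrow> int d = hpos w b c + int (Suc Tm)"
  "model w 3 b c d e \<longleftrightarrow> symb w b c (cell d) = e"
  "model w 4 b c d e \<longleftrightarrow> seen w b ! c = d"
  "model w 5 b c d e \<longleftrightarrow> b < length w \<and> w ! b"
  "model w 6 b c d e \<longleftrightarrow> \<not> (b < length w \<and> w ! b)"
  "model w 7 b c d e \<longleftrightarrow> b < length w"
  "model w 8 b c d e \<longleftrightarrow> length w \<le> b"
  by (simp_all add: model_def)

lemma reads_appendI: "r \<in> reads V \<Longrightarrow> s < n_symbols V \<Longrightarrow> length (snd r) < n_tapes V \<Longrightarrow> (fst r, snd r @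
    [s]) \<in> reads V"
  by (auto simp: reads_def)

lemma total_trans_reads: "r \<in> reads V \<Longrightarrow> length (snd r) = n_tapes V \<Longrightarrow> (fst (total_trans V r), []) \<in> reads V"
  using wf_total_trans[OF wf, of "fst r" "snd r" "fst (total_trans V r)" "snd (total_trans V r)"]
      by (simp add: reads_def)

lemma total_trans_symbol: "r \<in> reads V \<Longrightarrow> length (snd r) = n_tapes V \<Longrightarrow> j < n_tapes V \<Longrightarrow>
    fst (snd (total_trans V r) ! j) < n_symbols V"
  using wf_total_trans[OF wf, of "fst r" "snd r" "fst (total_trans V r)" "snd (total_trans V r)"]
  by (simp add: image_subset_iff)

lemma index_less' [simp]: "i < W \<Longrightarrow> Suc i < N" "i < W \<Longrightarrow> shift_index m i < N" "i < P \<Longrightarrow> Suc (Tm + i) < N"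
    "i < length x \<Longrightarrow> Suc (Tm + i) < N" "Suc Tm < N" "Suc (Suc Tm) < N"
  "0 < N" "Suc 0 < N" "2 < N"
  using N(1) W by (auto simp: shift_index_def split: move.split)

lemma accepts_imp_sat:
  assumes w: "length w \<le> P" and acc: "state w Tm = n_states V" "symb w Tm (n_tapes V - 1) 0 = 2"
      "symb w Tm (n_tapes V - 1) 1 = 0"
  shows "\<not> val w 0"
    "tab_horn V W P Tm N A B C \<Longrightarrow> val w A \<Longrightarrow> val w B \<Longrightarrow> val w C"
    "tab_or V x W P Tm N A B \<Longrightarrow> val w A \<or> val w B"
proof -
  show "\<not> val w 0" by (simp add: val_def model_def)
  have c: "cell (Suc (Tm + i)) = int i" "cell (Suc Tm) = 0" "cell (Suc (Suc Tm)) = 1" for i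
      by (simp_all add: cell_def)
  have T1: "1 < n_tapes V" and T0: "0 < n_tapes V" using K2 by simp_all
  note ms = val_code5 model_simps N(2)
  show "tab_or V x W P Tm N A B \<Longrightarrow> val w A \<or> val w B"
  proof (induction rule: tab_or.induct)
    case or_conf
    have "(0, []) \<in> reads V" by (simp add: reads_def)
    then show ?case by (auto simp: ms init_0 intro: exI[of _ 0])
  next
    case (or_head j) then show ?case by (simp add: ms init_0)
  next
    case (or_input i) then show ?case using T0 by (simp add: ms c symb_0 bit_at_def bit_symbol_def)
  next
    case (or_blank j i)
    then have "symb w 0 j (cell i) = 0" using w by (auto simp: symb_0 cell_def less_2_cases_iff)
    then show ?case using or_blank by (simp add: ms)
  next
    case (or_bit i) then show ?case by (simp add: ms)
  next
    case (or_len i) then show ?case by (simp add: ms) linarith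
  qed
  have rd: "r = (state w t, seen w t)" if "val w (conf N t r)" "r \<in> reads V" "t < Tm"
      "length (snd r) = n_tapes V" for r t
  proof -
    have "t < N" "to_nat r < N" using that N(2) by simp_all
    then have "model w 1 t (to_nat r) 0 0" using that(1) by (simp add: val_code5)
    then obtain l where "r = (state w t, take l (seen w t))" by (auto simp: model_def)
    then show ?thesis using that(4) seen(2)[of w t] by simp
  qed
  show "tab_horn V W P Tm N A B C \<Longrightarrow> val w A \<Longrightarrow> val w B \<Longrightarrow> val w C"
  proof (induction rule: tab_horn.induct)
    case (look t j i s)
    then have "cell i = hpos w t j" by (simp add: ms cell_def)
    then show ?case using look by (simp add: ms seen)
  next
    case (collect t r s)
    then obtain l where l: "r = (state w t, take l (seen w t))" by (auto simp: ms)
    with collect have "take (Suc l) (seen w t) = take l (seen w t) @ [seen w t ! l]" "length (snd r) = l"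
      using seen(2)[of w t] by (simp_all add: take_Suc_conv_app_nth min_def split: if_splits)
    with collect l have "(fst r, snd r @ [s]) = (state w t, take (Suc l) (seen w t))" by (simp add: ms)
    then show ?case using collect N(2)[OF reads_appendI[OF collect(2,3,4)]]
      by (simp add: ms) (metis)
  next
    case (state t r)
    obtain q' acts where tr: "total_trans V (state w t, seen w t) = (q', acts)" by fastforce
    have "r = (state w t, seen w t)" using state rd by blast
    then show ?case using trans_seen(1)[OF tr T0] tr state N(2)[OF total_trans_reads[OF state(2,3)]]
      by (auto simp: ms intro: exI[of _ 0])
  next
    case (move t r j i)
    obtain q' acts where tr: "total_trans V (state w t, seen w t) = (q', acts)" by fastforce
    have r: "r = (state w t, seen w t)" using move rd by blast
    have "int i = hpos w t j + int (Suc Tm)" using move by (simp add: ms)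
    moreover from this have "0 < i" using hpos_cell[of t j w] move by simp
    ultimately show ?case using trans_seen(2)[OF tr move(4)] tr move r
      by (auto simp: ms shift_index_def of_nat_diff split: move.split)
  next
    case (put t r j i)
    obtain q' acts where tr: "total_trans V (state w t, seen w t) = (q', acts)" by fastforce
    have r: "r = (state w t, seen w t)" using put rd by blast
    have "cell i = hpos w t j" using put by (simp add: ms cell_def)
    moreover have "fst (acts ! j) < N" using total_trans_symbol[OF put(2,3,4)] r tr by simp
    ultimately show ?case using trans_seen(3)[OF tr put(4)] tr put r by (simp add: ms)
  next
    case (keep t j i i' s)
    obtain q' acts where tr: "total_trans V (state w t, seen w t) = (q', acts)" by fastforce
    have "cell i \<noteq> hpos w t j" using keep by (auto simp: ms cell_def)
    then show ?case using trans_seen(3)[OF tr keep(2)] keep by (simp add: ms)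
  next
    case (bit_true i) then show ?case using T1 by (simp add: ms c symb_0 bit_symbol_def)
  next
    case (bit_false i) then show ?case using T1 by (simp add: ms c symb_0 bit_symbol_def)
  next
    case (bit_none i) then show ?case using T1 by (simp add: ms c symb_0)
  next
    case (bit_next i) then show ?case by (simp add: ms)
  next
    case (halted q)
    moreover from halted have "(q, []) \<in> reads V" by (simp add: reads_def)
    ultimately show ?case using acc by (auto simp: ms)
  next
    case (out_true s) then show ?case using acc T1 by (simp add: ms c)
  next
    case (out_end s) then show ?case using acc T1 by (simp add: ms c)
  qed
qed

lemma tab_or_less: "tab_or V x W P Tm N A B \<Longrightarrow> A < 9 * N * N * N * N \<and> B < 9 * N * N * N * N"
proof (induction rule: tab_or.induct)
  case or_conf
  have "(0, []) \<in> reads V" by (simp add: reads_def)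
  then show ?case by (simp add: code5_less N(2))
qed (use K2 in \<open>simp_all add: code5_less\<close>)

lemma tab_horn_less: "tab_horn V W P Tm N A B C \<Longrightarrow> A < 9 * N * N * N * N \<and> B < 9 * N * N * N * N \<and>
    C < 9 * N * N * N * N"
proof (induction rule: tab_horn.induct)
  case (collect t r s)
  then show ?case using N(2)[OF reads_appendI] by (simp add: code5_less N(2))
next
  case (state t r)
  then show ?case using N(2)[OF total_trans_reads] by (simp add: code5_less N(2))
next
  case (put t r j i)
  then show ?case using total_trans_symbol by (simp add: code5_less N(2))
next
  case (halted q)
  then have "(q, []) \<in> reads V" by (simp add: reads_def)
  then show ?case by (simp add: code5_less N(2))
qed (use K2 in \<open>simp_all add: code5_less N(2)\<close>)

lemma horn_or_sat_tableau:
  "horn_or_sat (9 * N * N * N * N) (tab_horn V W P Tm N) (tab_or V x W P Tm N) \<longleftrightarrow>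
    (\<exists>w. length w \<le> P \<and> state w Tm = n_states V \<and> symb w Tm (n_tapes V - 1) 0 = 2 \<and> symb w Tm (n_tapes V - 1)
        1 = 0)"
    (is "?S \<longleftrightarrow> ?A")
proof
  assume ?S
  then obtain va where "\<not> va 0"
    "\<forall>A<9 * N * N * N * N. \<forall>B<9 * N * N * N * N. \<forall>C<9 * N * N * N * N.
       tab_horn V W P Tm N A B C \<longrightarrow> va A \<longrightarrow> va B \<longrightarrow> va C"
    "\<forall>A<9 * N * N * N * N. \<forall>B<9 * N * N * N * N. tab_or V x W P Tm N A B \<longrightarrow> va A \<or> va B"
    unfolding horn_or_sat_def by blast
  then show ?A by (intro sat_imp_accepts[of va]) (use tab_horn_less tab_or_less in blast)+
next
  assume ?A
  then obtain w where w: "length w \<le> P" "state w Tm = n_states V" "symb w Tm (n_tapes V - 1) 0 = 2"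
      "symb w Tm (n_tapes V - 1) 1 = 0"
    by blast
  show ?S unfolding horn_or_sat_def
    using accepts_imp_sat[OF w] by (intro exI[of _ "val w"]) auto
qed

text \<open>A halted configuration is never left, so Tm can replace the halting time; and outputs
  are unique, so two cells of the last tape decide whether the output is
  \<open>[True]\<close>.\<close>

lemma computes_iff:
  assumes "computes_within V [x, w] y Tm"
  shows "y = [True] \<longleftrightarrow> state w Tm = n_states V \<and> symb w Tm (n_tapes V - 1) 0 = 2 \<and>
      symb w Tm (n_tapes V - 1) 1 = 0"
proof -
  obtain t where t: "t \<le> Tm" "fst (cfg w t) = n_states V" "has_output (cfg w t) y"
    using assms by (auto simp: computes_within_def cfg_def Let_def)
  have "cfg w (t + u) = cfg w t" for u
  proof (induction u)
    case (Suc u)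
    then show ?case using t(2) cfg_Suc[of w "t + u"] by (cases "cfg w t") simp
  qed simp
  then have T: "cfg w Tm = cfg w t" using t(1) by (metis le_add_diff_inverse)
  have l: "last (snd (cfg w t)) = snd (cfg w t) ! (n_tapes V - 1)"
    using run_inv[of w t] K2 by (metis last_conv_nth list.size(3) not_numeral_le_zero)
  have "y = [True] \<longleftrightarrow> has_output (cfg w t) [True]" using t(3) has_output_unique by blast
  also have "\<dots> \<longleftrightarrow> symb w Tm (n_tapes V - 1) 0 = 2 \<and> symb w Tm (n_tapes V - 1) 1 = 0"
    unfolding has_output_def l symb_def T by (cases "snd (cfg w t) ! (n_tapes V - 1)") (simp add:
        bit_symbol_def)
  finally show ?thesis using t(2) T by (simp add: state_def)
qed

end

section \<open>The reduction in polynomial time\<close>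

text \<open>Substitution is simulated by a sum over all i up to F in which only the term i = F
  survives.\<close>

lemma pf_let:
  assumes "pf a F" "pf a (\<lambda>xs v. G xs (\<lambda>i. v (Suc i)) (v 0))"
  shows "pf a (\<lambda>xs v. G xs v (F xs v))"
proof -
  have "pf a (\<lambda>xs v. \<Sum>i<Suc (F xs v). of_bool (i = F xs v) * G xs v i)"
    by (intro pf_sum pf_mult pf_of_bool pp_eq pf_Suc assms pf_var pf_shift)
  then show ?thesis by (rule pf_cong) simp
qed

lemma pf_subst:
  assumes "pf a (\<lambda>xs v. Q xs (v 0) (v (Suc 0)) (v 2))" and F: "pf a F0" "pf a F1" "pf a F2"
  shows "pf a (\<lambda>xs v. Q xs (F0 xs v) (F1 xs v) (F2 xs v))"
proof -
  have 0: "pf a (\<lambda>xs v. Q xs (v 2) (v (Suc 0)) (v 0))"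
    using pf_rename[OF assms(1), of "\<lambda>i. 2 - i"] by (simp add: numeral_2_eq_2)
  have 1: "pf a (\<lambda>xs v. Q xs (v (Suc 0)) (v 0) (F2 xs (\<lambda>i. v (Suc (Suc i)))))"
    by (rule pf_let[where G = "\<lambda>xs v. Q xs (v (Suc 0)) (v 0)"]) (use pf_rename[OF F(3)] 0 in
        \<open>simp_all add: numeral_2_eq_2\<close>)
  have 2: "pf a (\<lambda>xs v. Q xs (v 0) (F1 xs (\<lambda>i. v (Suc i))) (F2 xs (\<lambda>i. v (Suc i))))"
    by (rule pf_let[where G = "\<lambda>xs v x. Q xs (v 0) x (F2 xs (\<lambda>i. v (Suc i)))"]) (use pf_shift[OF F(2)] 1 in
        simp_all)
  show ?thesis
    by (rule pf_let[where G = "\<lambda>xs v x. Q xs x (F1 xs v) (F2 xs v)"]) (use F(1) 2 in simp_all)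
qed

lemma pp_subst:
  assumes "pp a (\<lambda>xs v. Q xs (v 0) (v (Suc 0)) (v 2))" "pf a F0" "pf a F1" "pf a F2"
  shows "pp a (\<lambda>xs v. Q xs (F0 xs v) (F1 xs v) (F2 xs v))"
  using pf_subst[of a "\<lambda>xs x y z. of_bool (Q xs x y z)"] assms by (simp add: pp_def)

lemma pp_subst2:
  assumes "pp a (\<lambda>xs v. Q xs (v 0) (v (Suc 0)))" "pf a F0" "pf a F1"
  shows "pp a (\<lambda>xs v. Q xs (F0 xs v) (F1 xs v))"
  using pp_subst[of a "\<lambda>xs x y z. Q xs x y"] assms by blast

lemma pf_subst2:
  assumes "pf a (\<lambda>xs v. Q xs (v 0) (v (Suc 0)))" "pf a F0" "pf a F1"
  shows "pf a (\<lambda>xs v. Q xs (F0 xs v) (F1 xs v))"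
  using pf_subst[of a "\<lambda>xs x y z. Q xs x y"] assms by blast

text \<open>The inductive definition becomes a combination of bounded quantifiers and finite
  disjunctions, which the closure rules for \<open>pp\<close> can handle. The quantifiers over
  \<open>reads V\<close> stand outside because each of their instances is a different
  expression.\<close>

lemma tab_horn_iff:
  "tab_horn V W P Tm N A B C \<longleftrightarrow>
    (\<exists>t<Suc Tm. \<exists>j<n_tapes V. \<exists>i<W. \<exists>s<n_symbols V.
       A = headat N t j i \<and> B = content_at N t j i s \<and> C = look N t j s) \<or>
    (\<exists>r\<in>reads V. \<exists>s\<in>{..<n_symbols V}. \<exists>t<Suc Tm. length (snd r) < n_tapes V \<and>
       A = conf N t r \<and> B = look N t (length (snd r)) s \<and> C = conf N t (fst r, snd r @ [s])) \<or>
    (\<exists>r\<in>reads V. \<exists>t<Tm. length (snd r) = n_tapes V \<and> A = conf N t r \<and>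
       B = conf N t r \<and> C = conf N (Suc t) (fst (total_trans V r), [])) \<or>
    (\<exists>r\<in>reads V. \<exists>j\<in>{..<n_tapes V}. \<exists>t<Tm. \<exists>i<W. length (snd r) = n_tapes V \<and> A = conf N t r \<and> B = headat N t
        j i \<and>
       (C = headat N (Suc t) j (shift_index (snd (snd (total_trans V r) ! j)) i) \<or>
        C = content_at N (Suc t) j i (fst (snd (total_trans V r) ! j)))) \<or>
    (\<exists>t<Tm. \<exists>j<n_tapes V. \<exists>i<W. \<exists>i'<W. \<exists>s<n_symbols V. i \<noteq> i' \<and>
       A = content_at N t j i s \<and> B = headat N t j i' \<and> C = content_at N (Suc t) j i s) \<or>
    (\<exists>i<P. A = wit N 5 i \<and> B = wit N 7 i \<and> C = content_at N 0 1 (Suc Tm + i) 2 \<or>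
       A = wit N 6 i \<and> B = wit N 7 i \<and> C = content_at N 0 1 (Suc Tm + i) 1 \<or>
       A = wit N 8 i \<and> B = wit N 8 i \<and> (C = content_at N 0 1 (Suc Tm + i) 0 \<or> Suc i < P \<and> C = wit N 8
           (Suc i))) \<or>
    B = A \<and> C = 0 \<and>
      ((\<exists>q\<in>{..<n_states V}. A = conf N Tm (q, [])) \<or>
       (\<exists>s<n_symbols V. s \<noteq> 2 \<and> A = content_at N Tm (n_tapes V - 1) (Suc Tm) s) \<or>
       (\<exists>s<n_symbols V. s \<noteq> 0 \<and> A = content_at N Tm (n_tapes V - 1) (Suc (Suc Tm)) s))" (is "?L \<longleftrightarrow> ?R")
proof
  show "?L \<Longrightarrow> ?R"
  proof (induction rule: tab_horn.induct)
    case look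
    then show ?case by - (rule disjI1, (unfold lessThan_iff)?, blast)
  next
    case collect
    then show ?case by - (rule disjI2, rule disjI1, (unfold lessThan_iff)?, blast)
  next
    case state
    then show ?case by - (rule disjI2, rule disjI2, rule disjI1, (unfold lessThan_iff)?, blast)
  next
    case move
    then show ?case by - (rule disjI2, rule disjI2, rule disjI2, rule disjI1, (unfold lessThan_iff)?, blast)
  next
    case put
    then show ?case by - (rule disjI2, rule disjI2, rule disjI2, rule disjI1, (unfold lessThan_iff)?, blast)
  next
    case keep
    then show ?case by - (rule disjI2, rule disjI2, rule disjI2, rule disjI2, rule disjI1,
        (unfold lessThan_iff)?, blast)
  next
    case bit_true
    then show ?case by - (rule disjI2, rule disjI2, rule disjI2, rule disjI2, rule disjI2, rule disjI1,
        (unfold lessThan_iff)?, blast)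
  next
    case bit_false
    then show ?case by - (rule disjI2, rule disjI2, rule disjI2, rule disjI2, rule disjI2, rule disjI1,
        (unfold lessThan_iff)?, blast)
  next
    case bit_none
    then show ?case by - (rule disjI2, rule disjI2, rule disjI2, rule disjI2, rule disjI2, rule disjI1,
        (unfold lessThan_iff)?, blast)
  next
    case bit_next
    then show ?case by - (rule disjI2, rule disjI2, rule disjI2, rule disjI2, rule disjI2, rule disjI1,
        (unfold lessThan_iff)?, blast)
  next
    case halted
    then show ?case by - (rule disjI2, rule disjI2, rule disjI2, rule disjI2, rule disjI2, rule disjI2,
        (unfold lessThan_iff)?, blast)
  next
    case out_true
    then show ?case by - (rule disjI2, rule disjI2, rule disjI2, rule disjI2, rule disjI2, rule disjI2,
        (unfold lessThan_iff)?, blast)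
  next
    case out_end
    then show ?case by - (rule disjI2, rule disjI2, rule disjI2, rule disjI2, rule disjI2, rule disjI2,
        (unfold lessThan_iff)?, blast)
  qed
  show "?R \<Longrightarrow> ?L" by (elim disjE exE conjE bexE; hypsubst; (unfold lessThan_iff)?; intro tab_horn.intros;
      assumption)
qed

lemma tab_or_iff:
  "tab_or V x W P Tm N A B \<longleftrightarrow>
    A = B \<and> (A = conf N 0 (0, []) \<or> (\<exists>j<n_tapes V. A = headat N 0 j (Suc Tm)) \<or>
      (\<exists>i<length x. A = content_at N 0 0 (Suc Tm + i) (if bit_at x i then 2 else 1)) \<or>
      (\<exists>j<n_tapes V. \<exists>i<W. (i < Suc Tm \<or> j = 0 \<and> Suc Tm + length x \<le> i \<or> j = 1 \<and> Suc Tm + P \<le> i \<or> 1 < j) \<and>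
         A = content_at N 0 j i 0)) \<or>
    (\<exists>i<P. A = wit N 5 i \<and> B = wit N 6 i \<or> A = wit N 7 i \<and> B = wit N 8 i)" (is "?L \<longleftrightarrow> ?R")
proof
  show "?L \<Longrightarrow> ?R" by (cases rule: tab_or.cases, assumption) blast+
  show "?R \<Longrightarrow> ?L" by (elim disjE exE conjE; hypsubst; intro tab_or.intros; (assumption | simp))
qed

lemma pf_shift_index: "pf a F \<Longrightarrow> pf a (\<lambda>xs v. shift_index m (F xs v))"
  by (cases m) (auto simp: shift_index_def intro!: pf_sub pf_Suc pf_const)

lemma pf_code5:
  "\<lbrakk>pf a N; pf a A; pf a B; pf a C; pf a D; pf a E\<rbrakk> \<Longrightarrow>
    pf a (\<lambda>xs v. code5 (N xs v) (A xs v) (B xs v) (C xs v) (D xs v) (E xs v))"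
  unfolding code5_def by (intro pf_add pf_mult)

lemma pp_tab_horn:
  assumes [intro]: "pf a (\<lambda>xs v. W xs)" "pf a (\<lambda>xs v. P xs)" "pf a (\<lambda>xs v. Tm xs)" "pf a (\<lambda>xs v. N xs)"
  shows "pp a (\<lambda>xs v. tab_horn V (W xs) (P xs) (Tm xs) (N xs) (v 0) (v (Suc 0)) (v 2))"
  unfolding tab_horn_iff
  by (intro pf_intros pf_code5 pf_shift_index pp_Ex_finite finite_reads finite_lessThan assms)

lemma pp_tab_or:
  assumes "0 < a" "pf a (\<lambda>xs v. W xs)" "pf a (\<lambda>xs v. P xs)" "pf a (\<lambda>xs v. Tm xs)" "pf a (\<lambda>xs v. N xs)"
  shows "pp a (\<lambda>xs v. tab_or V (xs ! 0) (W xs) (P xs) (Tm xs) (N xs) (v 0) (v (Suc 0)))"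
  unfolding tab_or_iff
  by (intro pf_intros pf_code5 pp_bit_at pf_length assms)

lemma pf_rel_code:
  assumes "pf a (\<lambda>xs v. M xs)" "pp a (\<lambda>xs v. horn xs (v 0) (v (Suc 0)) (v 2))"
      "pp a (\<lambda>xs v. or2 xs (v 0) (v (Suc 0)))"
  shows "pf a (\<lambda>xs v. rel_code \<Delta> (M xs) (horn xs) (or2 xs) (v 0) (v (Suc 0)))"
  unfolding rel_code_def rel_eq_def rel_two_def rel_one_def rel_both_def horn_at_def or_at_def
  by (intro pf_intros assms(1) pp_subst[OF assms(2)] pp_subst2[OF assms(3)])

section \<open>Binary digits and the code of an instance as output\<close>

lemma div_pow_eq_0_iff: "n div 2 ^ i = 0 \<longleftrightarrow> length (binary n) \<le> i"
proof (induction n arbitrary: i rule: binary.induct)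
  case (1 n)
  show ?case
  proof (cases "n = 0")
    case False
    show ?thesis
    proof (cases i)
      case 0
      then show ?thesis using False by (subst binary.simps) simp
    next
      case (Suc j)
      then show ?thesis using False 1[of j] by (subst binary.simps) (simp add: div_mult2_eq)
    qed
  qed (simp add: binary.simps)
qed

lemma binary_conv: "binary n = map (\<lambda>i. odd (n div 2 ^ i)) [0..<length (binary n)]"
proof (induction n rule: binary.induct)
  case (1 n)
  show ?case
  proof (cases "n = 0")
    case False
    have "map (\<lambda>i. odd (n div 2 ^ i)) [0..<Suc l] = odd n # map (\<lambda>i. odd (n div 2 div 2 ^ i)) [0..<l]" for l
      by (simp add: upt_conv_Cons map_Suc_upt[symmetric] div_mult2_eq del: upt_Suc)
    moreover have "binary n = odd n # binary (n div 2)" using False by (subst binary.simps) simp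
    ultimately show ?thesis using 1[OF False] by simp
  qed (simp add: binary.simps)
qed

lemma length_binary_le: "length (binary n) \<le> n"
  using div_pow_eq_0_iff[of n n] by simp

text \<open>The power of 2 may be too large for a counter. Halving E times never exceeds F, so the
  cap of the recursion has no effect on the values.\<close>

lemma pf_div_pow: "\<lbrakk>pf a F; pf a E\<rbrakk> \<Longrightarrow> pf a (\<lambda>xs v. F xs v div 2 ^ E xs v)"
proof -
  assume F: "pf a F" and E: "pf a E"
  have *: "rec_nat n (\<lambda>i x. min n (x div 2)) e = n div 2 ^ e" for n e :: nat
  proof (induction e)
    case (Suc e)
    have "n div 2 ^ e div 2 \<le> n" by (meson div_le_dividend le_trans)
    then show ?case using Suc by (simp add: div_mult2_eq[symmetric] mult.commute)
  qed simp
  have "pf a (\<lambda>xs v. rec_nat (F xs v) (\<lambda>i x. min (F xs v) (x div 2)) (E xs v))"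
    by (rule pf_rec[where S = "\<lambda>xs v i x. x div 2"]) (intro F E pf_intros)+
  then show ?thesis by (simp only: *)
qed

lemma pf_length_binary: "pf a F \<Longrightarrow> pf a (\<lambda>xs v. length (binary (F xs v)))"
proof -
  assume F: "pf a F"
  have "length (binary n) = (\<Sum>i<n. of_bool (n div 2 ^ i \<noteq> 0))" for n
  proof -
    have "(\<Sum>i<n. of_bool (n div 2 ^ i \<noteq> 0)) = card {i. i < n \<and> i < length (binary n)}"
      by (simp add: div_pow_eq_0_iff not_le Collect_conj_eq lessThan_def[symmetric])
    also have "{i. i < n \<and> i < length (binary n)} = {..<length (binary n)}" using length_binary_le[of n]
        by auto
    finally show ?thesis by simp
  qed
  moreover have "pf a (\<lambda>xs v. \<Sum>i<F xs v. of_bool (F xs v div 2 ^ i \<noteq> 0))"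
    by (intro pf_intros pf_div_pow F pf_shift[OF F])
  ultimately show ?thesis by simp
qed

lemma product_upt: "List.product [0..<m] [0..<n] = map (\<lambda>i. (i div n, i mod n)) [0..<m * n]"
proof (cases "n = 0")
  case False
  show ?thesis
  proof (induction m)
    case (Suc m)
    have "map (\<lambda>i. (i div n, i mod n)) [m * n..<m * n + n] = map (\<lambda>j. (m, j)) [0..<n]"
      using False by (intro nth_equalityI) simp_all
    moreover have "[0..<Suc m * n] = [0..<m * n] @ [m * n..<m * n + n]"
      using upt_add_eq_append[of 0 "m * n" n] by (simp add: add.commute)
    ultimately show ?case using Suc by (simp add: product_concat_map)
  qed simp
qed (simp add: product_concat_map)

lemma concat_map_upt_add:
  "concat (map h [0..<m + n]) = concat (map h [0..<m]) @ concat (map (\<lambda>i. h (m + i)) [0..<n])"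
proof -
  have "map h [m..<m + n] = map (\<lambda>i. h (m + i)) [0..<n]" by (rule nth_equalityI) simp_all
  then show ?thesis using upt_add_eq_append[of 0 m n] by simp
qed

lemma concat_encode_nat:
  "encode_nat n = concat (map (\<lambda>i. if i < length (binary n) then [True, odd (n div 2 ^ i)] else [False])
      [0..<length (binary n) + 1])"
proof -
  have "concat (map (\<lambda>b. [True, b]) (binary n)) = concat (map (\<lambda>i. [True, odd (n div 2 ^ i)]) [0..<length
      (binary n)])"
    by (subst binary_conv) (simp add: comp_def)
  also have "\<dots> = concat (map (\<lambda>i. if i < length (binary n) then [True, odd (n div 2 ^ i)] else [False])
      [0..<length (binary n)])"
    by (rule arg_cong[of _ _ concat]) simp
  finally show ?thesis by (simp add: encode_nat_def)
qed

fun decode_bound :: "nat \<Rightarrow> bool list" where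
  "decode_bound 0 = [False]"
| "decode_bound (Suc d) = True # encode_nat d"

lemma polytime_cong: "polytime a f \<Longrightarrow> (\<And>xs. length xs = a \<Longrightarrow> f xs = g xs) \<Longrightarrow> polytime a g"
  by (simp add: polytime_def)

text \<open>The period and the bound R on the entries are constants, so every piece of the code is a
  word from a finite table and only the index of the piece has to be computed.\<close>

lemma polytime_encode:
  assumes n: "pf a (\<lambda>xs v. n xs)" and arc: "pp a (\<lambda>xs v. arc xs (v 0) (v (Suc 0)))"
    and d: "pf a (\<lambda>xs v. d xs (v 0) (v (Suc 0)))" and R: "\<And>xs u v. d xs u v < R"
  shows "polytime a (\<lambda>xs. encode_nat (n xs) @ map (\<lambda>(u, v). arc xs u v) (List.product [0..<n xs] [0..<n xs]) @
    concat (map (\<lambda>(u, v). decode_bound (d xs u v)) (List.product [0..<n xs] [0..<n xs])) @ encode_nat \<Delta>)"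
    (is "polytime a ?f")
proof -
  \<comment> \<open>Indices 0 and 1 are the bit pairs of a number, 2 and 3 are single bits, where 2
    also ends a number; 4 is the code of the period, and 5 + e the code of the entry e.\<close>
  define tab where "tab u = (if u = 0 then [True, False] else if u = 1 then [True, True] else if u =
      2 then [False] else
     if u = 3 then [True] else if u = 4 then encode_nat \<Delta> else
         if u < 5 + R then decode_bound (u - 5) else [])" for u
  let ?l = "\<lambda>xs. length (binary (n xs))"
  let ?F = "\<lambda>xs v. ?l xs + 1 + (n xs * n xs + (n xs * n xs + 1))"
  let ?g = "\<lambda>xs i. if i < ?l xs then of_bool (odd (n xs div 2 ^ i)) else if i < ?l xs + 1 then 2
     else if i < ?l xs + 1 + n xs * n xs then (let j = i - (?l xs + 1) in
         if arc xs (j div n xs) (j mod n xs) then 3 else 2)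
     else if i < ?l xs + 1 + n xs * n xs + n xs * n xs then (let j = i - (?l xs + 1 + n xs * n xs) in 5 + d xs
         (j div n xs) (j mod n xs)) else 4"
  have "polytime a (\<lambda>xs. concat (map (\<lambda>i. tab (?g xs i)) [0..<?F xs (\<lambda>_. 0)]))"
    unfolding Let_def
    by (rule polytime_concat[where K = "5 + R" and G = "\<lambda>xs v. ?g xs (v 0)", unfolded Let_def])
      (simp_all only: tab_def, intro pf_intros pf_length_binary pf_div_pow n pp_subst2[OF arc] pf_subst2[OF
          d], 
        intro pf_intros pf_length_binary pf_div_pow n pp_subst2[OF arc] pf_subst2[OF d], simp)
  moreover have "concat (map (\<lambda>i. tab (?g xs i)) [0..<?F xs (\<lambda>_. 0)]) = ?f xs" for xs
  proof -
    have tabs: "tab (of_bool b) = [True, b]" "tab 2 = [False]" "tab (if b then 3 else 2) = [b]"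
        "tab 4 = encode_nat \<Delta>"
      "e < R \<Longrightarrow> tab (5 + e) = decode_bound e" for b e
      by (simp_all add: tab_def)
    have "map (\<lambda>i. tab (?g xs i)) [0..<?l xs + 1] = map (\<lambda>i. if i < ?l xs then [True, odd (n xs div 2 ^ i)]
        else [False]) [0..<?l xs + 1]"
      by (rule map_cong) (auto simp: tabs)
    then have 1: "concat (map (\<lambda>i. tab (?g xs i)) [0..<?l xs + 1]) = encode_nat (n xs)"
      unfolding concat_encode_nat by (rule arg_cong)
    have m2: "map (\<lambda>i. tab (?g xs (?l xs + 1 + i))) [0..<n xs * n xs] =
        map (\<lambda>i. [arc xs (i div n xs) (i mod n xs)]) [0..<n xs * n xs]"
      by (rule map_cong) (simp_all add: tabs)
    have 2: "concat (map (\<lambda>i. tab (?g xs (?l xs + 1 + i))) [0..<n xs * n xs]) =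
        map (\<lambda>(u, v). arc xs u v) (List.product [0..<n xs] [0..<n xs])"
      unfolding m2 product_upt by (simp add: comp_def)
    have m3: "map (\<lambda>i. tab (?g xs (?l xs + 1 + (n xs * n xs + i)))) [0..<n xs * n xs] =
        map (\<lambda>i. decode_bound (d xs (i div n xs) (i mod n xs))) [0..<n xs * n xs]"
      by (rule map_cong) (simp_all add: tabs R add.assoc[symmetric])
    have 3: "concat (map (\<lambda>i. tab (?g xs (?l xs + 1 + (n xs * n xs + i)))) [0..<n xs * n xs]) =
        concat (map (\<lambda>(u, v). decode_bound (d xs u v)) (List.product [0..<n xs] [0..<n xs]))"
      unfolding m3 product_upt by (simp add: comp_def)
    have 4: "concat (map (\<lambda>i. tab (?g xs (?l xs + 1 + (n xs * n xs + (n xs * n xs + i))))) [0..<1]) =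
        encode_nat \<Delta>"
      by (simp add: tabs)
    show ?thesis unfolding concat_map_upt_add[of _ "?l xs + 1"] concat_map_upt_add[of _ "n xs * n xs"] 1 2 3 4
        ..
  qed
  ultimately show ?thesis by simp
qed

lemma encode_nat_append_eq: "encode_nat m @ xs = encode_nat n @ ys \<longleftrightarrow> m = n \<and> xs = ys"
proof
  have *: "concat (map (\<lambda>b. [True, b]) bs) @ False # xs = concat (map (\<lambda>b. [True, b]) cs) @ False # ys \<Longrightarrow> bs =
      cs \<and> xs = ys" for bs cs
  proof (induction bs arbitrary: cs)
    case Nil
    then show ?case by (cases cs) auto
  next
    case (Cons b bs)
    then show ?case by (cases cs) auto
  qed
  have inj: "binary m = binary n \<Longrightarrow> m = n" for m n
  proof (induction m arbitrary: n rule: binary.induct)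
    case (1 m)
    show ?case
    proof (cases "m = 0 \<or> n = 0")
      case True
      then show ?thesis using 1(2) by (auto simp: binary.simps[of m] binary.simps[of n] split: if_splits)
    next
      case False
      then have "odd m = odd n" "binary (m div 2) = binary (n div 2)"
        using 1(2) by (simp_all add: binary.simps[of m] binary.simps[of n])
      moreover from this have "m div 2 = n div 2" using False 1(1) by blast
      ultimately show ?thesis by (metis dvd_mult_div_cancel odd_two_times_div_two_succ)
    qed
  qed
  assume "encode_nat m @ xs = encode_nat n @ ys"
  then show "m = n \<and> xs = ys" using *[of "binary m" "binary n"] inj[of m n] by (simp add: encode_nat_def)
qed simp

lemma encode_enat_append_eq: "encode_enat d @ xs = encode_enat e @ ys \<longleftrightarrow> d = e \<and> xs = ys"
  by (cases d; cases e) (auto simp: encode_enat_def encode_nat_append_eq)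

lemma concat_encode_enat_eq:
  "concat (map (\<lambda>(u, v). encode_enat (D u v)) ps) @ xs = concat (map (\<lambda>(u, v). encode_enat (E u v)) ps) @ ys \<Longrightarrow>
    (\<forall>(u, v)\<in>set ps. D u v = E u v) \<and> xs = ys"
  by (induction ps) (auto simp: encode_enat_append_eq split: prod.splits)

text \<open>Membership in the language only says that some instance has the given code, so the
  reduction needs unique readability. The matrix is recovered on the vertices, which is where it
  matters.\<close>

lemma encode_DiTTR_inject:
  assumes eq: "encode_DiTTR G D \<Delta> = encode_DiTTR G' D' \<Delta>'"
    and G: "pverts G = {..<card (pverts G)}" "bidirected_tree G"
    and G': "pverts G' = {..<card (pverts G')}" "bidirected_tree G'"
  shows "G = G'" "\<And>u v. u \<in> pverts G \<Longrightarrow> v \<in> pverts G \<Longrightarrow> D u v = D' u v" "\<Delta> = \<Delta>'"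
proof -
  have n: "card (pverts G) = card (pverts G')" using eq
      by (simp add: encode_DiTTR_def Let_def encode_nat_append_eq)
  let ?n = "card (pverts G)"
  let ?ps = "List.product [0..<?n] [0..<?n]"
  have e: "map (\<lambda>uv. uv \<in> parcs G) ?ps @ concat (map (\<lambda>(u, v). encode_enat (D u v)) ?ps) @ encode_nat \<Delta> =
      map (\<lambda>uv. uv \<in> parcs G') ?ps @ concat (map (\<lambda>(u, v). encode_enat (D' u v)) ?ps) @ encode_nat \<Delta>'"
    using eq by (simp add: encode_DiTTR_def Let_def encode_nat_append_eq n[symmetric])
  then have a: "uv \<in> parcs G \<longleftrightarrow> uv \<in> parcs G'" if "uv \<in> set ?ps" for uv using that by auto
  have wf: "parcs G \<subseteq> set ?ps" "parcs G' \<subseteq> set ?ps"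
    using tree_graphD(5)[OF G(2)] tree_graphD(5)[OF G'(2)] G(1) G'(1) n by (auto simp: image_subset_iff) 
  have "pverts G = pverts G'" using G(1) G'(1) n by simp
  moreover have "parcs G = parcs G'" using a wf by blast
  ultimately show "G = G'" by simp
  have "concat (map (\<lambda>(u, v). encode_enat (D u v)) ?ps) @ encode_nat \<Delta> =
      concat (map (\<lambda>(u, v). encode_enat (D' u v)) ?ps) @ encode_nat \<Delta>'"
    using e by simp
  from concat_encode_enat_eq[OF this] have *: "\<forall>(u, v)\<in>set ?ps. D u v = D' u v" "encode_nat \<Delta> = encode_nat \<Delta>'"
      by blast+
  from *(2) show "\<Delta> = \<Delta>'" using encode_nat_append_eq[of \<Delta> "[]" \<Delta>' "[]"] by simp
  show "D u v = D' u v" if "u \<in> pverts G" "v \<in> pverts G" for u v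
  proof -
    have "u < ?n" "v < ?n" using that G(1) by (metis lessThan_iff)+
    then show ?thesis using * by auto
  qed
qed

section \<open>Computing the constructed instance\<close>

context critical
begin

lemma off_less: "off v < \<beta>"
  by (simp add: off_def \<beta>_def)

lemma pf_blk: "pf c F \<Longrightarrow> pf c (\<lambda>xs v. blk (F xs v))" and pf_off: "pf c F \<Longrightarrow> pf c (\<lambda>xs v. off (F xs v))"
  unfolding blk_def off_def by (intro pf_intros, assumption)+

text \<open>There are only finitely many pairs of offsets, so an arbitrary function of them can be
  tabulated.\<close>

lemma pf_local:
  fixes g :: "nat \<Rightarrow> nat \<Rightarrow> nat"
  assumes "pf c F" "pf c G"
  shows "pf c (\<lambda>xs v. g (off (F xs v)) (off (G xs v)))"
proof -
  have "pf c (\<lambda>xs v. if off (F xs v) * \<beta> + off (G xs v) < \<beta> * \<beta>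
      then g ((off (F xs v) * \<beta> + off (G xs v)) div \<beta>) ((off (F xs v) * \<beta> + off (G xs v)) mod \<beta>) else 0)"
    by (rule pf_table[of _ _ _ "\<lambda>z. g (z div \<beta>) (z mod \<beta>)"]) (intro pf_intros pf_off assms)
  then show ?thesis
  proof (rule pf_cong)
    fix xs v
    have "off x * \<beta> + off y < \<beta> * \<beta>" for x y by (intro mult_add_less off_less)
    then show "(if off (F xs v) * \<beta> + off (G xs v) < \<beta> * \<beta>
      then g ((off (F xs v) * \<beta> + off (G xs v)) div \<beta>) ((off (F xs v) * \<beta> + off (G xs v)) mod \<beta>) else 0) =
      g (off (F xs v)) (off (G xs v))"
      using off_less[of "G xs v"] by simp
  qed
qed

lemma pp_is_arc: "pp c (\<lambda>xs v. is_arc (v 0) (v (Suc 0)))"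
proof -
  have "pp c (\<lambda>xs v. local_arc (off (v 0)) (off (v (Suc 0))))"
    unfolding pp_def by (rule pf_local[of _ _ _ "\<lambda>x y. of_bool (local_arc x y)"]) (intro pf_var)+
  then show ?thesis unfolding is_arc_def by (intro pf_intros pf_blk pf_off)
qed

lemma pf_req:
  assumes "pf c (\<lambda>xs v. rc xs (v 0) (v (Suc 0)))"
  shows "pf c (\<lambda>xs v. req (rc xs) (v 0) (v (Suc 0)))"
  unfolding req_def by (intro pf_intros pf_blk pf_off pf_local pf_subst2[OF assms])

text \<open>The constant bound does not depend on the instance; \<open>polytime_encode\<close> needs
  it for its finite table of codes.\<close>

lemma ex_req_less: "\<exists>R. \<forall>rc u v. (\<forall>i j. rc i j \<le> B) \<longrightarrow> req rc u v < R"
proof -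
  let ?m = "Max ((\<lambda>(x, y). local_req x y) ` ({..<\<beta>} \<times> {..<\<beta>}))"
  have "local_req (off u) (off v) \<le> ?m" for u v
    using off_less[of u] off_less[of v] by (intro Max_ge) auto
  then have "local_req (off u) (off v) < ?m + L + 4 + s + B" for u v by (rule le_less_trans) simp
  moreover have "L + 3 + s + c < ?m + L + 4 + s + B" if "c \<le> B" for c using that by simp
  ultimately have "req rc u v < ?m + L + 4 + s + B" if "\<forall>i j. rc i j \<le> B" for rc u v
    using that unfolding req_def by (simp add: less_Suc_eq_le trans_le_add2)
  then show ?thesis by blast
qed

lemma encode_graph:
  "encode_DiTTR (graph m) (bound rc) \<Delta> = encode_nat (size_of m) @
    map (\<lambda>(u, v). is_arc u v) (List.product [0..<size_of m] [0..<size_of m]) @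
    concat (map (\<lambda>(u, v). decode_bound (req rc u v)) (List.product [0..<size_of m] [0..<size_of m])) @
        encode_nat \<Delta>"
proof -
  have "encode_enat (bound rc u v) = decode_bound (req rc u v)" for u v
    by (cases "req rc u v") (simp_all add: bound_def encode_enat_def)
  moreover have "map (\<lambda>uv. uv \<in> parcs (graph m)) (List.product [0..<size_of m] [0..<size_of m]) =
      map (\<lambda>(u, v). is_arc u v) (List.product [0..<size_of m] [0..<size_of m])"
    by (rule map_cong) (auto simp: graph_def)
  ultimately show ?thesis by (simp add: encode_DiTTR_def Let_def graph_def)
qed

theorem tableau_reduction:
  assumes D: "3 \<le> \<Delta>" and X: "in_NP X"
  shows "\<exists>f rc m. polytime 1 (\<lambda>xs. f (hd xs)) \<and>
    (\<forall>x. f x = encode_DiTTR (graph (m x)) (bound (rc x)) \<Delta> \<and> (x \<in> X \<longleftrightarrow> csp \<Delta> (m x) (rc x)))"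
proof -
  from X obtain Vf p where Vf: "polytime 2 Vf"
      and Lp: "\<And>x. x \<in> X \<longleftrightarrow> (\<exists>w. length w \<le> poly p (length x) \<and> Vf [x, w] = [True])"
    unfolding in_NP_def by blast
  from Vf obtain V q where V: "wf_tm V" "2 \<le> n_tapes V"
    and comp: "\<And>xs. length xs = 2 \<Longrightarrow> computes_within V xs (Vf xs) (poly q (sum_list (map length xs)))"
    unfolding polytime_def by blast
  define P where "P x = poly p (length x)" for x :: "bool list"
  define Tm where "Tm x = poly q (length x + P x)" for x :: "bool list"
  define W where "W x = 2 * Tm x + length x + P x + 5" for x :: "bool list"
  \<comment> \<open>The numbers of the readings in \<open>reads V\<close> are bounded by a constant
    that depends on V only, so N stays polynomial.\<close>
  define N where "N x = W x + n_tapes V + n_symbols V + 10 + Suc (Max (to_nat ` reads V))"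
      for x :: "bool list"
  define M where "M x = 9 * N x * N x * N x * N x" for x :: "bool list"
  define horn where "horn x = tab_horn V (W x) (P x) (Tm x) (N x)" for x
  define or2 where "or2 x = tab_or V x (W x) (P x) (Tm x) (N x)" for x
  define rc where "rc x = rel_code \<Delta> (M x) (horn x) (or2 x)" for x
  define m where "m x = 16 * M x ^ 3" for x
  define f where "f x = encode_DiTTR (graph (m x)) (bound (rc x)) \<Delta>" for x
  have tb: "tableau V x (W x) (P x) (Tm x) (N x)" for x
  proof
    show "to_nat r < N x" if "r \<in> reads V" for r
      using that Max_ge[OF finite_imageI[OF finite_reads], of "to_nat r" to_nat V] by (simp add: N_def)
  qed (use V in \<open>simp_all add: W_def N_def\<close>)
  have "x \<in> X \<longleftrightarrow> csp \<Delta> (m x) (rc x)" for x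
  proof -
    interpret tableau V x "W x" "P x" "Tm x" "N x" by (rule tb)
    have "Vf [x, w] = [True] \<longleftrightarrow> state w (Tm x) = n_states V \<and> symb w (Tm x) (n_tapes V - 1) 0 = 2 \<and>
        symb w (Tm x) (n_tapes V - 1) 1 = 0"
      if "length w \<le> P x" for w
    proof (rule computes_iff)
      have "poly q (length x + length w) \<le> Tm x" unfolding Tm_def by (rule poly_nat_mono) (use that in simp)
      then show "computes_within V [x, w] (Vf [x, w]) (Tm x)"
        using comp[of "[x, w]"] unfolding computes_within_def by (auto intro: le_trans)
    qed
    then have "x \<in> X \<longleftrightarrow> horn_or_sat (M x) (horn x) (or2 x)"
      unfolding Lp M_def horn_def or2_def horn_or_sat_tableau P_def[symmetric] by blast
    also have "\<dots> \<longleftrightarrow> csp \<Delta> (m x) (rc x)"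
      unfolding m_def rc_def by (rule csp_horn_or_sat[symmetric]) (use D in \<open>simp_all add: M_def N_def\<close>)
    finally show ?thesis .
  qed
  moreover have "polytime 1 (\<lambda>xs. f (hd xs))"
  proof -
    have pP: "pf 1 (\<lambda>xs v. P (xs ! 0))" unfolding P_def by (intro pf_poly pf_length) simp
    have pT: "pf 1 (\<lambda>xs v. Tm (xs ! 0))" unfolding Tm_def by (intro pf_poly pf_add pf_length pP) simp
    have pW: "pf 1 (\<lambda>xs v. W (xs ! 0))" unfolding W_def by (intro pf_intros pf_length pP pT) simp
    have pN: "pf 1 (\<lambda>xs v. N (xs ! 0))" unfolding N_def by (intro pf_intros pW)
    have pM: "pf 1 (\<lambda>xs v. M (xs ! 0))" unfolding M_def by (intro pf_intros pN)
    have pm: "pf 1 (\<lambda>xs v. size_of (m (xs ! 0)))" unfolding m_def size_of_def power3_eq_cube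
        by (intro pf_intros pM)
    have prc: "pf 1 (\<lambda>xs v. rc (xs ! 0) (v 0) (v (Suc 0)))"
      unfolding rc_def horn_def or2_def
      by (intro pf_rel_code pM pp_tab_horn pp_tab_or pW pP pT pN) simp
    have "rc x i j \<le> \<Delta> + 2" for x i j unfolding rc_def rel_code_def
        by (simp split del: if_split) (auto split: if_split)
    then obtain R where R: "req (rc x) u v < R" for x u v using ex_req_less[of "\<Delta> + 2"] by blast
    have "polytime 1 (\<lambda>xs. encode_nat (size_of (m (xs ! 0))) @
        map (\<lambda>(u, v). is_arc u v) (List.product [0..<size_of (m (xs ! 0))] [0..<size_of (m (xs ! 0))]) @
        concat (map (\<lambda>(u, v). decode_bound (req (rc (xs ! 0)) u v)) (List.product [0..<size_of (m (xs ! 0))]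
            [0..<size_of (m (xs ! 0))])) @
        encode_nat \<Delta>)"
      by (rule polytime_encode[OF pm pp_is_arc pf_req[OF prc] R])
    then show ?thesis
      unfolding encode_graph[symmetric] f_def[symmetric]
      by (rule polytime_cong) (metis hd_conv_nth list.size(3) zero_neq_one)
  qed
  ultimately show ?thesis using f_def by blast
qed

end

text \<open>One reduction serves both problems, as its instances have period \<Delta> and slack at
  least k. The converse direction uses that a code determines its instance.\<close>

theorem NP_hard_DiTTR:
  assumes D: "\<Delta> > k + 2 \<or> (\<Delta> = k + 2 \<and> odd \<Delta>)"
  shows "NP_hard (DiTTR_fixed \<Delta> k)" and "NP_hard DiTTR"
proof -
  obtain T :: "nat pair_pre_digraph" and \<tau> S a b s l0 where c: "bidirected_tree T \<and> pverts T = {..<\<tau>} \<and>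
    S \<subseteq> {(x, y). x < \<tau> \<and> y < \<tau> \<and> x \<noteq> y} \<and> a < \<tau> \<and> b < \<tau> \<and> a \<noteq> b \<and> k < s \<and>
    (\<forall>e. l0 e < \<Delta>) \<and> (\<forall>(x, y)\<in>S. slack \<Delta> l0 (tree_path T x y) \<le> k) \<and> slack \<Delta> l0 (tree_path T a b) = s \<and>
    (\<forall>l. (\<forall>(x, y)\<in>S. slack \<Delta> l (tree_path T x y) \<le> k) \<longrightarrow> s \<le> slack \<Delta> l (tree_path T a b))"
    using ex_critical_path[OF D] by (elim exE) (erule that)
  interpret critical \<Delta> k \<tau> a b s T S l0
    by standard (use c D in auto)
  have "polytime_reducible L (DiTTR_fixed \<Delta> k) \<and> polytime_reducible L DiTTR" if "in_NP L" for L
  proof -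
    have "3 \<le> \<Delta>" using D by presburger
    from tableau_reduction[OF this that] obtain f rc m where f: "polytime 1 (\<lambda>xs. f (hd xs))"
      "\<And>x. f x = encode_DiTTR (graph (m x)) (bound (rc x)) \<Delta>" "\<And>x. x \<in> L \<longleftrightarrow> csp \<Delta> (m x) (rc x)" by blast
    have V: "pverts (graph n) = {..<card (pverts (graph n))}" for n by (simp add: graph_def)
    have yes: "csp \<Delta> (m x) (rc x)" if G: "f x = encode_DiTTR G D \<Delta>'" "pverts G = {..<card (pverts G)}"
        "DiTTR_input G D \<Delta>'" "DiTTR_yes G D \<Delta>'"
      for x G D \<Delta>'
    proof -
      have bt: "bidirected_tree (graph (m x))" "bidirected_tree G" using DiTTR_input_graph G(3)
          by (auto simp: DiTTR_input_def)
      note inj = encode_DiTTR_inject[OF G(1)[unfolded f(2)] V bt(1) G(2) bt(2)]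
      have "DiTTR_yes (graph (m x)) (bound (rc x)) \<Delta>"
        using G(4) inj(2) unfolding inj(1)[symmetric] inj(3)[symmetric] DiTTR_yes_def by metis
      then show ?thesis by (simp add: DiTTR_yes_graph)
    qed
    have "f x \<in> DiTTR_fixed \<Delta> k \<and> f x \<in> DiTTR" if "csp \<Delta> (m x) (rc x)" for x
      unfolding DiTTR_fixed_def DiTTR_def f(2) using V[of "m x"] DiTTR_input_graph[of "m x" "rc x"]
        slack_graph[of "m x" "rc x"] that[folded DiTTR_yes_graph] by blast
    moreover have "csp \<Delta> (m x) (rc x)" if fx: "f x \<in> DiTTR_fixed \<Delta> k \<or> f x \<in> DiTTR" for x
    proof -
      obtain G D \<Delta>' where "f x = encode_DiTTR G D \<Delta>'" "pverts G = {..<card (pverts G)}" "DiTTR_input G D \<Delta>'"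
          "DiTTR_yes G D \<Delta>'"
        using fx unfolding DiTTR_fixed_def DiTTR_def by blast
      then show ?thesis by (rule yes)
    qed
    ultimately have "x \<in> L \<longleftrightarrow> f x \<in> DiTTR_fixed \<Delta> k" "x \<in> L \<longleftrightarrow> f x \<in> DiTTR" for x
      unfolding f(3) by blast+
    then show ?thesis using f(1) unfolding polytime_reducible_def by blast
  qed
  then show "NP_hard (DiTTR_fixed \<Delta> k)" "NP_hard DiTTR" unfolding NP_hard_def by blast+
qed

section \<open>Certificates for durations\<close>

lemma static_dist_eq:
  assumes T: "bidirected_tree G" and vs: "path_in G u vs v"
  shows "static_dist G u v = ereal (real (length vs - 1))"
proof (rule antisym)
  note wf = tree_graphD(1)[OF T]
  show "static_dist G u v \<le> ereal (real (length vs - 1))" by (rule static_dist_le[OF wf vs])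
  interpret pair_wf_digraph G by (rule wf)
  have "ereal (real (length vs - 1)) \<le> ereal (awalk_cost (\<lambda>_. 1) p)" if p: "awalk u p v" for p
  proof -
    obtain ws where ws: "ws \<noteq> []" "hd ws = u" "last ws = v" "set ws \<subseteq> pverts G"
        "successively (\<lambda>a b. (a, b) \<in> parcs G) ws" "p = arcs_of ws"
      using p awalk_conv_list[OF wf] by blast
    obtain vs' where vs': "vs' \<noteq> []" "hd vs' = hd ws" "last vs' = last ws" "set vs' \<subseteq> set ws" "distinct vs'"
        "successively (\<lambda>a b. (a, b) \<in> parcs G) vs'"
      using walk_contains_path[OF ws(1,5)] by blast
    then have "path_in G u vs' v" using ws by (auto simp: path_in_def)
    then have "vs' = vs" using tree_path_unique[OF T vs] by blast
    moreover have "length vs' \<le> length ws"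
      using vs'(4,5) by (metis List.finite_set card_length card_mono distinct_card le_trans)
    ultimately show ?thesis using ws(6) by (simp add: awalk_cost_def length_arcs_of sum_list_triv)
  qed
  then show "ereal (real (length vs - 1)) \<le> static_dist G u v"
    unfolding static_dist_def \<mu>_def by (intro INF_greatest) simp
qed

fun descents :: "('a \<times> 'a \<Rightarrow> nat) \<Rightarrow> 'a list \<Rightarrow> nat" where
  "descents l (a # b # c # vs) = of_bool (l (b, c) \<le> l (a, b)) + descents l (b # c # vs)"
| "descents l vs = 0"

lemma slack_step_eq: "a < \<Delta> \<Longrightarrow> b < \<Delta> \<Longrightarrow> slack_step \<Delta> a b + 1 + a = b + of_bool (b \<le> a) * \<Delta>"
proof -
  assume ab: "a < \<Delta>" "b < \<Delta>"
  have "(int b - int a - 1) mod int \<Delta> = (if b \<le> a then int b - int a - 1 + int \<Delta> else int b - int a - 1)"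
  proof (cases "b \<le> a")
    case True
    have "(int b - int a - 1) mod int \<Delta> = (int b - int a - 1 + int \<Delta>) mod int \<Delta>" by simp
    also have "\<dots> = int b - int a - 1 + int \<Delta>" using ab True by (intro mod_pos_pos_trivial) auto
    finally show ?thesis using True by simp
  next
    case False
    then show ?thesis using ab by (auto intro!: mod_pos_pos_trivial)
  qed
  then have "int (slack_step \<Delta> a b) = (if b \<le> a then int b - int a - 1 + int \<Delta> else int b - int a - 1)"
    using ab int_slack_step[of \<Delta> a b] by simp
  then show ?thesis using ab by (cases "b \<le> a") simp_all
qed

text \<open>At each inner vertex the waiting time plus 1 is the increase of the label, with an
  additional \<Delta> if the label does not increase. These equations telescope along the
  path.\<close>

lemma slack_descents:
  assumes "\<forall>e\<in>set (arcs_of (u # w # ws)). l e < \<Delta>"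
  shows "length (w # ws) + slack \<Delta> l (u # w # ws) + l (u, w) =
    l (last (butlast (u # w # ws)), last (w # ws)) + descents l (u # w # ws) * \<Delta> + 1"
  using assms
proof (induction ws arbitrary: u w)
  case (Cons x ws)
  have "length (x # ws) + slack \<Delta> l (w # x # ws) + l (w, x) =
    l (last (butlast (w # x # ws)), last (x # ws)) + descents l (w # x # ws) * \<Delta> + 1" using Cons by simp
  moreover have "slack_step \<Delta> (l (u, w)) (l (w, x)) + 1 + l (u, w) = l (w, x) + of_bool (l (w, x) \<le> l (u,
      w)) * \<Delta>"
    using Cons.prems by (intro slack_step_eq) simp_all
  ultimately show ?case by (simp add: algebra_simps)
qed simp

text \<open>The distance d is also a termination measure: following \<open>nx\<close> decreases it
  and so must arrive at v. All conditions are local and can therefore be tested by the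
  verifier.\<close>

definition tree_cert :: "'a pair_pre_digraph \<Rightarrow> ('a \<Rightarrow> 'a \<Rightarrow> 'a) \<Rightarrow> ('a \<Rightarrow> 'a \<Rightarrow> nat) \<Rightarrow> bool" where
  "tree_cert G nx d \<longleftrightarrow> (\<forall>u\<in>pverts G. d u u = 0 \<and> (\<forall>v\<in>pverts G. u \<noteq> v \<longrightarrow>
     nx u v \<in> pverts G \<and> (u, nx u v) \<in> parcs G \<and> d u v = Suc (d (nx u v) v)))"

definition descent_cert :: "'a pair_pre_digraph \<Rightarrow> ('a \<times> 'a \<Rightarrow> nat) \<Rightarrow> ('a \<Rightarrow> 'a \<Rightarrow> 'a) \<Rightarrow> ('a \<Rightarrow> 'a \<Rightarrow> nat) \<Rightarrow> bool"
    where
  "descent_cert G l nx K \<longleftrightarrow> (\<forall>u\<in>pverts G. \<forall>v\<in>pverts G. u \<noteq> v \<longrightarrow>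
     K u v = (if nx u v = v then 0 else of_bool (l (nx u v, nx (nx u v) v) \<le> l (u, nx u v)) + K (nx u v) v))"

lemma tree_cert_path:
  assumes "tree_cert G nx d" "u \<in> pverts G" "v \<in> pverts G"
  shows "\<exists>ws. path_in G u (u # ws) v \<and> length ws = d u v \<and> (\<forall>x\<in>set ws. d x v < d u v) \<and>
    (u \<noteq> v \<longrightarrow> (\<exists>ws'. ws = nx u v # ws')) \<and> (descent_cert G l nx K \<longrightarrow> u \<noteq> v \<longrightarrow> descents l (u # ws) = K u v)"
  using assms(2)
proof (induction "d u v" arbitrary: u rule: less_induct)
  case less
  note c = assms(1)[unfolded tree_cert_def, rule_format]
  show ?case
  proof (cases "u = v")
    case True
    then show ?thesis using less c assms(3) by (intro exI[of _ "[]"]) (simp add: path_in_def)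
  next
    case False
    define w where "w = nx u v"
    have w: "w \<in> pverts G" "(u, w) \<in> parcs G" "d u v = Suc (d w v)"
      using c less assms(3) False by (auto simp: w_def)
    from less(1)[OF _ w(1)] w(3) obtain ws where ws: "path_in G w (w # ws) v" "length ws = d w v"
        "\<forall>x\<in>set ws. d x v < d w v"
      "w \<noteq> v \<longrightarrow> (\<exists>ws'. ws = nx w v # ws')" "descent_cert G l nx K \<longrightarrow> w \<noteq> v \<longrightarrow> descents l (w # ws) = K w v"
          by auto
    have "u \<notin> set (w # ws)" using w(3) ws(3) by auto
    then have "path_in G u (u # w # ws) v" using path_in_ConsI[OF ws(1) w(2) less(2)] by simp
    moreover have "descents l (u # w # ws) = K u v" if "descent_cert G l nx K"
    proof -
      have K: "K u v = (if w = v then 0 else of_bool (l (w, nx w v) \<le> l (u, w)) + K w v)"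
        using that less(2) assms(3) False unfolding descent_cert_def w_def by blast
      show ?thesis
      proof (cases "w = v")
        case True
        then have "ws = []" using ws(2) c assms(3) by simp
        then show ?thesis using K True by simp
      next
        case F: False
        then obtain ws' where "ws = nx w v # ws'" using ws(4) by blast
        then show ?thesis using K F ws(5) that by simp
      qed
    qed
    ultimately show ?thesis using w(3) ws(2,3) by (intro exI[of _ "w # ws"]) (auto simp: w_def[symmetric])
  qed
qed

text \<open>Take r as root and \<open>nx u r\<close> as the parent of u; then d is a rank, and the
  last assumption says that every arc joins a vertex to its parent.\<close>

lemma tree_cert_tree:
  assumes "tree_cert G nx d" "finite (pverts G)" "r \<in> pverts G" "\<And>u v. (u, v) \<in> parcs G \<Longrightarrow> (v, u) \<in> parcs G"
    "\<And>u v. (u, v) \<in> parcs G \<Longrightarrow> u \<in> pverts G \<and> v \<in> pverts G \<and> (u \<noteq> r \<and> nx u r = v \<or> v \<noteq> r \<and> nx v r = u)"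
  shows "bidirected_tree G"
proof (rule rooted_bidirected_tree)
  show "rooted G r (\<lambda>u. nx u r) (\<lambda>u. d u r)"
    unfolding rooted_def
  proof (intro conjI ballI)
    have *: "nx u r \<in> pverts G \<and> (u, nx u r) \<in> parcs G \<and> d u r = Suc (d (nx u r) r)" if "u \<in> pverts G - {r}"
        for u
      using assms(1,3) that unfolding tree_cert_def by blast
    show "nx v r \<in> pverts G" "d (nx v r) r < d v r" if "v \<in> pverts G - {r}" for v using *[OF that] by auto
    show "parcs G = (\<lambda>v. (v, nx v r)) ` (pverts G - {r}) \<union> (\<lambda>v. (nx v r, v)) ` (pverts G - {r})"
    proof
      show "parcs G \<subseteq> (\<lambda>v. (v, nx v r)) ` (pverts G - {r}) \<union> (\<lambda>v. (nx v r, v)) ` (pverts G - {r})"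
      proof
        fix e assume "e \<in> parcs G"
        then show "e \<in> (\<lambda>v. (v, nx v r)) ` (pverts G - {r}) \<union> (\<lambda>v. (nx v r, v)) ` (pverts G - {r})"
          using assms(5)[of "fst e" "snd e"] by (cases e) auto
      qed
      show "(\<lambda>v. (v, nx v r)) ` (pverts G - {r}) \<union> (\<lambda>v. (nx v r, v)) ` (pverts G - {r}) \<subseteq> parcs G"
        using * assms(4) by blast
    qed
  qed (use assms in auto)
qed

lemma tree_cert_duration:
  assumes T: "bidirected_tree G" and c: "tree_cert G nx d" and l: "periodic_labeling \<Delta> G l"
      and K: "descent_cert G l nx K"
    and uv: "u \<in> pverts G" "v \<in> pverts G" "u \<noteq> v"
  shows "static_dist G u v = ereal (real (d u v))"
    "fastest_duration \<Delta> G l u v \<le> enat e \<longleftrightarrow> l (nx v u, v) + K u v * \<Delta> + 1 \<le> e + l (u, nx u v)"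
proof -
  have "\<exists>ws. path_in G u (u # nx u v # ws) v \<and> length (nx u v # ws) = d u v \<and> (descent_cert G l nx K \<longrightarrow>
      descents l (u # nx u v # ws) = K u v)"
    if "u \<in> pverts G" "v \<in> pverts G" "u \<noteq> v" for u v
    using tree_cert_path[OF c that(1,2), of l K] that(3) by (elim exE conjE) (metis)
  from this[OF uv] this[OF uv(2,1) uv(3)[symmetric]] K obtain ws xs where
    ws: "path_in G u (u # nx u v # ws) v" "length (nx u v # ws) = d u v"
        "descents l (u # nx u v # ws) = K u v"
    and xs: "path_in G v (v # nx v u # xs) u" by blast
  \<comment> \<open>The certificate records first arcs only. The last arc of the path from u to v is
    found from the reverse path, whose second vertex is \<open>nx v u\<close>.\<close>
  have eq: "u # nx u v # ws = rev (v # nx v u # xs)"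
      by (rule tree_path_unique[OF T ws(1) path_in_rev[OF T xs]])
  have "last (butlast (rev (v # nx v u # xs))) = nx v u" by (simp add: butlast_append)
  then have last: "last (butlast (u # nx u v # ws)) = nx v u" "last (nx u v # ws) = v"
    using ws(1) unfolding eq[symmetric] by (simp_all add: path_in_def)
  have "\<forall>e\<in>set (arcs_of (u # nx u v # ws)). l e < \<Delta>"
    using l ws(1) set_arcs_of[of "u # nx u v # ws" "parcs G"]
        by (auto simp: periodic_labeling_def path_in_def)
  from slack_descents[OF this, unfolded last ws(3)]
  show "fastest_duration \<Delta> G l u v \<le> enat e \<longleftrightarrow> l (nx v u, v) + K u v * \<Delta> + 1 \<le> e + l (u, nx u v)"
    using fastest_duration_le_tree[OF T l ws(1), of e] by auto
  show "static_dist G u v = ereal (real (d u v))" using static_dist_eq[OF T ws(1)] ws(2) by simp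
qed

lemma ex_tree_cert:
  assumes T: "bidirected_tree G" and r: "r \<in> pverts G"
  shows "\<exists>nx d. tree_cert G nx d \<and> (\<forall>u v. (u, v) \<in> parcs G \<longrightarrow> u \<noteq> r \<and> nx u r = v \<or> v \<noteq> r \<and> nx v r = u) \<and>
    (\<forall>u\<in>pverts G. \<forall>v\<in>pverts G. d u v < card (pverts G)) \<and> (\<forall>l. \<exists>K. descent_cert G l nx K \<and>
       (\<forall>u\<in>pverts G. \<forall>v\<in>pverts G. u \<noteq> v \<longrightarrow> K u v < card (pverts G)))"
proof -
  define nx where "nx u v = tree_path G u v ! 1" for u v
  define d where "d u v = length (tree_path G u v) - 1" for u v
  have p: "path_in G u (tree_path G u v) v" if "u \<in> pverts G" "v \<in> pverts G" for u v
    by (rule path_in_tree_path[OF T that])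
  have tp: "tree_path G u v = u # tree_path G (nx u v) v \<and> nx u v \<in> pverts G \<and> (u, nx u v) \<in> parcs G \<and>
      (\<exists>ws. tree_path G (nx u v) v = nx u v # ws)"
    if uv: "u \<in> pverts G" "v \<in> pverts G" "u \<noteq> v" for u v
  proof -
    obtain y ws where *: "tree_path G u v = u # y # ws"
      using p[OF uv(1,2)] uv(3) by (cases "tree_path G u v" rule: remdups_adj.cases) (auto simp: path_in_def)
    then have "nx u v = y" by (simp add: nx_def)
    moreover have "path_in G y (y # ws) v" "(u, y) \<in> parcs G" using path_in_ConsD p[OF uv(1,2)] unfolding *
        by metis+
    ultimately show ?thesis using * tree_path_eq[OF T] tree_graphD(5)[OF T] by metis
  qed
  have self: "tree_path G u u = [u]" if "u \<in> pverts G" for u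
    by (rule tree_path_eq[OF T]) (use that in \<open>simp add: path_in_def\<close>)
  have len: "length (tree_path G u v) \<le> card (pverts G)" "tree_path G u v \<noteq> []"
      if "u \<in> pverts G" "v \<in> pverts G" for u v
    using p[OF that] tree_graphD(4)[OF T] unfolding path_in_def by (metis card_mono distinct_card, blast)
  have "tree_cert G nx d"
    unfolding tree_cert_def
  proof (intro ballI conjI impI)
    fix u v assume uv: "u \<in> pverts G" "v \<in> pverts G" "u \<noteq> v"
    note t = tp[OF uv]
    show "nx u v \<in> pverts G" "(u, nx u v) \<in> parcs G" using t by blast+
    have "length (tree_path G u v) = Suc (length (tree_path G (nx u v) v))" "tree_path G (nx u v) v \<noteq> []"
      using t by (metis length_Cons, fastforce)
    then show "d u v = Suc (d (nx u v) v)" by (simp add: d_def)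
  qed (simp add: d_def self)
  moreover have "d u v < card (pverts G)" if "u \<in> pverts G" "v \<in> pverts G" for u v
    using len[OF that] by (cases "tree_path G u v") (auto simp: d_def)
  moreover have "u \<noteq> r \<and> nx u r = v \<or> v \<noteq> r \<and> nx v r = u" if "(u, v) \<in> parcs G" for u v
    using that rooted_arc[OF tree_rooted[OF T r]] by (auto simp: nx_def)
  moreover have "\<exists>K. descent_cert G l nx K \<and> (\<forall>u\<in>pverts G. \<forall>v\<in>pverts G. u \<noteq> v \<longrightarrow> K u v < card (pverts G))"
      for l
  proof (intro exI conjI ballI impI)
    let ?K = "\<lambda>u v. descents l (tree_path G u v)"
    have desc: "descents l vs \<le> length vs - 2" for vs by (induction l vs rule: descents.induct) auto
    show "?K u v < card (pverts G)" if "u \<in> pverts G" "v \<in> pverts G" "u \<noteq> v" for u v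
      using desc[of "tree_path G u v"] len[OF that(1,2)] by (cases "tree_path G u v") auto
    show "descent_cert G l nx ?K"
      unfolding descent_cert_def
    proof (intro ballI impI)
      fix u v assume uv: "u \<in> pverts G" "v \<in> pverts G" "u \<noteq> v"
      define w where "w = nx u v"
      have t: "tree_path G u v = u # tree_path G w v" "w \<in> pverts G" using tp[OF uv] by (auto simp: w_def)
      show "?K u v = (if nx u v = v then 0 else of_bool (l (nx u v, nx (nx u v) v) \<le> l (u, nx u v)) + ?K
          (nx u v) v)"
        unfolding w_def[symmetric]
      proof (cases "w = v")
        case True
        then show "?K u v = (if w = v then 0 else of_bool (l (w, nx w v) \<le> l (u, w)) + ?K w v)"
          using t self[OF uv(2)] by simp
      next
        case False
        obtain ws where "tree_path G w v = w # nx w v # ws" using tp[OF t(2) uv(2) False] by auto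
        then show "?K u v = (if w = v then 0 else of_bool (l (w, nx w v) \<le> l (u, w)) + ?K w v)"
          using t False by simp
      qed
    qed
  qed
  ultimately show ?thesis by blast
qed

section \<open>Decoding instances\<close>

text \<open>Comparison of numbers too large for counters, by their digits to base 2. Digits larger
  than 1 are allowed, so sums and small multiples can be compared without carrying.\<close>

definition big_le :: "nat \<Rightarrow> (nat \<Rightarrow> nat) \<Rightarrow> (nat \<Rightarrow> nat) \<Rightarrow> bool" where
  "big_le B P N \<longleftrightarrow> (\<Sum>j<B. P j * 2 ^ j) \<le> (\<Sum>j<B. N j * 2 ^ j)"

text \<open>The invariant says that g equals D + C or is stuck at an end of the interval on the
  correct side. It is stable because doubling a difference of absolute value at least C and then
  changing it by at most C keeps it that large.\<close>

lemma clamp_step: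
  fixes g C p n :: nat and D :: int
  assumes "p + n \<le> C" "int g = D + int C \<or> g = 2 * C \<and> int C \<le> D \<or> g = 0 \<and> D \<le> - int C"
  defines "g' \<equiv> min (2 * C) (2 * g + n - (p + C))" and "D' \<equiv> 2 * D + (int n - int p)"
  shows "int g' = D' + int C \<or> g' = 2 * C \<and> int C \<le> D' \<or> g' = 0 \<and> D' \<le> - int C"
proof -
  consider "2 * g + n \<le> p + C" | "p + 3 * C \<le> 2 * g + n" | "p + C < 2 * g + n" "2 * g + n < p + 3 * C"
      by linarith
  then show ?thesis
  proof cases
    case 1
    then have "g' = 0" by (simp add: g'_def)
    then show ?thesis using 1 assms(1,2) unfolding D'_def by linarith
  next
    case 2
    then have "g' = 2 * C" by (simp add: g'_def)
    then show ?thesis using 2 assms(1,2) unfolding D'_def by linarith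
  next
    case 3
    then have "int g' = 2 * int g + int n - (int p + int C)" by (simp add: g'_def of_nat_diff)
    then show ?thesis using 3 assms(1,2) unfolding D'_def by linarith
  qed
qed

text \<open>Horner's scheme for the difference, shifted by \<open>C\<close> and clamped to the interval from \<open>0\<close> to
  \<open>2 C\<close>: once the absolute value of the difference reaches \<open>C\<close>, the remaining digits cannot change
  its sign.\<close>

lemma big_le_clamp:
  fixes P N :: "nat \<Rightarrow> nat" and B :: nat
  defines "C \<equiv> Suc (\<Sum>j<B. P j + N j)"
  shows "big_le B P N \<longleftrightarrow> C \<le> rec_nat C (\<lambda>i x. min (2 * C) (2 * x + N (B - 1 - i) - (P (B - 1 - i) + C))) B"
proof -
  define g where "g i = rec_nat C (\<lambda>i x. min (2 * C) (2 * x + N (B - 1 - i) - (P (B - 1 - i) + C))) i" for i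
  define \<delta> where "\<delta> j = int (N j) - int (P j)" for j
  define D where "D i = rec_nat 0 (\<lambda>i y. 2 * y + \<delta> (B - 1 - i)) i" for i
  have g: "g 0 = C" "g (Suc i) = min (2 * C) (2 * g i + N (B - 1 - i) - (P (B - 1 - i) + C))" for i
      by (simp_all add: g_def)
  have D: "D 0 = 0" "D (Suc i) = 2 * D i + \<delta> (B - 1 - i)" for i by (simp_all add: D_def)
  have C: "0 < C" by (simp add: C_def)
  have PN: "P j + N j \<le> C" if "j < B" for j
    using member_le_sum[of j "{..<B}" "\<lambda>j. P j + N j"] that by (simp add: C_def)
  have inv: "int (g i) = D i + int C \<or> g i = 2 * C \<and> int C \<le> D i \<or> g i = 0 \<and> D i \<le> - int C" if "i \<le> B" for i
    using that
  proof (induction i)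
    case 0
    then show ?case by (simp add: g D)
  next
    case (Suc i)
    have "P (B - 1 - i) + N (B - 1 - i) \<le> C" using Suc.prems by (intro PN) simp
    from clamp_step[OF this Suc.IH] Suc.prems show ?case by (simp only: g D \<delta>_def)
  qed
  have "D i * 2 ^ (B - i) + (\<Sum>j<B - i. \<delta> j * 2 ^ j) = (\<Sum>j<B. \<delta> j * 2 ^ j)" if "i \<le> B" for i
    using that
  proof (induction i)
    case (Suc i)
    define m where "m = B - Suc i"
    have m: "B - i = Suc m" "B - Suc i = m" "B - 1 - i = m" using Suc.prems by (simp_all add: m_def)
    have "D i * 2 ^ Suc m + (\<Sum>j<Suc m. \<delta> j * 2 ^ j) = (\<Sum>j<B. \<delta> j * 2 ^ j)"
      using Suc.IH Suc.prems unfolding m(1) by simp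
    then show ?case unfolding m D(2) by (simp add: algebra_simps)
  qed (simp add: D)
  from this[of B] have "D B = (\<Sum>j<B. \<delta> j * 2 ^ j)" by simp
  also have "\<dots> = int (\<Sum>j<B. N j * 2 ^ j) - int (\<Sum>j<B. P j * 2 ^ j)"
    by (simp add: \<delta>_def left_diff_distrib sum_subtractf)
  finally have "big_le B P N \<longleftrightarrow> 0 \<le> D B" unfolding big_le_def by linarith
  also have "\<dots> \<longleftrightarrow> C \<le> g B" using inv[of B] C by auto
  finally show ?thesis by (simp only: g_def)
qed

lemma pp_big_le:
  assumes B: "pf a B" and P: "pf a (\<lambda>xs v. P xs (\<lambda>i. v (Suc i)) (v 0))"
      and N: "pf a (\<lambda>xs v. N xs (\<lambda>i. v (Suc i)) (v 0))"
  shows "pp a (\<lambda>xs v. big_le (B xs v) (P xs v) (N xs v))"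
proof -
  let ?C = "\<lambda>xs v. Suc (\<Sum>j<B xs v. P xs v j + N xs v j)"
  have C: "pf a ?C" by (intro pf_intros B P N)
  have C2: "pf a (\<lambda>xs v. ?C xs (\<lambda>i. v (Suc (Suc i))))" "pf a (\<lambda>xs v. B xs (\<lambda>i. v (Suc (Suc i))))"
    using pf_rename[OF C, of "\<lambda>i. Suc (Suc i)"] pf_rename[OF B, of "\<lambda>i. Suc (Suc i)"] by simp_all
  have sub: "pf a (\<lambda>xs v. F xs (\<lambda>i. v (Suc (Suc i))) (B xs (\<lambda>i. v (Suc (Suc i))) - 1 - v 0))"
    if "pf a (\<lambda>xs v. F xs (\<lambda>i. v (Suc i)) (v 0))" for F
    using pf_rename[OF that, of "case_nat 0 (\<lambda>i. Suc (Suc (Suc i)))"]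
    by (intro pf_let[where G = "\<lambda>xs v. F xs (\<lambda>i. v (Suc (Suc i)))"] pf_intros C2(2)) simp
  have "pf a (\<lambda>xs v. rec_nat (?C xs v) (\<lambda>i x. min (2 * ?C xs v)
      (2 * x + N xs v (B xs v - 1 - i) - (P xs v (B xs v - 1 - i) + ?C xs v))) (B xs v))"
    by (rule pf_rec[where S = "\<lambda>xs v i x. 2 * x + N xs v (B xs v - 1 - i) - (P xs v (B xs v - 1 - i) + ?C xs
        v)"])
      (intro pf_mult pf_const C B pf_sub pf_add pf_var sub[OF P] sub[OF N] C2)+
  from pp_le[OF C this] show ?thesis by (simp only: big_le_clamp)
qed

text \<open>The last conjunct demands that the most significant digit is 1, so only the canonical
  code without leading zeros is accepted.\<close>

definition nat_code :: "bool list \<Rightarrow> nat \<Rightarrow> nat \<Rightarrow> bool" where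
  "nat_code x p b \<longleftrightarrow> (\<forall>j<b. bit_at x (p + 2 * j)) \<and> \<not> bit_at x (p + 2 * b) \<and> p + 2 * b < length x \<and>
     (0 < b \<longrightarrow> bit_at x (p + 2 * b - 1))"

definition digit :: "bool list \<Rightarrow> nat \<Rightarrow> nat \<Rightarrow> nat \<Rightarrow> nat" where
  "digit x p b j = of_bool (j < b \<and> bit_at x (p + 2 * j + 1))"

definition num :: "bool list \<Rightarrow> nat \<Rightarrow> nat \<Rightarrow> nat" where
  "num x p b = (\<Sum>j<b. digit x p b j * 2 ^ j)"

lemma num_eq: "b \<le> B \<Longrightarrow> num x p b = (\<Sum>j<B. digit x p b j * 2 ^ j)"
  unfolding num_def by (intro sum.mono_neutral_left) (auto simp: digit_def)

lemma bit_at_drop: "bit_at (drop p x) i = bit_at x (p + i)"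
  by (auto simp: bit_at_def)

lemma bit_at_Cons: "bit_at (a # x) 0 = a" "bit_at (a # x) (Suc i) = bit_at x i"
  by (simp_all add: bit_at_def)

lemma nat_code_drop: "nat_code x p b \<longleftrightarrow> nat_code (drop p x) 0 b"
  by (auto simp: nat_code_def bit_at_drop less_diff_conv add.commute)

lemma num_drop: "num x p b = num (drop p x) 0 b"
  by (simp add: num_def digit_def bit_at_drop add.assoc)

lemma nat_code_0: "nat_code x 0 0 \<longleftrightarrow> (\<exists>r. x = False # r)"
  by (cases x) (auto simp: nat_code_def bit_at_Cons bit_at_def)

lemma nat_code_Suc: "nat_code x 0 (Suc b) \<longleftrightarrow> (\<exists>a r. x = True # a # r \<and> nat_code r 0 b \<and> (b = 0 \<longrightarrow> a))"
proof (cases "2 \<le> length x")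
  case True
  then obtain c a r where x: "x = c # a # r" by (metis Suc_le_length_iff numeral_2_eq_2)
  have "0 < b \<Longrightarrow> bit_at x (2 * Suc b - 1) = bit_at r (2 * b - 1)"
    by (cases b) (simp_all add: x bit_at_Cons)
  moreover have "b = 0 \<Longrightarrow> bit_at x (2 * Suc b - 1) = a" by (simp add: x bit_at_Cons)
  ultimately show ?thesis
    by (cases "b = 0") (auto simp: nat_code_def All_less_Suc2 x bit_at_Cons)
qed (auto simp: nat_code_def)

lemma num_Suc: "num (c # a # r) 0 (Suc b) = of_bool a + 2 * num r 0 b"
  unfolding num_def sum.lessThan_Suc_shift by (simp add: digit_def bit_at_Cons sum_distrib_left mult_ac del:
      sum.lessThan_Suc sum_mult_of_bool_eq sum_of_bool_mult_eq)

lemma encode_nat_rec: "encode_nat n = (if n = 0 then [False] else True # odd n # encode_nat (n div 2))"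
  by (simp add: encode_nat_def binary.simps[of n])

lemma nat_codeD:
  assumes "nat_code x p b"
  shows "drop p x = encode_nat (num x p b) @ drop (Suc (p + 2 * b)) x" and "0 < b \<longleftrightarrow> 0 < num x p b"
proof -
  have "y = encode_nat (num y 0 b) @ drop (Suc (2 * b)) y \<and> (0 < b \<longleftrightarrow> 0 < num y 0 b)" if "nat_code y 0 b" for y
    using that
  proof (induction b arbitrary: y)
    case 0
    then show ?case by (auto simp: nat_code_0 num_def encode_nat_rec)
  next
    case (Suc b)
    then obtain a r where y: "y = True # a # r" "nat_code r 0 b" "b = 0 \<longrightarrow> a" by (auto simp: nat_code_Suc)
    let ?m = "num y 0 (Suc b)"
    have m: "?m = of_bool a + 2 * num r 0 b" by (simp add: y num_Suc)
    have "0 < ?m" using Suc.IH[OF y(2)] y(3) m by (cases "b = 0") auto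
    moreover have "?m div 2 = num r 0 b" "odd ?m = a" by (simp_all add: m)
    moreover have "r = encode_nat (num r 0 b) @ drop (Suc (2 * b)) r" using Suc.IH[OF y(2)] by blast
    ultimately show ?case using y(1) by (subst encode_nat_rec) simp
  qed
  from this[of "drop p x"] assms show "drop p x = encode_nat (num x p b) @ drop (Suc (p + 2 * b)) x"
      "0 < b \<longleftrightarrow> 0 < num x p b"
    by (simp_all add: nat_code_drop[symmetric] num_drop[symmetric] add.commute)
qed

lemma nat_codeI:
  assumes "drop p x = encode_nat m @ r"
  shows "nat_code x p (length (binary m))" "num x p (length (binary m)) = m"
      "r = drop (Suc (p + 2 * length (binary m))) x"
proof -
  have "nat_code (encode_nat m @ r) 0 (length (binary m)) \<and> num (encode_nat m @ r) 0 (length (binary m)) = m"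
  proof (induction m rule: binary.induct)
    case (1 m)
    show ?case
    proof (cases "m = 0")
      case True
      then show ?thesis by (simp add: binary.simps encode_nat_rec nat_code_0 num_def)
    next
      case False
      moreover have "binary m = odd m # binary (m div 2)" using False by (simp add: binary.simps[of m])
      moreover have "length (binary (m div 2)) = 0 \<Longrightarrow> odd m"
        using False div_pow_eq_0_iff[of "m div 2" 0] by (simp add: odd_iff_mod_2_eq_one)
      moreover have "of_bool (odd m) + 2 * (m div 2) = m"
          by (simp add: mod2_eq_if[symmetric] flip: odd_iff_mod_2_eq_one)
      ultimately show ?thesis using 1[OF False] encode_nat_rec[of m] by (simp add: nat_code_Suc num_Suc)
    qed
  qed
  then show c: "nat_code x p (length (binary m))" and n: "num x p (length (binary m)) = m"
    using assms by (simp_all add: nat_code_drop[of x] num_drop[of x])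
  show "r = drop (Suc (p + 2 * length (binary m))) x"
    using nat_codeD(1)[OF c] assms n by simp
qed

text \<open>For an entry, b = 0 stands for infinity, coded by one bit. Otherwise b is the number of
  digits plus 1, and the code has 1 + 2 (b - 1) + 1 bits.\<close>

definition code_len :: "nat \<Rightarrow> nat" where
  "code_len b = (if b = 0 then 1 else 2 * b)"

definition ent :: "bool list \<Rightarrow> nat \<Rightarrow> nat \<Rightarrow> enat" where
  "ent x p b = (if b = 0 then \<infinity> else enat (num x (Suc p) (b - 1)))"

definition ent_code :: "bool list \<Rightarrow> nat \<Rightarrow> nat \<Rightarrow> bool" where
  "ent_code x p b \<longleftrightarrow> p < length x \<and> (if b = 0 then \<not> bit_at x p else bit_at x p \<and> nat_code x (Suc p) (b - 1))"

definition ent_digits :: "enat \<Rightarrow> nat" where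
  "ent_digits e = (case e of \<infinity> \<Rightarrow> 0 | enat m \<Rightarrow> Suc (length (binary m)))"

lemma ent_codeD: "ent_code x p b \<Longrightarrow> drop p x = encode_enat (ent x p b) @ drop (p + code_len b) x"
proof -
  assume c: "ent_code x p b"
  then have d: "drop p x = bit_at x p # drop (Suc p) x"
      by (auto simp: ent_code_def bit_at_def Cons_nth_drop_Suc)
  show ?thesis
  proof (cases "b = 0")
    case True
    then show ?thesis using c d by (simp add: ent_code_def ent_def encode_enat_def code_len_def)
  next
    case False
    then have "nat_code x (Suc p) (b - 1)" "bit_at x p" using c by (auto simp: ent_code_def)
    moreover have "Suc (Suc p + 2 * (b - 1)) = p + code_len b" using False by (simp add: code_len_def)
    ultimately show ?thesis using d False nat_codeD(1)[of x "Suc p" "b - 1"]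
      by (simp only: ent_def encode_enat_def) simp
  qed
qed

lemma ent_codeI:
  assumes "drop p x = encode_enat e @ r"
  shows "ent_code x p (ent_digits e)" "ent x p (ent_digits e) = e"
      "length (encode_enat e) = code_len (ent_digits e)"
proof -
  have p: "p < length x"
  proof (rule ccontr)
    assume "\<not> p < length x"
    then show False using assms by (auto simp: encode_enat_def split: enat.splits)
  qed
  then have d: "drop p x = bit_at x p # drop (Suc p) x" by (simp add: bit_at_def Cons_nth_drop_Suc)
  show "ent_code x p (ent_digits e)" "ent x p (ent_digits e) = e"
    using assms d p nat_codeI[of "Suc p" x] by (auto simp: encode_enat_def ent_code_def ent_def ent_digits_def
        split: enat.splits)
  have "length (encode_nat m) = Suc (2 * length (binary m))" for m
    by (simp add: encode_nat_def length_concat comp_def sum_list_triv)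
  then show "length (encode_enat e) = code_len (ent_digits e)"
    by (simp add: encode_enat_def ent_digits_def code_len_def split: enat.splits)
qed

lemma drop_concat:
  assumes "\<And>q. q < m \<Longrightarrow> drop (p q) x = c q @ drop (p (Suc q)) x"
  shows "drop (p 0) x = concat (map c [0..<m]) @ drop (p m) x"
  using assms by (induction m) auto

lemma drop_concatI:
  assumes "drop p x = concat (map c [0..<m]) @ r" "q \<le> m"
  shows "drop (p + (\<Sum>i<q. length (c i))) x = concat (map c [q..<m]) @ r"
  using assms(2)
proof (induction q)
  case (Suc q)
  then have "[q..<m] = q # [Suc q..<m]" by (simp add: upt_conv_Cons)
  then have "drop (p + (\<Sum>i<q. length (c i))) x = c q @ concat (map c [Suc q..<m]) @ r" using Suc by simp
  then have "drop (length (c q)) (drop (p + (\<Sum>i<q. length (c i))) x) = concat (map c [Suc q..<m]) @ r" by simp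
  then show ?case by (simp add: add_ac)
qed (use assms(1) in simp)

definition pos :: "nat \<Rightarrow> (nat \<Rightarrow> nat \<Rightarrow> nat) \<Rightarrow> nat \<Rightarrow> nat" where
  "pos n bl q = 2 * length (binary n) + 1 + n * n + (\<Sum>r<q. code_len (bl (r div n) (r mod n)))"

definition arc_bit :: "bool list \<Rightarrow> nat \<Rightarrow> nat \<Rightarrow> nat \<Rightarrow> bool" where
  "arc_bit x n u v \<longleftrightarrow> bit_at x (2 * length (binary n) + 1 + (u * n + v))"

text \<open>Entries have variable length. With guessed digit counts \<open>bl\<close> and
  \<open>bd\<close> the start of each entry is a sum, so that the format splits into independent
  local tests instead of a sequential parse.\<close>

definition shape :: "bool list \<Rightarrow> nat \<Rightarrow> (nat \<Rightarrow> nat \<Rightarrow> nat) \<Rightarrow> nat \<Rightarrow> bool" where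
  "shape x n bl bd \<longleftrightarrow> 0 < n \<and> nat_code x 0 (length (binary n)) \<and> num x 0 (length (binary n)) = n \<and>
     (\<forall>q<n * n. ent_code x (pos n bl q) (bl (q div n) (q mod n))) \<and>
     nat_code x (pos n bl (n * n)) bd \<and> length x = pos n bl (n * n) + 2 * bd + 1"

lemma shape_encode:
  assumes s: "shape x n bl bd" and V: "pverts G = {..<n}"
    and E: "\<And>u v. u < n \<Longrightarrow> v < n \<Longrightarrow> (u, v) \<in> parcs G \<longleftrightarrow> arc_bit x n u v"
    and D: "\<And>u v. u < n \<Longrightarrow> v < n \<Longrightarrow> D u v = ent x (pos n bl (u * n + v)) (bl u v)"
  shows "x = encode_DiTTR G D (num x (pos n bl (n * n)) bd)"
proof -
  let ?h = "2 * length (binary n) + 1"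
  note s = s[unfolded shape_def]
  have qn: "q div n < n \<and> q mod n < n \<and> q div n * n + q mod n = q" if "q < n * n" for q
    using that s by (simp add: less_mult_imp_div_less)
  have "nat_code x 0 (length (binary n))" and n: "num x 0 (length (binary n)) = n" using s by blast+
  from nat_codeD(1)[OF this(1)] have 1: "x = encode_nat n @ drop ?h x" unfolding n by simp
  have "pos n bl 0 \<le> pos n bl (n * n)" by (simp add: pos_def)
  then have l: "?h + n * n \<le> length x" using s by (simp add: pos_def)
  have 2: "drop ?h x = map (\<lambda>uv. uv \<in> parcs G) (List.product [0..<n] [0..<n]) @ drop (?h + n * n) x"
  proof (rule nth_equalityI)
    show "length (drop ?h x) = length (map (\<lambda>uv. uv \<in> parcs G) (List.product [0..<n] [0..<n]) @
        drop (?h + n * n) x)"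
      using l by simp
    fix i assume i: "i < length (drop ?h x)"
    show "drop ?h x ! i = (map (\<lambda>uv. uv \<in> parcs G) (List.product [0..<n] [0..<n]) @ drop (?h + n * n) x) ! i"
    proof (cases "i < n * n")
      case True
      have "(i div n, i mod n) \<in> parcs G \<longleftrightarrow> x ! (?h + i)"
        using E[of "i div n" "i mod n"] qn[OF True] i by (auto simp: arc_bit_def bit_at_def)
      then show ?thesis using True i by (simp add: product_upt nth_append)
    next
      case False
      then show ?thesis using l i by (simp add: product_upt nth_append)
    qed
  qed
  have "drop (pos n bl 0) x = concat (map (\<lambda>q. encode_enat (D (q div n) (q mod n))) [0..<n * n]) @
      drop (pos n bl (n * n)) x"
  proof (rule drop_concat)
    fix q assume q: "q < n * n"
    have "D (q div n) (q mod n) = ent x (pos n bl q) (bl (q div n) (q mod n))"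
        using D[of "q div n" "q mod n"] qn[OF q] by simp
    moreover have "pos n bl (Suc q) = pos n bl q + code_len (bl (q div n) (q mod n))" by (simp add: pos_def)
    ultimately show "drop (pos n bl q) x = encode_enat (D (q div n) (q mod n)) @ drop (pos n bl (Suc q)) x"
      using ent_codeD[of x "pos n bl q"] s q by simp
  qed
  then have 3: "drop (?h + n * n) x = concat (map (\<lambda>(u, v). encode_enat (D u v)) (List.product [0..<n]
      [0..<n])) @ drop (pos n bl (n * n)) x"
    by (simp add: product_upt comp_def pos_def)
  have 4: "drop (pos n bl (n * n)) x = encode_nat (num x (pos n bl (n * n)) bd)"
    using nat_codeD(1)[of x "pos n bl (n * n)" bd] s by simp
  have "x = encode_nat n @ map (\<lambda>uv. uv \<in> parcs G) (List.product [0..<n] [0..<n]) @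
      concat (map (\<lambda>(u, v). encode_enat (D u v)) (List.product [0..<n] [0..<n])) @ encode_nat (num x (pos n bl
          (n * n)) bd)"
    using 1 unfolding 2 3 4 .
  then show ?thesis by (simp add: encode_DiTTR_def Let_def V)
qed

lemma encode_shape:
  assumes x: "x = encode_DiTTR G D \<Delta>" and V: "pverts G = {..<n}" "0 < n"
  defines "bl \<equiv> \<lambda>u v. ent_digits (D u v)"
  shows "shape x n bl (length (binary \<Delta>))"
    "\<And>u v. u < n \<Longrightarrow> v < n \<Longrightarrow> (u, v) \<in> parcs G \<longleftrightarrow> arc_bit x n u v"
    "\<And>u v. u < n \<Longrightarrow> v < n \<Longrightarrow> D u v = ent x (pos n bl (u * n + v)) (bl u v)"
    "num x (pos n bl (n * n)) (length (binary \<Delta>)) = \<Delta>"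
proof -
  let ?h = "2 * length (binary n) + 1"
  let ?c = "\<lambda>q. encode_enat (D (q div n) (q mod n))"
  have x': "x = encode_nat n @ map (\<lambda>uv. uv \<in> parcs G) (List.product [0..<n] [0..<n]) @
      concat (map ?c [0..<n * n]) @ encode_nat \<Delta>"
    using x V by (simp add: encode_DiTTR_def Let_def product_upt comp_def)
  note n = nat_codeI[of 0 x n, unfolded drop_0, OF x']
  have "drop ?h x = map (\<lambda>uv. uv \<in> parcs G) (List.product [0..<n] [0..<n]) @ concat (map ?c [0..<n * n]) @
      encode_nat \<Delta>"
    using n(3) by simp
  then have a: "drop ?h x = map (\<lambda>q. (q div n, q mod n) \<in> parcs G) [0..<n * n] @ concat (map ?c [0..<n * n]) @
      encode_nat \<Delta>"
    by (simp add: product_upt comp_def)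
  then have "drop (n * n) (drop ?h x) = concat (map ?c [0..<n * n]) @ encode_nat \<Delta>" by simp
  then have "drop (?h + n * n) x = concat (map ?c [0..<n * n]) @ encode_nat \<Delta>" by (simp add: add.commute)
  note dq = drop_concatI[OF this]
  have e: "drop (?h + n * n + (\<Sum>i<q. length (?c i))) x = ?c q @ concat (map ?c [Suc q..<n * n]) @
      encode_nat \<Delta>" if "q < n * n" for q
    using dq[of q] that by (simp add: upt_conv_Cons)
  have len: "length (?c q) = code_len (bl (q div n) (q mod n))" if "q < n * n" for q
    using ent_codeI(3)[OF e[OF that]] by (simp add: bl_def)
  have pos: "?h + n * n + (\<Sum>i<q. length (?c i)) = pos n bl q" if "q \<le> n * n" for q
    using that len by (simp add: pos_def)
  have ec: "ent_code x (pos n bl q) (bl (q div n) (q mod n))" "ent x (pos n bl q) (bl (q div n) (q mod n)) =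
      D (q div n) (q mod n)"
    if "q < n * n" for q
    using ent_codeI(1,2)[OF e[OF that]] pos[of q] that by (simp_all add: bl_def)
  have "drop (pos n bl (n * n)) x = encode_nat \<Delta> @ []" using dq[of "n * n"] pos[of "n * n"] by simp
  note d = nat_codeI[OF this]
  show "num x (pos n bl (n * n)) (length (binary \<Delta>)) = \<Delta>" by (rule d(2))
  have "length x \<le> pos n bl (n * n) + 2 * length (binary \<Delta>) + 1" using d(3) by simp
  moreover have "pos n bl (n * n) + 2 * length (binary \<Delta>) < length x" using d(1) by (simp add: nat_code_def)
  ultimately show "shape x n bl (length (binary \<Delta>))"
    unfolding shape_def using n V(2) ec(1) d(1) by simp
  fix u v assume uv: "u < n" "v < n"
  then have q: "(u * n + v) div n = u" "(u * n + v) mod n = v" by simp_all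
  have qn: "u * n + v < n * n" by (intro mult_add_less uv)
  show "D u v = ent x (pos n bl (u * n + v)) (bl u v)" using ec(2)[OF qn, unfolded q] by simp
  have "arc_bit x n u v \<longleftrightarrow> bit_at (drop ?h x) (u * n + v)" unfolding bit_at_drop arc_bit_def ..
  also have "\<dots> \<longleftrightarrow> (u, v) \<in> parcs G" unfolding a using qn uv by (simp add: bit_at_def nth_append)
  finally show "(u, v) \<in> parcs G \<longleftrightarrow> arc_bit x n u v" by simp
qed

section \<open>Membership in NP\<close>

text \<open>A value of the certificate is stored in unary, as the number of ones in a group of S
  bits. So every word decodes to some certificate, and its format needs no test.\<close>

definition slot :: "bool list \<Rightarrow> nat \<Rightarrow> nat \<Rightarrow> nat \<Rightarrow> nat \<Rightarrow> nat \<Rightarrow> nat" where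
  "slot w S t a b c = (\<Sum>j<S. of_bool (bit_at w (code5 S t a b c j)))"

lemma ex_slot:
  assumes "\<And>t a b c. g t a b c \<le> S"
  shows "\<exists>w. length w = m * S * S * S * S \<and> (\<forall>t<m. \<forall>a<S. \<forall>b<S. \<forall>c<S. slot w S t a b c = g t a b c)"
proof -
  define w where "w = map (\<lambda>i. i mod S < g (i div S div S div S div S) (i div S div S div S mod S) (i div S
      div S mod S) (i div S mod S)) [0..<m * S * S * S * S]"
  have "slot w S t a b c = g t a b c" if "t < m" "a < S" "b < S" "c < S" for t a b c
  proof -
    have "bit_at w (code5 S t a b c j) \<longleftrightarrow> j < g t a b c" if "j < S" for j
      using code5_less[OF \<open>t < m\<close> \<open>a < S\<close> \<open>b < S\<close> \<open>c < S\<close> that] \<open>a < S\<close> \<open>b < S\<close> \<open>c < S\<close> that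
      by (simp add: w_def bit_at_def code5_decode)
    then have "slot w S t a b c = (\<Sum>j<S. of_bool (j < g t a b c))" unfolding slot_def by (intro sum.cong) auto
    also have "\<dots> = card {j. j < S \<and> j < g t a b c}" by (simp add: Collect_conj_eq lessThan_def[symmetric])
    also have "{j. j < S \<and> j < g t a b c} = {..<g t a b c}" using assms[of t a b c] by auto
    finally show ?thesis by simp
  qed
  then show ?thesis by (intro exI[of _ w]) (simp add: w_def)
qed

lemma pf_slot:
  assumes "1 < c" "pf c (\<lambda>xs v. S xs)" "pf c A" "pf c B" "pf c C"
  shows "pf c (\<lambda>xs v. slot (xs ! 1) (S xs) t (A xs v) (B xs v) (C xs v))"
  unfolding slot_def by (intro pf_intros pp_bit_at pf_code5 assms pf_shift)

definition label_of :: "nat \<Rightarrow> (nat \<Rightarrow> nat \<Rightarrow> nat \<Rightarrow> nat) \<Rightarrow> nat \<Rightarrow> nat \<Rightarrow> nat" where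
  "label_of S lb u v = (\<Sum>j<S. of_bool (0 < lb u v j) * 2 ^ j)"

definition const_digit :: "nat \<Rightarrow> nat \<Rightarrow> nat" where
  "const_digit c j = (if j = 0 then c else 0)"

lemma const_digit_sum: "0 < S \<Longrightarrow> (\<Sum>j<S. const_digit c j * 2 ^ j) = c"
proof -
  assume "0 < S"
  then have "(\<Sum>j<S. const_digit c j * 2 ^ j) = (\<Sum>j\<in>{0}. const_digit c j * 2 ^ j)"
    by (intro sum.mono_neutral_right) (auto simp: const_digit_def)
  then show ?thesis by (simp add: const_digit_def)
qed

text \<open>The certificate: \<open>nx u v\<close> is the successor of \<open>u\<close> on the path to \<open>v\<close>, \<open>d u v\<close> the length of
  this path and \<open>K u v\<close> the number of its inner vertices at which the label does not increase;
  \<open>lb u v\<close> are the binary digits of the label of the arc, \<open>bd\<close> is the number of digits of \<open>\<Delta>\<close>, and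
  \<open>bl u v\<close> that of \<open>D u v\<close> plus \<open>1\<close> (or \<open>0\<close> for \<open>\<infinity>\<close>). A fixed period is given by \<open>z > 0\<close>.\<close>

definition check :: "bool list \<Rightarrow> nat \<Rightarrow> nat \<Rightarrow> nat \<Rightarrow> (nat \<Rightarrow> nat \<Rightarrow> nat) \<Rightarrow> (nat \<Rightarrow> nat \<Rightarrow> nat) \<Rightarrow> (nat \<Rightarrow> nat \<Rightarrow> nat) \<Rightarrow>
    (nat \<Rightarrow> nat \<Rightarrow> nat \<Rightarrow> nat) \<Rightarrow> (nat \<Rightarrow> nat \<Rightarrow> nat) \<Rightarrow> nat \<Rightarrow> nat \<Rightarrow> nat \<Rightarrow> bool" where
  "check x S p n nx d K lb bl bd k z \<longleftrightarrow> shape x n bl bd \<and> 0 < bd \<and>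
    (z = 0 \<or> big_le S (digit x p bd) (const_digit z) \<and> big_le S (const_digit z) (digit x p bd)) \<and>
    (\<forall>u<n. \<forall>v<n. arc_bit x n u v \<longrightarrow> arc_bit x n v u \<and> (u \<noteq> 0 \<and> nx u 0 = v \<or> v \<noteq> 0 \<and> nx v 0 = u) \<and>
      \<not> big_le S (digit x p bd) (\<lambda>j. of_bool (0 < lb u v j))) \<and>
    (\<forall>u<n. d u u = 0 \<and> (\<forall>v<n. u \<noteq> v \<longrightarrow>
      nx u v < n \<and> arc_bit x n u (nx u v) \<and> d u v = Suc (d (nx u v) v) \<and>
      K u v = (if nx u v = v then 0 else
        of_bool (big_le S (\<lambda>j. of_bool (0 < lb (nx u v) (nx (nx u v) v) j)) (\<lambda>j. of_bool (0 < lb u (nx u v)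
            j))) + K (nx u v) v) \<and>
      (bl u v = 0 \<or>
        big_le S (const_digit (d u v + k)) (digit x (Suc (pos n bl (u * n + v))) (bl u v - 1)) \<and>
        big_le S (\<lambda>j. of_bool (0 < lb (nx v u) v j) + K u v * digit x p bd j + const_digit 1 j)
          (\<lambda>j. digit x (Suc (pos n bl (u * n + v))) (bl u v - 1) j + of_bool (0 < lb u (nx u v) j)))))"

lemma nat_code_le: "nat_code x p b \<Longrightarrow> b \<le> length x + 2"
  by (simp add: nat_code_def)

lemma num_sum: "nat_code x p b \<Longrightarrow> (\<Sum>j<length x + 2. digit x p b j * 2 ^ j) = num x p b"
  using num_eq[of b "length x + 2" x p] nat_code_le[of x p b] by simp

lemma num_eq_iff: "nat_code x p b \<Longrightarrow> num x p b = c \<longleftrightarrow>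
    big_le (length x + 2) (digit x p b) (const_digit c) \<and> big_le (length x + 2) (const_digit c) (digit x p b)"
proof -
  assume "nat_code x p b"
  note n = num_sum[OF this]
  have c: "(\<Sum>j<length x + 2. const_digit c j * 2 ^ j) = c" by (rule const_digit_sum) simp
  show ?thesis unfolding big_le_def n c by auto
qed

definition cert :: "nat pair_pre_digraph \<Rightarrow> (nat \<Rightarrow> nat \<Rightarrow> enat) \<Rightarrow> nat \<Rightarrow> (nat \<times> nat \<Rightarrow> nat) \<Rightarrow>
    (nat \<Rightarrow> nat \<Rightarrow> nat) \<Rightarrow> (nat \<Rightarrow> nat \<Rightarrow> nat) \<Rightarrow> (nat \<Rightarrow> nat \<Rightarrow> nat) \<Rightarrow> nat \<Rightarrow> bool" where
  "cert G D \<Delta> l nx d K k \<longleftrightarrow>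
    (\<forall>u\<in>pverts G. \<forall>v\<in>pverts G. (u, v) \<in> parcs G \<longrightarrow> (v, u) \<in> parcs G \<and> (u \<noteq> 0 \<and> nx u 0 = v \<or> v \<noteq> 0 \<and> nx v 0 = u)
        \<and> l (u, v) < \<Delta>) \<and>
    (\<forall>u\<in>pverts G. d u u = 0 \<and> (\<forall>v\<in>pverts G. u \<noteq> v \<longrightarrow>
      nx u v \<in> pverts G \<and> (u, nx u v) \<in> parcs G \<and> d u v = Suc (d (nx u v) v) \<and>
      K u v = (if nx u v = v then 0 else of_bool (l (nx u v, nx (nx u v) v) \<le> l (u, nx u v)) + K (nx u v) v) \<and>
      (\<forall>e. D u v = enat e \<longrightarrow> d u v + k \<le> e \<and> l (nx v u, v) + K u v * \<Delta> + 1 \<le> e + l (u, nx u v))))"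

lemma check_iff_cert:
  assumes s: "shape x n bl bd" and V: "pverts G = {..<n}" and p: "p = pos n bl (n * n)"
    and E: "\<And>u v. u < n \<Longrightarrow> v < n \<Longrightarrow> (u, v) \<in> parcs G \<longleftrightarrow> arc_bit x n u v"
    and D: "\<And>u v. u < n \<Longrightarrow> v < n \<Longrightarrow> D u v = ent x (pos n bl (u * n + v)) (bl u v)"
    and \<Delta>: "\<Delta> = num x p bd"
  shows "check x (length x + 2) p n nx d K lb bl bd k z \<longleftrightarrow>
    0 < \<Delta> \<and> (z = 0 \<or> \<Delta> = z) \<and> cert G D \<Delta> (\<lambda>(u, v). label_of (length x + 2) lb u v) nx d K k"
proof -
  let ?S = "length x + 2"
  have pd: "nat_code x p bd" using s unfolding shape_def p by blast
  have bd: "0 < bd \<longleftrightarrow> 0 < \<Delta>" using nat_codeD(2)[OF pd] \<Delta> by simp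
  have z: "big_le ?S (digit x p bd) (const_digit z) \<and> big_le ?S (const_digit z) (digit x p bd) \<longleftrightarrow> \<Delta> = z"
    using num_eq_iff[OF pd, of z] \<Delta> by simp
  have lab: "\<not> big_le ?S (digit x p bd) (\<lambda>j. of_bool (0 < lb u v j)) \<longleftrightarrow> label_of ?S lb u v < \<Delta>" for u v
    unfolding big_le_def num_sum[OF pd] label_of_def \<Delta> by auto
  have K: "big_le ?S (\<lambda>j. of_bool (0 < lb u v j)) (\<lambda>j. of_bool (0 < lb u' v' j)) \<longleftrightarrow>
      label_of ?S lb u v \<le> label_of ?S lb u' v'" for u v u' v'
    unfolding big_le_def label_of_def ..
  \<comment> \<open>The duration is the last label minus the first label plus K \<Delta> + 1. With
    the first label moved to the other side, both sides are sequences of nonnegative digits.\<close>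
  have B: "(bl u v = 0 \<or>
        big_le ?S (const_digit (d u v + k)) (digit x (Suc (pos n bl (u * n + v))) (bl u v - 1)) \<and>
        big_le ?S (\<lambda>j. of_bool (0 < lb a v j) + K u v * digit x p bd j + const_digit 1 j)
          (\<lambda>j. digit x (Suc (pos n bl (u * n + v))) (bl u v - 1) j + of_bool (0 < lb u b j))) \<longleftrightarrow>
      (\<forall>e. D u v = enat e \<longrightarrow> d u v + k \<le> e \<and> label_of ?S lb a v + K u v * \<Delta> + 1 \<le> e + label_of ?S lb u b)"
    if uv: "u < n" "v < n" for u v a b
  proof (cases "bl u v = 0")
    case True
    then show ?thesis using D[OF uv] by (simp add: ent_def)
  next
    case False
    let ?p = "Suc (pos n bl (u * n + v))" and ?b = "bl u v - 1"
    have q: "(u * n + v) div n = u" "(u * n + v) mod n = v" using uv by simp_all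
    have "u * n + v < n * n" by (intro mult_add_less uv)
    then have "ent_code x (pos n bl (u * n + v)) (bl u v)" using s q unfolding shape_def by metis
    then have c: "nat_code x ?p ?b" using False by (simp add: ent_code_def)
    have e: "D u v = enat (num x ?p ?b)" using D[OF uv] False by (simp add: ent_def)
    have 1: "big_le ?S (const_digit (d u v + k)) (digit x ?p ?b) \<longleftrightarrow> d u v + k \<le> num x ?p ?b"
      unfolding big_le_def num_sum[OF c] by (subst const_digit_sum) simp_all
    have "(\<Sum>j<?S. (of_bool (0 < lb a v j) + K u v * digit x p bd j + const_digit 1 j) * 2 ^ j) =
      (\<Sum>j<?S. of_bool (0 < lb a v j) * 2 ^ j) + K u v * (\<Sum>j<?S. digit x p bd j * 2 ^ j) + (\<Sum>j<?S. const_digit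
          1 j * 2 ^ j)"
      unfolding distrib_right sum.distrib sum_distrib_left by (simp only: mult.assoc)
    also have "\<dots> = label_of ?S lb a v + K u v * \<Delta> + 1"
      unfolding num_sum[OF pd] label_of_def[symmetric] \<Delta> by (subst const_digit_sum) simp_all
    finally have 2: "(\<Sum>j<?S. (of_bool (0 < lb a v j) + K u v * digit x p bd j + const_digit 1 j) * 2 ^ j) =
        label_of ?S lb a v + K u v * \<Delta> + 1" .
    have 3: "(\<Sum>j<?S. (digit x ?p ?b j + of_bool (0 < lb u b j)) * 2 ^ j) = num x ?p ?b + label_of ?S lb u b"
      unfolding distrib_right sum.distrib num_sum[OF c] label_of_def ..
    show ?thesis using False 1 e unfolding big_le_def[of ?S
        "\<lambda>j. of_bool (0 < lb a v j) + K u v * digit x p bd j + const_digit 1 j"] 2 3 by simp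
  qed
  have "check x ?S p n nx d K lb bl bd k z \<longleftrightarrow> shape x n bl bd \<and> 0 < \<Delta> \<and> (z = 0 \<or> \<Delta> = z) \<and>
     (\<forall>u<n. \<forall>v<n. arc_bit x n u v \<longrightarrow> arc_bit x n v u \<and> (u \<noteq> 0 \<and> nx u 0 = v \<or> v \<noteq> 0 \<and> nx v 0 = u) \<and> label_of ?S
         lb u v < \<Delta>) \<and>
     (\<forall>u<n. d u u = 0 \<and> (\<forall>v<n. u \<noteq> v \<longrightarrow>
      nx u v < n \<and> arc_bit x n u (nx u v) \<and> d u v = Suc (d (nx u v) v) \<and>
      K u v = (if nx u v = v then 0 else of_bool (label_of ?S lb (nx u v) (nx (nx u v) v) \<le> label_of ?S lb u
          (nx u v)) + K (nx u v) v) \<and>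
      (\<forall>e. D u v = enat e \<longrightarrow> d u v + k \<le> e \<and> label_of ?S lb (nx v u) v + K u v * \<Delta> + 1 \<le> e + label_of ?S lb u
          (nx u v))))"
    unfolding check_def z bd lab K by (intro conj_cong iff_allI imp_cong refl) (rule B)
  also have "\<dots> \<longleftrightarrow> shape x n bl bd \<and> 0 < \<Delta> \<and> (z = 0 \<or> \<Delta> = z) \<and> cert G D \<Delta> (\<lambda>(u, v). label_of ?S lb u v) nx d K
      k"
    unfolding cert_def V Ball_def lessThan_iff prod.case
    by (intro conj_cong iff_allI imp_cong refl) (rule E[symmetric]; assumption)+
  finally show ?thesis using s by blast
qed

lemma certD:
  assumes c: "cert G D \<Delta> l nx d K k" and V: "pverts G = {..<n}" "0 < n"
      and arcs: "parcs G \<subseteq> pverts G \<times> pverts G" and \<Delta>: "0 < \<Delta>"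
  shows "DiTTR_input G D \<Delta>" "slack_at_least k G D" "DiTTR_yes G D \<Delta>"
proof -
  have t: "tree_cert G nx d" and K: "descent_cert G l nx K" and l: "periodic_labeling \<Delta> G l"
    using c arcs unfolding cert_def tree_cert_def descent_cert_def periodic_labeling_def by blast+
  have bt: "bidirected_tree G"
    by (rule tree_cert_tree[OF t, of 0]) (use c arcs V in \<open>auto simp: cert_def\<close>)
  note dur = tree_cert_duration[OF bt t l K]
  have b: "0 < d u v" "D u v = enat e \<Longrightarrow> d u v + k \<le> e" "D u v = enat e \<Longrightarrow> fastest_duration \<Delta> G l u v \<le> enat e"
    if "u \<in> pverts G" "v \<in> pverts G" "u \<noteq> v" for u v e
  proof -
    note c3 = c[unfolded cert_def, THEN conjunct2, rule_format, OF that(1), THEN conjunct2, rule_format, OF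
        that(2,3)]
    show "0 < d u v" "D u v = enat e \<Longrightarrow> d u v + k \<le> e" "D u v = enat e \<Longrightarrow> fastest_duration \<Delta> G l u v \<le> enat e"
      using c3 unfolding dur(2)[OF that] by (simp, blast+)
  qed
  have sl: "slack_at_least j G D" if "j \<le> k" for j
    unfolding slack_at_least_def
  proof (intro ballI impI)
    fix u v assume uv: "u \<in> pverts G" "v \<in> pverts G" "u \<noteq> v"
    show "static_dist G u v + ereal (real j) \<le> ereal_of_enat (D u v)"
      unfolding dur(1)[OF uv] using b(2)[OF uv] that by (cases "D u v") auto
  qed
  then show "slack_at_least k G D" by simp
  have "0 < D u v" if "u \<in> pverts G" "v \<in> pverts G" "u \<noteq> v" for u v
    using b(1,2)[OF that] by (cases "D u v") (auto simp: zero_enat_def)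
  then show "DiTTR_input G D \<Delta>" unfolding DiTTR_input_def using bt \<Delta> sl[of 0] by blast
  have "fastest_duration \<Delta> G l u v \<le> D u v" if "u \<in> pverts G" "v \<in> pverts G" "u \<noteq> v" for u v
    using b(3)[OF that] by (cases "D u v") auto
  then show "DiTTR_yes G D \<Delta>" unfolding DiTTR_yes_def using l by blast
qed

lemma ex_cert:
  assumes G: "DiTTR_input G D \<Delta>" "slack_at_least k G D" and l: "periodic_labeling \<Delta> G l"
    "\<forall>u\<in>pverts G. \<forall>v\<in>pverts G. u \<noteq> v \<longrightarrow> fastest_duration \<Delta> G l u v \<le> D u v" and 0: "0 \<in> pverts G"
  shows "\<exists>nx d K. cert G D \<Delta> l nx d K k \<and>
    (\<forall>u\<in>pverts G. \<forall>v\<in>pverts G. d u v < card (pverts G) \<and> (u \<noteq> v \<longrightarrow> K u v < card (pverts G)))"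
proof -
  have bt: "bidirected_tree G" using G by (simp add: DiTTR_input_def)
  obtain nx d where nx: "tree_cert G nx d" "\<forall>u v. (u, v) \<in> parcs G \<longrightarrow> u \<noteq> 0 \<and> nx u 0 = v \<or> v \<noteq> 0 \<and> nx v 0 = u"
      "\<forall>u\<in>pverts G. \<forall>v\<in>pverts G. d u v < card (pverts G)"
      "\<forall>l. \<exists>K. descent_cert G l nx K \<and> (\<forall>u\<in>pverts G. \<forall>v\<in>pverts G. u \<noteq> v \<longrightarrow> K u v < card (pverts G))"
    using ex_tree_cert[OF bt 0] by blast
  from nx(4) obtain K where K: "descent_cert G l nx K" "\<forall>u\<in>pverts G. \<forall>v\<in>pverts G. u \<noteq> v \<longrightarrow>
      K u v < card (pverts G)" by blast
  note dur = tree_cert_duration[OF bt nx(1) l(1) K(1)]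
  have "d u v + k \<le> e \<and> l (nx v u, v) + K u v * \<Delta> + 1 \<le> e + l (u, nx u v)"
    if uv: "u \<in> pverts G" "v \<in> pverts G" "u \<noteq> v" and e: "D u v = enat e" for u v e
  proof -
    have "static_dist G u v + ereal (real k) \<le> ereal_of_enat (D u v)" using G(2) uv
        by (simp add: slack_at_least_def)
    then have "d u v + k \<le> e" unfolding dur(1)[OF uv] e by simp
    moreover have "fastest_duration \<Delta> G l u v \<le> enat e" using l(2) uv e by metis
    ultimately show ?thesis using dur(2)[OF uv] by blast
  qed
  moreover have "(v, u) \<in> parcs G \<and> l (u, v) < \<Delta>" if "(u, v) \<in> parcs G" for u v
    using that l(1) tree_graphD(2)[OF bt] by (simp add: periodic_labeling_def)
  ultimately have "cert G D \<Delta> l nx d K k"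
    using nx(1,2) K(1) unfolding cert_def tree_cert_def descent_cert_def by blast
  then show ?thesis using nx(3) K(2) by blast
qed

text \<open>The certificate decoded from a witness agrees with the intended one only on arcs, on
  vertices and, for \<open>nx\<close> and \<open>K\<close>, on pairs of distinct vertices; no other
  values are consulted.\<close>

lemma cert_cong:
  assumes c: "cert G D \<Delta> l nx d K k" and "\<And>e. e \<in> parcs G \<Longrightarrow> l' e = l e" "\<And>u v. u \<in> pverts G \<Longrightarrow> v \<in> pverts G \<Longrightarrow>
      d' u v = d u v"
    "\<And>u v. u \<in> pverts G \<Longrightarrow> v \<in> pverts G \<Longrightarrow> u \<noteq> v \<Longrightarrow> nx' u v = nx u v \<and> K' u v = K u v" "0 \<in> pverts G"
  shows "cert G D \<Delta> l' nx' d' K' k"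
proof -
  note c1 = c[unfolded cert_def, THEN conjunct1, rule_format]
    and c2 = c[unfolded cert_def, THEN conjunct2, rule_format]
  show ?thesis
    unfolding cert_def
  proof (intro conjI ballI allI impI)
    fix u v assume uv: "u \<in> pverts G" "v \<in> pverts G" "(u, v) \<in> parcs G"
    then show "(v, u) \<in> parcs G" "l' (u, v) < \<Delta>" using c1[OF uv] assms(2) by simp_all
    show "u \<noteq> 0 \<and> nx' u 0 = v \<or> v \<noteq> 0 \<and> nx' v 0 = u" using c1[OF uv] assms(4,5) uv by metis
  next
    show "d' u u = 0" if "u \<in> pverts G" for u using c2[OF that] assms(3) that by simp
    fix u v assume uv: "u \<in> pverts G" "v \<in> pverts G" "u \<noteq> v"
    note c3 = c2[OF uv(1), THEN conjunct2, rule_format, OF uv(2,3)]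
    have w: "nx' u v = nx u v" "K' u v = K u v" "nx u v \<in> pverts G" "(u, nx u v) \<in> parcs G"
        using c3 assms(4) uv by simp_all
    show "nx' u v \<in> pverts G" "(u, nx' u v) \<in> parcs G" "d' u v = Suc (d' (nx' u v) v)"
      using c3 w assms(3) uv by simp_all
    show "K' u v = (if nx' u v = v then 0 else of_bool (l' (nx' u v, nx' (nx' u v) v) \<le> l' (u, nx' u v)) + K'
        (nx' u v) v)"
    proof (cases "nx u v = v")
      case False
      then have "(nx u v, nx (nx u v) v) \<in> parcs G" "nx' (nx u v) v = nx (nx u v) v"
          "K' (nx u v) v = K (nx u v) v"
        using c2[OF w(3), THEN conjunct2, rule_format, OF uv(2) False] assms(4)[OF w(3) uv(2) False]
            by simp_all
      then show ?thesis using c3 w assms(2) False by simp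
    qed (use c3 w in simp)
    fix e assume e: "D u v = enat e"
    have n: "nx' v u = nx v u" using assms(4) uv by simp
    have a: "(nx v u, v) \<in> parcs G"
      using c2[OF uv(2), THEN conjunct2, rule_format, OF uv(1) uv(3)[symmetric]] c1 uv by blast
    show "d' u v + k \<le> e" "l' (nx' v u, v) + K' u v * \<Delta> + 1 \<le> e + l' (u, nx' u v)"
      using c3 e unfolding n w(1,2) assms(2)[OF a] assms(2)[OF w(4)] assms(3)[OF uv(1,2)] by blast+
  qed
qed


text \<open>Both problems belong to this family: z = 0 leaves the period free, and k = 0 adds
  nothing to \<open>DiTTR_input\<close>.\<close>

definition DiTTR_restricted :: "nat \<Rightarrow> nat \<Rightarrow> language" where
  "DiTTR_restricted z k = {encode_DiTTR G D \<Delta> | G D \<Delta>. pverts G = {..<card (pverts G)} \<and> DiTTR_input G D \<Delta> \<and>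
     slack_at_least k G D \<and> (z = 0 \<or> \<Delta> = z) \<and> DiTTR_yes G D \<Delta>}"

text \<open>Slots 0 to 6 hold \<open>nx\<close>, \<open>d\<close>, \<open>K\<close>, the label bits,
  the digit counts of the entries, that of the period, and the number of vertices.\<close>

definition accepts :: "nat \<Rightarrow> nat \<Rightarrow> bool list \<Rightarrow> bool list \<Rightarrow> bool" where
  "accepts z k x w \<longleftrightarrow> (let F = slot w (length x + 2); n = F 6 0 0 0; bl = (\<lambda>u v. F 4 u v 0) in
     check x (length x + 2) (pos n bl (n * n)) n (\<lambda>u v. F 0 u v 0) (\<lambda>u v. F 1 u v 0) (\<lambda>u v. F 2 u v 0) (F 3)
         bl (F 5 0 0 0) k z)"

lemma sum_bits: "m < 2 ^ S \<Longrightarrow> (\<Sum>j<S. of_bool (odd (m div 2 ^ j)) * 2 ^ j) = (m :: nat)"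
proof -
  assume "m < 2 ^ S"
  then have "m = take_bit S m" by (simp add: take_bit_eq_mod)
  also have "\<dots> = (\<Sum>j<S. of_bool (odd (m div 2 ^ j)) * 2 ^ j)"
    unfolding take_bit_sum by (simp add: bit_iff_odd push_bit_eq_mult lessThan_atLeast0 del:
        sum_mult_of_bool_eq)
  finally show ?thesis ..
qed

lemma DiTTR_restricted_iff:
  "x \<in> DiTTR_restricted z k \<longleftrightarrow> (\<exists>w. length w \<le> 7 * (length x + 2) ^ 4 \<and> accepts z k x w)"
proof
  let ?S = "length x + 2"
  assume "x \<in> DiTTR_restricted z k"
  then obtain G D \<Delta> where x: "x = encode_DiTTR G D \<Delta>" and V: "pverts G = {..<card (pverts G)}"
      and G: "DiTTR_input G D \<Delta>" "slack_at_least k G D"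
    and z: "z = 0 \<or> \<Delta> = z" and yes: "DiTTR_yes G D \<Delta>" unfolding DiTTR_restricted_def by blast
  define n where "n = card (pverts G)"
  have V': "pverts G = {..<n}" using V by (simp add: n_def)
  have bt: "bidirected_tree G" and \<Delta>0: "0 < \<Delta>" using G by (simp_all add: DiTTR_input_def)
  have "pverts G \<noteq> {}" using bt unfolding bidirected_tree_def Digraph_Component.connected_def
      strongly_connected_def by simp
  then have n0: "0 < n" using V' by auto
  obtain l where l: "periodic_labeling \<Delta> G l" "\<forall>u\<in>pverts G. \<forall>v\<in>pverts G. u \<noteq> v \<longrightarrow> fastest_duration \<Delta> G l u v \<le>
      D u v"
    using yes unfolding DiTTR_yes_def by blast
  obtain nx d K where c: "cert G D \<Delta> l nx d K k"
      "\<forall>u\<in>pverts G. \<forall>v\<in>pverts G. d u v < card (pverts G) \<and> (u \<noteq> v \<longrightarrow> K u v < card (pverts G))"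
    using ex_cert[OF G l] n0 V' by auto
  let ?bl = "\<lambda>u v. ent_digits (D u v)"
  note sh = encode_shape[OF x V' n0]
  have nc: "nat_code x (pos n ?bl (n * n)) (length (binary \<Delta>))" using sh(1) unfolding shape_def by blast
  have "n * n < ?S" using sh(1) by (simp add: shape_def pos_def)
  then have nS: "n < ?S" by (rule le_less_trans[rotated]) simp
  \<comment> \<open>The minimum enforces the bound that \<open>ex_slot\<close> demands for all
    arguments; at the arguments that are consulted the values are small enough to be
    unchanged.\<close>
  define g where "g t a b c = min ?S (if t = 0 then nx a b else if t = 1 then d a b else if t = 2 then K a b
     else if t = 3 then of_bool (odd (l (a, b) div 2 ^ c)) else if t = 4 then ?bl a b else
         if t = 5 then length (binary \<Delta>) else n)"
    for t a b c :: nat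
  obtain w where w: "length w = 7 * ?S * ?S * ?S * ?S" "\<forall>t<7. \<forall>a<?S. \<forall>b<?S. \<forall>c<?S. slot w ?S t a b c =
      g t a b c"
    using ex_slot[of g ?S 7] by (auto simp: g_def)
  let ?F = "slot w ?S"
  have F: "?F 6 0 0 0 = n" "?F 5 0 0 0 = length (binary \<Delta>)"
    using w(2) nS nat_code_le[OF nc] by (simp_all add: g_def)
  have Fuv: "?F 4 u v 0 = ?bl u v" "?F 1 u v 0 = d u v" "u \<noteq> v \<Longrightarrow> ?F 0 u v 0 = nx u v \<and> ?F 2 u v 0 = K u v"
    "c < ?S \<Longrightarrow> ?F 3 u v c = of_bool (odd (l (u, v) div 2 ^ c))" if uv: "u < n" "v < n" for u v c
  proof -
    have uS: "u < ?S" "v < ?S" "0 < ?S" using uv nS by simp_all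
    have q: "u * n + v < n * n" by (intro mult_add_less uv)
    have "(u * n + v) div n = u" "(u * n + v) mod n = v" using uv by simp_all
    then have "ent_code x (pos n ?bl (u * n + v)) (?bl u v)" using sh(1) q unfolding shape_def by metis
    then have "?bl u v \<le> ?S" unfolding ent_code_def nat_code_def by (auto split: if_splits)
    then show "?F 4 u v 0 = ?bl u v" using w(2) uS by (simp add: g_def)
    have "d u v \<le> ?S" using c(2) uv V' nS n_def by (metis lessThan_iff less_imp_le less_trans)
    then show "?F 1 u v 0 = d u v" using w(2) uS by (simp add: g_def)
    show "u \<noteq> v \<Longrightarrow> ?F 0 u v 0 = nx u v \<and> ?F 2 u v 0 = K u v"
    proof -
      assume ne: "u \<noteq> v"
      have "K u v \<le> ?S" using c(2) uv V' nS n_def ne by (metis lessThan_iff less_imp_le less_trans)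
      moreover have "nx u v < n" using c(1) uv ne unfolding cert_def V' by blast
      ultimately show "?F 0 u v 0 = nx u v \<and> ?F 2 u v 0 = K u v" using w(2) uS nS by (simp add: g_def)
    qed
    show "c < ?S \<Longrightarrow> ?F 3 u v c = of_bool (odd (l (u, v) div 2 ^ c))" using w(2) uS by (simp add: g_def)
  qed
  have le: "label_of ?S (?F 3) u v = l (u, v)" if uv: "(u, v) \<in> parcs G" for u v
  proof -
    have u: "u < n" "v < n" using tree_graphD(5)[OF bt uv] V' by auto
    have "l (u, v) < \<Delta>" using uv l(1) by (simp add: periodic_labeling_def)
    also have "\<Delta> < 2 ^ length (binary \<Delta>)" using div_pow_eq_0_iff[of \<Delta> "length (binary \<Delta>)"]
        by (simp add: div_eq_0_iff)
    also have "(2 :: nat) ^ length (binary \<Delta>) \<le> 2 ^ ?S" using nat_code_le[OF nc]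
        by (intro power_increasing) auto
    finally have "l (u, v) < 2 ^ ?S" .
    then have "l (u, v) = (\<Sum>j<?S. of_bool (odd (l (u, v) div 2 ^ j)) * 2 ^ j)" by (rule sum_bits[symmetric])
    also have "\<dots> = label_of ?S (?F 3) u v" unfolding label_of_def using Fuv(4)[OF u] by (intro sum.cong) auto
    finally show ?thesis ..
  qed
  have posF: "pos n (\<lambda>u v. ?F 4 u v 0) q = pos n ?bl q" if "q \<le> n * n" for q
    unfolding pos_def using that n0 Fuv(1) by (auto intro!: sum.cong simp: less_mult_imp_div_less)
  have sF: "shape x n (\<lambda>u v. ?F 4 u v 0) (length (binary \<Delta>))"
    using sh(1) posF Fuv(1) n0 unfolding shape_def by (auto simp: less_mult_imp_div_less)
  have "cert G D \<Delta> (\<lambda>(u, v). label_of ?S (?F 3) u v) (\<lambda>u v. ?F 0 u v 0) (\<lambda>u v. ?F 1 u v 0) (\<lambda>u v. ?F 2 u v 0)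
      k"
    by (rule cert_cong[OF c(1)]) (use le Fuv n0 V' in auto)
  moreover have "D u v = ent x (pos n (\<lambda>u v. ?F 4 u v 0) (u * n + v)) (?F 4 u v 0)" if uv: "u < n" "v < n"
      for u v
  proof -
    have "u * n + v < n * n" by (intro mult_add_less uv)
    then show ?thesis using sh(3)[OF uv] posF[of "u * n + v"] Fuv(1)[OF uv] by simp
  qed
  ultimately have "accepts z k x w"
    unfolding accepts_def Let_def F
    using check_iff_cert[OF sF V' refl sh(2), of D \<Delta>] sh(4) posF \<Delta>0 z by simp
  moreover have "7 * s * s * s * s \<le> 7 * s ^ 4" for s :: nat by (simp add: power4_eq_xxxx mult.assoc)
  then have "length w \<le> 7 * ?S ^ 4" unfolding w(1) .
  ultimately show "\<exists>w. length w \<le> 7 * ?S ^ 4 \<and> accepts z k x w" by blast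
next
  let ?S = "length x + 2"
  assume "\<exists>w. length w \<le> 7 * ?S ^ 4 \<and> accepts z k x w"
  then obtain w where w: "accepts z k x w" by blast
  let ?F = "slot w ?S"
  define n bl bd where "n = ?F 6 0 0 0" and "bl u v = ?F 4 u v 0" and "bd = ?F 5 0 0 0" for u v
  define p where "p = pos n bl (n * n)"
  define G where "G = \<lparr>pverts = {..<n}, parcs = {(u, v). u < n \<and> v < n \<and> arc_bit x n u v}\<rparr>"
  define D where "D u v = ent x (pos n bl (u * n + v)) (bl u v)" for u v
  define \<Delta> where "\<Delta> = num x p bd"
  have ch: "check x ?S p n (\<lambda>u v. ?F 0 u v 0) (\<lambda>u v. ?F 1 u v 0) (\<lambda>u v. ?F 2 u v 0) (?F 3) bl bd k z"
    using w unfolding accepts_def Let_def n_def bl_def bd_def p_def .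
  then have s: "shape x n bl bd" unfolding check_def by blast
  have V: "pverts G = {..<n}" by (simp add: G_def)
  have c: "0 < \<Delta> \<and> (z = 0 \<or> \<Delta> = z) \<and> cert G D \<Delta> (\<lambda>(u, v). label_of ?S (?F 3) u v) (\<lambda>u v. ?F 0 u v 0) (\<lambda>u v. ?F
      1 u v 0) (\<lambda>u v. ?F 2 u v 0) k"
    by (rule check_iff_cert[OF s V p_def _ _ \<Delta>_def, THEN iffD1, OF _ _ ch]) (simp_all add: G_def D_def)
  have "parcs G \<subseteq> pverts G \<times> pverts G" "0 < n" using s by (auto simp: G_def shape_def)
  note certD[OF c[THEN conjunct2, THEN conjunct2] V this(2,1) c[THEN conjunct1]]
  moreover have "x = encode_DiTTR G D \<Delta>" unfolding \<Delta>_def p_def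
      by (rule shape_encode[OF s V]) (simp_all add: G_def D_def)
  moreover have "pverts G = {..<card (pverts G)}" by (simp add: V)
  ultimately show "x \<in> DiTTR_restricted z k"
    using c unfolding DiTTR_restricted_def by blast
qed

text \<open>The equation between \<open>num\<close> and n is replaced by two digitwise comparisons,
  since \<open>num\<close> may be too large to be the value of an expression.\<close>

lemma shape_alt:
  "shape x n bl bd \<longleftrightarrow> 0 < n \<and> nat_code x 0 (length (binary n)) \<and>
     (big_le (length x + 2) (digit x 0 (length (binary n))) (const_digit n) \<and> big_le (length x + 2)
         (const_digit n) (digit x 0 (length (binary n)))) \<and>
     (\<forall>q<n * n. ent_code x (pos n bl q) (bl (q div n) (q mod n))) \<and>
     nat_code x (pos n bl (n * n)) bd \<and> length x = pos n bl (n * n) + 2 * bd + 1"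
  unfolding shape_def by (simp add: num_eq_iff cong: conj_cong)

section \<open>The verifier as an expression\<close>

lemma pf_code_len: "pf a F \<Longrightarrow> pf a (\<lambda>xs v. code_len (F xs v))"
  unfolding code_len_def by (intro pf_intros)

lemma pf_digit: "\<lbrakk>c < a; pf a P; pf a B; pf a J\<rbrakk> \<Longrightarrow> pf a (\<lambda>xs v. digit (xs ! c) (P xs v) (B xs v) (J xs v))"
  unfolding digit_def by (intro pf_intros pp_bit_at)

lemma pf_const_digit: "\<lbrakk>pf a F; pf a J\<rbrakk> \<Longrightarrow> pf a (\<lambda>xs v. const_digit (F xs v) (J xs v))"
  unfolding const_digit_def by (intro pf_intros)

lemma pp_nat_code: "\<lbrakk>c < a; pf a P; pf a B\<rbrakk> \<Longrightarrow> pp a (\<lambda>xs v. nat_code (xs ! c) (P xs v) (B xs v))"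
  unfolding nat_code_def by (intro pf_intros pp_bit_at pf_length pf_shift[of a P])

lemma pp_ent_code: "\<lbrakk>c < a; pf a P; pf a B\<rbrakk> \<Longrightarrow> pp a (\<lambda>xs v. ent_code (xs ! c) (P xs v) (B xs v))"
  unfolding ent_code_def by (intro pf_intros pp_bit_at pf_length pp_nat_code)

lemma pp_accepts: "pp 2 (\<lambda>xs v. accepts z k (xs ! 0) (xs ! 1))"
  unfolding accepts_def Let_def check_def shape_alt pos_def arc_bit_def
  by (intro pf_intros pf_code_len pf_digit pf_const_digit pp_nat_code pp_ent_code pp_bit_at pp_big_le
      pf_length pf_slot pf_length_binary) simp_all

theorem in_NP_restricted: "in_NP (DiTTR_restricted z k)"
proof -
  define tab where "tab u = (if u = 0 then [False] else if u = Suc 0 then [True] else [])" for u :: nat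
  let ?V = "\<lambda>xs. concat (map (\<lambda>i. tab (of_bool (accepts z k (xs ! 0) (xs ! 1)))) [0..<1])"
  have "polytime 2 ?V"
    by (rule polytime_concat[where K = 2 and G = "\<lambda>xs v. of_bool (accepts z k (xs ! 0) (xs ! 1))"])
      (intro pf_const pf_of_bool pp_accepts | simp add: tab_def)+
  moreover have "?V [x, w] = [True] \<longleftrightarrow> accepts z k x w" for x w by (simp add: tab_def)
  moreover have "poly (smult 7 ([:2, 1:] ^ 4)) (length x) = 7 * (length x + 2) ^ 4" for x :: "bool list"
    by (simp add: add.commute)
  ultimately show ?thesis unfolding in_NP_def using DiTTR_restricted_iff
    by (intro exI[of _ ?V] exI[of _ "smult 7 ([:2, 1:] ^ 4)"]) simp
qed

lemma DiTTR_conv_restricted: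
  "DiTTR = DiTTR_restricted 0 0" "1 \<le> \<Delta> \<Longrightarrow> DiTTR_fixed \<Delta> k = DiTTR_restricted \<Delta> k"
  unfolding DiTTR_def DiTTR_fixed_def DiTTR_restricted_def DiTTR_input_def by auto

theorem theorem20:
  shows "(\<forall>(\<Delta> :: nat) (k :: nat).
            1 \<le> \<Delta> \<and> (\<Delta> > k + 2 \<or> (\<Delta> = k + 2 \<and> odd \<Delta>)) \<longrightarrow>
            NP_complete (DiTTR_fixed \<Delta> k))
         \<and> NP_complete DiTTR"
proof (intro conjI allI impI)
  fix \<Delta> k :: nat
  assume D: "1 \<le> \<Delta> \<and> (\<Delta> > k + 2 \<or> (\<Delta> = k + 2 \<and> odd \<Delta>))"
  then have "in_NP (DiTTR_fixed \<Delta> k)" using in_NP_restricted[of \<Delta> k] DiTTR_conv_restricted(2)[of \<Delta> k] by simp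
  then show "NP_complete (DiTTR_fixed \<Delta> k)" using NP_hard_DiTTR(1)[of k \<Delta>] D unfolding NP_complete_def
      by blast
next
  \<comment> \<open>For the unrestricted problem, hardness comes from the smallest admissible case,
    \<Delta> = 3 and k = 0.\<close>
  show "NP_complete DiTTR" unfolding NP_complete_def
    using NP_hard_DiTTR(2)[of 0 3] in_NP_restricted[of 0 0] DiTTR_conv_restricted(1) by simp
qed

end
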